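(* Let $A$ be a $\pi$-formal abelian scheme of relative dimension $g\ge1$ over $S=\operatorname{Spf}R$. For every $n\ge1$, the family $\{\Psi_{ij}\}$, for $1\le i\le n$ and $1\le j\le g$, forms an $R$-basis of $\operatorname{Hom}(N^n,\hat{\mathbb{G}}_a)$. In particular, $\operatorname{rk}_R\operatorname{Hom}(N^n,\hat{\mathbb{G}}_a)=ng$.
   Context: $p$ is a prime, $q>1$ a power of $p$; $R$ is a $p$-adically complete discrete valuation ring with uniformizer $\pi$, perfect residue field, and absolute ramification index $e=v(p)\le p-2$ (with $v(\pi)=1$); $\phi:R\to R$ is a fixed ring endomorphism with $\phi(x)\equiv x^q\bmod\pi R$. $S=\operatorname{Spf}R$; $\pi$-formal schemes are $\pi$-adic formal schemes over $S$. Witt vectors: for an $R$-algebra $B$ with structure map $f$, $B^{\phi^n}$ is the ring $B$ with structure map $f\circ\phi^n$; $W_n(B)=B^{n+1}$ as a set, with the unique functorial $R$-algebra structure making the ghost map $w:W_n(B)\to B\times B^\phi\times\cdots\times B^{\phi^n}$, $w_i=x_0^{q^i}+\pi x_1^{q^{i-1}}+\cdots+\pi^ix_i$, a natural map of $R$-algebras. $F:W_n(B)\to W_{n-1}(B)$ is the functorial ring map inducing the left shift on ghost components; $V(x_0,\dots,x_{n-1})=(0,x_0,\dots,x_{n-1})$. Put $\tilde W_n(B)=R\times_BW_n(B)$. With $\tilde f:R\to W_n(B)$ the $R$-algebra structure map, every element of $\tilde W_n(B)$ is uniquely $(r,\tilde f(r)+V(z))$, and $\tilde F:\tilde W_n(B)\to\tilde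 W_{n-1}(B^\phi)$ is the $R$-algebra map $(r,\tilde f(r)+V(z))\mapsto(r,\tilde f(r)+VF(z))$. Jet spaces: $J^nA(C)=A(W_n(C))$, $N^n=\ker(J^nA\to A)$ (truncation), with projections $u:N^n\to N^{n-1}$. $N^n(B)$ is the set of maps $\operatorname{Spf}\tilde W_n(B)\to A$ restricting to the identity section on $\operatorname{Spf}R$; composing with $\tilde F$ gives the lateral Frobenius $\mathfrak{f}:N^n\to N^{n-1}$, a group homomorphism lying over $\phi:S\to S$. Characters: $\operatorname{Hom}(N^n,\hat{\mathbb{G}}_a)$ is the $R$-module of homomorphisms of $\pi$-formal group schemes over $S$ to the $\pi$-formal additive group. Fix étale coordinates $\mathbf{x}_0=(x_{01},\dots,x_{0g})$ of $A$ at the identity section; these induce Witt coordinates giving $N^n\simeq\operatorname{Spf}R[\mathbf{x}_1,\dots,\mathbf{x}_n]^\wedge$, $\mathbf{x}_i=(x_{i1},\dots,x_{ig})$. Let $\Psi_1=(\Psi_{11},\dots,\Psi_{1g}):N^1\to\hat{\mathbb{G}}_a^g$ be the isomorphism of $\pi$-formal group schemes constructed by Buium from the étale coordinates (via the formal logarithm), with derivative the identity at the origin in the coordinates $\mathbf{x}_1$. For $1\le i\le n$ and $1\le j\le g$, $\Psi_{ij}$ is the composition $N^n\xrightarrow{\mathfrak{f}^{\circ(i-1)}}N^{n-i+1}\xrightarrow{u}N^1\xrightarrow{\Psi_{1j}}\hat{\mathbb{G}}_a$, regarded as a homomorphism over $S$, i.e. the pull-back of the function $\Psi_{1j}$ along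 the $\phi^{i-1}$-semilinear morphism $u^{n-i}\circ\mathfrak{f}^{\circ(i-1)}$. *)

theory Defs
  imports
    "HOL-Algebra.Module"
    "HOL-Algebra.Ideal"
    "HOL-Algebra.RingHom"
    "HOL-Analysis.Analysis"
begin

section \<open>Base ring and algebras\<close>

text \<open>The base ring \<open>R\<close> is the type \<open>'r\<close>. An \<open>R\<close>-algebra is a ring with carrier together with its
  structure map, so that one ring can carry several structures (\<open>B\<close> and its Frobenius twists). The
  record \<open>base\<close> holds the uniformizer \<open>\<pi>\<close>, the prime power \<open>q\<close> and the Frobenius lift \<open>\<phi>\<close>.\<close>

record 'r base =
  unif :: 'r
  resq :: nat
  frob :: "'r \<Rightarrow> 'r"

record ('r, 'b) ralg = "'b ring" +
  alg :: "'r \<Rightarrow> 'b"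

definition base_alg :: "('r::comm_ring_1, 'r) ralg" where
  "base_alg = \<lparr>carrier = UNIV, monoid.mult = (*), one = 1, zero = 0, add = (+), alg = (\<lambda>r. r)\<rparr>"

definition ralgebra :: "('r::comm_ring_1, 'b) ralg \<Rightarrow> bool" where
  "ralgebra B \<longleftrightarrow> cring B \<and> alg B \<in> ring_hom base_alg B"

definition is_alg_hom :: "('r, 'b) ralg \<Rightarrow> ('r, 'c) ralg \<Rightarrow> ('b \<Rightarrow> 'c) \<Rightarrow> bool" where
  "is_alg_hom B C h \<longleftrightarrow> h \<in> ring_hom B C \<and> (\<forall>r. h (alg B r) = alg C r)"

definition alg_hom :: "('r, 'b) ralg \<Rightarrow> ('r, 'c) ralg \<Rightarrow> ('b \<Rightarrow> 'c) set" where
  "alg_hom B C = {h \<in> extensional (carrier B). is_alg_hom B C h}"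

text \<open>The ideal \<open>a\<^sup>m C\<close>, and completeness together with separatedness for the \<open>a\<close>-adic topology.\<close>

definition pow_ideal :: "'r::comm_ring_1 \<Rightarrow> nat \<Rightarrow> ('r, 'c) ralg \<Rightarrow> 'c set" where
  "pow_ideal a m C = (\<lambda>c. alg C (a ^ m) \<otimes>\<^bsub>C\<^esub> c) ` carrier C"

definition adic_complete :: "'r::comm_ring_1 \<Rightarrow> ('r, 'c) ralg \<Rightarrow> bool" where
  "adic_complete a C \<longleftrightarrow> ralgebra C \<and> (\<Inter>m. pow_ideal a m C) = {\<zero>\<^bsub>C\<^esub>} \<and>
     (\<forall>s. (\<forall>m::nat. s m \<in> carrier C \<and> s (Suc m) \<ominus>\<^bsub>C\<^esub> s m \<in> pow_ideal a m C) \<longrightarrow>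
        (\<exists>c\<in>carrier C. \<forall>m. c \<ominus>\<^bsub>C\<^esub> s m \<in> pow_ideal a m C))"

definition complete_algebras :: "'r::comm_ring_1 base \<Rightarrow> ('r, 'c) ralg set" where
  "complete_algebras K = {C. adic_complete (unif K) C}"

text \<open>The second line says that \<open>R\<close> is a discrete valuation ring with uniformizer \<open>\<pi>\<close>. In the
  third, \<open>e\<close> is the absolute ramification index; \<open>1 \<le> e\<close> says that the residue characteristic is
  \<open>p\<close>.\<close>

definition base_data :: "nat \<Rightarrow> 'r::idom base \<Rightarrow> bool" where
  "base_data p K \<longleftrightarrow>
     prime p \<and> (\<exists>h\<ge>1. resq K = p ^ h) \<and>
     unif K \<noteq> 0 \<and> \<not> unif K dvd 1 \<and> (\<forall>x. x \<noteq> 0 \<longrightarrow> (\<exists>u k. u dvd 1 \<and> x = u * unif K ^ k)) \<and>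
     (\<exists>e u. 1 \<le> e \<and> e + 2 \<le> p \<and> u dvd 1 \<and> of_nat p = u * unif K ^ e) \<and>
     adic_complete (of_nat p) (base_alg :: ('r, 'r) ralg) \<and>
     (\<forall>x. \<exists>y. unif K dvd y ^ p - x) \<and>
     frob K \<in> ring_hom (base_alg :: ('r, 'r) ralg) (base_alg :: ('r, 'r) ralg) \<and>
     (\<forall>x. unif K dvd frob K x - x ^ resq K)"

text \<open>\<open>twist K k B\<close> is \<open>B\<close> with its structure map precomposed with the \<open>k\<close>-th iterate of \<open>frob K\<close>.\<close>

definition twist :: "'r base \<Rightarrow> nat \<Rightarrow> ('r, 'b) ralg \<Rightarrow> ('r, 'b) ralg" where
  "twist K k B = B\<lparr>alg := alg B \<circ> (frob K ^^ k)\<rparr>"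


section \<open>Witt vectors\<close>

text \<open>Elements of \<open>W\<^sub>n(B)\<close> are lists of length \<open>n + 1\<close>.\<close>

definition ghost :: "'r::comm_ring_1 base \<Rightarrow> ('r, 'b) ralg \<Rightarrow> nat \<Rightarrow> 'b list \<Rightarrow> 'b" where
  "ghost K B i x =
     (\<Oplus>\<^bsub>B\<^esub>j\<in>{..i}. alg B (unif K ^ j) \<otimes>\<^bsub>B\<^esub> ((x ! j) [^]\<^bsub>B\<^esub> (resq K ^ (i - j))))"

definition witt_structure ::
    "'r::comm_ring_1 base \<Rightarrow> nat \<Rightarrow> (('r, 'b) ralg \<Rightarrow> ('r, 'b list) ralg) \<Rightarrow> bool" where
  "witt_structure K n W \<longleftrightarrow>
     (\<forall>B. ralgebra B \<longrightarrow>
        ralgebra (W B) \<and> carrier (W B) = {x. length x = Suc n \<and> set x \<subseteq> carrier B} \<and>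
        (\<forall>i\<le>n. is_alg_hom (W B) (twist K i B) (ghost K B i))) \<and>
     (\<forall>B C h. ralgebra B \<longrightarrow> ralgebra C \<longrightarrow> h \<in> alg_hom B C \<longrightarrow> is_alg_hom (W B) (W C) (map h))"

text \<open>There is at most one such structure on the algebras with carrier in \<open>'b\<close>, provided that \<open>'b\<close>
  can hold the polynomial algebras over \<open>R\<close>; hence the choice operator picks it, up to the irrelevant
  values of the operations outside the carrier. The same applies to \<open>witt_F\<close>. A structure exists for
  every \<open>n\<close> if and only if \<open>\<phi>(\<pi>) = \<pi>\<close>.\<close>

definition witt :: "'r::comm_ring_1 base \<Rightarrow> nat \<Rightarrow> ('r, 'b) ralg \<Rightarrow> ('r, 'b list) ralg" where
  "witt K n = (SOME W. witt_structure K n W)"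

text \<open>\<open>F : W\<^sub>n(B) \<rightarrow> W\<^sub>n\<^sub>-\<^sub>1(B)\<close>, for \<open>n \<ge> 1\<close>.\<close>

definition witt_F_structure ::
    "'r::comm_ring_1 base \<Rightarrow> nat \<Rightarrow> (('r, 'b) ralg \<Rightarrow> 'b list \<Rightarrow> 'b list) \<Rightarrow> bool" where
  "witt_F_structure K n \<Phi> \<longleftrightarrow>
     (\<forall>B. ralgebra B \<longrightarrow>
        \<Phi> B \<in> ring_hom (witt K n B) (witt K (n - 1) B) \<and>
        (\<forall>x\<in>carrier (witt K n B). \<forall>i<n. ghost K B i (\<Phi> B x) = ghost K B (Suc i) x)) \<and>
     (\<forall>B C h. ralgebra B \<longrightarrow> ralgebra C \<longrightarrow> h \<in> alg_hom B C \<longrightarrow>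
        (\<forall>x\<in>carrier (witt K n B). \<Phi> C (map h x) = map h (\<Phi> B x)))"

definition witt_F :: "'r::comm_ring_1 base \<Rightarrow> nat \<Rightarrow> ('r, 'b) ralg \<Rightarrow> 'b list \<Rightarrow> 'b list" where
  "witt_F K n = (SOME \<Phi>. witt_F_structure K n \<Phi>)"

definition witt_V :: "('r, 'b) ralg \<Rightarrow> 'b list \<Rightarrow> 'b list" where
  "witt_V B x = \<zero>\<^bsub>B\<^esub> # x"

text \<open>The fibre product \<open>R \<times>\<^sub>B W\<^sub>n(B)\<close>.\<close>

definition twitt :: "'r::comm_ring_1 base \<Rightarrow> nat \<Rightarrow> ('r, 'b) ralg \<Rightarrow> ('r, 'r \<times> 'b list) ralg" where
  "twitt K n B =
     \<lparr>carrier = {(r, w). w \<in> carrier (witt K n B) \<and> w ! 0 = alg B r},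
      monoid.mult = (\<lambda>(r, w) (s, v). (r * s, w \<otimes>\<^bsub>witt K n B\<^esub> v)),
      one = (1, \<one>\<^bsub>witt K n B\<^esub>),
      zero = (0, \<zero>\<^bsub>witt K n B\<^esub>),
      add = (\<lambda>(r, w) (s, v). (r + s, w \<oplus>\<^bsub>witt K n B\<^esub> v)),
      alg = (\<lambda>r. (r, alg (witt K n B) r))\<rparr>"

text \<open>The map sending \<open>(r, f(r) + V z)\<close> to \<open>(r, f(r) + V F z)\<close>, where \<open>f\<close> stands for the structure
  maps of \<open>W\<^sub>n(B)\<close> and \<open>W\<^sub>n\<^sub>-\<^sub>1(B\<^sup>\<phi>)\<close> respectively. Only meaningful for \<open>n \<ge> 2\<close>; for \<open>n = 1\<close> the target
  is \<open>R\<close> and the lateral Frobenius \<open>N\<^sup>1 \<rightarrow> N\<^sup>0 = 0\<close> is never used.\<close>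

definition twitt_F :: "'r::comm_ring_1 base \<Rightarrow> nat \<Rightarrow> ('r, 'b) ralg \<Rightarrow> 'r \<times> 'b list \<Rightarrow> 'r \<times> 'b list" where
  "twitt_F K n B = (\<lambda>(r, w)\<in>carrier (twitt K n B).
     let z = (THE z. z \<in> carrier (witt K (n - 1) B) \<and>
                     w = alg (witt K n B) r \<oplus>\<^bsub>witt K n B\<^esub> witt_V B z);
         W' = witt K (n - 1) (twist K 1 B)
     in (r, alg W' r \<oplus>\<^bsub>W'\<^esub> witt_V B (witt_F K (n - 1) B z)))"


section \<open>Formal schemes\<close>

text \<open>Spaces with a sheaf of \<open>R\<close>-algebras. All morphisms below are \<open>R\<close>-linear, i.e. live over \<open>Spf R\<close>.
  Between \<open>\<pi>\<close>-adic formal schemes, \<open>R\<close>-linearity makes the maps on sections continuous.\<close>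

record ('p, 'r, 's) rspace =
  tp :: "'p topology"
  sec :: "'p set \<Rightarrow> ('r, 's) ralg"
  res :: "'p set \<Rightarrow> 'p set \<Rightarrow> 's \<Rightarrow> 's"

definition ringed :: "('p, 'r::comm_ring_1, 's) rspace \<Rightarrow> bool" where
  "ringed X \<longleftrightarrow>
     (\<forall>U. openin (tp X) U \<longrightarrow> ralgebra (sec X U)) \<and>
     (\<forall>U V. openin (tp X) U \<longrightarrow> openin (tp X) V \<longrightarrow> V \<subseteq> U \<longrightarrow>
        is_alg_hom (sec X U) (sec X V) (res X U V)) \<and>
     (\<forall>U. openin (tp X) U \<longrightarrow> (\<forall>s\<in>carrier (sec X U). res X U U s = s)) \<and>
     (\<forall>U V W. openin (tp X) U \<longrightarrow> openin (tp X) V \<longrightarrow> openin (tp X) W \<longrightarrow> W \<subseteq> V \<longrightarrow> V \<subseteq> U \<longrightarrow>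
        (\<forall>s\<in>carrier (sec X U). res X V W (res X U V s) = res X U W s)) \<and>
     (\<forall>\<U> \<sigma>. (\<forall>V\<in>\<U>. openin (tp X) V \<and> \<sigma> V \<in> carrier (sec X V)) \<longrightarrow>
        (\<forall>V\<in>\<U>. \<forall>W\<in>\<U>. res X V (V \<inter> W) (\<sigma> V) = res X W (V \<inter> W) (\<sigma> W)) \<longrightarrow>
        (\<exists>!s. s \<in> carrier (sec X (\<Union>\<U>)) \<and> (\<forall>V\<in>\<U>. res X (\<Union>\<U>) V s = \<sigma> V)))"

definition germ_unit :: "('p, 'r, 's) rspace \<Rightarrow> 'p set \<Rightarrow> 'p \<Rightarrow> 's \<Rightarrow> bool" where
  "germ_unit X U x s \<longleftrightarrow>
     (\<exists>V. openin (tp X) V \<and> x \<in> V \<and> V \<subseteq> U \<and> res X U V s \<in> Units (sec X V))"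

text \<open>The stalks are local rings: the germ of \<open>0\<close> is not a unit, and if a sum of germs is a unit
  then one of the summands is.\<close>

definition locally_ringed :: "('p, 'r::comm_ring_1, 's) rspace \<Rightarrow> bool" where
  "locally_ringed X \<longleftrightarrow> ringed X \<and>
     (\<forall>U x. openin (tp X) U \<longrightarrow> x \<in> U \<longrightarrow>
        \<not> germ_unit X U x \<zero>\<^bsub>sec X U\<^esub> \<and>
        (\<forall>s\<in>carrier (sec X U). \<forall>t\<in>carrier (sec X U).
           germ_unit X U x (s \<oplus>\<^bsub>sec X U\<^esub> t) \<longrightarrow> germ_unit X U x s \<or> germ_unit X U x t))"

definition restr :: "('p, 'r, 's) rspace \<Rightarrow> 'p set \<Rightarrow> ('p, 'r, 's) rspace" where
  "restr X U = X\<lparr>tp := subtopology (tp X) U\<rparr>"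

record ('p, 's, 'u, 'v) mor =
  pts :: "'p \<Rightarrow> 'u"
  pull :: "'u set \<Rightarrow> 'v \<Rightarrow> 's"

definition pre :: "('p, 's, 'u, 'v) mor \<Rightarrow> ('p, 'r, 's) rspace \<Rightarrow> 'u set \<Rightarrow> 'p set" where
  "pre f X V = {x \<in> topspace (tp X). pts f x \<in> V}"

text \<open>Morphisms of locally ringed spaces over \<open>R\<close>, made extensional so that equality of morphisms is
  equality in HOL.\<close>

definition Mor :: "('p, 'r, 's) rspace \<Rightarrow> ('u, 'r, 'v) rspace \<Rightarrow> ('p, 's, 'u, 'v) mor set" where
  "Mor X Y = {f.
     pts f \<in> extensional (topspace (tp X)) \<and> continuous_map (tp X) (tp Y) (pts f) \<and>
     pull f \<in> extensional {V. openin (tp Y) V} \<and>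
     (\<forall>V. openin (tp Y) V \<longrightarrow> pull f V \<in> alg_hom (sec Y V) (sec X (pre f X V))) \<and>
     (\<forall>V W. openin (tp Y) V \<longrightarrow> openin (tp Y) W \<longrightarrow> W \<subseteq> V \<longrightarrow>
        (\<forall>s\<in>carrier (sec Y V).
           pull f W (res Y V W s) = res X (pre f X V) (pre f X W) (pull f V s))) \<and>
     (\<forall>x\<in>topspace (tp X). \<forall>V. openin (tp Y) V \<longrightarrow> pts f x \<in> V \<longrightarrow>
        (\<forall>s\<in>carrier (sec Y V). germ_unit X (pre f X V) x (pull f V s) \<longrightarrow> germ_unit Y V (pts f x) s))}"

definition comp_mor :: "('p, 'r, 's) rspace \<Rightarrow> ('u, 'r, 'v) rspace \<Rightarrow> ('w, 'r, 'x) rspace \<Rightarrow>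
    ('u, 'v, 'w, 'x) mor \<Rightarrow> ('p, 's, 'u, 'v) mor \<Rightarrow> ('p, 's, 'w, 'x) mor" where
  "comp_mor X Y Z g f =
     \<lparr>pts = (\<lambda>x\<in>topspace (tp X). pts g (pts f x)),
      pull = (\<lambda>V\<in>{V. openin (tp Z) V}. \<lambda>s\<in>carrier (sec Z V). pull f (pre g Y V) (pull g V s))\<rparr>"

definition id_mor :: "('p, 'r, 's) rspace \<Rightarrow> ('p, 's, 'p, 's) mor" where
  "id_mor X = \<lparr>pts = (\<lambda>x\<in>topspace (tp X). x),
               pull = (\<lambda>V\<in>{V. openin (tp X) V}. \<lambda>s\<in>carrier (sec X V). s)\<rparr>"

definition isomorphic :: "('p, 'r, 's) rspace \<Rightarrow> ('u, 'r, 'v) rspace \<Rightarrow> bool" where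
  "isomorphic X Y \<longleftrightarrow> (\<exists>f\<in>Mor X Y. \<exists>g\<in>Mor Y X.
     comp_mor X Y X g f = id_mor X \<and> comp_mor Y X Y f g = id_mor Y)"


subsection \<open>Formal spectra\<close>

definition spf_pts :: "'r base \<Rightarrow> ('r, 'c) ralg \<Rightarrow> 'c set set" where
  "spf_pts K C = {P. primeideal P C \<and> alg C (unif K) \<in> P}"

definition spf_top :: "'r base \<Rightarrow> ('r, 'c) ralg \<Rightarrow> 'c set topology" where
  "spf_top K C = topology_generated_by ((\<lambda>f. {P \<in> spf_pts K C. f \<notin> P}) ` carrier C)"

text \<open>\<open>fraction K C m P a t\<close> is the fraction \<open>a / t\<close> in the localization of \<open>C / \<pi>\<^sup>m C\<close> at \<open>P\<close>, as the
  equivalence class of all pairs representing it.\<close>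

definition fraction :: "'r::comm_ring_1 base \<Rightarrow> ('r, 'c) ralg \<Rightarrow> nat \<Rightarrow> 'c set \<Rightarrow> 'c \<Rightarrow> 'c \<Rightarrow> ('c \<times> 'c) set" where
  "fraction K C m P a t = {(b, u). b \<in> carrier C \<and> u \<in> carrier C - P \<and>
     (\<exists>v\<in>carrier C - P. v \<otimes>\<^bsub>C\<^esub> (u \<otimes>\<^bsub>C\<^esub> a \<ominus>\<^bsub>C\<^esub> t \<otimes>\<^bsub>C\<^esub> b) \<in> pow_ideal (unif K) m C)}"

type_synonym 'c spf_sec = "nat \<Rightarrow> 'c set \<Rightarrow> ('c \<times> 'c) set"

text \<open>A section over \<open>U\<close> of the structure sheaf of \<open>Spf C\<close> is a compatible family, indexed by \<open>m\<close>, of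
  sections \<open>s m\<close> over \<open>U\<close> of the structure sheaf of \<open>Spec (C / \<pi>\<^sup>m C)\<close>, each being locally a
  fraction. The reduction map from fractions modulo \<open>\<pi>\<^sup>m\<^sup>+\<^sup>1\<close> to fractions modulo \<open>\<pi>\<^sup>m\<close> is, on
  equivalence classes, given by inclusion.\<close>

definition spf_sections :: "'r::comm_ring_1 base \<Rightarrow> ('r, 'c) ralg \<Rightarrow> 'c set set \<Rightarrow> 'c spf_sec set" where
  "spf_sections K C U = {s. \<forall>m.
     (\<forall>P. P \<notin> U \<longrightarrow> s m P = {}) \<and>
     (\<forall>P\<in>U. s (Suc m) P \<subseteq> s m P) \<and>
     (\<forall>P\<in>U. \<exists>V a t. openin (spf_top K C) V \<and> P \<in> V \<and> V \<subseteq> U \<and> a \<in> carrier C \<and> t \<in> carrier C \<and>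
        (\<forall>Q\<in>V. t \<notin> Q \<and> s m Q = fraction K C m Q a t))}"

definition spf_const :: "'r::comm_ring_1 base \<Rightarrow> ('r, 'c) ralg \<Rightarrow> 'c set set \<Rightarrow> 'c \<Rightarrow> 'c spf_sec" where
  "spf_const K C U c = (\<lambda>m P. if P \<in> U then fraction K C m P c \<one>\<^bsub>C\<^esub> else {})"

definition spf_alg :: "'r::comm_ring_1 base \<Rightarrow> ('r, 'c) ralg \<Rightarrow> 'c set set \<Rightarrow> ('r, 'c spf_sec) ralg" where
  "spf_alg K C U =
     \<lparr>carrier = spf_sections K C U,
      monoid.mult = (\<lambda>s s' m P. \<Union>(a, t)\<in>s m P. \<Union>(b, u)\<in>s' m P. fraction K C m P (a \<otimes>\<^bsub>C\<^esub> b) (t \<otimes>\<^bsub>C\<^esub> u)),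
      one = spf_const K C U \<one>\<^bsub>C\<^esub>,
      zero = spf_const K C U \<zero>\<^bsub>C\<^esub>,
      add = (\<lambda>s s' m P. \<Union>(a, t)\<in>s m P. \<Union>(b, u)\<in>s' m P.
               fraction K C m P (u \<otimes>\<^bsub>C\<^esub> a \<oplus>\<^bsub>C\<^esub> t \<otimes>\<^bsub>C\<^esub> b) (t \<otimes>\<^bsub>C\<^esub> u)),
      alg = (\<lambda>r. spf_const K C U (alg C r))\<rparr>"

type_synonym ('r, 'c) fspace = "('c set, 'r, 'c spf_sec) rspace"

definition Spf :: "'r::comm_ring_1 base \<Rightarrow> ('r, 'c) ralg \<Rightarrow> ('r, 'c) fspace" where
  "Spf K C = \<lparr>tp = spf_top K C, sec = spf_alg K C, res = (\<lambda>U V s m P. if P \<in> V then s m P else {})\<rparr>"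

text \<open>The morphism \<open>Spf D \<rightarrow> Spf C\<close> induced by \<open>h : C \<rightarrow> D\<close>.\<close>

definition Spf_map :: "'r::comm_ring_1 base \<Rightarrow> ('r, 'c) ralg \<Rightarrow> ('r, 'd) ralg \<Rightarrow> ('c \<Rightarrow> 'd) \<Rightarrow>
    ('d set, 'd spf_sec, 'c set, 'c spf_sec) mor" where
  "Spf_map K C D h =
     (let i = (\<lambda>Q. {c \<in> carrier C. h c \<in> Q}) in
      \<lparr>pts = (\<lambda>Q\<in>spf_pts K D. i Q),
       pull = (\<lambda>U\<in>{U. openin (spf_top K C) U}. \<lambda>s\<in>spf_sections K C U. \<lambda>m Q.
          if Q \<in> spf_pts K D \<and> i Q \<in> U then \<Union>(a, t)\<in>s m (i Q). fraction K D m Q (h a) (h t) else {})\<rparr>)"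

text \<open>The element of \<open>C\<close> corresponding to a global section of \<open>Spf C\<close>.\<close>

definition spf_global :: "'r::comm_ring_1 base \<Rightarrow> ('r, 'c) ralg \<Rightarrow> 'c spf_sec \<Rightarrow> 'c" where
  "spf_global K C s = (THE c. c \<in> carrier C \<and> spf_const K C (spf_pts K C) c = s)"


subsection \<open>Formal schemes and their properties\<close>

definition affine_open :: "'r::comm_ring_1 base \<Rightarrow> ('p, 'r, 's) rspace \<Rightarrow> 'p set \<Rightarrow> bool" where
  "affine_open K X U \<longleftrightarrow> openin (tp X) U \<and> sec X U \<in> complete_algebras K \<and>
     isomorphic (restr X U) (Spf K (sec X U))"

definition formal_scheme :: "'r::comm_ring_1 base \<Rightarrow> ('p, 'r, 's) rspace \<Rightarrow> bool" where
  "formal_scheme K X \<longleftrightarrow> locally_ringed X \<and> (\<forall>x\<in>topspace (tp X). \<exists>U. x \<in> U \<and> affine_open K X U)"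

text \<open>Products over \<open>Spf R\<close> of \<open>\<pi>\<close>-formal schemes. The test objects \<open>T\<close> range over the formal schemes
  in the same types as \<open>P\<close>.\<close>

definition is_prod :: "'r::comm_ring_1 base \<Rightarrow> ('p, 'r, 's) rspace \<Rightarrow> ('u, 'r, 'v) rspace \<Rightarrow>
    ('w, 'r, 'x) rspace \<Rightarrow> ('w, 'x, 'p, 's) mor \<Rightarrow> ('w, 'x, 'u, 'v) mor \<Rightarrow> bool" where
  "is_prod K X Y P p1 p2 \<longleftrightarrow> formal_scheme K P \<and> p1 \<in> Mor P X \<and> p2 \<in> Mor P Y \<and>
     (\<forall>T :: ('w, 'r, 'x) rspace. formal_scheme K T \<longrightarrow> (\<forall>f\<in>Mor T X. \<forall>g\<in>Mor T Y.
        \<exists>!h. h \<in> Mor T P \<and> comp_mor T P X p1 h = f \<and> comp_mor T P Y p2 h = g))"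

text \<open>The definitions below that quantify over auxiliary algebras or formal schemes take a type
  \<open>'c\<close> as universe: algebras have carrier in \<open>'c\<close>, and formal schemes have the types of the formal
  spectra of such algebras.\<close>

inductive_set generated :: "('r, 'c) ralg \<Rightarrow> 'c set \<Rightarrow> 'c set" for C Y where
  "c \<in> Y \<Longrightarrow> c \<in> generated C Y"
| "alg C r \<in> generated C Y"
| "c \<in> generated C Y \<Longrightarrow> d \<in> generated C Y \<Longrightarrow> c \<oplus>\<^bsub>C\<^esub> d \<in> generated C Y"
| "c \<in> generated C Y \<Longrightarrow> d \<in> generated C Y \<Longrightarrow> c \<otimes>\<^bsub>C\<^esub> d \<in> generated C Y"

text \<open>Topologically of finite type: \<open>C / \<pi> C\<close> is a finitely generated algebra.\<close>

definition top_finite_type :: "'r::comm_ring_1 base \<Rightarrow> ('r, 'c) ralg \<Rightarrow> bool" where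
  "top_finite_type K C \<longleftrightarrow> (\<exists>Y. finite Y \<and> Y \<subseteq> carrier C \<and>
     (\<forall>c\<in>carrier C. \<exists>d\<in>generated C Y. c \<ominus>\<^bsub>C\<^esub> d \<in> pow_ideal (unif K) 1 C))"

text \<open>Unique infinitesimal lifting for the map from the \<open>\<pi>\<close>-completed polynomial ring in \<open>g\<close> variables
  to \<open>C\<close> given by \<open>\<xi> 1, \<dots>, \<xi> g\<close>. A homomorphism from the former ring to an algebra killed by a power
  of \<open>\<pi>\<close> amounts to the choice of \<open>g\<close> elements \<open>d 1, \<dots>, d g\<close>.\<close>

definition formally_etale ::
    "'c itself \<Rightarrow> 'r::comm_ring_1 base \<Rightarrow> ('r, 's) ralg \<Rightarrow> nat \<Rightarrow> (nat \<Rightarrow> 's) \<Rightarrow> bool" where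
  "formally_etale (_ :: 'c itself) K C g \<xi> \<longleftrightarrow>
     (\<forall>(D :: ('r, 'c) ralg) (D' :: ('r, 'c) ralg) \<psi> m h d.
        ralgebra D \<longrightarrow> ralgebra D' \<longrightarrow> alg D (unif K ^ m) = \<zero>\<^bsub>D\<^esub> \<longrightarrow>
        \<psi> \<in> alg_hom D D' \<longrightarrow> \<psi> ` carrier D = carrier D' \<longrightarrow>
        (\<forall>a\<in>carrier D. \<forall>b\<in>carrier D. \<psi> a = \<zero>\<^bsub>D'\<^esub> \<longrightarrow> \<psi> b = \<zero>\<^bsub>D'\<^esub> \<longrightarrow> a \<otimes>\<^bsub>D\<^esub> b = \<zero>\<^bsub>D\<^esub>) \<longrightarrow>
        h \<in> alg_hom C D' \<longrightarrow> (\<forall>j\<in>{1..g}. d j \<in> carrier D \<and> \<psi> (d j) = h (\<xi> j)) \<longrightarrow>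
        (\<exists>!h'. h' \<in> alg_hom C D \<and> (\<forall>c\<in>carrier C. \<psi> (h' c) = h c) \<and> (\<forall>j\<in>{1..g}. h' (\<xi> j) = d j)))"

text \<open>The functions \<open>\<xi> 1, \<dots>, \<xi> g\<close> define an \'etale morphism from the affine open \<open>U\<close> to the
  \<open>\<pi>\<close>-formal affine \<open>g\<close>-space. As \<open>R\<close> is noetherian, finite type and finite presentation agree
  modulo every power of \<open>\<pi>\<close>.\<close>

definition etale_coordinates :: "'c itself \<Rightarrow> 'r::comm_ring_1 base \<Rightarrow> ('p, 'r, 's) rspace \<Rightarrow>
    nat \<Rightarrow> 'p set \<Rightarrow> (nat \<Rightarrow> 's) \<Rightarrow> bool" where
  "etale_coordinates u K X g U \<xi> \<longleftrightarrow> affine_open K X U \<and> top_finite_type K (sec X U) \<and>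
     (\<forall>j\<in>{1..g}. \<xi> j \<in> carrier (sec X U)) \<and> formally_etale u K (sec X U) g \<xi>"

definition smooth_of_reldim ::
    "'c itself \<Rightarrow> 'r::comm_ring_1 base \<Rightarrow> ('p, 'r, 's) rspace \<Rightarrow> nat \<Rightarrow> bool" where
  "smooth_of_reldim u K X g \<longleftrightarrow>
     (\<forall>x\<in>topspace (tp X). \<exists>U \<xi>. x \<in> U \<and> etale_coordinates u K X g U \<xi>)"

definition finite_type :: "'r::comm_ring_1 base \<Rightarrow> ('p, 'r, 's) rspace \<Rightarrow> bool" where
  "finite_type K X \<longleftrightarrow> compact_space (tp X) \<and>
     (\<forall>x\<in>topspace (tp X). \<exists>U. x \<in> U \<and> affine_open K X U \<and> top_finite_type K (sec X U))"

definition separated :: "'c itself \<Rightarrow> 'r::comm_ring_1 base \<Rightarrow> ('p, 'r, 's) rspace \<Rightarrow> bool" where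
  "separated (_ :: 'c itself) K X \<longleftrightarrow> (\<forall>(P :: ('r, 'c) fspace) p1 p2. is_prod K X X P p1 p2 \<longrightarrow>
     (\<forall>\<delta>\<in>Mor X P. comp_mor X P X p1 \<delta> = id_mor X \<longrightarrow> comp_mor X P X p2 \<delta> = id_mor X \<longrightarrow>
        closedin (tp P) (pts \<delta> ` topspace (tp X))))"

definition universally_closed :: "'c itself \<Rightarrow> 'r::comm_ring_1 base \<Rightarrow> ('p, 'r, 's) rspace \<Rightarrow> bool" where
  "universally_closed (_ :: 'c itself) K X \<longleftrightarrow>
     (\<forall>D :: ('r, 'c) ralg. D \<in> complete_algebras K \<longrightarrow>
        (\<forall>(P :: ('r, 'c) fspace) p1 p2. is_prod K X (Spf K D) P p1 p2 \<longrightarrow>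
           (\<forall>Z. closedin (tp P) Z \<longrightarrow> closedin (spf_top K D) (pts p2 ` Z))))"

definition proper :: "'c itself \<Rightarrow> 'r::comm_ring_1 base \<Rightarrow> ('p, 'r, 's) rspace \<Rightarrow> bool" where
  "proper u K X \<longleftrightarrow> finite_type K X \<and> separated u K X \<and> universally_closed u K X"

text \<open>The fields \<open>L\<close> below are the extensions of the residue field of \<open>R\<close>, the only point of
  \<open>Spf R\<close>.\<close>

definition geom_connected_fibre ::
    "'c itself \<Rightarrow> 'r::comm_ring_1 base \<Rightarrow> ('p, 'r, 's) rspace \<Rightarrow> bool" where
  "geom_connected_fibre (_ :: 'c itself) K X \<longleftrightarrow>
     (\<forall>L :: ('r, 'c) ralg. ralgebra L \<longrightarrow> field L \<longrightarrow> alg L (unif K) = \<zero>\<^bsub>L\<^esub> \<longrightarrow>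
        (\<forall>(P :: ('r, 'c) fspace) p1 p2. is_prod K X (Spf K L) P p1 p2 \<longrightarrow>
           topspace (tp P) \<noteq> {} \<and> connected_space (tp P)))"


subsection \<open>Formal abelian schemes\<close>

text \<open>A formal group scheme is given by its identity section and, via the functor of points, by the
  group laws on \<open>A(C) = Mor (Spf C) A\<close> for \<open>\<pi>\<close>-complete algebras \<open>C\<close> with carrier in \<open>'c\<close>.\<close>

record ('p, 'r, 's, 'c) fgroup =
  und :: "('p, 'r, 's) rspace"
  idsec :: "('r set, 'r spf_sec, 'p, 's) mor"
  gmul :: "('r, 'c) ralg \<Rightarrow> ('c set, 'c spf_sec, 'p, 's) mor \<Rightarrow> ('c set, 'c spf_sec, 'p, 's) mor \<Rightarrow>
             ('c set, 'c spf_sec, 'p, 's) mor"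

definition points :: "'r::comm_ring_1 base \<Rightarrow> ('p, 'r, 's, 'c) fgroup \<Rightarrow> ('r, 'd) ralg \<Rightarrow>
    ('d set, 'd spf_sec, 'p, 's) mor set" where
  "points K A C = Mor (Spf K C) (und A)"

text \<open>The map \<open>A(C) \<rightarrow> A(D)\<close> induced by \<open>h : C \<rightarrow> D\<close>.\<close>

definition points_map :: "'r::comm_ring_1 base \<Rightarrow> ('p, 'r, 's, 'c) fgroup \<Rightarrow>
    ('r, 'd) ralg \<Rightarrow> ('r, 'e) ralg \<Rightarrow> ('d \<Rightarrow> 'e) \<Rightarrow>
    ('d set, 'd spf_sec, 'p, 's) mor \<Rightarrow> ('e set, 'e spf_sec, 'p, 's) mor" where
  "points_map K A C D h x = comp_mor (Spf K D) (Spf K C) (und A) x (Spf_map K C D h)"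

definition id_point :: "'r::comm_ring_1 base \<Rightarrow> ('p, 'r, 's, 'c) fgroup \<Rightarrow> ('r, 'd) ralg \<Rightarrow>
    ('d set, 'd spf_sec, 'p, 's) mor" where
  "id_point K A C = points_map K A base_alg C (alg C) (idsec A)"

definition formal_group_scheme :: "'r::comm_ring_1 base \<Rightarrow> ('p, 'r, 's, 'c) fgroup \<Rightarrow> bool" where
  "formal_group_scheme K A \<longleftrightarrow> formal_scheme K (und A) \<and> idsec A \<in> points K A base_alg \<and>
     (\<forall>C\<in>complete_algebras K.
        group \<lparr>carrier = points K A C, monoid.mult = gmul A C, one = id_point K A C\<rparr>) \<and>
     (\<forall>C\<in>complete_algebras K. \<forall>D\<in>complete_algebras K. \<forall>h\<in>alg_hom C D.
        \<forall>x\<in>points K A C. \<forall>y\<in>points K A C.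
          points_map K A C D h (gmul A C x y) =
          gmul A D (points_map K A C D h x) (points_map K A C D h y))"

definition formal_abelian_scheme :: "'r::comm_ring_1 base \<Rightarrow> ('p, 'r, 's, 'c) fgroup \<Rightarrow> nat \<Rightarrow> bool" where
  "formal_abelian_scheme K A g \<longleftrightarrow> formal_group_scheme K A \<and>
     proper TYPE('c) K (und A) \<and> smooth_of_reldim TYPE('c) K (und A) g \<and>
     geom_connected_fibre TYPE('c) K (und A)"

text \<open>\'Etale coordinates on a neighbourhood \<open>U\<close> of the identity section, vanishing along it.\<close>

definition coordinates_at_identity :: "'r::comm_ring_1 base \<Rightarrow> ('p, 'r, 's, 'c) fgroup \<Rightarrow> nat \<Rightarrow>
    'p set \<Rightarrow> (nat \<Rightarrow> 's) \<Rightarrow> bool" where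
  "coordinates_at_identity K A g U \<xi> \<longleftrightarrow> etale_coordinates TYPE('c) K (und A) g U \<xi> \<and>
     pts (idsec A) ` spf_pts K (base_alg :: ('r, 'r) ralg) \<subseteq> U \<and>
     (\<forall>j\<in>{1..g}. pull (idsec A) U (\<xi> j) =
        spf_const K base_alg (spf_pts K (base_alg :: ('r, 'r) ralg)) 0)"


section \<open>The kernel of the jet space\<close>

text \<open>\<open>J\<^sup>n A(B) = A(W\<^sub>n(B))\<close>, and \<open>N\<^sup>n(B)\<close> (here \<open>jet_ker\<close>) is the kernel of the truncation \<open>J\<^sup>n A(B) \<rightarrow> A(B)\<close>. All functors
  are evaluated on \<open>\<pi>\<close>-complete algebras with carrier in \<open>'b\<close>, so that \<open>'b list\<close> serves as the
  universe for the group law of \<open>A\<close>. If \<open>'b\<close> has the cardinality of its countable powers and is at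
  least as large as \<open>R\<close>, it holds a copy of every algebra that is needed, in particular of the
  coordinate rings of \<open>N\<^sup>n\<close> and of affine opens of \<open>A\<close> and \<open>A \<times> A\<close>.\<close>

type_synonym ('p, 's, 'b) jet = "('b list set, 'b list spf_sec, 'p, 's) mor"

definition jet_space :: "'r::comm_ring_1 base \<Rightarrow> ('p, 'r, 's, 'b list) fgroup \<Rightarrow> nat \<Rightarrow> ('r, 'b) ralg \<Rightarrow>
    ('p, 's, 'b) jet set" where
  "jet_space K A n B = points K A (witt K n B)"

definition jet_ker :: "'r::comm_ring_1 base \<Rightarrow> ('p, 'r, 's, 'b list) fgroup \<Rightarrow> nat \<Rightarrow> ('r, 'b) ralg \<Rightarrow>
    ('p, 's, 'b) jet set" where
  "jet_ker K A n B = {x \<in> jet_space K A n B.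
     points_map K A (witt K n B) B (\<lambda>w\<in>carrier (witt K n B). w ! 0) x = id_point K A B}"

definition jet_ker_map :: "'r::comm_ring_1 base \<Rightarrow> ('p, 'r, 's, 'b list) fgroup \<Rightarrow> nat \<Rightarrow>
    ('r, 'b) ralg \<Rightarrow> ('r, 'b) ralg \<Rightarrow> ('b \<Rightarrow> 'b) \<Rightarrow> ('p, 's, 'b) jet \<Rightarrow> ('p, 's, 'b) jet" where
  "jet_ker_map K A n B C h =
     points_map K A (witt K n B) (witt K n C) (\<lambda>w\<in>carrier (witt K n B). map h w)"

text \<open>The projection \<open>u : N\<^sup>n \<rightarrow> N\<^sup>n\<^sup>-\<^sup>1\<close>, for \<open>n \<ge> 1\<close>, and the iterated projection \<open>N\<^sup>n \<rightarrow> N\<^sup>1\<close>.\<close>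

definition jet_ker_proj :: "'r::comm_ring_1 base \<Rightarrow> ('p, 'r, 's, 'b list) fgroup \<Rightarrow> nat \<Rightarrow> ('r, 'b) ralg \<Rightarrow>
    ('p, 's, 'b) jet \<Rightarrow> ('p, 's, 'b) jet" where
  "jet_ker_proj K A n B =
     points_map K A (witt K n B) (witt K (n - 1) B) (\<lambda>w\<in>carrier (witt K n B). butlast w)"

primrec jet_ker_proj_to_1 :: "'r::comm_ring_1 base \<Rightarrow> ('p, 'r, 's, 'b list) fgroup \<Rightarrow> nat \<Rightarrow> ('r, 'b) ralg \<Rightarrow>
    ('p, 's, 'b) jet \<Rightarrow> ('p, 's, 'b) jet" where
  "jet_ker_proj_to_1 K A 0 B x = x"
| "jet_ker_proj_to_1 K A (Suc n) B x =
     (if n = 0 then x else jet_ker_proj_to_1 K A n B (jet_ker_proj K A (Suc n) B x))"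

text \<open>An element \<open>x\<close> of \<open>N\<^sup>n(B)\<close> is the same as a map from the formal spectrum of \<open>R \<times>\<^sub>B W\<^sub>n(B)\<close> to \<open>A\<close>
  restricting to the identity section on \<open>Spf R\<close>; \<open>jet_ker_ext\<close> is the map obtained from \<open>x\<close>.\<close>

definition jet_ker_ext :: "'r::comm_ring_1 base \<Rightarrow> ('p, 'r, 's, 'b list) fgroup \<Rightarrow> nat \<Rightarrow> ('r, 'b) ralg \<Rightarrow>
    ('p, 's, 'b) jet \<Rightarrow> (('r \<times> 'b list) set, ('r \<times> 'b list) spf_sec, 'p, 's) mor" where
  "jet_ker_ext K A n B x = (THE y. y \<in> points K A (twitt K n B) \<and>
     points_map K A (twitt K n B) base_alg (\<lambda>w\<in>carrier (twitt K n B). fst w) y = idsec A \<and>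
     points_map K A (twitt K n B) (witt K n B) (\<lambda>w\<in>carrier (twitt K n B). snd w) y = x)"

text \<open>The lateral Frobenius \<open>N\<^sup>n(B) \<rightarrow> N\<^sup>n\<^sup>-\<^sup>1(B\<^sup>\<phi>)\<close> for \<open>n \<ge> 2\<close>, and its \<open>k\<close>-fold iterate
  \<open>N\<^sup>n(B) \<rightarrow> N\<^sup>n\<^sup>-\<^sup>k\<close> evaluated on the \<open>k\<close>-th twist of \<open>B\<close>, for \<open>k < n\<close>.\<close>

definition lat_frob :: "'r::comm_ring_1 base \<Rightarrow> ('p, 'r, 's, 'b list) fgroup \<Rightarrow> nat \<Rightarrow> ('r, 'b) ralg \<Rightarrow>
    ('p, 's, 'b) jet \<Rightarrow> ('p, 's, 'b) jet" where
  "lat_frob K A n B x =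
     (let T = twitt K (n - 1) (twist K 1 B) in
      points_map K A T (witt K (n - 1) (twist K 1 B)) (\<lambda>w\<in>carrier T. snd w)
        (points_map K A (twitt K n B) T (twitt_F K n B) (jet_ker_ext K A n B x)))"

primrec lat_frob_iter :: "'r::comm_ring_1 base \<Rightarrow> ('p, 'r, 's, 'b list) fgroup \<Rightarrow> nat \<Rightarrow> nat \<Rightarrow>
    ('r, 'b) ralg \<Rightarrow> ('p, 's, 'b) jet \<Rightarrow> ('p, 's, 'b) jet" where
  "lat_frob_iter K A n 0 B x = x"
| "lat_frob_iter K A n (Suc k) B x = lat_frob K A (n - k) (twist K k B) (lat_frob_iter K A n k B x)"


section \<open>Characters\<close>

text \<open>Homomorphisms from \<open>N\<^sup>n\<close> to the formal additive group, as natural additive maps \<open>N\<^sup>n(B) \<rightarrow> B\<close>.\<close>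

type_synonym ('p, 'r, 's, 'b) character = "('r, 'b) ralg \<Rightarrow> ('p, 's, 'b) jet \<Rightarrow> 'b"

definition Hom_Ga :: "'r::comm_ring_1 base \<Rightarrow> ('p, 'r, 's, 'b list) fgroup \<Rightarrow> nat \<Rightarrow>
    ('p, 'r, 's, 'b) character set" where
  "Hom_Ga K A n = {\<theta> \<in> (\<Pi>\<^sub>E B\<in>complete_algebras K. jet_ker K A n B \<rightarrow>\<^sub>E carrier B).
     (\<forall>B\<in>complete_algebras K. \<forall>x\<in>jet_ker K A n B. \<forall>y\<in>jet_ker K A n B.
        \<theta> B (gmul A (witt K n B) x y) = \<theta> B x \<oplus>\<^bsub>B\<^esub> \<theta> B y) \<and>
     (\<forall>B\<in>complete_algebras K. \<forall>C\<in>complete_algebras K. \<forall>h\<in>alg_hom B C. \<forall>x\<in>jet_ker K A n B.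
        \<theta> C (jet_ker_map K A n B C h x) = h (\<theta> B x))}"

text \<open>The \<open>R\<close>-module of characters; the multiplicative part of the module record is not used.\<close>

definition Hom_module :: "'r::comm_ring_1 base \<Rightarrow> ('p, 'r, 's, 'b list) fgroup \<Rightarrow> nat \<Rightarrow>
    ('r, ('p, 'r, 's, 'b) character) module" where
  "Hom_module K A n =
     \<lparr>carrier = Hom_Ga K A n, monoid.mult = undefined, one = undefined,
      zero = (\<lambda>B\<in>complete_algebras K. \<lambda>x\<in>jet_ker K A n B. \<zero>\<^bsub>B\<^esub>),
      add = (\<lambda>\<theta> \<eta>. \<lambda>B\<in>complete_algebras K. \<lambda>x\<in>jet_ker K A n B. \<theta> B x \<oplus>\<^bsub>B\<^esub> \<eta> B x),
      module.smult = (\<lambda>r \<theta>. \<lambda>B\<in>complete_algebras K. \<lambda>x\<in>jet_ker K A n B. alg B r \<otimes>\<^bsub>B\<^esub> \<theta> B x)\<rparr>"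

text \<open>The Witt coordinate \<open>x\<^sub>i\<^sub>j\<close> on \<open>N\<^sup>n\<close> is the \<open>i\<close>-th Witt component of the pull-back of \<open>\<xi> j\<close> to
  \<open>W\<^sub>n(B)\<close>. Points of \<open>N\<^sup>n(B)\<close> factor through \<open>U\<close>, so this pull-back is a global section.\<close>

definition witt_coord :: "'r::comm_ring_1 base \<Rightarrow> 'p set \<Rightarrow> (nat \<Rightarrow> 's) \<Rightarrow> nat \<Rightarrow> ('r, 'b) ralg \<Rightarrow>
    nat \<Rightarrow> nat \<Rightarrow> ('p, 's, 'b) jet \<Rightarrow> 'b" where
  "witt_coord K U \<xi> n B i j x = spf_global K (witt K n B) (pull x U (\<xi> j)) ! i"

text \<open>An isomorphism of formal group schemes from \<open>N\<^sup>1\<close> to the \<open>g\<close>-th power of the additive group, with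
  derivative the identity at the origin: it agrees with the coordinates on the first infinitesimal
  neighbourhood of the origin, i.e. at points whose coordinates have pairwise vanishing products.
  As endomorphisms of powers of the formal additive group over \<open>R\<close> are linear, there is at most one
  such isomorphism.\<close>

definition normalized_iso :: "'r::comm_ring_1 base \<Rightarrow> ('p, 'r, 's, 'b list) fgroup \<Rightarrow> nat \<Rightarrow>
    'p set \<Rightarrow> (nat \<Rightarrow> 's) \<Rightarrow> (nat \<Rightarrow> ('p, 'r, 's, 'b) character) \<Rightarrow> bool" where
  "normalized_iso K A g U \<xi> \<Psi>1 \<longleftrightarrow>
     (\<forall>j\<in>{1..g}. \<Psi>1 j \<in> Hom_Ga K A 1) \<and>
     (\<forall>B\<in>complete_algebras K.
        bij_betw (\<lambda>x. \<lambda>j\<in>{1..g}. \<Psi>1 j B x) (jet_ker K A 1 B) ({1..g} \<rightarrow>\<^sub>E carrier B)) \<and>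
     (\<forall>B\<in>complete_algebras K. \<forall>x\<in>jet_ker K A 1 B.
        (\<forall>k\<in>{1..g}. \<forall>l\<in>{1..g}.
           witt_coord K U \<xi> 1 B 1 k x \<otimes>\<^bsub>B\<^esub> witt_coord K U \<xi> 1 B 1 l x = \<zero>\<^bsub>B\<^esub>) \<longrightarrow>
        (\<forall>j\<in>{1..g}. \<Psi>1 j B x = witt_coord K U \<xi> 1 B 1 j x))"

definition Psi :: "'r::comm_ring_1 base \<Rightarrow> ('p, 'r, 's, 'b list) fgroup \<Rightarrow>
    (nat \<Rightarrow> ('p, 'r, 's, 'b) character) \<Rightarrow> nat \<Rightarrow> nat \<Rightarrow> nat \<Rightarrow> ('p, 'r, 's, 'b) character" where
  "Psi K A \<Psi>1 n i j = (\<lambda>B\<in>complete_algebras K. \<lambda>x\<in>jet_ker K A n B.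
     (let B' = twist K (i - 1) B
      in \<Psi>1 j B' (jet_ker_proj_to_1 K A (n - i + 1) B' (lat_frob_iter K A n (i - 1) B x))))"


section \<open>Bases and rank\<close>

definition is_basis :: "('r, 'z) ring_scheme \<Rightarrow> ('r, 'a, 'y) module_scheme \<Rightarrow> 'i set \<Rightarrow> ('i \<Rightarrow> 'a) \<Rightarrow> bool" where
  "is_basis R M I b \<longleftrightarrow> Module.module R M \<and> finite I \<and> b \<in> I \<rightarrow> carrier M \<and>
     (\<forall>m\<in>carrier M. \<exists>!c. c \<in> I \<rightarrow>\<^sub>E carrier R \<and> m = (\<Oplus>\<^bsub>M\<^esub>i\<in>I. c i \<odot>\<^bsub>M\<^esub> b i))"

definition lin_indep :: "('r, 'z) ring_scheme \<Rightarrow> ('r, 'a, 'y) module_scheme \<Rightarrow> 'a set \<Rightarrow> bool" where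
  "lin_indep R M S \<longleftrightarrow> (\<forall>c\<in>S \<rightarrow> carrier R.
     (\<Oplus>\<^bsub>M\<^esub>v\<in>S. c v \<odot>\<^bsub>M\<^esub> v) = \<zero>\<^bsub>M\<^esub> \<longrightarrow> (\<forall>v\<in>S. c v = \<zero>\<^bsub>R\<^esub>))"

text \<open>The rank of a module over an integral domain.\<close>

definition module_rank :: "('r, 'z) ring_scheme \<Rightarrow> ('r, 'a, 'y) module_scheme \<Rightarrow> enat" where
  "module_rank R M = (SUP S\<in>{S. finite S \<and> S \<subseteq> carrier M \<and> lin_indep R M S}. enat (card S))"

end

(* Over a torsion-free algebra B, ghost components show that a point x of N^n is determined by the values
Psi_ij(x), and that for every family b_ij some point has the values p^n b_ij. Taking for the b_ij
the variables X_ij of a completed polynomial ring and evaluating a character th at this point gives a function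
f with f(p X) = p f(X), since th and the Psi_ij commute with multiplication by p. As p^k - 1 is a unit
for k > 0, only the linear terms of f survive, so p^n th is an R-linear combination of the Psi_ij.

The coefficients can be divided by p^n: modulo pi the lateral Frobenius becomes the q-th power map on
coordinates and Psi_1j becomes x_1j, so Psi_ij reduces to the power x_1j^(q^(i-1)) on N^n. These are
linearly independent over the residue field, hence a combination that is divisible by pi has coefficients
divisible by pi. An algebra with torsion is reached by lifting its points to a torsion-free one. *)
theory Submission
 imports Defs "HOL-Library.Poly_Mapping"
begin

text \<open>A point of a jet kernel is treated as an algebra homomorphism from the chart
  \<open>CU\<close> to Witt vectors. This is possible because \<open>V x ** V y\<close> is \<pi>
  times a Verschiebung: the kernel of \<open>W_n(B) -> B\<close> is nil modulo \<pi>, so such points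
  land in the chart, and etale lifting makes their coordinates free. Identities of Witt vectors are
  checked on a torsion-free polynomial algebra, where ghost components are faithful, and then
  specialised. The existence of Witt structures there forces \<open>\<phi> \<pi> = \<pi>\<close>,
  and this makes ghost components insensitive to twisting. The factor \<open>p^n\<close> serves two
  ends. A vector that is congruent modulo \<open>\<pi>^n\<close> to the ghost of a constant is
  itself the ghost of a Witt vector of length \<open>n + 1\<close>, and points of \<open>N^1\<close>
  with values divisible by \<open>p^n\<close> lead to such vectors. Also, multiplication by an
  integer, unlike multiplication by \<pi>, is an operation of the group. Auxiliary algebras must lie
  in the types on which the functors live. They are copied along injections into \<open>'b\<close>
  or \<open>'b list\<close>, and quotients consist of chosen representatives.\<close>

no_notation matrix_matrix_mult (infixl "**" 70) and map_add (infixl "++" 100)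
notation (input) monoid.mult (infixl "**\<index>" 70) and add (infixl "++\<index>" 65)
abbreviation (input) biimp (infixr "<->" 25) where "P <-> Q \<equiv> P = (Q :: bool)"
abbreviation (input) "adic K \<equiv> adic_complete (unif K)"
abbreviation (input) "psing \<equiv> Poly_Mapping.single"
abbreviation (input) "plook \<equiv> Poly_Mapping.lookup"
abbreviation (input) "pkeys \<equiv> Poly_Mapping.keys"
abbreviation (input) elem (infix "<:" 50) where "x <: B \<equiv> x \<in> carrier B"
syntax "_index" :: "logic \<Rightarrow> index" ("._" [1000] 1000)

section \<open>Commutative algebra with explicit carriers\<close>

section \<open>Algebras over the base ring\<close>

lemma base_alg_sel [simp]:
 "carrier base_alg = UNIV" "a **.base_alg b = a * b" "\<one>.base_alg = 1"
 "\<zero>.base_alg = 0" "a ++.base_alg b = a + b" "alg base_alg r = r"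
 by (simp_all add: base_alg_def)

lemma cring_base_alg: "cring (base_alg :: ('r::comm_ring_1, 'r) ralg)"
proof (rule cringI)
 show "abelian_group (base_alg :: ('r, 'r) ralg)"
 proof (rule abelian_groupI)
  show "EX y:carrier base_alg. y ++.base_alg x = \<zero>.base_alg" for x :: 'r
  by (auto intro: exI[of _ "- x"])
 qed (auto simp: algebra_simps)
 show "comm_monoid (base_alg :: ('r, 'r) ralg)"
  by (rule comm_monoidI) (auto simp: algebra_simps)
qed (auto simp: algebra_simps)

lemma base_alg_minus [simp]:
 "\<ominus>.base_alg (a::'r::comm_ring_1) = - a" "a \<ominus>.base_alg b = a - b"
proof -
 interpret cring "base_alg :: ('r, 'r) ralg" by (rule cring_base_alg)
 show 1: "\<ominus>.base_alg (a::'r::comm_ring_1) = - a" for a :: 'r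
  by (rule minus_equality) auto
 show "a \<ominus>.base_alg b = a - b" by (simp add: minus_eq 1)
qed

lemma base_alg_pow [simp]: "a [^].base_alg (n::nat) = (a::'r::comm_ring_1) ^ n"
 by (induction n) (simp_all add: mult.commute)

lemma ralgebra_base_alg: "ralgebra base_alg"
 unfolding ralgebra_def by (auto simp: cring_base_alg intro!: ring_hom_memI)

locale r_algebra = cring B for B :: "('r::comm_ring_1, 'b) ralg" (structure) +
 assumes structure_map: "alg B : ring_hom base_alg B"
begin

lemma alg_closed [simp, intro]: "alg B r <: B"
 using ring_hom_closed[OF structure_map] by simp

lemma alg_mult: "alg B (r * s) = alg B r ** alg B s"
 using ring_hom_mult[OF structure_map] by simp

lemma alg_add: "alg B (r + s) = alg B r ++ alg B s"
 using ring_hom_add[OF structure_map] by simp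

lemma alg_one [simp]: "alg B 1 = \<one>"
 using ring_hom_one[OF structure_map] by simp

lemma alg_zero [simp]: "alg B 0 = \<zero>"
 using ring_hom_zero[OF structure_map] cring.axioms(1)[OF cring_base_alg] ring_axioms by simp

lemma alg_uminus: "alg B (- r) = \<ominus> alg B r"
 using alg_add[of "- r" r] by (intro minus_equality[symmetric]) auto

lemma alg_power: "alg B (r ^ n) = alg B r [^] n"
 by (induction n) (auto simp: alg_mult m_comm)

end

lemma r_algebra_iff: "r_algebra B <-> ralgebra B"
 by (auto simp: r_algebra_def ralgebra_def r_algebra_axioms_def)

lemma ralgebraD [intro?]: "ralgebra B ==> r_algebra B" by (simp add: r_algebra_iff)

lemma homD:
 assumes "is_alg_hom B C h"
 shows "h : ring_hom B C" "!!x. x <: B ==> h x <: C" "!!r. h (alg B r) = alg C r"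
  "!!x y. x <: B ==> y <: B ==> h (x **.B y) = h x **.C h y"
  "!!x y. x <: B ==> y <: B ==> h (x ++.B y) = h x ++.C h y"
  "h \<one>.B = \<one>.C"
 using assms by (auto simp: is_alg_hom_def ring_hom_def)

lemma ring_hom_cringI:
 "ralgebra B ==> ralgebra C ==> is_alg_hom B C h ==> ring_hom_cring B C h"
 by (simp add: ring_hom_cring_def ring_hom_cring_axioms_def is_alg_hom_def ralgebra_def)

lemma hom_more:
 assumes "ralgebra B" "ralgebra C" "is_alg_hom B C h"
 shows "h \<zero>.B = \<zero>.C" "!!x. x <: B ==> h (\<ominus>.B x) = \<ominus>.C h x"
  "!!x y. x <: B ==> y <: B ==> h (x \<ominus>.B y) = h x \<ominus>.C h y"
  "!!x n. x <: B ==> h (x [^].B (n::nat)) = h x [^].C n"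
proof -
 interpret ring_hom_cring B C h by (rule ring_hom_cringI) fact+
 show "h \<zero>.B = \<zero>.C" "!!x. x <: B ==> h (\<ominus>.B x) = \<ominus>.C h x" by auto
 show "!!x y. x <: B ==> y <: B ==> h (x \<ominus>.B y) = h x \<ominus>.C h y"
  by (simp add: R.minus_eq S.minus_eq)
 show "h (x [^].B n) = h x [^].C n" if "x <: B" for x and n :: nat
  using that by (induction n) auto
qed

lemma homI:
 assumes "!!x. x <: B ==> h x <: C" "!!r. h (alg B r) = alg C r"
  "!!x y. x <: B ==> y <: B ==> h (x **.B y) = h x **.C h y"
  "!!x y. x <: B ==> y <: B ==> h (x ++.B y) = h x ++.C h y"
  "h \<one>.B = \<one>.C"
 shows "is_alg_hom B C h"
 using assms by (auto simp: is_alg_hom_def ring_hom_def)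

lemma hom_comp:
 "is_alg_hom B C h ==> is_alg_hom C D g ==> is_alg_hom B D (%x. g (h x))"
 by (rule homI) (simp_all add: homD)

lemma hom_cong:
 assumes "ralgebra B" "!!x. x <: B ==> h x = h' x" "is_alg_hom B C h"
 shows "is_alg_hom B C h'"
proof -
 interpret r_algebra B by (rule ralgebraD) fact
 show ?thesis using homD[OF assms(3)] by (intro homI) (simp_all flip: assms(2))
qed

lemma restrict_hom:
 "ralgebra B ==> is_alg_hom B C h ==> restrict h (carrier B) : alg_hom B C"
 unfolding alg_hom_def by (auto intro: hom_cong[of B h])

lemma alg_homD: "h : alg_hom B C ==> is_alg_hom B C h" by (simp add: alg_hom_def)

lemmas ahD = homD[OF alg_homD]

lemma alg_hom_eqI:
 "h : alg_hom B C ==> h' : alg_hom B C' ==> (!!x. x <: B ==> h x = h' x) ==> h = h'"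
 by (auto simp: alg_hom_def intro: extensionalityI)

lemma is_alg_hom_id: "is_alg_hom B B (%x. x)"
 by (auto intro: homI)

lemma is_alg_hom_alg: "ralgebra B ==> is_alg_hom base_alg B (alg B)"
 by (simp add: is_alg_hom_def ralgebra_def)

subsection \<open>Congruences\<close>

lemma (in abelian_group) minus_eq_zero_iff:
 assumes "x <: G" "y <: G" shows "x \<ominus> y = \<zero> <-> x = y"
proof
 assume "x \<ominus> y = \<zero>"
 hence "\<ominus> (\<ominus> y) = x" using assms by (intro minus_equality) (auto simp: minus_eq)
 thus "x = y" using assms by simp
qed (use assms in "simp add: minus_eq r_neg")

text \<open>Membership of both sides is part of the relation, so that a chain of congruences carries
  its own closedness facts.\<close>

definition cong_mod :: "('a, 'm) ring_scheme => 'a set => 'a => 'a => bool" where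
 "cong_mod R J x y <-> x <: R & y <: R & x \<ominus>.R y : J"

abbreviation (input) "cgr a m B \<equiv> cong_mod B (pow_ideal a m B)"

lemma cong_mod_mono: "cong_mod R J x y ==> J <= J' ==> cong_mod R J' x y"
 by (auto simp: cong_mod_def)

lemma cong_modD: "cong_mod R J x y ==> x <: R" "cong_mod R J x y ==> y <: R"
 "cong_mod R J x y ==> x \<ominus>.R y : J"
 by (auto simp: cong_mod_def)

lemma idealI_cring:
 fixes R :: "('a, 'm) ring_scheme" (structure)
 assumes "cring R" "J <= carrier R" "\<zero>.R : J"
  "!!x y. x : J ==> y : J ==> x ++.R y : J"
  "!!x c. x : J ==> c <: R ==> c **.R x : J"
 shows "ideal J R"
proof -
 interpret cring R by fact
 have neg: "\<ominus> x : J" if "x : J" for x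
 proof -
  have "\<ominus> x = (\<ominus> \<one>) ** x" using assms(2) that by (simp add: l_minus subsetD)
  thus ?thesis using assms(5)[OF that, of "\<ominus> \<one>"] by simp
 qed
 show ?thesis
 proof (rule idealI)
  show "subgroup J (add_monoid R)"
  by (rule add.subgroupI) (use assms neg in "auto simp flip: a_inv_def")
 qed (use assms in "auto simp: m_comm subsetD intro: ring_axioms")
qed

lemma idealD:
 fixes R :: "('a, 'm) ring_scheme" (structure)
 assumes "ideal J R"
 shows "x : J ==> x <: R" "\<zero> : J" "x : J ==> y : J ==> x ++ y : J"
  "x : J ==> c <: R ==> c ** x : J" "x : J ==> \<ominus> x : J"
proof -
 interpret ideal J R by fact
 show "x : J ==> x <: R" "\<zero> : J" "x : J ==> y : J ==> x ++ y : J"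
  "x : J ==> c <: R ==> c ** x : J" "x : J ==> \<ominus> x : J"
  by (auto intro: I_l_closed)
qed

context cring begin

context
 fixes J assumes J: "ideal J R"
begin

interpretation J: ideal J R by (rule J)

lemma cong_refl: "x <: R ==> cong_mod R J x x"
 by (simp add: cong_mod_def r_neg minus_eq)

lemma cong_sym: assumes "cong_mod R J x y" shows "cong_mod R J y x"
proof -
 have "y \<ominus> x = \<ominus> (x \<ominus> y)" using assms unfolding cong_mod_def by algebra
 thus ?thesis using assms by (simp add: cong_mod_def)
qed

lemma cong_trans: assumes "cong_mod R J x y" "cong_mod R J y z" shows "cong_mod R J x z"
proof -
 have "x \<ominus> z = (x \<ominus> y) ++ (y \<ominus> z)" using assms unfolding cong_mod_def by algebra
 thus ?thesis using assms by (simp add: cong_mod_def)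
qed

lemma cong_add:
 assumes "cong_mod R J x x'" "cong_mod R J y y'" shows "cong_mod R J (x ++ y) (x' ++ y')"
proof -
 have "x ++ y \<ominus> (x' ++ y') = (x \<ominus> x') ++ (y \<ominus> y')" using assms unfolding cong_mod_def by algebra
 thus ?thesis using assms by (simp add: cong_mod_def)
qed

lemma cong_mult:
 assumes "cong_mod R J x x'" "cong_mod R J y y'" shows "cong_mod R J (x ** y) (x' ** y')"
proof -
 have "x ** y \<ominus> x' ** y' = y ** (x \<ominus> x') ++ x' ** (y \<ominus> y')" using assms unfolding cong_mod_def by algebra
 thus ?thesis using assms by (simp add: cong_mod_def J.I_l_closed)
qed

lemma cong_uminus:
 assumes "cong_mod R J x x'" shows "cong_mod R J (\<ominus> x) (\<ominus> x')"
proof -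
 have "(\<ominus> x) \<ominus> (\<ominus> x') = \<ominus> (x \<ominus> x')" using assms unfolding cong_mod_def by algebra
 thus ?thesis using assms by (simp add: cong_mod_def)
qed

lemma cong_zero_iff: "x <: R ==> cong_mod R J x \<zero> <-> x : J"
 by (simp add: cong_mod_def minus_eq)

lemma cong_mem: assumes "cong_mod R J x y" shows "x : J <-> y : J"
proof -
 have "y : J" if "cong_mod R J x y" "x : J" for x y
 proof -
  have "cong_mod R J x \<zero>" using that cong_modD(1)[OF that(1)] by (simp add: cong_zero_iff)
  hence "cong_mod R J y \<zero>" by (rule cong_trans[OF cong_sym[OF that(1)]])
  thus ?thesis using cong_modD(2)[OF that(1)] by (simp add: cong_zero_iff)
 qed
 thus ?thesis using assms cong_sym by blast
qed

end

end

context r_algebra begin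

lemma pow_idealI: "c <: B ==> x = alg B (a ^ m) ** c ==> x : pow_ideal a m B"
 by (auto simp: pow_ideal_def)

lemma pow_idealE: assumes "x : pow_ideal a m B"
 obtains c where "c <: B" "x = alg B (a ^ m) ** c"
 using assms by (auto simp: pow_ideal_def)

lemma pow_ideal: "ideal (pow_ideal a m B) B"
proof (rule idealI_cring)
 show "cring B" by (rule is_cring)
 show "\<zero> : pow_ideal a m B" by (rule pow_idealI[of \<zero>]) auto
 show "x ++ y : pow_ideal a m B" if xy: "x : pow_ideal a m B" "y : pow_ideal a m B" for x y
 proof -
  obtain c where "c <: B" "x = alg B (a ^ m) ** c" using xy(1) by (rule pow_idealE)
  moreover obtain d where "d <: B" "y = alg B (a ^ m) ** d" using xy(2) by (rule pow_idealE)
  ultimately show ?thesis by (intro pow_idealI[of "c ++ d"]) (auto simp: r_distr)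
 qed
 show "c ** x : pow_ideal a m B" if "x : pow_ideal a m B" "c <: B" for x c
 proof -
  obtain d where "d <: B" "x = alg B (a ^ m) ** d" using \<open>x : pow_ideal a m B\<close> by (rule pow_idealE)
  thus ?thesis using that by (intro pow_idealI[of "c ** d"]) (auto simp: m_lcomm)
 qed
qed (auto simp: pow_ideal_def)

lemma pow_ideal_sub: "x : pow_ideal a m B ==> x <: B"
 by (auto simp: pow_ideal_def)

lemma pow_ideal_0 [simp]: "pow_ideal a 0 B = carrier B"
 by (auto simp: pow_ideal_def)

lemma pow_ideal_mult:
 assumes "x : pow_ideal a m B" "y : pow_ideal a n B"
 shows "x ** y : pow_ideal a (m + n) B"
proof -
 obtain c where "c <: B" "x = alg B (a ^ m) ** c" using assms(1) by (rule pow_idealE)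
 moreover obtain d where "d <: B" "y = alg B (a ^ n) ** d" using assms(2) by (rule pow_idealE)
 ultimately show ?thesis
  by (intro pow_idealI[of "c ** d"]) (auto simp: power_add alg_mult m_ac)
qed

lemma pow_ideal_antimono: assumes "m \<le> n" shows "pow_ideal a n B <= pow_ideal a m B"
proof
 fix x assume "x : pow_ideal a n B"
 then obtain c where c: "c <: B" "x = alg B (a ^ n) ** c" by (rule pow_idealE)
 have "a ^ n = a ^ m * a ^ (n - m)" using assms by (simp flip: power_add)
 thus "x : pow_ideal a m B" using c
  by (intro pow_idealI[of "alg B (a ^ (n - m)) ** c"]) (auto simp: alg_mult m_assoc)
qed

lemma alg_pow_in_pow_ideal: "alg B (a ^ m) : pow_ideal a m B"
 by (rule pow_idealI[of \<one>]) auto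

end

lemma hom_pow_ideal:
 fixes B :: "('r::comm_ring_1, 'b) ralg" (structure)
 assumes "ralgebra B" "is_alg_hom B C h" "x : pow_ideal a m B"
 shows "h x : pow_ideal a m C"
proof -
 interpret r_algebra B by (rule ralgebraD) fact
 obtain c where c: "c <: B" "x = alg B (a ^ m) **.B c" using assms(3) by (rule pow_idealE)
 thus ?thesis using homD[OF assms(2)]
  by (auto simp: pow_ideal_def)
qed

lemma hom_cong_mod:
 assumes "ralgebra B" "ralgebra C" "is_alg_hom B C h" "cgr a m B x y"
 shows "cgr a m C (h x) (h y)"
proof -
 have "x <: B" "y <: B" "h (x \<ominus>.B y) : pow_ideal a m C"
  using assms hom_pow_ideal[OF assms(1,3)] by (auto simp: cong_mod_def)
 thus ?thesis using hom_more(3)[OF assms(1-3)] homD(2)[OF assms(3)]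
  by (auto simp: cong_mod_def)
qed

definition torsion_free :: "'r::comm_ring_1 => ('r, 'b) ralg => bool" where
 "torsion_free a B <-> (ALL c:carrier B. alg B a **.B c = \<zero>.B --> c = \<zero>.B)"

lemma torsion_free_cancel:
 fixes B :: "('r::comm_ring_1, 'b) ralg" (structure)
 assumes "ralgebra B" "torsion_free a B" "x <: B" "y <: B"
  "alg B (a ^ m) **.B x = alg B (a ^ m) **.B y"
 shows "x = y"
 using assms(5)
proof (induction m)
 case 0
 interpret r_algebra B by (rule ralgebraD) fact
 show ?case using 0 assms by simp
next
 case (Suc m)
 interpret r_algebra B by (rule ralgebraD) fact
 let ?c = "alg B (a ^ m) ** x" and ?d = "alg B (a ^ m) ** y"
 have eq: "alg B a ** ?c = alg B a ** ?d"
  using Suc.prems assms by (simp add: alg_mult m_assoc)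
 have "alg B a ** (?c \<ominus> ?d) = alg B a ** ?c \<ominus> alg B a ** ?d"
  using assms(3,4) by (simp add: minus_eq r_distr r_minus)
 also have "... = \<zero>" using assms(3,4) by (simp add: eq minus_eq r_neg)
 finally have "?c \<ominus> ?d = \<zero>" using assms(2,3,4) by (auto simp: torsion_free_def)
 hence "?c = ?d" using assms(3,4) by (simp add: minus_eq_zero_iff)
 thus ?case by (rule Suc.IH)
qed

subsection \<open>Images of algebras\<close>

text \<open>Transport of structure along \<open>f\<close>. With an injective \<open>f\<close> it
  copies an algebra into another type; with a choice of coset representatives it is a
  quotient.\<close>

definition image_alg :: "('d => 'e) => ('r, 'd) ralg => ('r, 'e) ralg" where
 "image_alg f D = (let g = inv_into (carrier D) f in
  \<lparr>carrier = f ` carrier D, monoid.mult = (%u v. f (g u **.D g v)), one = f \<one>.D,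
  zero = f \<zero>.D, add = (%u v. f (g u ++.D g v)), alg = (%r. f (alg D r))\<rparr>)"

lemma image_alg:
 fixes D :: "('r::comm_ring_1, 'd) ralg" (structure)
 assumes D: "ralgebra D" and J: "ideal J D"
  and f: "!!x y. x <: D ==> y <: D ==> f x = f y <-> x \<ominus>.D y : J"
 shows "ralgebra (image_alg f D)" "is_alg_hom D (image_alg f D) f"
  "carrier (image_alg f D) = f ` carrier D"
proof -
 interpret r_algebra D by (rule ralgebraD) fact
 define g where "g = inv_into (carrier D) f"
 have fg: "f x = f y <-> cong_mod D J x y" if "x <: D" "y <: D" for x y
  using f that by (auto simp: cong_mod_def)
 \<comment> \<open>The chosen preimage of \<open>f x\<close> need not be \<open>x\<close>; it is
   only congruent to \<open>x\<close> modulo \<open>J\<close>.\<close>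
 have g: "cong_mod D J (g (f x)) x" if "x <: D" for x
 proof -
  have "g (f x) <: D" "f (g (f x)) = f x"
  unfolding g_def using that by (auto simp: inv_into_into f_inv_into_f)
  thus ?thesis using fg that by blast
 qed
 let ?E = "image_alg f D"
 have car: "carrier ?E = f ` carrier D" by (simp add: image_alg_def Let_def)
 have mult: "f x **.?E f y = f (x ** y)" if "x <: D" "y <: D" for x y
  using cong_mult[OF J g[OF that(1)] g[OF that(2)]] fg cong_modD(1,2)[OF g] that
  by (simp add: image_alg_def Let_def g_def[symmetric])
 have add: "f x ++.?E f y = f (x ++ y)" if "x <: D" "y <: D" for x y
  using cong_add[OF J g[OF that(1)] g[OF that(2)]] fg cong_modD(1,2)[OF g] that
  by (simp add: image_alg_def Let_def g_def[symmetric])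
 have sel: "\<one>.?E = f \<one>" "\<zero>.?E = f \<zero>" "alg ?E = (%r. f (alg D r))"
  by (simp_all add: image_alg_def Let_def)
 have "cring ?E"
 proof (rule cringI)
  show "abelian_group ?E"
  proof (rule abelian_groupI)
  fix x assume "x <: ?E"
  then obtain a where a: "a <: D" "x = f a" by (auto simp: car)
  show "EX y:carrier ?E. y ++.?E x = \<zero>.?E"
  using a by (intro bexI[of _ "f (\<ominus> a)"]) (auto simp: add sel car l_neg)
  qed (auto simp: car add sel a_ac)
  show "comm_monoid ?E"
  by (rule comm_monoidI) (auto simp: car mult sel m_ac)
 qed (auto simp: car add mult l_distr)
 thus "ralgebra ?E"
  unfolding ralgebra_def
  by (auto intro!: ring_hom_memI simp: car sel mult add alg_mult alg_add)
 show "is_alg_hom D ?E f" by (rule homI) (auto simp: car sel mult add)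
 show "carrier ?E = f ` carrier D" by (rule car)
qed

lemma image_alg_inj:
 fixes D :: "('r::comm_ring_1, 'd) ralg" (structure)
 assumes D: "ralgebra D" and f: "inj_on f (carrier D)"
 shows "ralgebra (image_alg f D)" "is_alg_hom D (image_alg f D) f"
  "is_alg_hom (image_alg f D) D (inv_into (carrier D) f)" "bij_betw f (carrier D) (carrier (image_alg f D))"
proof -
 interpret r_algebra D by (rule ralgebraD) fact
 have J: "ideal {\<zero>} D" by (rule zeroideal)
 have fJ: "f x = f y <-> x \<ominus> y : {\<zero>}" if "x <: D" "y <: D" for x y
  using that f by (simp add: inj_on_eq_iff[OF f] minus_eq_zero_iff)
 note I = image_alg[OF D J fJ]
 show "ralgebra (image_alg f D)" "is_alg_hom D (image_alg f D) f" using I by auto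
 show "bij_betw f (carrier D) (carrier (image_alg f D))"
  using f I(3) by (auto simp: bij_betw_def)
 show "is_alg_hom (image_alg f D) D (inv_into (carrier D) f)"
  by (rule homI)
  (auto simp: image_alg_def Let_def inv_into_into f inv_into_f_f)
qed

text \<open>The predicate \<open>cong_mod R J x\<close> depends only on the coset of
  \<open>x\<close>, so the choice is constant on cosets. Representatives in place of cosets keep the
  quotient in the type of the ring, which the universe of the functors prescribes.\<close>

definition crep :: "('a, 'm) ring_scheme => 'a set => 'a => 'a" where
 "crep R J x = (SOME y. cong_mod R J x y)"

lemma (in cring) crep:
 assumes "ideal J R"
 shows "x <: R ==> cong_mod R J x (crep R J x)"
  "x <: R ==> crep R J x <: R"
  "x <: R ==> y <: R ==> crep R J x = crep R J y <-> x \<ominus> y : J"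
proof -
 have 1: "cong_mod R J x (crep R J x)" if "x <: R" for x
  unfolding crep_def by (rule someI[of _ x]) (rule cong_refl[OF assms that])
 thus "x <: R ==> cong_mod R J x (crep R J x)"
  "x <: R ==> crep R J x <: R"
  by (auto dest: cong_modD)
 show "crep R J x = crep R J y <-> x \<ominus> y : J" if xy: "x <: R" "y <: R"
 proof
  assume "crep R J x = crep R J y"
  hence "cong_mod R J x y" using 1[OF xy(1)] cong_sym[OF assms 1[OF xy(2)]] cong_trans[OF assms]
  by metis
  thus "x \<ominus> y : J" by (rule cong_modD)
 next
  assume "x \<ominus> y : J"
  hence "cong_mod R J x y" using xy by (simp add: cong_mod_def)
  hence "cong_mod R J x = cong_mod R J y"
  using cong_trans[OF assms] cong_sym[OF assms] by blast
  thus "crep R J x = crep R J y" by (simp add: crep_def)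
 qed
qed

definition quot :: "'d set => ('r, 'd) ralg => ('r, 'd) ralg" where
 "quot J D = image_alg (crep D J) D"

lemma quot:
 fixes D :: "('r::comm_ring_1, 'd) ralg" (structure)
 assumes D: "ralgebra D" and J: "ideal J D"
 shows "ralgebra (quot J D)" "is_alg_hom D (quot J D) (crep D J)"
  "carrier (quot J D) = crep D J ` carrier D"
  "carrier (quot J D) <= carrier D"
  "!!x y. x <: D ==> y <: D ==> crep D J x = crep D J y <-> cong_mod D J x y"
  "!!x. x <: quot J D ==> crep D J x = x"
  "!!x. x <: D ==> crep D J x = \<zero>.(quot J D) <-> x : J"
proof -
 interpret r_algebra D by (rule ralgebraD) fact
 note r = crep[OF J]
 note I = image_alg[of D J "crep D J", OF D J r(3)]
 show "ralgebra (quot J D)" and h: "is_alg_hom D (quot J D) (crep D J)"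
  and c: "carrier (quot J D) = crep D J ` carrier D"
  using I by (auto simp: quot_def)
 thus "carrier (quot J D) <= carrier D" using r by auto
 show e: "crep D J x = crep D J y <-> cong_mod D J x y" if "x <: D" "y <: D" for x y
  using r(3) that by (auto simp: cong_mod_def)
 show "crep D J x = x" if "x <: quot J D" for x
  using that cong_sym[OF J r(1)] e r(2) unfolding c by auto
 show "crep D J x = \<zero>.(quot J D) <-> x : J" if "x <: D" for x
  using hom_more(1)[OF D _ h] I(1) e[OF that, of \<zero>] cong_zero_iff[OF J that]
  by (auto simp: quot_def)
qed

subsection \<open>Complete algebras\<close>

lemma adicD:
 assumes "adic_complete a C"
 shows "ralgebra C" "!!c. (!!m. c : pow_ideal a m C) ==> c = \<zero>.C"
  "!!s. (!!m. cgr a m C (s (Suc m)) (s m)) ==>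
  EX c:carrier C. ALL m. cgr a m C c (s m)"
proof -
 show "ralgebra C" "!!c. (!!m. c : pow_ideal a m C) ==> c = \<zero>.C"
  using assms by (auto simp: adic_complete_def)
 show "EX c:carrier C. ALL m. cgr a m C c (s m)"
  if s: "!!m. cgr a m C (s (Suc m)) (s m)" for s
 proof -
  have "ALL m. s m <: C & s (Suc m) \<ominus>.C s m : pow_ideal a m C"
  using s by (auto simp: cong_mod_def)
  then obtain c where "c <: C" "ALL m. c \<ominus>.C s m : pow_ideal a m C"
  using assms unfolding adic_complete_def by blast
  thus ?thesis using s by (auto simp: cong_mod_def)
 qed
qed

lemmas adic_r_algebra [intro?] = ralgebraD[OF adicD(1)]

lemma adic_complete_eqI:
 assumes "adic_complete a C" "!!m. cgr a m C x y"
 shows "x = y"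
proof -
 interpret r_algebra C by (rule ralgebraD, rule adicD) fact
 have "x \<ominus>.C y = \<zero>.C" using assms by (intro adicD(2)) (auto simp: cong_mod_def)
 thus ?thesis using assms(2)[of 0] by (simp add: cong_mod_def minus_eq_zero_iff)
qed

lemma adic_completeI:
 fixes C :: "('r::comm_ring_1, 'c) ralg" (structure)
 assumes "ralgebra C" "!!c. c <: C ==> (!!m. c : pow_ideal a m C) ==> c = \<zero>.C"
  "!!s. (!!m. cgr a m C (s (Suc m)) (s m)) ==>
  EX c:carrier C. ALL m. cgr a m C c (s m)"
 shows "adic_complete a C"
 unfolding adic_complete_def
proof (intro conjI allI impI)
 interpret r_algebra C by (rule ralgebraD) fact
 show "\<Inter>(range (%m. pow_ideal a m C)) = {\<zero>.C}"
 proof -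
  have "\<zero> : pow_ideal a m C" for m
  by (intro additive_subgroup.zero_closed ideal.axioms(1) pow_ideal)
  moreover have "c = \<zero>" if "!!m. c : pow_ideal a m C" for c
  using assms(2)[of c] that pow_ideal_sub by blast
  ultimately show ?thesis by auto
 qed
 fix s assume s: "ALL m. s m <: C & s (Suc m) \<ominus>.C s m : pow_ideal a m C"
 hence "EX c:carrier C. ALL m. cgr a m C c (s m)"
  by (intro assms) (auto simp: cong_mod_def)
 thus "EX c:carrier C. ALL m. c \<ominus>.C s m : pow_ideal a m C"
  by (auto simp: cong_mod_def)
qed (rule assms)

lemma (in r_algebra) cauchy_cong:
 assumes "!!m. cgr a m B (s (Suc m)) (s m)" "m \<le> n"
 shows "cgr a m B (s n) (s m)"
 using assms(2)
proof (induction n rule: dec_induct)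
 case base
 show ?case by (rule cong_refl[OF pow_ideal cong_modD(2)[OF assms(1)]])
next
 case (step n)
 have "cgr a m B (s (Suc n)) (s n)"
  by (rule cong_mod_mono[OF assms(1) pow_ideal_antimono]) (use step in simp)
 thus ?case using cong_trans[OF pow_ideal] step.IH by blast
qed

lemma adic_complete_iso:
 assumes "adic_complete a C" "ralgebra D" "is_alg_hom C D h" "bij_betw h (carrier C) (carrier D)"
 shows "adic_complete a D"
proof -
 have rC: "ralgebra C" by (rule adicD) fact
 interpret C: r_algebra C by (rule ralgebraD) fact
 interpret D: r_algebra D by (rule ralgebraD) fact
 define g where "g = inv_into (carrier C) h"
 have hg: "h (g x) = x" "g x <: C" if "x <: D" for x
  using assms(4) that unfolding g_def bij_betw_def
  by (auto intro: inv_into_into simp: f_inv_into_f)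
 have inj: "inj_on h (carrier C)" using assms(4) by (simp add: bij_betw_def)
 note H = homD[OF assms(3)] hom_more[OF rC assms(2,3)]
 have P: "h x : pow_ideal a m D <-> x : pow_ideal a m C" if x: "x <: C" for x m
 proof
  assume "h x : pow_ideal a m D"
  then obtain d where d: "d <: D" "h x = alg D (a ^ m) **.D d" by (rule D.pow_idealE)
  hence "h x = h (alg C (a ^ m) **.C g d)" using hg by (simp add: H)
  hence "x = alg C (a ^ m) **.C g d" using inj_onD[OF inj] x hg d by auto
  thus "x : pow_ideal a m C" using hg d by (intro C.pow_idealI) auto
 next
  assume "x : pow_ideal a m C"
  thus "h x : pow_ideal a m D" by (rule hom_pow_ideal[OF rC assms(3)])
 qed
 have Q: "cgr a m D (h x) (h y) <-> cgr a m C x y"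
  if "x <: C" "y <: C" for x y m
  using that P[of "x \<ominus>.C y"] by (auto simp: cong_mod_def H)
 show ?thesis
 proof (rule adic_completeI)
  show "ralgebra D" by fact
  fix c assume c: "c <: D" "!!m. c : pow_ideal a m D"
  hence "g c : pow_ideal a m C" for m using P[of "g c" m] hg by simp
  hence "g c = \<zero>.C" by (intro adicD(2)[OF assms(1)])
  thus "c = \<zero>.D" using hg(1)[OF c(1)] H by simp
 next
  fix s assume s: "!!m. cgr a m D (s (Suc m)) (s m)"
  hence sD: "s m <: D" for m by (auto simp: cong_mod_def)
  have "cgr a m C (g (s (Suc m))) (g (s m))" for m
  using Q[of "g (s (Suc m))" "g (s m)" m] sD hg s by simp
  then obtain c where "c <: C" "ALL m. cgr a m C c (g (s m))"
  using adicD(3)[OF assms(1), of "%m. g (s m)"] by blast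
  moreover have "cgr a m D (h c) (s m)"
  if "c <: C" "cgr a m C c (g (s m))" for m
  using Q[of c "g (s m)" m] sD hg that by simp
  ultimately show "EX c:carrier D. ALL m. cgr a m D c (s m)"
  using H(2) by blast
 qed
qed

section \<open>Formal spectra and the points of affine open subsets\<close>

section \<open>The structure sheaf of a formal spectrum\<close>

subsection \<open>Prime ideals\<close>

lemma (in cring) ideal_add_multiple:
 assumes "ideal J R" "a <: R"
 shows "ideal {x ++ c ** a | x c. x : J & c <: R} R" (is "ideal ?M R")
proof -
 interpret J: ideal J R by fact
 note sub = J.a_subset[THEN subsetD]
 show ?thesis
 proof (rule idealI_cring)
  show "\<zero> : ?M" using assms(2) by (auto intro!: exI[of _ \<zero>])
  show "u ++ v : ?M" if uv: "u : ?M" "v : ?M" for u v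
  proof -
  obtain x c where u: "u = x ++ c ** a" "x : J" "c <: R" using uv(1) by auto
  obtain y d where v: "v = y ++ d ** a" "y : J" "d <: R" using uv(2) by auto
  note sub[OF u(2)] sub[OF v(2)]
  hence "u ++ v = (x ++ y) ++ (c ++ d) ** a" unfolding u(1) v(1) using u(3) v(3) assms(2) by algebra
  thus ?thesis using u v by blast
  qed
  show "d ** u : ?M" if ud: "u : ?M" "d <: R" for u d
  proof -
  obtain x c where u: "u = x ++ c ** a" "x : J" "c <: R" using ud(1) by auto
  note sub[OF u(2)]
  hence "d ** u = (d ** x) ++ (d ** c) ** a" unfolding u(1) using u(3) assms(2) ud(2) by algebra
  thus ?thesis using u ud(2) J.I_l_closed by blast
  qed
 qed (use assms sub in "auto intro: is_cring")
qed

text \<open>An ideal that is maximal among those containing \<open>J\<close> and missing all powers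
  of \<open>g\<close> is prime; Zorn's lemma provides one.\<close>

lemma (in cring) prime_avoidance:
 assumes J: "ideal J R" and g: "g <: R" and gJ: "!!n::nat. g [^] n ~: J"
 obtains P where "primeideal P R" "J <= P" "g ~: P"
proof -
 define S where "S = {I. ideal I R & J <= I & (\<forall>n::nat. g [^] n ~: I)}"
 have "EX M:S. ALL X:S. M <= X --> X = M"
 proof (rule subset_Zorn_nonempty)
  show "S ~= {}" using J gJ by (auto simp: S_def)
  fix \<C> assume ne: "\<C> ~= {}" and ch: "subset.chain S \<C>"
  have tot: "X <= Y \<or> Y <= X" if "X : \<C>" "Y : \<C>" for X Y
  using ch that by (auto simp: subset_chain_def)
  have CS: "\<C> <= S" using ch by (auto simp: subset_chain_def)
  hence id: "ideal X R" if "X : \<C>" for X using that by (auto simp: S_def)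
  have "ideal (\<Union>\<C>) R"
  proof (rule idealI_cring)
  show "\<Union>\<C> <= carrier R" using idealD(1)[OF id] by auto
  show "\<zero> : \<Union>\<C>" using ne idealD(2)[OF id] by auto
  show "x ++ y : \<Union>\<C>" if xy: "x : \<Union>\<C>" "y : \<Union>\<C>" for x y
  proof -
  obtain X Y where XY: "X : \<C>" "x : X" "Y : \<C>" "y : Y" using xy by auto
  from tot[OF XY(1,3)] show ?thesis
  proof
  assume "X <= Y"
  hence "x ++ y : Y" using XY idealD(3)[OF id[OF XY(3)]] by auto
  thus ?thesis using XY by auto
  next
  assume "Y <= X"
  hence "x ++ y : X" using XY idealD(3)[OF id[OF XY(1)]] by auto
  thus ?thesis using XY by auto
  qed
  qed
  show "c ** x : \<Union>\<C>" if "x : \<Union>\<C>" "c <: R" for x c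
  using that idealD(4)[OF id] by auto
  qed (rule is_cring)
  thus "\<Union>\<C> : S" using CS ne by (auto simp: S_def)
 qed
 then obtain M where M: "M : S" and max: "!!X. X : S ==> M <= X ==> X = M" by blast
 interpret M: ideal M R using M by (simp add: S_def)
 have gM: "g [^] n ~: M" for n :: nat using M by (simp add: S_def)
 \<comment> \<open>By maximality the ideal generated by \<open>M\<close> and \<open>a\<close>
   contains a power of \<open>g\<close>. For \<open>a\<close>, \<open>b\<close> outside
   \<open>M\<close> with product in \<open>M\<close>, the product of two such powers would lie in
   \<open>M\<close>.\<close>
 have grow: "\<exists>n::nat. EX x:M. EX c:carrier R. g [^] n = x ++ c ** a" if a: "a <: R" "a ~: M" for a
 proof (rule ccontr)
  let ?N = "{x ++ c ** a | x c. x : M & c <: R}"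
  assume *: "\<not> ?thesis"
  have "ideal ?N R" by (rule ideal_add_multiple) (use a M.ideal_axioms in auto)
  moreover have MN: "M <= ?N"
  proof
  fix x assume "x : M"
  moreover from this have "x = x ++ \<zero> ** a" using a M.a_subset by auto
  ultimately show "x : ?N" by blast
  qed
  moreover have "a : ?N"
  proof -
  have "a = \<zero> ++ \<one> ** a" using a by simp
  thus ?thesis using M.zero_closed by blast
  qed
  moreover have "g [^] n ~: ?N" for n :: nat using * by blast
  ultimately have "?N : S" using M by (simp add: S_def) blast
  from max[OF this MN] \<open>a : ?N\<close> a(2) show False by simp
 qed
 have "primeideal M R"
 proof (rule primeidealI)
  show "carrier R ~= M" using gM g by auto
  fix a b assume ab: "a <: R" "b <: R" "a ** b : M"
  show "a : M \<or> b : M"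
  proof (rule ccontr)
  assume *: "\<not> ?thesis"
  obtain i x c where 1: "x : M" "c <: R" "g [^] (i::nat) = x ++ c ** a"
  using grow[of a] * ab by blast
  obtain j y d where 3: "y : M" "d <: R" "g [^] (j::nat) = y ++ d ** b"
  using grow[of b] * ab by blast
  note 1 = 1 3
  have 2: "x <: R" "y <: R" using 1 M.a_subset by auto
  have "g [^] (i + j) = (x ++ c ** a) ** (y ++ d ** b)"
  using 1 g by (simp add: nat_pow_mult[symmetric])
  also have "... = (y ++ d ** b) ** x ++ ((c ** a) ** y ++ (c ** d) ** (a ** b))"
  using 1(2,5) 2 ab(1,2) by algebra
  also have "... : M"
  by (rule M.a_closed[OF M.I_l_closed[OF 1(1)] M.a_closed[OF M.I_l_closed[OF 1(4)] M.I_l_closed[OF ab(3)]]])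
  (use 1 2 ab in auto)
  finally show False using gM by blast
  qed
 qed (auto intro: M.ideal_axioms is_cring)
 thus thesis using M gM[of 1] g by (intro that[of M]) (auto simp: S_def)
qed

subsection \<open>Fractions\<close>

locale spf_algebra = r_algebra C for C :: "('r::comm_ring_1, 'c) ralg" (structure) +
 fixes K :: "'r base"
begin

abbreviation pideal :: "nat => 'c set" where "pideal m \<equiv> pow_ideal (unif K) m C"
abbreviation frac :: "nat => 'c set => 'c => 'c => ('c \<times> 'c) set" where "frac \<equiv> fraction K C"
abbreviation (input) X :: "'c set set" where "X \<equiv> spf_pts K C"
abbreviation (input) basic :: "'c => 'c set set" where "basic f \<equiv> {P : X. f ~: P}"
abbreviation (input) "sects \<equiv> spf_sections K C"
abbreviation (input) "cst \<equiv> spf_const K C"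
abbreviation (input) "SA \<equiv> spf_alg K C"
abbreviation (input) "opn \<equiv> openin (spf_top K C)"

lemma pideal_ideal: "ideal (pideal m) C" by (rule pow_ideal)

lemmas pideal_add = idealD(3)[OF pideal_ideal] and pideal_mult = idealD(4)[OF pideal_ideal]
 and pideal_uminus = idealD(5)[OF pideal_ideal] and pideal_zero [simp] = idealD(2)[OF pideal_ideal]

lemma pt_prime: "P : X ==> primeideal P C" by (simp add: spf_pts_def)

lemma pt_ideal: "P : X ==> ideal P C" by (rule primeideal.axioms(1)[OF pt_prime])

lemmas pt_sub = idealD(1)[OF pt_ideal] and pt_zero = idealD(2)[OF pt_ideal] and pt_add = idealD(3)[OF pt_ideal]

lemma pt_mult_iff: assumes "P : X" "a <: C" "b <: C"
 shows "a ** b : P <-> a : P \<or> b : P"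
 using primeideal.I_prime[OF pt_prime[OF assms(1)] assms(2,3)] ideal.I_l_closed[OF pt_ideal[OF assms(1)] _ assms(2), of b]
  ideal.I_r_closed[OF pt_ideal[OF assms(1)] _ assms(3), of a] by auto

lemma pt_one: "P : X ==> \<one> ~: P"
 using ideal.one_imp_carrier[OF pt_ideal, of P] primeideal.I_notcarr[OF pt_prime, of P] by auto

lemma pt_pow_iff: "P : X ==> a <: C ==> a [^] (n::nat) : P <-> a : P & n ~= 0"
 by (induction n) (auto simp: pt_one pt_mult_iff)

lemma pt_pideal: assumes "P : X" "m \<ge> 1" "x : pideal m" shows "x : P"
proof -
 have "x : pideal 1" using assms pow_ideal_antimono by blast
 then obtain c where "c <: C" "x = alg C (unif K ^ 1) ** c" by (rule pow_idealE)
 thus ?thesis using assms(1) by (auto simp: spf_pts_def pt_mult_iff[OF assms(1)])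
qed

lemma primeideal_pt:
 assumes "primeideal P C" "alg C (unif K ^ m) : P" shows "P : X"
proof -
 interpret P: primeideal P C by fact
 have "alg C (unif K ^ n) : P ==> alg C (unif K) : P" for n
 proof (induction n)
  case 0 thus ?case using P.one_imp_carrier P.I_notcarr by simp
 next
  case (Suc n)
  hence "alg C (unif K) ** alg C (unif K ^ n) : P" by (simp add: alg_mult)
  thus ?case using Suc.IH P.I_prime by blast
 qed
 thus ?thesis using assms by (simp add: spf_pts_def)
qed

text \<open>Equality of \<open>a / t\<close> and \<open>b / u\<close> in the localization of
  \<open>C / \<pi>^m C\<close> at \<open>P\<close>.\<close>

definition frel :: "nat => 'c set => 'c => 'c => 'c => 'c => bool" where
 "frel m P a t b u <-> (EX v:carrier C - P. v ** (u ** a \<ominus> t ** b) : pideal m)"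

lemma frac_mem: "(b, u) : frac m P a t <-> b <: C & u : carrier C - P & frel m P a t b u"
 by (auto simp: fraction_def frel_def)

lemma frel_eqI:
 assumes "P : X" "u ** a = t ** b" "t <: C" "b <: C"
 shows "frel m P a t b u"
 unfolding frel_def
 by (rule bexI[of _ \<one>]) (use assms pt_one in "auto simp: minus_eq_zero_iff minus_eq r_neg")

lemma frel_refl: "P : X ==> a <: C ==> t <: C ==> frel m P a t a t"
 by (rule frel_eqI) auto

lemma frel_sym:
 assumes "frel m P a t b u" "a <: C" "t <: C" "b <: C" "u <: C"
 shows "frel m P b u a t"
proof -
 obtain v where v: "v <: C" "v ~: P" "v ** (u ** a \<ominus> t ** b) : pideal m"
  using assms(1) by (auto simp: frel_def)
 have "v ** (t ** b \<ominus> u ** a) = \<ominus> (v ** (u ** a \<ominus> t ** b))" using assms(2-5) v(1) by algebra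
 thus ?thesis using v pideal_uminus unfolding frel_def by (intro bexI[of _ v]) auto
qed

lemma frel_trans:
 assumes P: "P : X" and "frel m P a t b u" "frel m P b u c s"
  and cl: "a <: C" "t <: C" "b <: C" "u <: C" "c <: C" "s <: C"
  and u: "u ~: P"
 shows "frel m P a t c s"
proof -
 obtain v where v: "v <: C" "v ~: P" "v ** (u ** a \<ominus> t ** b) : pideal m"
  using assms(2) by (auto simp: frel_def)
 obtain w where w: "w <: C" "w ~: P" "w ** (s ** b \<ominus> u ** c) : pideal m"
  using assms(3) by (auto simp: frel_def)
 \<comment> \<open>The multiplier has to contain the middle denominator \<open>u\<close>, which
   therefore must avoid \<open>P\<close>.\<close>
 have "(v ** w ** u) ** (s ** a \<ominus> t ** c) =
  (s ** w) ** (v ** (u ** a \<ominus> t ** b)) ++ (t ** v) ** (w ** (s ** b \<ominus> u ** c))"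
  using cl v(1) w(1) by algebra
 also have "... : pideal m"
  by (rule pideal_add[OF pideal_mult[OF v(3)] pideal_mult[OF w(3)]]) (use cl v w in auto)
 finally show ?thesis unfolding frel_def
  using v w u cl P by (intro bexI[of _ "v ** w ** u"]) (auto simp: pt_mult_iff)
qed

lemma frac_eq_iff:
 assumes "P : X" "a <: C" "t : carrier C - P" "b <: C" "u : carrier C - P"
 shows "frac m P a t = frac m P b u <-> frel m P a t b u"
proof
 assume eq: "frac m P a t = frac m P b u"
 have "(b, u) : frac m P a t" unfolding eq using assms by (auto simp: frac_mem intro: frel_refl)
 thus "frel m P a t b u" by (auto simp: frac_mem)
next
 assume r: "frel m P a t b u"
 have r': "frel m P b u a t" by (rule frel_sym[OF r]) (use assms in auto)
 have "frel m P a t c s <-> frel m P b u c s" if "c <: C" "s <: C" for c s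
  using frel_trans[OF assms(1) r] frel_trans[OF assms(1) r'] assms that by blast
 thus "frac m P a t = frac m P b u" by (auto simp: frac_mem)
qed

lemma frac_self: "P : X ==> a <: C ==> t : carrier C - P ==> (a, t) : frac m P a t"
 by (auto simp: frac_mem intro: frel_refl)

lemma frac_mem_eq:
 assumes "P : X" "a <: C" "t : carrier C - P" "(b, u) : frac m P a t"
 shows "frac m P a t = frac m P b u" "b <: C" "u : carrier C - P"
 using assms frac_eq_iff[OF assms(1-3), of b u m] by (auto simp: frac_mem)

lemma frac_eqI:
 assumes "P : X" "a <: C" "t : carrier C - P" "b <: C" "u : carrier C - P" "u ** a = t ** b"
 shows "frac m P a t = frac m P b u"
 using assms frac_eq_iff[OF assms(1-5)] frel_eqI[OF assms(1,6)] by blast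

lemma frac_cong:
 assumes "P : X" "cong_mod C (pideal m) a b" "t : carrier C - P"
 shows "frac m P a t = frac m P b t"
proof -
 note ab = cong_modD[OF assms(2)]
 have "\<one> ** (t ** a \<ominus> t ** b) = t ** (a \<ominus> b)" using ab(1,2) DiffD1[OF assms(3)] by algebra
 also have "... : pideal m" using ab(3) assms(3) by (intro pideal_mult) auto
 finally have "frel m P a t b t" unfolding frel_def using pt_one[OF assms(1)] by (intro bexI[of _ \<one>]) auto
 thus ?thesis using ab assms by (subst frac_eq_iff) auto
qed

lemma frel_mono: assumes "frel n P a t b u" "m \<le> n" shows "frel m P a t b u"
 using assms pow_ideal_antimono[OF assms(2)] unfolding frel_def by blast

lemma frac_mono: "m \<le> n ==> frac n P a t <= frac m P a t"
 using frel_mono by (auto simp: frac_mem)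

lemma frel_mult:
 assumes P: "P : X" and "frel m P a t a' t'" "frel m P b u b' u'"
  and cl: "a <: C" "t <: C" "b <: C" "u <: C"
  "a' <: C" "t' <: C" "b' <: C" "u' <: C"
 shows "frel m P (a ** b) (t ** u) (a' ** b') (t' ** u')"
  "frel m P (u ** a ++ t ** b) (t ** u) (u' ** a' ++ t' ** b') (t' ** u')"
proof -
 obtain v where v: "v <: C" "v ~: P" "v ** (t' ** a \<ominus> t ** a') : pideal m"
  using assms(2) by (auto simp: frel_def)
 obtain w where w: "w <: C" "w ~: P" "w ** (u' ** b \<ominus> u ** b') : pideal m"
  using assms(3) by (auto simp: frel_def)
 have vw: "v ** w : carrier C - P" using v w P by (auto simp: pt_mult_iff)
 have "(v ** w) ** ((t' ** u') ** (a ** b) \<ominus> (t ** u) ** (a' ** b')) =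
  (w ** u' ** b) ** (v ** (t' ** a \<ominus> t ** a')) ++ (v ** t ** a') ** (w ** (u' ** b \<ominus> u ** b'))"
  using cl v(1) w(1) by algebra
 also have "... : pideal m"
  by (rule pideal_add[OF pideal_mult[OF v(3)] pideal_mult[OF w(3)]]) (use cl v w in auto)
 finally show "frel m P (a ** b) (t ** u) (a' ** b') (t' ** u')" unfolding frel_def using vw by blast
 let ?A = "t' ** a \<ominus> t ** a'" and ?B = "u' ** b \<ominus> u ** b'"
 have A: "?A <: C" and B: "?B <: C" using cl by auto
 have "(t' ** u') ** (u ** a ++ t ** b) \<ominus> (t ** u) ** (u' ** a' ++ t' ** b') =
  (u ** u') ** ?A ++ (t ** t') ** ?B"
  using cl by algebra
 hence "(v ** w) ** ((t' ** u') ** (u ** a ++ t ** b) \<ominus> (t ** u) ** (u' ** a' ++ t' ** b')) =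
  (v ** w) ** ((u ** u') ** ?A ++ (t ** t') ** ?B)" by simp
 also have "... = (w ** u ** u') ** (v ** ?A) ++ (v ** t ** t') ** (w ** ?B)"
  using A B cl v(1) w(1) by (simp add: r_distr m_ac)
 also have "... : pideal m"
  by (rule pideal_add[OF pideal_mult[OF v(3)] pideal_mult[OF w(3)]]) (use cl v w in auto)
 finally show "frel m P (u ** a ++ t ** b) (t ** u) (u' ** a' ++ t' ** b') (t' ** u')"
  unfolding frel_def using vw by blast
qed

text \<open>The operations of \<open>spf_alg\<close> are unions over all representatives; by
  \<open>frel_mult\<close> every member of such a union is the same class.\<close>

lemma frac_ops:
 assumes P: "P : X" and cl: "a <: C" "t : carrier C - P" "b <: C" "u : carrier C - P"
 shows "(\<Union>(a, t)\<in>frac m P a t. \<Union>(b, u)\<in>frac m P b u. frac m P (a ** b) (t ** u)) = frac m P (a ** b) (t ** u)"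
  (is "?A = _")
  "(\<Union>(a, t)\<in>frac m P a t. \<Union>(b, u)\<in>frac m P b u. frac m P (u ** a ++ t ** b) (t ** u)) =
  frac m P (u ** a ++ t ** b) (t ** u)" (is "?B = _")
proof -
 have 1: "frac m P (a' ** b') (t' ** u') = frac m P (a ** b) (t ** u)"
  "frac m P (u' ** a' ++ t' ** b') (t' ** u') = frac m P (u ** a ++ t ** b) (t ** u)"
  if "(a', t') : frac m P a t" "(b', u') : frac m P b u" for a' t' b' u'
 proof -
  have *: "a' <: C" "t' : carrier C - P" "frel m P a t a' t'"
  "b' <: C" "u' : carrier C - P" "frel m P b u b' u'" using that by (auto simp: frac_mem)
  show "frac m P (a' ** b') (t' ** u') = frac m P (a ** b) (t ** u)"
  using frel_mult(1)[OF P *(3,6)] cl * P by (subst eq_commute, subst frac_eq_iff) (auto simp: pt_mult_iff)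
  show "frac m P (u' ** a' ++ t' ** b') (t' ** u') = frac m P (u ** a ++ t ** b) (t ** u)"
  using frel_mult(2)[OF P *(3,6)] cl * P by (subst eq_commute, subst frac_eq_iff) (auto simp: pt_mult_iff)
 qed
 have 2: "(a, t) : frac m P a t" "(b, u) : frac m P b u" using cl P by (auto intro: frac_self)
 have 3: "(\<Union>(a', t')\<in>S. \<Union>(b', u')\<in>T. h a' t' b' u') = Z"
  if h: "!!a' t' b' u'. (a', t') : S ==> (b', u') : T ==> h a' t' b' u' = Z" and ne: "S ~= {}" "T ~= {}"
  for S T :: "('c \<times> 'c) set" and h and Z :: "('c \<times> 'c) set"
 proof -
  have "(\<Union>(b', u')\<in>T. h a' t' b' u') = Z" if "(a', t') : S" for a' t'
  proof -
  have "(\<Union>(b', u')\<in>T. h a' t' b' u') = (\<Union>_\<in>T. Z)"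
  by (rule SUP_cong[OF refl]) (use that h in auto)
  thus ?thesis using ne by simp
  qed
  hence "(case z of (a', t') => \<Union>(b', u')\<in>T. h a' t' b' u') = Z" if "z : S" for z
  using that by (cases z) simp
  hence "(\<Union>(a', t')\<in>S. \<Union>(b', u')\<in>T. h a' t' b' u') = (\<Union>_\<in>S. Z)"
  by (rule SUP_cong[OF refl])
  thus ?thesis using ne by simp
 qed
 show "?A = frac m P (a ** b) (t ** u)" "?B = frac m P (u ** a ++ t ** b) (t ** u)"
  using 1 2 by (intro 3; blast)+
qed

end

context spf_algebra begin

subsection \<open>The Zariski topology\<close>

lemma basic_mult: "f <: C ==> g <: C ==> basic (f ** g) = basic f \<inter> basic g"
 by (auto simp: pt_mult_iff)

lemma basic_one: "basic \<one> = X" by (auto simp: pt_one)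

lemma topspace_spf [simp]: "topspace (spf_top K C) = X"
proof -
 have "topspace (spf_top K C) = (\<Union>f\<in>carrier C. basic f)"
  by (simp add: spf_top_def topology_generated_by_topspace)
 also have "... = X" by (auto intro!: bexI[of _ \<one>] simp: pt_one)
 finally show ?thesis .
qed

lemma open_basic: "f <: C ==> opn (basic f)"
 unfolding spf_top_def by (intro topology_generated_by_Basis) auto

lemma open_X: "opn X"
 using openin_topspace[of "spf_top K C"] by simp

lemma open_sub: "opn V ==> V <= X"
 using openin_subset[of "spf_top K C" V] by simp

text \<open>By \<open>basic_mult\<close> the sets \<open>basic f\<close> are closed under finite
  intersections, so they form a base and not only a subbase.\<close>

lemma basic_nbhd:
 assumes "opn V" "P : V"
 obtains f where "f <: C" "P : basic f" "basic f <= V"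
proof -
 have "generate_topology_on (basic ` carrier C) V"
  by (rule openin_topology_generated_by[OF assms(1)[unfolded spf_top_def]])
 hence "ALL P:V. EX f:carrier C. P : basic f & basic f <= V"
 proof (rule generate_topology_on.induct[where P = "%V. ALL P:V. EX f:carrier C. P : basic f & basic f <= V"], goal_cases)
  case (2 a b)
  show ?case
  proof
  fix P assume "P : a \<inter> b"
  hence ab: "P : a" "P : b" by auto
  obtain f where f: "f <: C" "P : basic f" "basic f <= a" using bspec[OF 2(2) ab(1)] by blast
  obtain g where g: "g <: C" "P : basic g" "basic g <= b" using bspec[OF 2(4) ab(2)] by blast
  from f g show "EX f:carrier C. P : basic f & basic f <= a \<inter> b"
  using basic_mult[of f g] by (intro bexI[of _ "f ** g"]) auto
  qed
 next
  case (3 \<K>)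
  show ?case
  proof
  fix P assume "P : \<Union>\<K>"
  then obtain k where k: "k : \<K>" "P : k" by blast
  then obtain f where "f <: C" "P : basic f" "basic f <= k" using bspec[OF 3(2)[OF k(1)] k(2)] by blast
  thus "EX f:carrier C. P : basic f & basic f <= \<Union>\<K>" using k by blast
  qed
 next
  case (4 s)
  thus ?case by blast
 qed simp
 thus thesis using assms(2) that by blast
qed

lemma pideal_in_prime_pt:
 assumes "ideal J C" "alg C (unif K ^ m) : J" "g <: C" "!!n::nat. g [^] n ~: J"
 obtains P where "P : basic g" "J <= P"
proof -
 obtain P where P: "primeideal P C" "J <= P" "g ~: P"
  using prime_avoidance[OF assms(1,3,4)] .
 hence "P : X" using assms(2) primeideal_pt by blast
 thus thesis using P that by blast
qed

text \<open>The ideals generated by \<pi> and a finite part of \<open>F\<close> have a directed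
  union \<open>J\<close>. If \<open>J\<close> contained no power of \<open>g\<close>, some point of
  \<open>basic g\<close> would contain all of \<open>F\<close>. A power of \<open>g\<close> in
  \<open>J\<close> already lies in the ideal of one finite part.\<close>

lemma basic_compact:
 assumes g: "g <: C" and F: "F <= carrier C" and cov: "basic g <= (\<Union>f\<in>F. basic f)"
 obtains F0 where "finite F0" "F0 <= F" "basic g <= (\<Union>f\<in>F0. basic f)"
proof -
 let ?\<pi> = "alg C (unif K)"
 let ?I = "%F0. Idl (insert ?\<pi> F0)"
 define J where "J = (\<Union>F0\<in>{F0. finite F0 & F0 <= F}. ?I F0)"
 have id: "ideal (?I F0) C" and gen: "insert ?\<pi> F0 <= ?I F0" if "F0 <= F" for F0
  using that F genideal_ideal[of "insert ?\<pi> F0"] genideal_self[of "insert ?\<pi> F0"] by auto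
 have mono: "?I F0 <= ?I F1" if "F0 <= F1" "F1 <= F" for F0 F1
  using gen[OF that(2)] that by (intro genideal_minimal id) auto
 have "ideal J C"
 proof (rule idealI_cring)
  show "J <= carrier C" unfolding J_def using idealD(1)[OF id] by auto
  show "\<zero> : J" unfolding J_def using idealD(2)[OF id[of "{}"]] by auto
  show "x ++ y : J" if xy: "x : J" "y : J" for x y
  proof -
  obtain F0 where 0: "finite F0" "F0 <= F" "x : ?I F0" using xy(1) by (auto simp: J_def)
  obtain F1 where 1: "finite F1" "F1 <= F" "y : ?I F1" using xy(2) by (auto simp: J_def)
  have U: "F0 \<union> F1 <= F" using 0 1 by auto
  have "x ++ y : ?I (F0 \<union> F1)"
  using 0 1 mono[OF _ U, of F0] mono[OF _ U, of F1] by (intro idealD(3)[OF id[OF U]]) auto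
  thus ?thesis unfolding J_def using 0 1 U by auto
  qed
  show "c ** x : J" if "x : J" "c <: C" for x c
  using that idealD(4)[OF id] by (auto simp: J_def)
 qed (rule is_cring)
 moreover have pJ: "?\<pi> : J" using gen[of "{}"] by (auto simp: J_def)
 moreover have FJ: "f : J" if "f : F" for f
  using that gen[of "{f}"] unfolding J_def by (intro UN_I[of "{f}"]) auto
 ultimately have "\<exists>n::nat. g [^] n : J"
 proof (rule_tac ccontr)
  assume J: "ideal J C" and "\<not> ?thesis"
  then obtain P where P: "P : basic g" "J <= P"
  using pideal_in_prime_pt[OF J, of 1 g] g pJ by auto
  thus False using cov FJ by blast
 qed
 then obtain n :: nat and F0 where n: "finite F0" "F0 <= F" "g [^] n : ?I F0" by (auto simp: J_def)
 have "basic g <= (\<Union>f\<in>F0. basic f)"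
 proof
  fix P assume P: "P : basic g"
  show "P : (\<Union>f\<in>F0. basic f)"
  proof (rule ccontr)
  assume *: "P ~: (\<Union>f\<in>F0. basic f)"
  hence "insert ?\<pi> F0 <= P" using P by (auto simp: spf_pts_def)
  hence "?I F0 <= P" using P by (intro genideal_minimal pt_ideal) auto
  thus False using n(3) P g by (auto simp: pt_pow_iff)
  qed
 qed
 thus thesis using n that by blast
qed

subsection \<open>Sections over basic open sets\<close>

lemma sectionD:
 assumes "s : sects U"
 shows "P ~: U ==> s m P = {}" "m \<le> n ==> P : U ==> s n P <= s m P"
  "P : U ==> EX V a t. opn V & P : V & V <= U & a <: C & t <: C &
  (ALL Q:V. t ~: Q & s m Q = frac m Q a t)"
proof -
 show "P ~: U ==> s m P = {}" using assms by (auto simp: spf_sections_def)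
 show "m \<le> n ==> P : U ==> s n P <= s m P"
  by (rule lift_Suc_antimono_le[of "%m. s m P"]) (use assms in "auto simp: spf_sections_def")
 show "P : U ==> EX V a t. opn V & P : V & V <= U & a <: C & t <: C &
  (ALL Q:V. t ~: Q & s m Q = frac m Q a t)"
  using assms unfolding spf_sections_def mem_Collect_eq by blast
qed

text \<open>Expanding the fraction by \<open>f\<close> makes its denominator cut out the
  neighbourhood on which the fraction is valid.\<close>

lemma section_local:
 assumes "s : sects U" "P : U"
 obtains f a where "f <: C" "P : basic f" "basic f <= U" "a <: C"
  "!!Q. Q : basic f ==> s m Q = frac m Q a f"
proof -
 obtain V a t where V: "opn V" "P : V" "V <= U" "a <: C" "t <: C"
  "!!Q. Q : V ==> t ~: Q & s m Q = frac m Q a t"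
  using sectionD(3)[OF assms] by metis
 obtain f where f: "f <: C" "P : basic f" "basic f <= V" by (rule basic_nbhd[OF V(1,2)])
 show thesis
 proof (rule that[of "f ** t" "f ** a"])
  show "P : basic (f ** t)" using f V by (auto simp: pt_mult_iff)
  show "basic (f ** t) <= U" using f V by (auto simp: basic_mult)
  fix Q assume "Q : basic (f ** t)"
  hence Q: "Q : X" "f ~: Q" "t ~: Q" "Q : V" using f V by (auto simp: pt_mult_iff)
  hence "s m Q = frac m Q a t" using V(6) by blast
  also have "... = frac m Q (f ** a) (f ** t)"
  using Q f V by (intro frac_eqI) (auto simp: pt_mult_iff m_ac)
  finally show "s m Q = frac m Q (f ** a) (f ** t)" .
 qed (use f V in auto)
qed

lemma section_frac:
 assumes "s : sects U" "P : U" "P : X"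
 obtains a t where "a <: C" "t : carrier C - P" "s m P = frac m P a t"
 by (rule section_local[OF assms(1,2), of m]) (use that in auto)

lemma section_mem:
 assumes "s : sects U" "P : U" "P : X" "(a, t) : s m P"
 shows "s m P = frac m P a t" "a <: C" "t : carrier C - P"
proof -
 obtain b u where "b <: C" "u : carrier C - P" "s m P = frac m P b u"
  by (rule section_frac[OF assms(1-3)])
 thus "s m P = frac m P a t" "a <: C" "t : carrier C - P"
  using frac_mem_eq[OF assms(3), of b u a t m] assms(4) by auto
qed

lemma section_ex_mem:
 assumes "s : sects U" "P : U" "P : X"
 obtains a t where "(a, t) : s m P"
proof -
 obtain a t where at: "a <: C" "t : carrier C - P" "s m P = frac m P a t"
  by (rule section_frac[OF assms])
 show thesis by (rule that[of a t]) (use at frac_self[OF assms(3) at(1,2)] in simp)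
qed

lemma section_level:
 assumes "s : sects U" "P : U" "P : X" "m \<le> n" "s n P = frac n P a t"
  "a <: C" "t : carrier C - P"
 shows "s m P = frac m P a t"
proof -
 have "(a, t) : s n P" using assms frac_self by auto
 hence "(a, t) : s m P" using sectionD(2)[OF assms(1,4,2)] by auto
 thus ?thesis using section_mem assms by blast
qed

lemma ideal_annihilator:
 assumes "J = {d : carrier C. d ** c : pideal m}" "c <: C" shows "ideal J C"
proof (rule idealI_cring)
 show "x ++ y : J" if "x : J" "y : J" for x y
  using that assms pideal_add[of "x ** c" m "y ** c"] by (auto simp: l_distr)
 show "d ** x : J" if "x : J" "d <: C" for x d
  using that assms pideal_mult[of "x ** c" m d] by (auto simp: m_assoc)
qed (use assms in "auto intro: is_cring")

text \<open>Otherwise the annihilator of \<open>c\<close> modulo \<open>\<pi>^m\<close> would be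
  contained in a point of \<open>basic f\<close>, but at each such point some \<open>v\<close>
  outside the point kills \<open>c\<close>.\<close>

lemma const_zero_on_basic:
 assumes f: "f <: C" and c: "c <: C"
  and z: "!!P. P : basic f ==> frel m P c \<one> \<zero> \<one>"
 shows "\<exists>N::nat. f [^] N ** c : pideal m"
proof (rule ccontr)
 assume *: "\<not> ?thesis"
 define J where "J = {d : carrier C. d ** c : pideal m}"
 have J: "ideal J C" by (rule ideal_annihilator[OF J_def c])
 have "alg C (unif K ^ m) : J" unfolding J_def using c by (auto intro: pow_idealI)
 moreover have "f [^] n ~: J" for n :: nat using * f by (auto simp: J_def)
 ultimately obtain P where P: "P : basic f" "J <= P" using pideal_in_prime_pt[OF J _ f] by blast
 obtain v where v: "v : carrier C - P" "v ** (\<one> ** c \<ominus> \<one> ** \<zero>) : pideal m"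
  using z[OF P(1)] by (auto simp: frel_def)
 have "v : J" using v c by (simp add: J_def minus_eq)
 thus False using v P by auto
qed

lemma frel_one_zero:
 assumes "frel m P a t b u" "P : X" "a <: C" "t <: C" "b <: C" "u <: C"
 shows "frel m P (u ** a \<ominus> t ** b) \<one> \<zero> \<one>"
 using assms unfolding frel_def by (auto simp: minus_eq)

text \<open>A section over a basic open set is globally a fraction: the multipliers \<open>c\<close> for which
 \<open>c s\<close> comes from an element of the algebra form an ideal, and this ideal contains a power of \<open>g\<close> because it is
 not contained in any point of \<open>basic g\<close>.\<close>

lemma section_on_basic:
 assumes g: "g <: C" and s: "s : sects U" and gU: "basic g <= U"
 shows "\<exists>N::nat. EX a:carrier C. ALL P:basic g. s m P = frac m P a (g [^] N)"
proof -
 define F where "F = {f : carrier C. basic f <= U & (EX a:carrier C. ALL P:basic f. s m P = frac m P a f)}"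
 have cov: "basic g <= (\<Union>f\<in>F. basic f)"
 proof
  fix P assume "P : basic g"
  hence PU: "P : U" using gU by auto
  obtain f a where f: "f <: C" "P : basic f" "basic f <= U" "a <: C"
  "!!Q. Q : basic f ==> s m Q = frac m Q a f"
  by (rule section_local[OF s PU, where m = m]) (rule that)
  have "EX a:carrier C. ALL P:basic f. s m P = frac m P a f" using f(4,5) by (intro bexI[of _ a] ballI)
  hence "f : F" unfolding F_def using f(1,3) by simp
  thus "P : (\<Union>f\<in>F. basic f)" using f(2) by (rule UN_I)
 qed
 have Fc: "F <= carrier C" by (simp add: F_def)
 obtain F0 where F0: "finite F0" "F0 <= F" "basic g <= (\<Union>f\<in>F0. basic f)"
  by (rule basic_compact[OF g Fc cov])
 have fc: "f <: C" if "f : F0" for f using that F0 by (auto simp: F_def)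
 have "ALL f:F0. EX a:carrier C. ALL P:basic f. s m P = frac m P a f" using F0 by (auto simp: F_def)
 then obtain a where a: "!!f. f : F0 ==> a f <: C"
  "!!f P. f : F0 ==> P : basic f ==> s m P = frac m P (a f) f" by metis
 \<comment> \<open>On \<open>basic (f ** f')\<close> the fractions \<open>a f / f\<close> and
   \<open>a f' / f'\<close> agree, so \<open>d f f'\<close> is killed modulo \<open>\<pi>^m\<close>
   by a power of \<open>f ** f'\<close>. The exponent \<open>M\<close> below serves for the finitely
   many pairs at once.\<close>
 define d where "d f f' = f' ** a f \<ominus> f ** a f'" for f f'
 have dc: "d f f' <: C" if "f : F0" "f' : F0" for f f' using that a fc by (auto simp: d_def)
 have "\<exists>N::nat. (f ** f') [^] N ** d f f' : pideal m" if "f : F0" "f' : F0" for f f'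
 proof (rule const_zero_on_basic)
  show "frel m P (d f f') \<one> \<zero> \<one>" if P: "P : basic (f ** f')" for P
  unfolding d_def
  proof (rule frel_one_zero)
  have P: "P : basic f" "P : basic f'" using P fc \<open>f : F0\<close> \<open>f' : F0\<close> by (auto simp: basic_mult)
  hence "frac m P (a f) f = frac m P (a f') f'" using a(2) \<open>f : F0\<close> \<open>f' : F0\<close> by metis
  thus "frel m P (a f) f (a f') f'"
  using P a(1) fc \<open>f : F0\<close> \<open>f' : F0\<close> by (subst (asm) frac_eq_iff) auto
  qed (use a(1) fc that \<open>f : F0\<close> \<open>f' : F0\<close> in auto)
 qed (use dc fc that in auto)
 then obtain N where N: "!!f f'. f : F0 ==> f' : F0 ==> (f ** f') [^] (N f f' :: nat) ** d f f' : pideal m"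
  by metis
 define M where "M = Max (case_prod N ` (F0 \<times> F0))"
 have NM: "N f f' \<le> M" if "f : F0" "f' : F0" for f f'
  unfolding M_def using F0(1) that by (intro Max_ge) auto
 have M: "(f ** f') [^] M ** d f f' : pideal m" if ff: "f : F0" "f' : F0" for f f'
 proof -
  have "M = (M - N f f') + N f f'" using NM[OF ff] by simp
  hence "(f ** f') [^] M = (f ** f') [^] (M - N f f') ** (f ** f') [^] N f f'"
  using fc ff nat_pow_mult[of "f ** f'" "M - N f f'" "N f f'"] by simp
  hence "(f ** f') [^] M ** d f f' = (f ** f') [^] (M - N f f') ** ((f ** f') [^] N f f' ** d f f')"
  using fc dc ff by (simp add: m_assoc)
  thus ?thesis using N[OF ff] fc ff by (simp add: pideal_mult)
 qed
 define J where "J = {c : carrier C. EX b:carrier C. ALL Q:basic g. ALL x t. (x, t) : s m Q --> frel m Q (c ** x) t b \<one>}"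
 have JI: "c : J" if "c <: C" "b <: C"
  "!!Q x t. Q : basic g ==> (x, t) : s m Q ==> frel m Q (c ** x) t b \<one>" for b c
  unfolding J_def
  by (rule CollectI, rule conjI[OF that(1)], rule bexI[OF _ that(2)], intro ballI allI impI, rule that(3))
 have JE: "EX b:carrier C. ALL Q:basic g. ALL x t. (x, t) : s m Q --> frel m Q (c ** x) t b \<one>" if "c : J" for c
  using that unfolding J_def by (elim CollectE conjE)
 have sg: "x <: C" "t : carrier C - Q" if "(x, t) : s m Q" "Q : basic g" for x t Q
  using section_mem[OF s _ _ that(1)] that(2) gU by auto
 have J: "ideal J C"
 proof (rule idealI_cring)
  have "frel m Q (\<zero> ** x) t \<zero> \<one>" if "Q : basic g" "(x, t) : s m Q" for Q x t
  using sg[OF that(2,1)] that(1) by (intro frel_eqI) auto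
  thus "\<zero> : J" by (intro JI[of _ \<zero>]) auto
  show "x ++ y : J" if xy: "x : J" "y : J" for x y
  proof -
  obtain b where b: "b <: C" "ALL Q:basic g. ALL z t. (z, t) : s m Q --> frel m Q (x ** z) t b \<one>"
  using JE[OF xy(1)] by (rule bexE)
  obtain b' where b': "b' <: C" "ALL Q:basic g. ALL z t. (z, t) : s m Q --> frel m Q (y ** z) t b' \<one>"
  using JE[OF xy(2)] by (rule bexE)
  have xyc: "x <: C" "y <: C" using xy by (auto simp: J_def)
  have "frel m Q ((x ++ y) ** z) t (b ++ b') \<one>" if "Q : basic g" "(z, t) : s m Q" for Q z t
  proof -
  note zt = sg[OF that(2,1)]
  have tc: "t <: C" using zt by simp
  have "frel m Q (t ** (x ** z) ++ t ** (y ** z)) (t ** t) (\<one> ** b ++ \<one> ** b') (\<one> ** \<one>)"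
  by (rule frel_mult(2)) (use b b' zt xyc that in auto)
  hence 1: "frel m Q (t ** (x ** z) ++ t ** (y ** z)) (t ** t) (b ++ b') \<one>" using b b' by simp
  have 2: "frel m Q ((x ++ y) ** z) t (t ** (x ** z) ++ t ** (y ** z)) (t ** t)"
  proof (rule frel_eqI)
  show "t ** t ** ((x ++ y) ** z) = t ** (t ** (x ** z) ++ t ** (y ** z))"
  using xyc zt(1) tc by algebra
  qed (use xyc zt that in auto)
  show ?thesis
  by (rule frel_trans[OF _ 2 1]) (use xyc zt b b' that in "auto simp: pt_mult_iff")
  qed
  thus ?thesis using b b' xyc by (intro JI[of _ "b ++ b'"]) auto
  qed
  show "e ** x : J" if xe: "x : J" "e <: C" for x e
  proof -
  obtain b where b: "b <: C" "ALL Q:basic g. ALL z t. (z, t) : s m Q --> frel m Q (x ** z) t b \<one>"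
  using JE[OF xe(1)] by (rule bexE)
  have xc: "x <: C" using xe by (auto simp: J_def)
  have "frel m Q ((e ** x) ** z) t (e ** b) \<one>" if "Q : basic g" "(z, t) : s m Q" for Q z t
  proof -
  note zt = sg[OF that(2,1)]
  have "frel m Q (e ** (x ** z)) (\<one> ** t) (e ** b) (\<one> ** \<one>)"
  by (rule frel_mult(1)) (use b zt xc xe that in "auto intro: frel_refl")
  thus ?thesis using xc xe zt by (simp add: m_assoc)
  qed
  thus ?thesis using b xe xc by (intro JI[of _ "e ** b"]) auto
  qed
 qed (auto simp: J_def intro: is_cring)
 \<comment> \<open>The candidate for \<open>f^(M+1) s\<close> is \<open>f^M a f\<close>. On
   \<open>basic f'\<close>, where \<open>s\<close> is \<open>a f' / f'\<close>, their difference
   multiplied by \<open>f'^(M+1)\<close> is a multiple of \<open>(f f')^M d f f'\<close>.\<close>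
 have fJ: "f [^] Suc M : J" if f: "f : F0" for f
 proof -
  have "frel m Q (f [^] Suc M ** x) t (f [^] M ** a f) \<one>" if Q: "Q : basic g" "(x, t) : s m Q" for Q x t
  proof -
  obtain f' where f': "f' : F0" "Q : basic f'" using F0 Q by auto
  have "(x, t) : frac m Q (a f') f'" using a(2)[OF f'] Q by simp
  then obtain v where v: "v : carrier C - Q" "v ** (t ** a f' \<ominus> f' ** x) : pideal m"
  by (auto simp: frac_mem frel_def)
  note cl = fc[OF f] fc[OF f'(1)] a(1)[OF f] a(1)[OF f'(1)] sg(1)[OF Q(2,1)] DiffD1[OF sg(2)[OF Q(2,1)]]
  define y z where "y = f [^] M" and "z = f' [^] M"
  have yz: "y <: C" "z <: C" using cl by (auto simp: y_def z_def)
  have D: "(y ** z) ** d f f' : pideal m"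
  using M[OF f f'(1)] cl by (simp add: y_def z_def nat_pow_distrib)
  have "(v ** (z ** f')) ** (\<one> ** ((y ** f) ** x) \<ominus> t ** (y ** a f)) =
  \<ominus> ((z ** y ** f) ** (v ** (t ** a f' \<ominus> f' ** x))) ++ \<ominus> ((t ** v) ** ((y ** z) ** (f' ** a f \<ominus> f ** a f')))"
  using cl yz DiffD1[OF v(1)] by algebra
  also have "... : pideal m"
  using v D cl yz unfolding d_def by (intro pideal_add pideal_uminus pideal_mult[of _ m "z ** y ** f"] pideal_mult[of _ m "t ** v"]) auto
  finally have "(v ** (z ** f')) ** (\<one> ** (f [^] Suc M ** x) \<ominus> t ** (f [^] M ** a f)) : pideal m"
  using cl by (simp add: y_def)
  moreover have "v ** (z ** f') : carrier C - Q"
  using v cl yz f' Q by (auto simp: pt_mult_iff z_def pt_pow_iff)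
  ultimately show ?thesis unfolding frel_def by blast
  qed
  thus ?thesis using fc[OF f] a(1)[OF f] by (intro JI[of _ "f [^] M ** a f"]) auto
 qed
 have "\<exists>n::nat. g [^] n : J"
 proof (rule ccontr)
  assume *: "\<not> ?thesis"
  have "alg C (unif K ^ m) : J"
  proof -
  have "frel m Q (alg C (unif K ^ m) ** x) t \<zero> \<one>" if "Q : basic g" "(x, t) : s m Q" for Q x t
  unfolding frel_def using sg[OF that(2,1)] pt_one[of Q] that(1)
  by (intro bexI[of _ \<one>]) (auto simp: minus_eq intro: pow_idealI)
  thus ?thesis by (intro JI[of _ \<zero>]) auto
  qed
  then obtain P where P: "P : basic g" "J <= P" using pideal_in_prime_pt[OF J _ g] * by blast
  then obtain f where f: "f : F0" "P : basic f" using F0 by auto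
  thus False using fJ[OF f(1)] P pt_pow_iff[of P f "Suc M"] fc by auto
 qed
 then obtain n :: nat where n: "g [^] n : J" by (rule exE)
 obtain b where nb: "b <: C"
  "ALL Q:basic g. ALL x t. (x, t) : s m Q --> frel m Q (g [^] n ** x) t b \<one>"
  using JE[OF n] by (rule bexE)
 have "s m P = frac m P b (g [^] n)" if P: "P : basic g" for P
 proof -
  have PU: "P : U" "P : X" using P gU by auto
  obtain x t where xt: "(x, t) : s m P" by (rule section_ex_mem[OF s PU])
  note cl = section_mem[OF s PU xt]
  have "frel m P (g [^] n ** x) t b \<one>" using nb(2) P xt by simp
  hence "frel m P x t b (g [^] n)" using cl nb(1) g by (simp add: frel_def)
  hence "frac m P x t = frac m P b (g [^] n)"
  using cl nb(1) g PU P by (subst frac_eq_iff) (auto simp: pt_pow_iff)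
  thus ?thesis using cl by simp
 qed
 thus ?thesis using nb(1) by blast
qed

end

lemma Spf_sel [simp]:
 "tp (Spf K C) = spf_top K C" "sec (Spf K C) U = spf_alg K C U"
 "res (Spf K C) U V s = (%m P. if P : V then s m P else {})"
 by (simp_all add: Spf_def)

lemma spf_alg_sel [simp]:
 "carrier (spf_alg K C U) = spf_sections K C U"
 "\<one>.(spf_alg K C U) = spf_const K C U \<one>.C" "\<zero>.(spf_alg K C U) = spf_const K C U \<zero>.C"
 "alg (spf_alg K C U) r = spf_const K C U (alg C r)"
 by (simp_all add: spf_alg_def)

context spf_algebra begin

lemma sectionI:
 assumes "!!m P. P ~: U ==> s m P = {}" "!!m P. P : U ==> s (Suc m) P <= s m P"
  "!!m P. P : U ==> EX V a t. opn V & P : V & V <= U & a <: C & t <: C &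
  (ALL Q:V. t ~: Q & s m Q = frac m Q a t)"
 shows "s : sects U"
 unfolding spf_sections_def using assms by (intro CollectI allI conjI impI ballI)

lemma local_fracI:
 assumes "opn V" "P : V" "V <= U" "a <: C" "t <: C"
  "!!Q. Q : V ==> t ~: Q" "!!Q. Q : V ==> s Q = frac m Q a t"
 shows "EX V a t. opn V & P : V & V <= U & a <: C & t <: C &
  (ALL Q:V. t ~: Q & s Q = frac m Q a t)"
 by (intro exI[of _ V] exI[of _ a] exI[of _ t] conjI ballI assms)

lemma spf_const_at: "P : U ==> cst U c m P = frac m P c \<one>"
 and spf_const_out: "P ~: U ==> cst U c m P = {}"
 by (simp_all add: spf_const_def)

lemma pt_one': "P : X ==> \<one> : carrier C - P" by (simp add: pt_one)

lemma spf_const_section: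
 assumes "opn U" "c <: C" shows "cst U c : sects U"
proof (rule sectionI)
 fix m P assume "P : U"
 thus "cst U c (Suc m) P <= cst U c m P"
  by (simp add: spf_const_at frac_mono)
 show "EX V a t. opn V & P : V & V <= U & a <: C & t <: C &
  (ALL Q:V. t ~: Q & cst U c m Q = frac m Q a t)"
 proof (rule local_fracI[OF assms(1) \<open>P : U\<close> subset_refl assms(2) one_closed])
  fix Q assume Q: "Q : U"
  show "\<one> ~: Q" by (rule pt_one[OF subsetD[OF open_sub[OF assms(1)] Q]])
  show "cst U c m Q = frac m Q c \<one>" by (rule spf_const_at[OF Q])
 qed
qed (simp add: spf_const_out)

lemma section_res:
 assumes "s : sects U" "opn V" "V <= U"
 shows "(%m P. if P : V then s m P else {}) : sects V"
proof (rule sectionI)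
 fix m P assume P: "P : V"
 hence PU: "P : U" using assms(3) by auto
 show "(if P : V then s (Suc m) P else {}) <= (if P : V then s m P else {})"
  using P sectionD(2)[OF assms(1), of m "Suc m" P] PU by simp
 obtain W a t where W: "opn W" "P : W" "W <= U" "a <: C" "t <: C"
  "ALL Q:W. t ~: Q & s m Q = frac m Q a t"
  using sectionD(3)[OF assms(1) PU, of m] by (elim exE conjE)
 show "EX W a t. opn W & P : W & W <= V & a <: C & t <: C &
  (ALL Q:W. t ~: Q & (if Q : V then s m Q else {}) = frac m Q a t)"
 proof (rule local_fracI[OF openin_Int[OF W(1) assms(2)] _ _ W(4,5)])
  fix Q assume "Q : W \<inter> V"
  thus "t ~: Q" "(if Q : V then s m Q else {}) = frac m Q a t" using W(6) by simp_all
 qed (use W(2) P in simp_all)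
qed simp

lemma sec_mult_at:
 assumes "P : X" "a <: C" "t : carrier C - P" "b <: C" "u : carrier C - P"
  "s m P = frac m P a t" "s' m P = frac m P b u"
 shows "(s **.(SA U) s') m P = frac m P (a ** b) (t ** u)"
  "(s ++.(SA U) s') m P = frac m P (u ** a ++ t ** b) (t ** u)"
 using frac_ops[OF assms(1-5), of m] by (simp_all add: spf_alg_def assms(6,7))

lemma sec_mult_out:
 assumes "s m P = {}"
 shows "(s **.(SA U) s') m P = {}" "(s ++.(SA U) s') m P = {}"
 using assms by (simp_all add: spf_alg_def)

lemma pt_mult_notin: "P : X ==> t : carrier C - P ==> u : carrier C - P ==> t ** u : carrier C - P"
 by (simp add: pt_mult_iff)

lemma section_eqI:
 assumes "!!m P. P : U ==> s m P = s' m P" "!!m P. P ~: U ==> s m P = {}" "!!m P. P ~: U ==> s' m P = {}"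
 shows "s = s'"
proof (intro ext)
 fix m P show "s m P = s' m P" using assms by (cases "P : U") simp_all
qed

lemma spf_const_mult:
 assumes "U <= X" "c <: C" "d <: C"
 shows "cst U c **.(SA U) cst U d = cst U (c ** d)"
  "cst U c ++.(SA U) cst U d = cst U (c ++ d)"
proof -
 have *: "(cst U c **.(SA U) cst U d) m P = cst U (c ** d) m P"
  "(cst U c ++.(SA U) cst U d) m P = cst U (c ++ d) m P" if P: "P : U" for m P
 proof -
  have PX: "P : X" using P assms(1) by auto
  note 1 = sec_mult_at[OF PX assms(2) pt_one'[OF PX] assms(3) pt_one'[OF PX], of "cst U c" m "cst U d" U]
  show "(cst U c **.(SA U) cst U d) m P = cst U (c ** d) m P"
  "(cst U c ++.(SA U) cst U d) m P = cst U (c ++ d) m P"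
  using P assms 1 by (simp_all add: spf_const_at)
 qed
 show "cst U c **.(SA U) cst U d = cst U (c ** d)"
  by (rule section_eqI[of U]) (use * in "auto simp: spf_const_out sec_mult_out")
 show "cst U c ++.(SA U) cst U d = cst U (c ++ d)"
  by (rule section_eqI[of U]) (use * in "auto simp: spf_const_out sec_mult_out")
qed

lemma spf_const_eq_cong:
 assumes "c <: C" "d <: C" "!!P. P : X ==> frac m P c \<one> = frac m P d \<one>"
 shows "cong_mod C (pideal m) c d"
proof -
 have "\<exists>N::nat. \<one> [^] N ** (c \<ominus> d) : pideal m"
 proof (rule const_zero_on_basic)
  fix P assume "P : basic \<one>"
  hence P: "P : X" by simp
  have "frel m P c \<one> d \<one>"
  using assms(3)[OF P] frac_eq_iff[OF P assms(1) pt_one'[OF P] assms(2) pt_one'[OF P], of m] by simp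
  from frel_one_zero[OF this P assms(1) one_closed assms(2) one_closed]
  show "frel m P (c \<ominus> d) \<one> \<zero> \<one>" using assms by simp
 qed (use assms in auto)
 thus ?thesis using assms by (simp add: cong_mod_def)
qed

text \<open>\<open>section_on_basic\<close> with \<open>g = 1\<close> gives one element for each
  level \<open>m\<close>; consecutive ones are congruent modulo \<open>\<pi>^m\<close>, so they
  converge.\<close>

lemma global_section:
 assumes "adic K C" "s : sects X"
 shows "EX c:carrier C. cst X c = s"
proof -
 have "EX a:carrier C. ALL P:X. s m P = frac m P a \<one>" for m
  using section_on_basic[OF one_closed assms(2), of m] by (simp add: basic_one)
 then obtain a where a: "!!m. a m <: C" "!!m P. P : X ==> s m P = frac m P (a m) \<one>" by metis
 have "cong_mod C (pideal m) (a (Suc m)) (a m)" for m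
 proof (rule spf_const_eq_cong)
  fix P assume P: "P : X"
  have "s m P = frac m P (a (Suc m)) \<one>"
  by (rule section_level[OF assms(2) P P, of m "Suc m"]) (use a P pt_one' in auto)
  thus "frac m P (a (Suc m)) \<one> = frac m P (a m) \<one>" using a(2)[OF P] by simp
 qed (use a in auto)
 then obtain c where c: "c <: C" "ALL m. cong_mod C (pideal m) c (a m)"
  using adicD(3)[OF assms(1), of a] by blast
 have "cst X c = s"
 proof (rule section_eqI[of X])
  fix m P assume P: "P : X"
  have "frac m P c \<one> = frac m P (a m) \<one>" using frac_cong[OF P _ pt_one'[OF P]] c(2) by blast
  thus "cst X c m P = s m P" using a(2)[OF P] P by (simp add: spf_const_at)
 next
  show "!!m P. P ~: X ==> s m P = {}" by (rule sectionD(1)[OF assms(2)])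
 qed (simp add: spf_const_out)
 thus ?thesis using c by blast
qed

lemma spf_const_inj:
 assumes "adic K C" "c <: C" "d <: C" "cst X c = cst X d"
 shows "c = d"
proof (rule adic_complete_eqI[OF assms(1)])
 fix m show "cong_mod C (pideal m) c d"
 proof (rule spf_const_eq_cong)
  fix P assume P: "P : X"
  have "cst X c m P = cst X d m P" by (simp add: assms(4))
  thus "frac m P c \<one> = frac m P d \<one>" using P by (simp add: spf_const_at)
 qed (use assms in auto)
qed

lemma spf_global_const:
 assumes "adic K C" "c <: C"
 shows "spf_global K C (cst X c) = c"
 unfolding spf_global_def
 by (rule the_equality) (use assms spf_const_inj[OF assms(1)] in auto)

lemma spf_global:
 assumes "adic K C" "s : sects X"
 shows "spf_global K C s <: C" "cst X (spf_global K C s) = s"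
proof -
 obtain c where c: "c <: C" "cst X c = s" using global_section[OF assms] by blast
 thus "spf_global K C s <: C" "cst X (spf_global K C s) = s"
  using spf_global_const[OF assms(1), of c] by auto
qed

text \<open>Successive approximation: a section over \<open>basic g\<close> is a fraction at every level, so the
 quotient by \<open>\<pi>\<^sup>m\<close> can be corrected level by level.\<close>

lemma section_divisible:
 assumes g: "g <: C" and s: "s : sects (basic g)"
  and z: "!!P. P : basic g ==> s m P = frac m P \<zero> \<one>"
 obtains t where "t : sects (basic g)"
  "s = alg (SA (basic g)) (unif K ^ m) **.(SA (basic g)) t"
proof -
 let ?p = "%k. alg C (unif K ^ k)"
 have gN: "g [^] (N::nat) : carrier C - P" if "P : basic g" for P N
  using that g by (auto simp: pt_pow_iff)
 \<comment> \<open>State of the approximation: at level \<open>m + j\<close> the section is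
   \<open>\<pi>^m x / g^n\<close> for the pair \<open>(x, n)\<close>.\<close>
 define okl where "okl j xn <-> fst xn <: C &
  (ALL P:basic g. s (m + j) P = frac (m + j) P (?p m ** fst xn) (g [^] (snd xn :: nat)))" for j and xn :: "'c \<times> nat"
 have "EX f. ALL j. okl j (f j) &
  (ALL P:basic g. frac j P (fst (f (Suc j))) (g [^] snd (f (Suc j))) = frac j P (fst (f j)) (g [^] snd (f j)))"
 proof (rule dependent_nat_choice)
  show "EX xn. okl 0 xn" unfolding okl_def using z by (intro exI[of _ "(\<zero>, 0)"]) auto
  fix xn j assume "okl j xn"
  then obtain x n where xn: "xn = (x, n)" and x: "x <: C"
  "ALL P:basic g. s (m + j) P = frac (m + j) P (?p m ** x) (g [^] n)"
  by (cases xn) (auto simp: okl_def)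
  obtain l :: nat and b where b: "b <: C"
  "ALL P:basic g. s (m + Suc j) P = frac (m + Suc j) P b (g [^] l)"
  using section_on_basic[OF g s subset_refl, of "m + Suc j"] by blast
  define e where "e = g [^] n ** b \<ominus> g [^] l ** (?p m ** x)"
  have "\<exists>M::nat. g [^] M ** e : pideal (m + j)"
  proof (rule const_zero_on_basic)
  fix P assume P: "P : basic g"
  hence PX: "P : X" by simp
  have "s (m + j) P = frac (m + j) P b (g [^] l)"
  by (rule section_level[OF s P PX, of _ "m + Suc j"]) (use b P gN in auto)
  hence "frac (m + j) P b (g [^] l) = frac (m + j) P (?p m ** x) (g [^] n)" using x P by simp
  hence "frel (m + j) P b (g [^] l) (?p m ** x) (g [^] n)"
  using x b P gN[OF P] g by (subst (asm) frac_eq_iff) auto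
  thus "frel (m + j) P e \<one> \<zero> \<one>" unfolding e_def
  by (rule frel_one_zero) (use x b P g in auto)
  qed (use g b x in "auto simp: e_def")
  then obtain M :: nat where "g [^] M ** e : pideal (m + j)" ..
  then obtain y where y: "y <: C" "g [^] M ** e = ?p (m + j) ** y" by (rule pow_idealE)
  \<comment> \<open>This choice makes \<open>\<pi>^m x'\<close> equal to \<open>g^(M + n) b\<close>.
    Thus \<open>x'\<close> is correct at the next level, and up to a power of \<open>g\<close> it
    differs from \<open>x\<close> by a multiple of \<open>\<pi>^j\<close>.\<close>
  define x' where "x' = g [^] (M + l) ** x ++ ?p j ** y"
  have x': "x' <: C" using g x y by (simp add: x'_def)
  have key: "?p m ** x' = g [^] (M + n) ** b"
  proof -
  have "?p m ** (?p j ** y) = g [^] M ** e" using y by (simp add: power_add alg_mult m_assoc)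
  moreover have "?p m ** x' = ?p m ** (g [^] M ** g [^] l ** x) ++ ?p m ** (?p j ** y)"
  using g x y by (simp add: x'_def r_distr nat_pow_mult)
  ultimately have "?p m ** x' = ?p m ** (g [^] M ** g [^] l ** x) ++ g [^] M ** e" by simp
  also have "... = (g [^] M ** g [^] n) ** b"
  using g x b alg_closed[of "unif K ^ m"] nat_pow_closed[OF g, of M] nat_pow_closed[OF g, of l] nat_pow_closed[OF g, of n]
  unfolding e_def by algebra
  finally show ?thesis using g by (simp add: nat_pow_mult)
  qed
  have "okl (Suc j) (x', M + n + l)"
  unfolding okl_def fst_conv snd_conv
  proof (intro conjI ballI)
  fix P assume P: "P : basic g"
  have "frac (m + Suc j) P b (g [^] l) = frac (m + Suc j) P (?p m ** x') (g [^] (M + n + l))"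
  using P gN[OF P, of l] gN[OF P, of "M + n + l"] b x' g
  by (intro frac_eqI) (auto simp: key nat_pow_mult[symmetric] m_ac)
  thus "s (m + Suc j) P = frac (m + Suc j) P (?p m ** x') (g [^] (M + n + l))" using b P by simp
  qed (rule x')
  moreover have "frac j P x' (g [^] (M + n + l)) = frac j P x (g [^] n)" if P: "P : basic g" for P
  proof -
  have PX: "P : X" using P by simp
  have "x' \<ominus> g [^] (M + l) ** x = ?p j ** y"
  using g x(1) y(1) alg_closed[of "unif K ^ j"] nat_pow_closed[OF g, of "M + l"] unfolding x'_def by algebra
  also have "... : pideal j" using y by (intro pow_idealI) auto
  finally have "cong_mod C (pideal j) x' (g [^] (M + l) ** x)" using x' g x by (simp add: cong_mod_def)
  hence "frac j P x' (g [^] (M + n + l)) = frac j P (g [^] (M + l) ** x) (g [^] (M + n + l))"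
  by (rule frac_cong[OF PX _ gN[OF P]])
  also have "... = frac j P x (g [^] n)"
  using PX gN[OF P, of n] gN[OF P, of "M + n + l"] x g
  by (intro frac_eqI) (auto simp: nat_pow_mult[symmetric] m_ac)
  finally show ?thesis .
  qed
  ultimately show "EX xn'. okl (Suc j) xn' &
  (ALL P:basic g. frac j P (fst xn') (g [^] snd xn') = frac j P (fst xn) (g [^] snd xn))"
  unfolding xn by (intro exI[of _ "(x', M + n + l)"]) simp
 qed
 then obtain f where f: "!!j. okl j (f j)"
  "!!j P. P : basic g ==> frac j P (fst (f (Suc j))) (g [^] snd (f (Suc j))) = frac j P (fst (f j)) (g [^] snd (f j))"
  by blast
 have fc: "fst (f j) <: C" for j using f(1)[of j] by (simp add: okl_def)
 \<comment> \<open>Dividing by \<open>\<pi>^m\<close> costs \<open>m\<close> levels: level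
   \<open>j\<close> of \<open>t\<close> comes from level \<open>m + j\<close> of
   \<open>s\<close>.\<close>
 define t where "t = (%j P. if P : basic g then frac j P (fst (f j)) (g [^] snd (f j)) else {})"
 have tat: "t j P = frac j P (fst (f j)) (g [^] snd (f j))" if "P : basic g" for j P
  unfolding t_def using that by (rule if_P)
 have tout: "t j P = {}" if "P ~: basic g" for j P unfolding t_def using that by (rule if_not_P)
 have ts: "t : sects (basic g)"
 proof (rule sectionI)
  fix j P assume P: "P : basic g"
  have "t (Suc j) P <= frac j P (fst (f (Suc j))) (g [^] snd (f (Suc j)))"
  unfolding tat[OF P] by (rule frac_mono) simp
  also have "... = t j P" unfolding tat[OF P] by (rule f(2)[OF P])
  finally show "t (Suc j) P <= t j P" .
  show "EX V a u. opn V & P : V & V <= basic g & a <: C & u <: C &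
  (ALL Q:V. u ~: Q & t j Q = frac j Q a u)"
  proof (rule local_fracI[OF open_basic[OF g] P subset_refl fc nat_pow_closed[OF g]])
  fix Q assume Q: "Q : basic g"
  show "g [^] snd (f j) ~: Q" using gN[OF Q, of "snd (f j)"] by simp
  show "t j Q = frac j Q (fst (f j)) (g [^] snd (f j))" by (rule tat[OF Q])
  qed
 qed (rule tout)
 have "s = cst (basic g) (?p m) **.(SA (basic g)) t"
 proof (rule section_eqI[of "basic g"])
  fix k P assume P: "P : basic g"
  hence PX: "P : X" by simp
  have "s (m + k) P = frac (m + k) P (?p m ** fst (f k)) (g [^] snd (f k))"
  using f(1)[of k] P by (simp add: okl_def)
  hence "s k P = frac k P (?p m ** fst (f k)) (g [^] snd (f k))"
  using gN[OF P] fc by (intro section_level[OF s P PX, of k "m + k"]) auto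
  moreover have "(cst (basic g) (?p m) **.(SA (basic g)) t) k P =
  frac k P (?p m ** fst (f k)) (\<one> ** g [^] snd (f k))"
  by (rule sec_mult_at(1)[where s = "cst (basic g) (?p m)" and s' = t and m = k,
  OF PX alg_closed pt_one'[OF PX] fc gN[OF P] spf_const_at[OF P] tat[OF P]])
  ultimately show "s k P = (cst (basic g) (?p m) **.(SA (basic g)) t) k P"
  using g by simp
 next
  fix k P assume "P ~: basic g"
  thus "s k P = {}" "(cst (basic g) (?p m) **.(SA (basic g)) t) k P = {}"
  by (rule sectionD(1)[OF s], rule sec_mult_out(1)[OF spf_const_out])
 qed
 thus thesis using ts that by simp
qed

subsection \<open>Units in the stalks\<close>

text \<open>Level 1 decides: an inverse \<open>b / u\<close> makes \<open>v (a b - t u)\<close> a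
  multiple of \<pi>, hence an element of \<open>P\<close>, while \<open>v t u\<close> is not in
  \<open>P\<close>.\<close>

lemma germ_unit_numerator:
 assumes "germ_unit (Spf K C) U P s" "s : sects U" "(a, t) : s 1 P"
 shows "a ~: P"
proof
 assume aP: "a : P"
 obtain V where V: "opn V" "P : V" "V <= U"
  "(%m P. if P : V then s m P else {}) : Units (SA V)"
  using assms(1) by (auto simp: germ_unit_def)
 then obtain r where r: "r : sects V"
  "(%m P. if P : V then s m P else {}) **.(SA V) r = cst V \<one>"
  by (auto simp: Units_def)
 have P: "P : X" "P : U" using V open_sub by auto
 note at = section_mem[OF assms(2) P(2,1) assms(3)]
 obtain b u where bu: "b <: C" "u : carrier C - P" "r 1 P = frac 1 P b u"
  by (rule section_frac[OF r(1) V(2) P(1)])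
 have "frac 1 P (a ** b) (t ** u) = ((%m P. if P : V then s m P else {}) **.(SA V) r) 1 P"
  using at bu P V(2) by (intro sec_mult_at(1)[symmetric]) auto
 also have "... = frac 1 P \<one> \<one>" using V by (simp only: r(2) spf_const_at)
 finally have "frel 1 P (a ** b) (t ** u) \<one> \<one>"
  using at bu P pt_one' pt_mult_notin by (subst (asm) frac_eq_iff) auto
 then obtain v where v: "v : carrier C - P" "v ** (\<one> ** (a ** b) \<ominus> (t ** u) ** \<one>) : pideal 1"
  by (auto simp: frel_def)
 let ?d = "v ** (\<one> ** (a ** b) \<ominus> (t ** u) ** \<one>)"
 have d: "?d : P" using pt_pideal[OF P(1)] v by blast
 have "(v ** b) ** a : P" by (rule idealD(4)[OF pt_ideal[OF P(1)] aP]) (use v bu in auto)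
 hence "(v ** b) ** a ++ \<ominus> ?d : P" by (intro idealD(3,5)[OF pt_ideal[OF P(1)]] d)
 also have "(v ** b) ** a ++ \<ominus> ?d = v ** (t ** u)"
  using DiffD1[OF v(1)] at(2) bu(1) DiffD1[OF at(3)] DiffD1[OF bu(2)] by algebra
 finally show False using v at bu P by (auto simp: pt_mult_iff)
qed

text \<open>Modulo \<pi> the section is \<open>b / f\<close> near \<open>P\<close>, with
  \<open>b\<close> outside \<open>P\<close>. Points contain \<pi>, so on
  \<open>basic (f ** b)\<close> the numerators at all positive levels avoid the points, and
  exchanging numerators and denominators gives the inverse.\<close>

lemma germ_unitI:
 assumes "opn U" "s : sects U" "P : U" "(a, t) : s 1 P" "a ~: P"
 shows "germ_unit (Spf K C) U P s"
proof -
 have PX: "P : X" using assms(1,3) open_sub by auto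
 note at = section_mem[OF assms(2,3) PX assms(4)]
 obtain f b where f: "f <: C" "P : basic f" "basic f <= U" "b <: C"
  "!!Q. Q : basic f ==> s 1 Q = frac 1 Q b f"
  by (rule section_local[OF assms(2,3), where m = 1]) (rule that)
 define V where "V = basic (f ** b)"
 have Vf: "V <= basic f" and VX: "V <= X" unfolding V_def using f by (auto simp: basic_mult)
 have oV: "opn V" unfolding V_def using f by (intro open_basic) auto
 have "b ~: P"
 proof
  assume bP: "b : P"
  have "frel 1 P b f a t"
  using f(5)[OF f(2)] at f PX by (subst (asm) at(1), subst (asm) eq_commute, subst (asm) frac_eq_iff) auto
  then obtain v where v: "v : carrier C - P" "v ** (t ** b \<ominus> f ** a) : pideal 1" by (auto simp: frel_def)
  have d: "v ** (t ** b \<ominus> f ** a) : P" using pt_pideal[OF PX] v by blast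
  have "(v ** t) ** b : P" by (rule idealD(4)[OF pt_ideal[OF PX] bP]) (use v at in auto)
  hence "(v ** t) ** b ++ \<ominus> (v ** (t ** b \<ominus> f ** a)) : P" by (intro idealD(3,5)[OF pt_ideal[OF PX]] d)
  also have "(v ** t) ** b ++ \<ominus> (v ** (t ** b \<ominus> f ** a)) = v ** (f ** a)"
  using DiffD1[OF v(1)] at(2) f(1,4) DiffD1[OF at(3)] by algebra
  finally show False using v at f PX assms(5) by (auto simp: pt_mult_iff)
 qed
 hence PV: "P : V" unfolding V_def using f by (auto simp: pt_mult_iff)
 have num: "c ~: Q" if Q: "Q : V" and cu: "(c, u) : s (Suc m) Q" for c u m Q
 proof
  assume cQ: "c : Q"
  have QX: "Q : X" "Q : U" "Q : basic f" using Q VX Vf f(3) by auto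
  note cu' = section_mem[OF assms(2) QX(2,1) cu]
  have "(c, u) : frac 1 Q b f" using sectionD(2)[OF assms(2) _ QX(2), of 1 "Suc m"] cu f(5)[OF QX(3)] by auto
  then obtain v where v: "v : carrier C - Q" "v ** (u ** b \<ominus> f ** c) : pideal 1" by (auto simp: frac_mem frel_def)
  have d: "v ** (u ** b \<ominus> f ** c) : Q" using pt_pideal[OF QX(1)] v by blast
  have "(v ** f) ** c : Q" by (rule idealD(4)[OF pt_ideal[OF QX(1)] cQ]) (use v f in auto)
  hence "(v ** f) ** c ++ v ** (u ** b \<ominus> f ** c) : Q" by (intro idealD(3,5)[OF pt_ideal[OF QX(1)]] d)
  also have "(v ** f) ** c ++ v ** (u ** b \<ominus> f ** c) = v ** (u ** b)"
  using DiffD1[OF v(1)] cu'(2) f(1,4) DiffD1[OF cu'(3)] by algebra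
  finally show False using v cu' f QX Q by (auto simp: pt_mult_iff V_def)
 qed
 \<comment> \<open>Level \<open>m\<close> of the inverse is read off level \<open>m + 1\<close> of
   \<open>s\<close>: at level 0 all fractions coincide, so a numerator there carries no
   information.\<close>
 define r where "r = (%m Q. if Q : V then (\<Union>(c, u)\<in>s (Suc m) Q. frac m Q u c) else {})"
 have rat: "r m Q = frac m Q u c" if Q: "Q : V" and cu: "(c, u) : s (Suc m) Q" for m Q c u
 proof -
  have QX: "Q : X" "Q : U" using Q VX Vf f(3) by auto
  note cu' = section_mem[OF assms(2) QX(2,1) cu]
  have "frac m Q u' c' = frac m Q u c" if cu2: "(c', u') : s (Suc m) Q" for c' u'
  proof -
  note cu2' = section_mem[OF assms(2) QX(2,1) cu2]
  have "frel (Suc m) Q c' u' c u"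
  using frac_eq_iff[OF QX(1) cu2'(2,3) cu'(2,3), of "Suc m"] cu'(1) cu2'(1) by simp
  hence "frel m Q c' u' c u" by (rule frel_mono) simp
  then obtain v where v: "v : carrier C - Q" "v ** (u ** c' \<ominus> u' ** c) : pideal m" by (auto simp: frel_def)
  have "v ** (c ** u' \<ominus> c' ** u) = \<ominus> (v ** (u ** c' \<ominus> u' ** c))"
  using DiffD1[OF v(1)] cu'(2) cu2'(2) DiffD1[OF cu'(3)] DiffD1[OF cu2'(3)] by algebra
  hence "frel m Q u' c' u c" unfolding frel_def using v pideal_uminus by (intro bexI[of _ v]) auto
  thus ?thesis
  using num[OF Q cu] num[OF Q cu2] cu' cu2' QX by (subst frac_eq_iff) auto
  qed
  hence "(case z of (c', u') => frac m Q u' c') = frac m Q u c" if "z : s (Suc m) Q" for z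
  using that by (cases z) simp
  hence "(\<Union>(c', u')\<in>s (Suc m) Q. frac m Q u' c') = (\<Union>_\<in>s (Suc m) Q. frac m Q u c)"
  by (rule SUP_cong[OF refl])
  thus ?thesis using Q cu by (auto simp: r_def)
 qed
 have rs: "r : sects V"
 proof (rule sectionI)
  fix m Q assume Q: "Q : V"
  have QX: "Q : X" "Q : U" using Q VX Vf f(3) by auto
  obtain c u where cu: "(c, u) : s (Suc (Suc m)) Q" by (rule section_ex_mem[OF assms(2) QX(2,1)])
  hence "(c, u) : s (Suc m) Q" using sectionD(2)[OF assms(2) _ QX(2), of "Suc m" "Suc (Suc m)"] by auto
  thus "r (Suc m) Q <= r m Q" using rat[OF Q] cu frac_mono[of m "Suc m"] by auto
  obtain k c where k: "k <: C" "Q : basic k" "basic k <= U" "c <: C"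
  "!!Q. Q : basic k ==> s (Suc m) Q = frac (Suc m) Q c k"
  by (rule section_local[OF assms(2) QX(2), where m = "Suc m"]) (rule that)
  have "c ~: Q' & r m Q' = frac m Q' k c" if "Q' : basic k \<inter> V" for Q'
  proof -
  have "(c, k) : s (Suc m) Q'" using k(5)[of Q'] that frac_self[of Q' c k "Suc m"] k(1,4) by auto
  thus ?thesis using num[of Q' c k m] rat[of Q' c k m] that by blast
  qed
  thus "EX W a t. opn W & Q : W & W <= V & a <: C & t <: C &
  (ALL Q:W. t ~: Q & r m Q = frac m Q a t)"
  by (intro local_fracI[OF openin_Int[OF open_basic[OF k(1)] oV] _ _ k(1,4)])
  (use k(2) Q in simp_all)
 qed (simp add: r_def)
 let ?s = "%m P. if P : V then s m P else {}"
 have 1: "?s **.(SA V) r = cst V \<one>" "r **.(SA V) ?s = cst V \<one>"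
 proof -
  have *: "(?s **.(SA V) r) m Q = cst V \<one> m Q"
  "(r **.(SA V) ?s) m Q = cst V \<one> m Q" if Q: "Q : V" for m Q
  proof -
  have QX: "Q : X" "Q : U" using Q VX Vf f(3) by auto
  obtain c u where cu: "(c, u) : s (Suc m) Q" by (rule section_ex_mem[OF assms(2) QX(2,1)])
  hence cu2: "(c, u) : s m Q" using sectionD(2)[OF assms(2) _ QX(2), of m "Suc m"] by auto
  note cu' = section_mem[OF assms(2) QX(2,1) cu2]
  have cQ: "c : carrier C - Q" using num[OF Q cu] cu' by simp
  have sQ: "?s m Q = frac m Q c u" using Q cu'(1) by simp
  have "(?s **.(SA V) r) m Q = frac m Q (c ** u) (u ** c)"
  by (rule sec_mult_at(1)[where s = ?s and s' = r and m = m, OF QX(1) cu'(2,3) _ cQ sQ rat[OF Q cu]]) (use cu' in auto)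
  also have "... = frac m Q \<one> \<one>"
  using QX cu' cQ pt_one' pt_mult_notin by (intro frac_eqI) (auto simp: m_ac)
  finally show "(?s **.(SA V) r) m Q = cst V \<one> m Q" using Q by (simp add: spf_const_at)
  have "(r **.(SA V) ?s) m Q = frac m Q (u ** c) (c ** u)"
  by (rule sec_mult_at(1)[where s = r and s' = ?s and m = m, OF QX(1) _ cQ cu'(2,3) rat[OF Q cu] sQ]) (use cu' in auto)
  also have "... = frac m Q \<one> \<one>"
  using QX cu' cQ pt_one' pt_mult_notin by (intro frac_eqI) (auto simp: m_ac)
  finally show "(r **.(SA V) ?s) m Q = cst V \<one> m Q" using Q by (simp add: spf_const_at)
  qed
  show "?s **.(SA V) r = cst V \<one>"
  by (rule section_eqI[of V]) (use * in "simp_all add: sec_mult_out spf_const_out")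
  show "r **.(SA V) ?s = cst V \<one>"
  by (rule section_eqI[of V]) (use * in "simp_all add: sec_mult_out spf_const_out r_def")
 qed
 have "?s : sects V"
  by (rule section_res[OF assms(2) oV]) (use Vf f(3) in auto)
 hence "?s : Units (SA V)" using 1 rs by (auto simp: Units_def)
 thus ?thesis unfolding germ_unit_def using oV PV Vf f(3) by (intro exI[of _ V]) auto
qed

end

section \<open>Morphisms into an affine open subset\<close>

subsection \<open>Composition of morphisms\<close>

lemma MorD:
 assumes "f : Mor X Y"
 shows "pts f : extensional (topspace (tp X))" "continuous_map (tp X) (tp Y) (pts f)"
  "pull f : extensional {V. openin (tp Y) V}"
  "!!V. openin (tp Y) V ==> pull f V : alg_hom (sec Y V) (sec X (pre f X V))"
  "!!V W s. openin (tp Y) V ==> openin (tp Y) W ==> W <= V ==> s <: sec Y V ==>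
  pull f W (res Y V W s) = res X (pre f X V) (pre f X W) (pull f V s)"
  "!!x V s. x : topspace (tp X) ==> openin (tp Y) V ==> pts f x : V ==> s <: sec Y V ==>
  germ_unit X (pre f X V) x (pull f V s) ==> germ_unit Y V (pts f x) s"
 using assms unfolding Mor_def by simp_all

lemma MorI:
 assumes "pts f : extensional (topspace (tp X))" "continuous_map (tp X) (tp Y) (pts f)"
  "pull f : extensional {V. openin (tp Y) V}"
  "!!V. openin (tp Y) V ==> pull f V : alg_hom (sec Y V) (sec X (pre f X V))"
  "!!V W s. openin (tp Y) V ==> openin (tp Y) W ==> W <= V ==> s <: sec Y V ==>
  pull f W (res Y V W s) = res X (pre f X V) (pre f X W) (pull f V s)"
  "!!x V s. x : topspace (tp X) ==> openin (tp Y) V ==> pts f x : V ==> s <: sec Y V ==>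
  germ_unit X (pre f X V) x (pull f V s) ==> germ_unit Y V (pts f x) s"
 shows "f : Mor X Y"
 using assms unfolding Mor_def by simp

text \<open>The part of the axioms of a sheaf of algebras that is needed to compose morphisms.\<close>

definition ops_closed :: "('r, 'b) ralg => bool" where
 "ops_closed B <-> \<one>.B <: B & (ALL r. alg B r <: B) &
  (ALL x:carrier B. ALL y:carrier B. x **.B y <: B & x ++.B y <: B)"

definition presheaf :: "('p, 'r, 's) rspace => bool" where
 "presheaf X <-> (ALL V. openin (tp X) V --> ops_closed (sec X V)) &
  (ALL V W s. openin (tp X) V --> openin (tp X) W --> W <= V --> s <: sec X V -->
  res X V W s <: sec X W)"

lemma restrict_alg_hom_closed:
 assumes "ops_closed B" "is_alg_hom B C h" shows "restrict h (carrier B) : alg_hom B C"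
proof -
 have "is_alg_hom B C (restrict h (carrier B))"
  by (rule homI) (use assms homD[OF assms(2)] in "simp_all add: ops_closed_def")
 thus ?thesis by (simp add: alg_hom_def)
qed

lemma ralgebra_ops_closed: "ralgebra B ==> ops_closed B"
proof -
 assume "ralgebra B"
 then interpret r_algebra B by (rule ralgebraD)
 show ?thesis by (simp add: ops_closed_def)
qed

lemma ringedD:
 assumes "ringed X"
 shows "openin (tp X) U ==> ralgebra (sec X U)"
  "openin (tp X) U ==> openin (tp X) V ==> V <= U ==> is_alg_hom (sec X U) (sec X V) (res X U V)"
  "openin (tp X) U ==> s <: sec X U ==> res X U U s = s"
  "openin (tp X) U ==> openin (tp X) V ==> openin (tp X) W ==> W <= V ==> V <= U ==>
  s <: sec X U ==> res X V W (res X U V s) = res X U W s"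
 using assms unfolding ringed_def by simp_all

lemma ringed_presheaf: "ringed X ==> presheaf X"
 unfolding presheaf_def by (simp add: ralgebra_ops_closed ringedD(1) homD(2)[OF ringedD(2)])

lemma restr_sel [simp]: "tp (restr X U) = subtopology (tp X) U" "sec (restr X U) = sec X" "res (restr X U) = res X"
 by (simp_all add: restr_def)

lemma openin_restr: "openin (tp X) U ==> openin (subtopology (tp X) U) V <-> openin (tp X) V & V <= U"
 by (rule openin_open_subtopology)

lemma restr_presheaf: "presheaf X ==> openin (tp X) U ==> presheaf (restr X U)"
 unfolding presheaf_def by (simp add: openin_restr)

context spf_algebra begin

text \<open>On a common neighbourhood \<open>basic (f ** g)\<close> sum and product are fractions
  with denominator \<open>f ** g\<close>.\<close>

lemma sec_ops_closed:
 assumes "opn U" shows "ops_closed (SA U)"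
proof -
 have "s **.(SA U) s' : sects U & s ++.(SA U) s' : sects U"
  if s: "s : sects U" and s': "s' : sects U" for s s'
 proof -
  have loc: "EX f:carrier C. EX a:carrier C. EX b:carrier C. P : basic f & basic f <= U &
  (ALL Q:basic f. (s **.(SA U) s') m Q = frac m Q a f & (s ++.(SA U) s') m Q = frac m Q b f)"
  if P: "P : U" for m P
  proof -
  obtain f a where f: "f <: C" "P : basic f" "basic f <= U" "a <: C"
  "!!Q. Q : basic f ==> s m Q = frac m Q a f"
  by (rule section_local[OF s P, where m = m]) (rule that)
  obtain g b where g: "g <: C" "P : basic g" "basic g <= U" "b <: C"
  "!!Q. Q : basic g ==> s' m Q = frac m Q b g"
  by (rule section_local[OF s' P, where m = m]) (rule that)
  have fg: "basic (f ** g) = basic f \<inter> basic g" by (rule basic_mult[OF f(1) g(1)])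
  show ?thesis
  proof (rule bexI[of _ "f ** g"], rule bexI[of _ "a ** b"], rule bexI[of _ "g ** a ++ f ** b"], intro conjI ballI)
  show "P : basic (f ** g)" "basic (f ** g) <= U" unfolding fg using f(2,3) g(2,3) by auto
  fix Q assume "Q : basic (f ** g)"
  hence Q: "Q : basic f" "Q : basic g" "Q : X" unfolding fg by auto
  show "(s **.(SA U) s') m Q = frac m Q (a ** b) (f ** g)"
  "(s ++.(SA U) s') m Q = frac m Q (g ** a ++ f ** b) (f ** g)"
  by (rule sec_mult_at[where s = s and s' = s' and m = m and U = U, OF Q(3) f(4) _ g(4) _ f(5)[OF Q(1)] g(5)[OF Q(2)]];
  use Q f g in simp)+
  qed (use f g in simp_all)
  qed
  have low: "!!m P. P : U ==> (s **.(SA U) s') (Suc m) P <= (s **.(SA U) s') m P"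
  "!!m P. P : U ==> (s ++.(SA U) s') (Suc m) P <= (s ++.(SA U) s') m P"
  proof -
  fix m P assume P: "P : U"
  have PX: "P : X" using P open_sub[OF assms] by auto
  obtain a t where a: "a <: C" "t : carrier C - P" "s (Suc m) P = frac (Suc m) P a t"
  by (rule section_frac[OF s P PX])
  obtain b u where b: "b <: C" "u : carrier C - P" "s' (Suc m) P = frac (Suc m) P b u"
  by (rule section_frac[OF s' P PX])
  have a': "s m P = frac m P a t" by (rule section_level[OF s P PX _ a(3,1,2)]) simp
  have b': "s' m P = frac m P b u" by (rule section_level[OF s' P PX _ b(3,1,2)]) simp
  note 1 = sec_mult_at[where s = s and s' = s' and m = "Suc m" and U = U, OF PX a(1,2) b(1,2) a(3) b(3)]
  note 2 = sec_mult_at[where s = s and s' = s' and m = m and U = U, OF PX a(1,2) b(1,2) a' b']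
  show "(s **.(SA U) s') (Suc m) P <= (s **.(SA U) s') m P"
  unfolding 1(1) 2(1) by (rule frac_mono) simp
  show "(s ++.(SA U) s') (Suc m) P <= (s ++.(SA U) s') m P"
  unfolding 1(2) 2(2) by (rule frac_mono) simp
  qed
  have out: "!!m P. P ~: U ==> s m P = {}" by (rule sectionD(1)[OF s])
  show ?thesis
  proof (intro conjI sectionI)
  fix m P assume P: "P : U"
  obtain f a b where f: "f <: C" "a <: C" "b <: C" "P : basic f" "basic f <= U"
  and eq: "ALL Q:basic f. (s **.(SA U) s') m Q = frac m Q a f & (s ++.(SA U) s') m Q = frac m Q b f"
  using loc[OF P, of m] by (elim bexE conjE)
  show "EX V a t. opn V & P : V & V <= U & a <: C & t <: C &
  (ALL Q:V. t ~: Q & (s **.(SA U) s') m Q = frac m Q a t)"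
  by (rule local_fracI[OF open_basic[OF f(1)] f(4,5,2,1)]) (use eq in simp_all)
  show "EX V a t. opn V & P : V & V <= U & a <: C & t <: C &
  (ALL Q:V. t ~: Q & (s ++.(SA U) s') m Q = frac m Q a t)"
  by (rule local_fracI[OF open_basic[OF f(1)] f(4,5,3,1)]) (use eq in simp_all)
  qed (use low out in "simp_all add: sec_mult_out")
 qed
 thus ?thesis using spf_const_section[OF assms] by (simp add: ops_closed_def)
qed

lemma Spf_presheaf: "presheaf (Spf K C)"
 unfolding presheaf_def using sec_ops_closed section_res by simp

end

lemma Mor_pts: "f : Mor X Y ==> x : topspace (tp X) ==> pts f x : topspace (tp Y)"
 using continuous_map_image_subset_topspace[OF MorD(2)] by fastforce

lemma Mor_pre_open: "f : Mor X Y ==> openin (tp Y) V ==> openin (tp X) (pre f X V)"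
 unfolding pre_def by (rule openin_continuous_map_preimage[OF MorD(2)])

lemma Mor_pull: "f : Mor X Y ==> openin (tp Y) V ==> s <: sec Y V ==>
  pull f V s <: sec X (pre f X V)"
 by (rule ahD(2)[OF MorD(4)])

lemma comp_mor_sel:
 "x : topspace (tp X) ==> pts (comp_mor X Y Z g f) x = pts g (pts f x)"
 "openin (tp Z) V ==> s <: sec Z V ==> pull (comp_mor X Y Z g f) V s = pull f (pre g Y V) (pull g V s)"
 by (simp_all add: comp_mor_def)

lemma pre_comp:
 assumes "f : Mor X Y" shows "pre (comp_mor X Y Z g f) X V = pre f X (pre g Y V)"
 using Mor_pts[OF assms] by (auto simp: pre_def comp_mor_sel)

lemma pre_mono: "W <= V ==> pre f X W <= pre f X V"
 by (auto simp: pre_def)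

lemma comp_mor_Mor:
 assumes f: "f : Mor X Y" and g: "g : Mor Y Z" and Z: "presheaf Z"
 shows "comp_mor X Y Z g f : Mor X Z"
proof (rule MorI)
 show "pts (comp_mor X Y Z g f) : extensional (topspace (tp X))"
  "pull (comp_mor X Y Z g f) : extensional {V. openin (tp Z) V}"
  by (simp_all add: comp_mor_def)
 have "continuous_map (tp X) (tp Z) (pts g \<circ> pts f)"
  by (rule continuous_map_compose[OF MorD(2)[OF f] MorD(2)[OF g]])
 thus "continuous_map (tp X) (tp Z) (pts (comp_mor X Y Z g f))"
  by (rule continuous_map_eq) (simp add: comp_mor_sel)
next
 fix V assume V: "openin (tp Z) V"
 have h: "is_alg_hom (sec Z V) (sec X (pre f X (pre g Y V))) (%s. pull f (pre g Y V) (pull g V s))"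
  by (rule hom_comp[OF alg_homD[OF MorD(4)[OF g V]] alg_homD[OF MorD(4)[OF f Mor_pre_open[OF g V]]]])
 have "pull (comp_mor X Y Z g f) V = restrict (%s. pull f (pre g Y V) (pull g V s)) (carrier (sec Z V))"
  using V by (simp add: comp_mor_def)
 moreover have "restrict (%s. pull f (pre g Y V) (pull g V s)) (carrier (sec Z V)) : alg_hom (sec Z V) (sec X (pre f X (pre g Y V)))"
  by (rule restrict_alg_hom_closed[OF _ h]) (use Z V in "simp add: presheaf_def")
 ultimately show "pull (comp_mor X Y Z g f) V : alg_hom (sec Z V) (sec X (pre (comp_mor X Y Z g f) X V))"
  by (simp add: pre_comp[OF f])
next
 fix V W s assume V: "openin (tp Z) V" "openin (tp Z) W" "W <= V" "s <: sec Z V"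
 show "pull (comp_mor X Y Z g f) W (res Z V W s) =
  res X (pre (comp_mor X Y Z g f) X V) (pre (comp_mor X Y Z g f) X W) (pull (comp_mor X Y Z g f) V s)"
 proof -
  have "res Z V W s <: sec Z W" using V Z by (simp add: presheaf_def)
  hence "pull (comp_mor X Y Z g f) W (res Z V W s) = pull f (pre g Y W) (pull g W (res Z V W s))"
  by (rule comp_mor_sel(2)[OF V(2)])
  also have "pull g W (res Z V W s) = res Y (pre g Y V) (pre g Y W) (pull g V s)" by (rule MorD(5)[OF g V])
  also have "pull f (pre g Y W) ... = res X (pre f X (pre g Y V)) (pre f X (pre g Y W)) (pull f (pre g Y V) (pull g V s))"
  by (rule MorD(5)[OF f Mor_pre_open[OF g V(1)] Mor_pre_open[OF g V(2)] pre_mono[OF V(3)] Mor_pull[OF g V(1,4)]])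
  finally show ?thesis using V by (simp add: pre_comp[OF f] comp_mor_sel)
 qed
next
 fix x V s assume *: "x : topspace (tp X)" "openin (tp Z) V" "pts (comp_mor X Y Z g f) x : V"
  "s <: sec Z V" "germ_unit X (pre (comp_mor X Y Z g f) X V) x (pull (comp_mor X Y Z g f) V s)"
 hence 1: "germ_unit X (pre f X (pre g Y V)) x (pull f (pre g Y V) (pull g V s))" "pts g (pts f x) : V"
  by (simp_all add: comp_mor_sel pre_comp[OF f])
 have fx: "pts f x : topspace (tp Y)" by (rule Mor_pts[OF f *(1)])
 have "germ_unit Y (pre g Y V) (pts f x) (pull g V s)"
  by (rule MorD(6)[OF f *(1) Mor_pre_open[OF g *(2)] _ Mor_pull[OF g *(2,4)] 1(1)])
  (use fx 1 in "simp add: pre_def")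
 hence "germ_unit Z V (pts g (pts f x)) s" by (rule MorD(6)[OF g fx *(2) 1(2) *(4)])
 thus "germ_unit Z V (pts (comp_mor X Y Z g f) x) s" using * by (simp add: comp_mor_sel)
qed

lemma mor_eqI:
 assumes f: "f : Mor X Y" and g: "g : Mor X Y"
  and "!!x. x : topspace (tp X) ==> pts f x = pts g x"
  and "!!V s. openin (tp Y) V ==> s <: sec Y V ==> pull f V s = pull g V s"
 shows "f = g"
proof -
 have "pts f = pts g" by (rule extensionalityI[OF MorD(1)[OF f] MorD(1)[OF g] assms(3)])
 moreover have "pull f = pull g"
 proof (rule extensionalityI[OF MorD(3)[OF f] MorD(3)[OF g]])
  fix V assume "V : {V. openin (tp Y) V}"
  hence V: "openin (tp Y) V" by simp
  show "pull f V = pull g V" by (rule alg_hom_eqI[OF MorD(4)[OF f V] MorD(4)[OF g V] assms(4)[OF V]])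
 qed
 ultimately show ?thesis by simp
qed

lemma comp_mor_assoc:
 assumes f: "f : Mor X Y" and g: "g : Mor Y Z" and h: "h : Mor Z T" and pr: "presheaf Z" "presheaf T"
 shows "comp_mor X Z T h (comp_mor X Y Z g f) = comp_mor X Y T (comp_mor Y Z T h g) f"
proof (rule mor_eqI[of _ X T])
 show "comp_mor X Z T h (comp_mor X Y Z g f) : Mor X T" "comp_mor X Y T (comp_mor Y Z T h g) f : Mor X T"
  using assms by (simp_all add: comp_mor_Mor)
 show "pts (comp_mor X Z T h (comp_mor X Y Z g f)) x = pts (comp_mor X Y T (comp_mor Y Z T h g) f) x"
  if "x : topspace (tp X)" for x
  using that Mor_pts[OF f that] by (simp add: comp_mor_sel)
 fix V s assume V: "openin (tp T) V" "s <: sec T V"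
 show "pull (comp_mor X Z T h (comp_mor X Y Z g f)) V s = pull (comp_mor X Y T (comp_mor Y Z T h g) f) V s"
  using V Mor_pre_open[OF h V(1)] Mor_pull[OF h V] by (simp add: comp_mor_sel pre_comp[OF g])
qed

lemma comp_mor_id_left:
 assumes f: "f : Mor X Y" and pr: "presheaf Y"
 shows "comp_mor X Y Y (id_mor Y) f = f"
proof -
 have pr': "pre (id_mor Y) Y V = V" if "openin (tp Y) V" for V
  using openin_subset[OF that] by (auto simp: pre_def id_mor_def)
 have idm: "x : topspace (tp Y) ==> pts (id_mor Y) x = x"
  "openin (tp Y) V ==> s <: sec Y V ==> pull (id_mor Y) V s = s" for x V s
  by (simp_all add: id_mor_def)
 have id: "id_mor Y : Mor Y Y"
 proof (rule MorI)
  show "continuous_map (tp Y) (tp Y) (pts (id_mor Y))"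
  by (rule continuous_map_eq[OF continuous_map_id]) (simp add: id_mor_def)
  show "pull (id_mor Y) V : alg_hom (sec Y V) (sec Y (pre (id_mor Y) Y V))" if V: "openin (tp Y) V" for V
  unfolding pr'[OF V] using pr V restrict_alg_hom_closed[OF _ is_alg_hom_id, of "sec Y V"]
  by (simp add: presheaf_def id_mor_def)
  show "pull (id_mor Y) W (res Y V W s) =
  res Y (pre (id_mor Y) Y V) (pre (id_mor Y) Y W) (pull (id_mor Y) V s)"
  if "openin (tp Y) V" "openin (tp Y) W" "W <= V" "s <: sec Y V" for V W s
  using that pr by (simp add: pr' idm presheaf_def)
  show "germ_unit Y V (pts (id_mor Y) x) s"
  if "x : topspace (tp Y)" "openin (tp Y) V" "pts (id_mor Y) x : V" "s <: sec Y V"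
  "germ_unit Y (pre (id_mor Y) Y V) x (pull (id_mor Y) V s)" for x V s
  using that by (simp add: pr' idm)
 qed (simp_all add: id_mor_def)
 show ?thesis
 proof (rule mor_eqI[OF comp_mor_Mor[OF f id pr] f])
  show "pts (comp_mor X Y Y (id_mor Y) f) x = pts f x" if "x : topspace (tp X)" for x
  using that Mor_pts[OF f that] by (simp add: comp_mor_sel idm)
  show "pull (comp_mor X Y Y (id_mor Y) f) V s = pull f V s" if V: "openin (tp Y) V" "s <: sec Y V" for V s
  using V by (simp add: comp_mor_sel pr' idm)
 qed
qed

subsection \<open>Morphisms between formal spectra\<close>

lemma spf_algebraI: "ralgebra C ==> spf_algebra C"
 by (simp add: spf_algebra_def r_algebra_iff)

lemma (in spf_algebra) spf_const_res:
 assumes "W <= U"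
 shows "(%m P. if P : W then cst U c m P else {}) = cst W c"
proof (intro ext)
 fix m P show "(if P : W then cst U c m P else {}) = cst W c m P"
  using assms by (cases "P : W") (auto simp: spf_const_at spf_const_out)
qed

locale spf_pair = C: spf_algebra C K + D: spf_algebra D K
 for C :: "('r::comm_ring_1, 'c) ralg" and D :: "('r, 'd) ralg" and K :: "'r base" +
 fixes h :: "'c => 'd"
 assumes hom: "is_alg_hom C D h"
begin

abbreviation (input) inv_pt :: "'d set => 'c set" where "inv_pt Q \<equiv> {c : carrier C. h c : Q}"

lemma ralg: "ralgebra C" "ralgebra D"
 using C.r_algebra_axioms D.r_algebra_axioms by (simp_all add: r_algebra_iff)

lemmas hom_simps = homD(2-6)[OF hom] hom_more[OF ralg hom]

lemma inv_pt: assumes "Q : D.X" shows "inv_pt Q : C.X"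
proof -
 have "primeideal (inv_pt Q) C"
 proof (rule primeidealI)
  show "ideal (inv_pt Q) C"
  by (rule idealI_cring)
  (use D.pt_zero[OF assms] D.pt_add[OF assms] idealD(4)[OF D.pt_ideal[OF assms]] in
  \<open>auto simp: hom_simps C.is_cring\<close>)
  have "\<one>.C ~: inv_pt Q" using D.pt_one[OF assms] by (simp add: hom_simps)
  thus "carrier C ~= inv_pt Q" using C.one_closed by blast
  show "a : inv_pt Q \<or> b : inv_pt Q"
  if "a <: C" "b <: C" "a **.C b : inv_pt Q" for a b
  using that D.pt_mult_iff[OF assms, of "h a" "h b"] by (simp add: hom_simps)
 qed (rule C.is_cring)
 moreover have "alg D (unif K) : Q" using assms by (simp add: spf_pts_def)
 ultimately show ?thesis by (simp add: spf_pts_def hom_simps)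
qed

lemma notin_inv_pt: "t : carrier C - inv_pt Q ==> h t : carrier D - Q"
 by (auto simp: hom_simps)

lemma frel_push:
 assumes "C.frel m (inv_pt Q) a t b u" "a <: C" "t <: C" "b <: C" "u <: C"
 shows "D.frel m Q (h a) (h t) (h b) (h u)"
proof -
 obtain v where v: "v : carrier C - inv_pt Q" "v **.C (u **.C a \<ominus>.C t **.C b) : C.pideal m"
  using assms(1) unfolding C.frel_def by (rule bexE)
 have "h (v **.C (u **.C a \<ominus>.C t **.C b)) : D.pideal m"
  by (rule hom_pow_ideal[OF ralg(1) hom v(2)])
 thus ?thesis unfolding D.frel_def
  using assms(2-) notin_inv_pt[OF v(1)] v(1) by (intro bexI[of _ "h v"]) (simp_all add: hom_simps)
qed

lemma frac_push:
 assumes Q: "Q : D.X" and s: "S = C.frac m (inv_pt Q) a t" and at: "a <: C" "t : carrier C - inv_pt Q"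
 shows "(\<Union>(a, t)\<in>S. D.frac m Q (h a) (h t)) = D.frac m Q (h a) (h t)"
proof -
 have "D.frac m Q (h b) (h u) = D.frac m Q (h a) (h t)" if "(b, u) : S" for b u
 proof -
  have bu: "b <: C" "u : carrier C - inv_pt Q" "C.frel m (inv_pt Q) a t b u"
  using that unfolding s by (simp_all add: C.frac_mem)
  have "D.frel m Q (h a) (h t) (h b) (h u)"
  by (rule frel_push[OF bu(3)]) (use at bu in simp_all)
  thus ?thesis
  using D.frac_eq_iff[OF Q _ notin_inv_pt[OF at(2)] _ notin_inv_pt[OF bu(2)], of "h a" "h b" m] at bu
  by (simp add: hom_simps)
 qed
 hence "(case z of (b, u) => D.frac m Q (h b) (h u)) = D.frac m Q (h a) (h t)" if "z : S" for z
  using that by (cases z) simp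
 hence "(\<Union>(a, t)\<in>S. D.frac m Q (h a) (h t)) = (\<Union>_\<in>S. D.frac m Q (h a) (h t))"
  by (rule SUP_cong[OF refl])
 moreover have "(a, t) : S" unfolding s by (rule C.frac_self[OF inv_pt[OF Q] at])
 ultimately show ?thesis by auto
qed

lemma Spf_map_pts: "Q : D.X ==> pts (Spf_map K C D h) Q = inv_pt Q"
 by (simp add: Spf_map_def Let_def)

lemma Spf_map_pull:
 assumes U: "C.opn U" and s: "s : C.sects U" and Q: "Q : D.X" "inv_pt Q : U"
  and at: "(a, t) : s m (inv_pt Q)"
 shows "pull (Spf_map K C D h) U s m Q = D.frac m Q (h a) (h t)"
proof -
 note at' = C.section_mem[OF s Q(2) inv_pt[OF Q(1)] at]
 have "pull (Spf_map K C D h) U s m Q = (\<Union>(a, t)\<in>s m (inv_pt Q). D.frac m Q (h a) (h t))"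
  using U s Q by (simp add: Spf_map_def Let_def)
 thus ?thesis using frac_push[OF Q(1) at'] by simp
qed

lemma Spf_map_pull_out:
 assumes "C.opn U" "s : C.sects U" "\<not> (Q : D.X & inv_pt Q : U)"
 shows "pull (Spf_map K C D h) U s m Q = {}"
 using assms by (auto simp: Spf_map_def Let_def)

lemma Spf_map_pre: "pre (Spf_map K C D h) (Spf K D) U = {Q : D.X. inv_pt Q : U}"
 by (auto simp: pre_def Spf_map_pts)

lemma Spf_map_pre_X: "pre (Spf_map K C D h) (Spf K D) C.X = D.X"
 using inv_pt by (auto simp: Spf_map_pre)

lemma Spf_map_pull_const:
 assumes U: "C.opn U" and c: "c <: C"
 shows "pull (Spf_map K C D h) U (C.cst U c) = D.cst {Q : D.X. inv_pt Q : U} (h c)"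
proof (intro ext)
 fix m Q
 have s: "C.cst U c : C.sects U" by (rule C.spf_const_section[OF U c])
 show "pull (Spf_map K C D h) U (C.cst U c) m Q = D.cst {Q : D.X. inv_pt Q : U} (h c) m Q"
 proof (cases "Q : D.X & inv_pt Q : U")
  case True
  hence Q: "Q : D.X" "inv_pt Q : U" by auto
  have "(c, \<one>.C) : C.cst U c m (inv_pt Q)"
  unfolding C.spf_const_at[OF Q(2)] by (rule C.frac_self[OF inv_pt[OF Q(1)] c C.pt_one'[OF inv_pt[OF Q(1)]]])
  from Spf_map_pull[OF U s Q this] show ?thesis using True by (simp add: spf_const_def hom_simps)
 next
  case False
  hence "Q ~: {Q : D.X. inv_pt Q : U}" by simp
  thus ?thesis unfolding D.spf_const_out[OF \<open>Q ~: _\<close>] by (intro Spf_map_pull_out[OF U s False])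
 qed
qed

lemma Spf_map_section:
 assumes U: "C.opn U" and s: "s : C.sects U"
 shows "pull (Spf_map K C D h) U s : D.sects {Q : D.X. inv_pt Q : U}" (is "?s : D.sects ?V")
proof (rule D.sectionI)
 show "?s m Q = {}" if "Q ~: ?V" for m Q
  by (rule Spf_map_pull_out[OF U s]) (use that in simp)
next
 fix m Q assume "Q : ?V"
 hence Q: "Q : D.X" "inv_pt Q : U" by auto
 obtain a t where at: "(a, t) : s (Suc m) (inv_pt Q)" by (rule C.section_ex_mem[OF s Q(2) inv_pt[OF Q(1)]])
 have at': "(a, t) : s m (inv_pt Q)" using C.sectionD(2)[OF s _ Q(2), of m "Suc m"] at by auto
 show "?s (Suc m) Q <= ?s m Q"
  unfolding Spf_map_pull[OF U s Q at] Spf_map_pull[OF U s Q at'] by (rule D.frac_mono) simp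
 obtain f b where f: "f <: C" "inv_pt Q : C.basic f" "C.basic f <= U" "b <: C"
  "!!P. P : C.basic f ==> s m P = C.frac m P b f"
  by (rule C.section_local[OF s Q(2), where m = m]) (rule that)
 have hf: "h f <: D" using f(1) by (simp add: hom_simps)
 have iQ: "inv_pt Q' : C.basic f" if "Q' : D.basic (h f)" for Q' using that inv_pt[of Q'] by simp
 show "EX W a t. D.opn W & Q : W & W <= ?V & a <: D & t <: D &
  (ALL Q':W. t ~: Q' & ?s m Q' = D.frac m Q' a t)"
 proof (rule D.local_fracI[OF D.open_basic[OF hf] _ _ _ hf, where a = "h b"])
  show "Q : D.basic (h f)" using f(1,2) Q by simp
  show "D.basic (h f) <= ?V" using iQ f(3) by blast
  show "h b <: D" using f(4) by (simp add: hom_simps)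
  fix Q' assume Q': "Q' : D.basic (h f)"
  thus "h f ~: Q'" by simp
  have QU: "Q' : D.X" "inv_pt Q' : U" using Q' iQ[OF Q'] f(3) by auto
  have "(b, f) : s m (inv_pt Q')"
  unfolding f(5)[OF iQ[OF Q']]
  by (rule C.frac_self[OF inv_pt[OF QU(1)] f(4)]) (use f(1) Q' in simp)
  thus "?s m Q' = D.frac m Q' (h b) (h f)" by (rule Spf_map_pull[OF U s QU])
 qed
qed

lemma Spf_map_open:
 assumes "C.opn U" shows "D.opn {Q : D.X. inv_pt Q : U}" (is "openin _ ?V")
proof (rule openin_subopen[THEN iffD2], intro ballI)
 fix Q assume "Q : ?V"
 hence Q: "Q : D.X" "inv_pt Q : U" by auto
 obtain f where f: "f <: C" "inv_pt Q : C.basic f" "C.basic f <= U"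
  by (rule C.basic_nbhd[OF assms Q(2)])
 have iQ: "inv_pt Q' : C.basic f" if "Q' : D.basic (h f)" for Q' using that inv_pt[of Q'] by simp
 show "EX T. D.opn T & Q : T & T <= ?V"
 proof (intro exI conjI)
  show "D.opn (D.basic (h f))" using f(1) by (intro D.open_basic) (simp add: hom_simps)
  show "Q : D.basic (h f)" using f(1,2) Q by simp
  show "D.basic (h f) <= ?V" using iQ f(3) by blast
 qed
qed

lemma Spf_map_hom:
 assumes U: "C.opn U"
 shows "pull (Spf_map K C D h) U : alg_hom (C.SA U) (D.SA {Q : D.X. inv_pt Q : U})"
  (is "?p : alg_hom _ (D.SA ?V)")
proof -
 have mult: "?p (s **.(C.SA U) s') = ?p s **.(D.SA ?V) ?p s'"
  and add: "?p (s ++.(C.SA U) s') = ?p s ++.(D.SA ?V) ?p s'"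
  if s: "s : C.sects U" and s': "s' : C.sects U" for s s'
 proof -
  have cl: "s **.(C.SA U) s' : C.sects U" "s ++.(C.SA U) s' : C.sects U"
  using C.sec_ops_closed[OF U] s s' by (simp_all add: ops_closed_def)
  have *: "?p (s **.(C.SA U) s') m Q = (?p s **.(D.SA ?V) ?p s') m Q"
  "?p (s ++.(C.SA U) s') m Q = (?p s ++.(D.SA ?V) ?p s') m Q" if "Q : ?V" for m Q
  proof -
  have Q: "Q : D.X" "inv_pt Q : U" using that by auto
  note P = inv_pt[OF Q(1)]
  obtain a t where at: "(a, t) : s m (inv_pt Q)" by (rule C.section_ex_mem[OF s Q(2) P])
  note at' = C.section_mem[OF s Q(2) P at]
  obtain b u where bu: "(b, u) : s' m (inv_pt Q)" by (rule C.section_ex_mem[OF s' Q(2) P])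
  note bu' = C.section_mem[OF s' Q(2) P bu]
  note ops = C.sec_mult_at[where s = s and s' = s' and m = m and U = U, OF P at'(2,3) bu'(2,3) at'(1) bu'(1)]
  note ops' = D.sec_mult_at[where s = "?p s" and s' = "?p s'" and m = m and U = ?V,
  OF Q(1) _ notin_inv_pt[OF at'(3)] _ notin_inv_pt[OF bu'(3)]
  Spf_map_pull[OF U s Q at] Spf_map_pull[OF U s' Q bu]]
  have tu: "t **.C u : carrier C - inv_pt Q" by (rule C.pt_mult_notin[OF P at'(3) bu'(3)])
  have "(a **.C b, t **.C u) : (s **.(C.SA U) s') m (inv_pt Q)"
  unfolding ops(1) by (rule C.frac_self[OF P _ tu]) (use at' bu' in simp)
  from Spf_map_pull[OF U cl(1) Q this] ops'(1) at' bu'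
  show "?p (s **.(C.SA U) s') m Q = (?p s **.(D.SA ?V) ?p s') m Q" by (simp add: hom_simps)
  have "(u **.C a ++.C t **.C b, t **.C u) : (s ++.(C.SA U) s') m (inv_pt Q)"
  unfolding ops(2) by (rule C.frac_self[OF P _ tu]) (use at' bu' in simp)
  from Spf_map_pull[OF U cl(2) Q this] ops'(2) at' bu'
  show "?p (s ++.(C.SA U) s') m Q = (?p s ++.(D.SA ?V) ?p s') m Q" by (simp add: hom_simps)
  qed
  have out: "?p r m Q = {}" if "r : C.sects U" "Q ~: ?V" for r m Q
  by (rule Spf_map_pull_out[OF U that(1)]) (use that(2) in simp)
  show "?p (s **.(C.SA U) s') = ?p s **.(D.SA ?V) ?p s'"
  by (rule D.section_eqI[of ?V, OF *(1) out[OF cl(1)] D.sec_mult_out(1)[OF out[OF s]]])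
  show "?p (s ++.(C.SA U) s') = ?p s ++.(D.SA ?V) ?p s'"
  by (rule D.section_eqI[of ?V, OF *(2) out[OF cl(2)] D.sec_mult_out(2)[OF out[OF s]]])
 qed
 have "is_alg_hom (C.SA U) (D.SA ?V) ?p"
  by (rule homI)
  (simp_all add: Spf_map_section[OF U] Spf_map_pull_const[OF U] mult add hom_simps)
 moreover have "?p : extensional (carrier (C.SA U))" using U by (simp add: Spf_map_def Let_def)
 ultimately show ?thesis by (simp add: alg_hom_def)
qed

text \<open>Locality holds because the numerator at level 1 decides whether a germ is a unit, and
  \<open>h a\<close> avoids \<open>Q\<close> exactly when \<open>a\<close> avoids the preimage of
  \<open>Q\<close>.\<close>

lemma Spf_map_Mor: "Spf_map K C D h : Mor (Spf K D) (Spf K C)"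
proof (rule MorI)
 show "pts (Spf_map K C D h) : extensional (topspace (tp (Spf K D)))"
  "pull (Spf_map K C D h) : extensional {V. openin (tp (Spf K C)) V}"
  by (simp_all add: Spf_map_def Let_def)
 show "continuous_map (tp (Spf K D)) (tp (Spf K C)) (pts (Spf_map K C D h))"
  unfolding continuous_map_def
 proof (intro conjI allI impI)
  show "pts (Spf_map K C D h) : topspace (tp (Spf K D)) \<rightarrow> topspace (tp (Spf K C))"
  by (simp add: Spf_map_pts inv_pt)
  fix U assume "openin (tp (Spf K C)) U"
  hence "D.opn {Q : D.X. inv_pt Q : U}" by (intro Spf_map_open) simp
  moreover have "{Q : D.X. inv_pt Q : U} = {x : D.X. pts (Spf_map K C D h) x : U}"
  by (auto simp: Spf_map_pts)
  ultimately show "openin (tp (Spf K D)) {x : topspace (tp (Spf K D)). pts (Spf_map K C D h) x : U}" by simp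
 qed
 show "pull (Spf_map K C D h) V : alg_hom (sec (Spf K C) V) (sec (Spf K D) (pre (Spf_map K C D h) (Spf K D) V))"
  if "openin (tp (Spf K C)) V" for V using Spf_map_hom[of V] that by (simp add: Spf_map_pre)
next
 fix V W s assume *: "openin (tp (Spf K C)) V" "openin (tp (Spf K C)) W" "W <= V" "s <: sec (Spf K C) V"
 hence o: "C.opn V" "C.opn W" "s : C.sects V" by simp_all
 let ?r = "%m P. if P : W then s m P else {}"
 have r: "?r : C.sects W" by (rule C.section_res[OF o(3,2) *(3)])
 have "pull (Spf_map K C D h) W ?r m Q = (if Q : D.X & inv_pt Q : W then pull (Spf_map K C D h) V s m Q else {})" for m Q
 proof (cases "Q : D.X & inv_pt Q : W")
  case True
  hence Q: "Q : D.X" "inv_pt Q : W" "inv_pt Q : V" using *(3) by auto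
  obtain a t where at: "(a, t) : s m (inv_pt Q)" by (rule C.section_ex_mem[OF o(3) Q(3) inv_pt[OF Q(1)]])
  have "(a, t) : ?r m (inv_pt Q)" using at Q(2) by simp
  thus ?thesis using Spf_map_pull[OF o(2) r Q(1,2)] Spf_map_pull[OF o(1,3) Q(1,3) at] Q by simp
 next
  case False
  show ?thesis unfolding if_not_P[OF False] by (rule Spf_map_pull_out[OF o(2) r False])
 qed
 thus "pull (Spf_map K C D h) W (res (Spf K C) V W s) =
  res (Spf K D) (pre (Spf_map K C D h) (Spf K D) V) (pre (Spf_map K C D h) (Spf K D) W) (pull (Spf_map K C D h) V s)"
  by (intro ext) (simp add: Spf_map_pre)
next
 fix Q V s assume *: "Q : topspace (tp (Spf K D))" "openin (tp (Spf K C)) V" "pts (Spf_map K C D h) Q : V"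
  "s <: sec (Spf K C) V"
  "germ_unit (Spf K D) (pre (Spf_map K C D h) (Spf K D) V) Q (pull (Spf_map K C D h) V s)"
 hence Q: "Q : D.X" "inv_pt Q : V" and V: "C.opn V" and s: "s : C.sects V"
  by (simp_all add: Spf_map_pts)
 obtain a t where at: "(a, t) : s 1 (inv_pt Q)" by (rule C.section_ex_mem[OF s Q(2) inv_pt[OF Q(1)]])
 note at' = C.section_mem[OF s Q(2) inv_pt[OF Q(1)] at]
 have "(h a, h t) : pull (Spf_map K C D h) V s 1 Q"
  unfolding Spf_map_pull[OF V s Q at] using at' notin_inv_pt[OF at'(3)] by (intro D.frac_self Q(1)) (simp_all add: hom_simps)
 hence "h a ~: Q"
  using D.germ_unit_numerator *(5) Spf_map_section[OF V s] by (simp add: Spf_map_pre)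
 hence "germ_unit (Spf K C) V (inv_pt Q) s"
  by (intro C.germ_unitI[OF V s Q(2) at]) simp
 thus "germ_unit (Spf K C) V (pts (Spf_map K C D h) Q) s" using Q by (simp add: Spf_map_pts)
qed

text \<open>Locality determines the map on points, and near a point a section is congruent
 modulo \<open>\<pi>\<^sup>m\<close> to a fraction, up to a multiple of \<open>\<pi>\<^sup>m\<close>, which is respected by \<open>R\<close>-linear maps.\<close>

lemma Spf_Mor_unique:
 assumes F: "F : Mor (Spf K D) (Spf K C)"
  and glob: "!!c. c <: C ==> pull F C.X (C.cst C.X c) = D.cst D.X (h c)"
 shows "F = Spf_map K C D h"
proof (rule mor_eqI[OF F Spf_map_Mor])
 have preX: "pre F (Spf K D) C.X = D.X" using Mor_pts[OF F] by (auto simp: pre_def)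
 have FX: "pts F Q : C.X" if "Q : D.X" for Q using Mor_pts[OF F, of Q] that by simp
 have pt: "pts F Q = inv_pt Q" if Q: "Q : D.X" for Q
 proof -
  have "c : pts F Q <-> h c : Q" if c: "c <: C" for c
  proof -
  let ?c = "C.cst C.X c" and ?d = "D.cst D.X (h c)"
  have hc: "h c <: D" using c by (simp add: hom_simps)
  have cs: "?c : C.sects C.X" by (rule C.spf_const_section[OF C.open_X c])
  have ds: "?d : D.sects D.X" by (rule D.spf_const_section[OF D.open_X hc])
  have cm: "(c, \<one>.C) : ?c 1 (pts F Q)"
  unfolding C.spf_const_at[OF FX[OF Q]] by (rule C.frac_self[OF FX[OF Q] c C.pt_one'[OF FX[OF Q]]])
  have dm: "(h c, \<one>.D) : ?d 1 Q"
  unfolding D.spf_const_at[OF Q] by (rule D.frac_self[OF Q hc D.pt_one'[OF Q]])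
  \<comment> \<open>A unit germ is pulled back to a unit germ. The opposite direction below is the
    locality of \<open>F\<close>.\<close>
  have "h c ~: Q" if nc: "c ~: pts F Q"
  proof -
  have "germ_unit (Spf K C) C.X (pts F Q) ?c" by (rule C.germ_unitI[OF C.open_X cs FX[OF Q] cm nc])
  then obtain V where V: "C.opn V" "pts F Q : V" "V <= C.X"
  "res (Spf K C) C.X V ?c : Units (C.SA V)" by (auto simp: germ_unit_def)
  let ?r = "res (Spf K C) C.X V ?c"
  obtain r where r: "r : C.sects V" "?r : C.sects V"
  "r **.(C.SA V) ?r = C.cst V \<one>.C" "?r **.(C.SA V) r = C.cst V \<one>.C"
  using V(4) by (auto simp: Units_def)
  let ?W = "pre F (Spf K D) V"
  have pV: "is_alg_hom (C.SA V) (D.SA ?W) (pull F V)"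
  using alg_homD[OF MorD(4)[OF F]] V(1) by simp
  have "pull F V r **.(D.SA ?W) pull F V ?r = \<one>.(D.SA ?W)"
  "pull F V ?r **.(D.SA ?W) pull F V r = \<one>.(D.SA ?W)"
  using homD(4)[OF pV, of r ?r] homD(4)[OF pV, of ?r r] homD(6)[OF pV] r by simp_all
  moreover have "pull F V r <: D.SA ?W" "pull F V ?r <: D.SA ?W"
  using homD(2)[OF pV] r(1,2) by simp_all
  ultimately have "pull F V ?r : Units (D.SA ?W)" unfolding Units_def by blast
  moreover have "pull F V ?r = res (Spf K D) D.X ?W ?d"
  using MorD(5)[OF F, of C.X V ?c] V(1,3) C.open_X cs glob[OF c] preX by simp
  moreover have "D.opn ?W" using Mor_pre_open[OF F] V(1) by simp
  moreover have "Q : ?W" using V(2) Q by (simp add: pre_def)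
  moreover have "?W <= D.X" by (auto simp: pre_def)
  ultimately have "germ_unit (Spf K D) D.X Q ?d" unfolding germ_unit_def by (intro exI[of _ ?W]) simp
  thus ?thesis by (rule D.germ_unit_numerator[OF _ ds dm])
  qed
  moreover have "c ~: pts F Q" if nc: "h c ~: Q"
  proof -
  have "germ_unit (Spf K D) (pre F (Spf K D) C.X) Q (pull F C.X ?c)"
  unfolding preX glob[OF c] by (rule D.germ_unitI[OF D.open_X ds Q dm nc])
  hence "germ_unit (Spf K C) C.X (pts F Q) ?c"
  using MorD(6)[OF F, of Q C.X ?c] Q FX[OF Q] C.open_X cs by simp
  thus ?thesis by (rule C.germ_unit_numerator[OF _ cs cm])
  qed
  ultimately show ?thesis by blast
  qed
  thus ?thesis using C.pt_sub[OF FX[OF Q]] by blast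
 qed
 show "pts F Q = pts (Spf_map K C D h) Q" if "Q : topspace (tp (Spf K D))" for Q
  using that pt by (simp add: Spf_map_pts)
 fix V s assume "openin (tp (Spf K C)) V" "s <: sec (Spf K C) V"
 hence V: "C.opn V" and s: "s : C.sects V" by simp_all
 have preF: "pre F (Spf K D) W = {Q : D.X. inv_pt Q : W}" for W using pt by (auto simp: pre_def)
 have pF: "is_alg_hom (C.SA W) (D.SA {Q : D.X. inv_pt Q : W}) (pull F W)"
  if "C.opn W" for W using alg_homD[OF MorD(4)[OF F, of W]] that by (simp add: preF)
 show "pull F V s = pull (Spf_map K C D h) V s"
 proof (rule D.section_eqI[of "{Q : D.X. inv_pt Q : V}"])
  show "pull F V s m Q = {}" if "Q ~: {Q : D.X. inv_pt Q : V}" for m Q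
  using D.sectionD(1)[OF _ that] homD(2)[OF pF[OF V]] s by simp
  show "pull (Spf_map K C D h) V s m Q = {}" if "Q ~: {Q : D.X. inv_pt Q : V}" for m Q
  by (rule D.sectionD(1)[OF Spf_map_section[OF V s] that])
  fix m Q assume "Q : {Q : D.X. inv_pt Q : V}"
  hence Q: "Q : D.X" "inv_pt Q : V" by auto
  obtain g where g: "g <: C" "inv_pt Q : C.basic g" "C.basic g <= V"
  by (rule C.basic_nbhd[OF V Q(2)])
  let ?B = "C.basic g" let ?W = "{Q : D.X. inv_pt Q : ?B}"
  have B: "C.opn ?B" by (rule C.open_basic[OF g(1)])
  define r where "r = res (Spf K C) V ?B s"
  have r: "r : C.sects ?B" unfolding r_def Spf_sel by (rule C.section_res[OF s B g(3)])
  have QW: "Q : ?W" using Q g(2) by simp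
  have rQ: "pull F V s m Q = pull F ?B r m Q"
  using MorD(5)[OF F, of V ?B s] V B g(3) s QW by (simp add: r_def preF)
  obtain N :: nat and a where a: "a <: C" "ALL P:?B. r m P = C.frac m P a (g [^].C N)"
  using C.section_on_basic[OF g(1) r subset_refl, of m] by (elim exE bexE)
  define t where "t = g [^].C N"
  have t: "t <: C" "t : carrier C - P" if "P : ?B" for P
  using g(1) that C.pt_pow_iff[of P g N] by (auto simp: t_def)
  have tc: "t <: C" using g(1) by (simp add: t_def)
  let ?SC = "C.SA ?B" and ?SD = "D.SA ?W"
  let ?ct = "C.cst ?B t" and ?ca = "C.cst ?B (\<ominus>.C a)"
  have cs: "?ct : C.sects ?B" "?ca : C.sects ?B"
  using C.spf_const_section[OF B] tc a(1) by simp_all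
  \<comment> \<open>\<open>z\<close> is \<open>t r - a\<close>. It vanishes at level
    \<open>m\<close> on \<open>basic g\<close>, so it is \<open>\<pi>^m y\<close> for a section
    \<open>y\<close>, and \<open>F\<close> maps it to a multiple of \<open>\<pi>^m\<close>. Hence
    the pull-back of \<open>r\<close> is \<open>h a / h t\<close> at level \<open>m\<close>.\<close>
  define z where "z = ?ct **.?SC r ++.?SC ?ca"
  have tr: "?ct **.?SC r : C.sects ?B"
  using C.sec_ops_closed[OF B] cs r by (simp add: ops_closed_def)
  have z: "z : C.sects ?B"
  using C.sec_ops_closed[OF B] cs tr by (simp add: ops_closed_def z_def)
  have "z m P = C.frac m P \<zero>.C \<one>.C" if P: "P : ?B" for P
  proof -
  have PX: "P : C.X" using P by simp
  have 1: "(?ct **.?SC r) m P = C.frac m P (t **.C a) (\<one>.C **.C t)"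
  by (rule C.sec_mult_at(1)[where s = ?ct and s' = r and m = m, OF PX tc C.pt_one'[OF PX] a(1) t(2)[OF P]
  C.spf_const_at[OF P]]) (use a(2) P in "simp add: t_def")
  have 2: "z m P = C.frac m P (\<one>.C **.C (t **.C a) ++.C (\<one>.C **.C t) **.C (\<ominus>.C a)) ((\<one>.C **.C t) **.C \<one>.C)"
  unfolding z_def
  by (rule C.sec_mult_at(2)[where s = "?ct **.?SC r" and s' = ?ca and m = m, OF PX _ _ _ C.pt_one'[OF PX] 1 C.spf_const_at[OF P]])
  (use tc a(1) t(2)[OF P] in simp_all)
  have "\<one>.C **.C (t **.C a) ++.C (\<one>.C **.C t) **.C (\<ominus>.C a) = \<zero>.C"
  using tc a(1) by (simp add: C.r_minus C.r_neg)
  thus ?thesis unfolding 2 using t(2)[OF P] PX C.pt_one'[OF PX]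
  by (intro C.frac_eqI) simp_all
  qed
  then obtain y where y: "y : C.sects ?B" "z = alg ?SC (unif K ^ m) **.?SC y"
  using C.section_divisible[OF g(1) z, of m] by (auto simp del: spf_alg_sel(4))
  note H = homD[OF pF[OF B]]
  have const: "pull F ?B (C.cst ?B c) = D.cst ?W (h c)" if c: "c <: C" for c
  proof -
  have "pull F ?B (res (Spf K C) C.X ?B (C.cst C.X c)) =
  res (Spf K D) D.X ?W (pull F C.X (C.cst C.X c))"
  using MorD(5)[OF F, of C.X ?B "C.cst C.X c"] C.open_X B C.spf_const_section[OF C.open_X c] preX
  by (simp add: preF)
  moreover have "res (Spf K C) C.X ?B (C.cst C.X c) = C.cst ?B c"
  unfolding Spf_sel by (rule C.spf_const_res) simp
  moreover have "res (Spf K D) D.X ?W (D.cst D.X (h c)) = D.cst ?W (h c)"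
  unfolding Spf_sel by (rule D.spf_const_res) auto
  ultimately show ?thesis by (simp add: glob[OF c])
  qed
  have pr: "pull F ?B r : D.sects ?W" and py: "pull F ?B y : D.sects ?W"
  using H(2) r y(1) by simp_all
  have "pull F ?B z = D.cst ?W (h t) **.?SD pull F ?B r ++.?SD D.cst ?W (h (\<ominus>.C a))"
  using H(4)[of ?ct r] H(5)[of "?ct **.?SC r" ?ca] cs r tr const[OF tc] const[of "\<ominus>.C a"] a(1)
  by (simp add: z_def)
  moreover have "pull F ?B z = alg ?SD (unif K ^ m) **.?SD pull F ?B y"
  using H(4)[of "alg ?SC (unif K ^ m)" y] H(3)[of "unif K ^ m"] y C.spf_const_section[OF B] by simp
  ultimately have eq: "(D.cst ?W (h t) **.?SD pull F ?B r ++.?SD D.cst ?W (h (\<ominus>.C a))) m Q =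
  (D.cst ?W (alg D (unif K ^ m)) **.?SD pull F ?B y) m Q" by simp
  obtain x u where xu: "x <: D" "u : carrier D - Q" "pull F ?B r m Q = D.frac m Q x u"
  by (rule D.section_frac[OF pr QW Q(1)])
  obtain b w where bw: "b <: D" "w : carrier D - Q" "pull F ?B y m Q = D.frac m Q b w"
  by (rule D.section_frac[OF py QW Q(1)])
  have ht: "h t : carrier D - Q" by (rule notin_inv_pt[OF t(2)[OF g(2)]])
  have ha: "h a <: D" using a(1) by (simp add: hom_simps)
  have one: "\<one>.D : carrier D - Q" by (rule D.pt_one'[OF Q(1)])
  have 1: "(D.cst ?W (h t) **.?SD pull F ?B r) m Q = D.frac m Q (h t **.D x) (\<one>.D **.D u)"
  by (rule D.sec_mult_at(1)[where s = "D.cst ?W (h t)" and s' = "pull F ?B r" and m = m,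
  OF Q(1) DiffD1[OF ht] one xu(1,2) D.spf_const_at[OF QW] xu(3)])
  have 2: "(D.cst ?W (h t) **.?SD pull F ?B r ++.?SD D.cst ?W (h (\<ominus>.C a))) m Q =
  D.frac m Q (\<one>.D **.D (h t **.D x) ++.D (\<one>.D **.D u) **.D h (\<ominus>.C a)) ((\<one>.D **.D u) **.D \<one>.D)"
  by (rule D.sec_mult_at(2)[where s = "D.cst ?W (h t) **.?SD pull F ?B r" and s' = "D.cst ?W (h (\<ominus>.C a))" and m = m,
  OF Q(1) _ _ _ one 1 D.spf_const_at[OF QW]]) (use ht xu ha a(1) in "simp_all add: hom_simps")
  have 3: "(D.cst ?W (alg D (unif K ^ m)) **.?SD pull F ?B y) m Q =
  D.frac m Q (alg D (unif K ^ m) **.D b) (\<one>.D **.D w)"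
  by (rule D.sec_mult_at(1)[where s = "D.cst ?W (alg D (unif K ^ m))" and s' = "pull F ?B y" and m = m,
  OF Q(1) D.alg_closed one bw(1,2) D.spf_const_at[OF QW] bw(3)])
  let ?e = "h t **.D x ++.D u **.D h (\<ominus>.C a)"
  have htc: "h t <: D" and uc: "u <: D" and wc: "w <: D" using ht xu bw by simp_all
  have e: "?e <: D" using ht xu a(1) by (simp add: hom_simps)
  have "D.frac m Q ?e u = D.frac m Q (alg D (unif K ^ m) **.D b) w"
  using eq unfolding 2 3 using e ht xu bw ha a(1) by (simp add: hom_simps)
  moreover have "D.frac m Q (alg D (unif K ^ m) **.D b) w = D.frac m Q \<zero>.D w"
  using bw by (intro D.frac_cong Q(1))
  (auto simp: cong_mod_def D.minus_eq intro: D.pow_idealI)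
  ultimately have "D.frel m Q ?e u \<zero>.D w"
  using D.frac_eq_iff[OF Q(1) e xu(2) D.zero_closed bw(2), of m] by simp
  then obtain v where v: "v : carrier D - Q" "v **.D (w **.D ?e \<ominus>.D u **.D \<zero>.D) : D.pideal m"
  unfolding D.frel_def by (rule bexE)
  have "v **.D (w **.D ?e \<ominus>.D u **.D \<zero>.D) = (v **.D w) **.D (h t **.D x \<ominus>.D u **.D h a)"
  using v(1) wc uc htc xu(1) ha a(1) by (simp add: hom_simps D.minus_eq D.r_minus D.m_assoc)
  hence "D.frel m Q x u (h a) (h t)" unfolding D.frel_def
  using v D.pt_mult_notin[OF Q(1) v(1) bw(2)] by (intro bexI[of _ "v **.D w"]) simp_all
  hence "D.frac m Q x u = D.frac m Q (h a) (h t)"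
  using D.frac_eq_iff[OF Q(1) xu(1,2) ha ht, of m] by simp
  moreover have "(a, t) : s m (inv_pt Q)"
  proof -
  have "(a, t) : r m (inv_pt Q)"
  using a(2) g(2) C.frac_self[OF inv_pt[OF Q(1)] a(1) t(2)[OF g(2)], of m] by (simp add: t_def)
  thus ?thesis using g(2) by (simp add: r_def)
  qed
  ultimately show "pull F V s m Q = pull (Spf_map K C D h) V s m Q"
  using Spf_map_pull[OF V s Q] rQ xu(3) by simp
 qed
qed

end

lemma Spf_map_eqI:
 assumes "ralgebra C" "ralgebra D" "is_alg_hom C D h" "F : Mor (Spf K D) (Spf K C)"
  "!!c. c <: C ==> pull F (spf_pts K C) (spf_const K C (spf_pts K C) c) = spf_const K D (spf_pts K D) (h c)"
 shows "F = Spf_map K C D h"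
proof -
 interpret spf_pair C D K h
  by (intro spf_pair.intro spf_pair_axioms.intro spf_algebraI assms(1-3))
 show ?thesis by (rule Spf_Mor_unique[OF assms(4,5)])
qed

lemma Spf_map_in_Mor:
 assumes "ralgebra C" "ralgebra D" "is_alg_hom C D h"
 shows "Spf_map K C D h : Mor (Spf K D) (Spf K C)"
  "c <: C ==> pull (Spf_map K C D h) (spf_pts K C) (spf_const K C (spf_pts K C) c) = spf_const K D (spf_pts K D) (h c)"
  "pre (Spf_map K C D h) (Spf K D) (spf_pts K C) = spf_pts K D"
  "Q : spf_pts K D ==> pts (Spf_map K C D h) Q = {c : carrier C. h c : Q}"
proof -
 interpret spf_pair C D K h
  by (intro spf_pair.intro spf_pair_axioms.intro spf_algebraI assms)
 show "Spf_map K C D h : Mor (Spf K D) (Spf K C)" by (rule Spf_map_Mor)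
 show "pre (Spf_map K C D h) (Spf K D) (spf_pts K C) = spf_pts K D" by (rule Spf_map_pre_X)
 show "Q : spf_pts K D ==> pts (Spf_map K C D h) Q = {c : carrier C. h c : Q}" by (rule Spf_map_pts)
 have "{Q : D.X. inv_pt Q : C.X} = D.X" using inv_pt by auto
 thus "c <: C ==> pull (Spf_map K C D h) (spf_pts K C) (spf_const K C (spf_pts K C) c) = spf_const K D (spf_pts K D) (h c)"
  using Spf_map_pull_const[OF C.open_X, of c] by simp
qed

lemma Spf_presheaf: "ralgebra C ==> presheaf (Spf K C)"
 by (rule spf_algebra.Spf_presheaf[OF spf_algebraI])

lemma Spf_topspace: "ralgebra C ==> topspace (spf_top K C) = spf_pts K C"
 by (rule spf_algebra.topspace_spf[OF spf_algebraI])

subsection \<open>Open subspaces\<close>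

definition inclusion :: "('p, 'r, 's) rspace => 'p set => ('p, 's, 'p, 's) mor" where
 "inclusion X U = \<lparr>pts = (\<lambda>x\<in>U. x),
  pull = (\<lambda>V\<in>{V. openin (tp X) V}. \<lambda>s\<in>carrier (sec X V). res X V (V \<inter> U) s)\<rparr>"

text \<open>\<open>restr\<close> changes only the topology, so the sections stay the same and
  \<open>pull\<close> is cut down to the open subsets of \<open>U\<close>.\<close>

definition corestrict :: "('p, 'r, 's) rspace => 'p set => ('q, 't, 'p, 's) mor => ('q, 't, 'p, 's) mor" where
 "corestrict X U f = \<lparr>pts = pts f, pull = (\<lambda>V\<in>{V. openin (tp X) V & V <= U}. pull f V)\<rparr>"

context
 fixes X :: "('p, 'r::comm_ring_1, 's) rspace" and U :: "'p set"
 assumes X: "ringed X" and U: "openin (tp X) U"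
begin

lemma restr_topspace: "topspace (subtopology (tp X) U) = U"
 using openin_subset[OF U] by auto

lemma topspace_Int_U: "topspace (tp X) \<inter> U = U"
 using openin_subset[OF U] by auto

lemma inclusion_pre: "pre (inclusion X U) (restr X U) V = V \<inter> U"
 using openin_subset[OF U] by (auto simp: pre_def inclusion_def)

lemma inclusion_pull: "openin (tp X) V ==> s <: sec X V ==> pull (inclusion X U) V s = res X V (V \<inter> U) s"
 by (simp add: inclusion_def)

lemma inclusion_Mor: "inclusion X U : Mor (restr X U) X"
proof (rule MorI)
 show "pts (inclusion X U) : extensional (topspace (tp (restr X U)))"
  "pull (inclusion X U) : extensional {V. openin (tp X) V}"
  by (simp_all add: topspace_Int_U inclusion_def)
 have "continuous_map (subtopology (tp X) U) (tp X) (%x. x)" by simp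
 thus "continuous_map (tp (restr X U)) (tp X) (pts (inclusion X U))"
  unfolding restr_sel by (rule continuous_map_eq) (simp add: restr_topspace inclusion_def)
 fix V assume V: "openin (tp X) V"
 have "restrict (res X V (V \<inter> U)) (carrier (sec X V)) : alg_hom (sec X V) (sec X (V \<inter> U))"
  by (rule restrict_hom[OF ringedD(1)[OF X V] ringedD(2)[OF X V openin_Int[OF V U]]]) simp
 thus "pull (inclusion X U) V : alg_hom (sec X V) (sec (restr X U) (pre (inclusion X U) (restr X U) V))"
  unfolding inclusion_pre using V by (simp add: inclusion_def)
next
 fix V W s assume VW: "openin (tp X) V" "openin (tp X) W" "W <= V" "s <: sec X V"
 have "res X V W s <: sec X W" using ringed_presheaf[OF X] VW by (simp add: presheaf_def)
 thus "pull (inclusion X U) W (res X V W s) = res (restr X U) (pre (inclusion X U) (restr X U) V)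
  (pre (inclusion X U) (restr X U) W) (pull (inclusion X U) V s)"
  unfolding inclusion_pre restr_sel inclusion_pull[OF VW(1,4)]
  using ringedD(4)[OF X VW(1,2) openin_Int[OF VW(2) U] Int_lower1 VW(3,4)]
  ringedD(4)[OF X VW(1) openin_Int[OF VW(1) U] openin_Int[OF VW(2) U] Int_mono[OF VW(3) subset_refl] Int_lower1 VW(4)]
  by (simp add: inclusion_pull[OF VW(2)])
next
 fix x V s assume *: "x : topspace (tp (restr X U))" "openin (tp X) V" "pts (inclusion X U) x : V" "s <: sec X V"
  "germ_unit (restr X U) (pre (inclusion X U) (restr X U) V) x (pull (inclusion X U) V s)"
 hence x: "x : U" "pts (inclusion X U) x = x" by (simp_all add: restr_topspace inclusion_def)
 have g: "germ_unit (restr X U) (V \<inter> U) x (res X V (V \<inter> U) s)"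
  using *(5) unfolding inclusion_pre inclusion_pull[OF *(2,4)] .
 then obtain W where W: "openin (tp X) W" "W <= U" "x : W" "W <= V \<inter> U" "res X (V \<inter> U) W (res X V (V \<inter> U) s) : Units (sec X W)"
  by (auto simp: germ_unit_def openin_restr[OF U])
 have "res X (V \<inter> U) W (res X V (V \<inter> U) s) = res X V W s"
  by (rule ringedD(4)[OF X *(2) openin_Int[OF *(2) U] W(1,4) _ *(4)]) simp
 thus "germ_unit X V (pts (inclusion X U) x) s"
  unfolding x(2) germ_unit_def using W by (intro exI[of _ W]) simp
qed

lemma corestrict_Mor:
 assumes f: "f : Mor Y X" and fU: "!!y. y : topspace (tp Y) ==> pts f y : U"
 shows "corestrict X U f : Mor Y (restr X U)"
proof (rule MorI)
 have pre: "pre (corestrict X U f) Y V = pre f Y V" for V by (simp add: pre_def corestrict_def)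
 have pl: "openin (tp X) V ==> V <= U ==> pull (corestrict X U f) V = pull f V" for V
  by (simp add: corestrict_def)
 show "pts (corestrict X U f) : extensional (topspace (tp Y))" using MorD(1)[OF f] by (simp add: corestrict_def)
 show "continuous_map (tp Y) (tp (restr X U)) (pts (corestrict X U f))"
  using MorD(2)[OF f] fU by (auto simp: corestrict_def continuous_map_in_subtopology)
 show "pull (corestrict X U f) : extensional {V. openin (tp (restr X U)) V}"
  by (simp add: corestrict_def openin_restr[OF U])
 show "pull (corestrict X U f) V : alg_hom (sec (restr X U) V) (sec Y (pre (corestrict X U f) Y V))"
  if "openin (tp (restr X U)) V" for V
  using that MorD(4)[OF f, of V] by (simp add: pre pl openin_restr[OF U])
 show "pull (corestrict X U f) W (res (restr X U) V W s) =
  res Y (pre (corestrict X U f) Y V) (pre (corestrict X U f) Y W) (pull (corestrict X U f) V s)"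
  if "openin (tp (restr X U)) V" "openin (tp (restr X U)) W" "W <= V" "s <: sec (restr X U) V" for V W s
  using that MorD(5)[OF f, of V W s] by (simp add: pre pl openin_restr[OF U])
 fix y V s assume *: "y : topspace (tp Y)" "openin (tp (restr X U)) V" "pts (corestrict X U f) y : V"
  "s <: sec (restr X U) V" "germ_unit Y (pre (corestrict X U f) Y V) y (pull (corestrict X U f) V s)"
 hence V: "openin (tp X) V" "V <= U" "pts f y : V" by (simp_all add: openin_restr[OF U] corestrict_def)
 have "germ_unit X V (pts f y) s"
  by (rule MorD(6)[OF f *(1) V(1,3)]) (use * V in "simp_all add: pre pl")
 then obtain W where "openin (tp X) W" "pts f y : W" "W <= V" "res X V W s : Units (sec X W)"
  by (auto simp: germ_unit_def)
 thus "germ_unit (restr X U) V (pts (corestrict X U f) y) s"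
  unfolding germ_unit_def using V by (intro exI[of _ W]) (auto simp: openin_restr[OF U] corestrict_def)
qed

text \<open>For a morphism with image in \<open>U\<close> the preimages of \<open>V\<close> and
  \<open>V \<inter> U\<close> coincide, so its \<open>pull\<close> on \<open>V\<close> is determined
  by the one on \<open>V \<inter> U\<close>.\<close>

lemma Mor_eq_if_corestrict_eq:
 assumes D: "ralgebra D" and f: "f : Mor (Spf K D) X" and g: "g : Mor (Spf K D) X"
  and fU: "!!y. y : spf_pts K D ==> pts f y : U" and eq: "corestrict X U f = corestrict X U g"
 shows "f = g"
proof (rule mor_eqI[OF f g])
 have p: "pts f = pts g" using eq by (simp add: corestrict_def)
 show "pts f x = pts g x" for x by (simp add: p)
 have pl: "pull f V = pull g V" if "openin (tp X) V" "V <= U" for V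
 proof -
  have "pull (corestrict X U f) V = pull (corestrict X U g) V" by (simp add: eq)
  thus ?thesis using that by (simp add: corestrict_def)
 qed
 interpret D: spf_algebra D K by (rule spf_algebraI) fact
 fix V s assume V: "openin (tp X) V" "s <: sec X V"
 have *: "pull h V s = pull h (V \<inter> U) (res X V (V \<inter> U) s)" if h: "h : Mor (Spf K D) X" "pts h = pts f" for h
 proof -
  have pre: "pre h (Spf K D) (V \<inter> U) = pre h (Spf K D) V" using fU by (auto simp: pre_def h(2))
  have "pull h V s : spf_sections K D (pre h (Spf K D) V)" using Mor_pull[OF h(1) V] by simp
  hence "(%m P. if P : pre h (Spf K D) V then pull h V s m P else {}) = pull h V s"
  by (intro ext) (simp add: D.sectionD(1))
  thus ?thesis using MorD(5)[OF h(1) V(1) openin_Int[OF V(1) U] _ V(2)] by (simp add: pre)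
 qed
 show "pull f V s = pull g V s" using *[OF f refl] *[OF g] pl[OF openin_Int[OF V(1) U]] p by simp
qed

end

subsection \<open>Points of an affine open subset\<close>

definition point_hom :: "'r::comm_ring_1 base => ('p, 'r, 's) rspace => 'p set => ('r, 'd) ralg =>
  ('d set, 'd spf_sec, 'p, 's) mor => 's => 'd" where
 "point_hom K X U D x = (\<lambda>c\<in>carrier (sec X U). spf_global K D (pull x U c))"

definition lands_in :: "'r::comm_ring_1 base => ('r, 'd) ralg => 'p set => ('d set, 'd spf_sec, 'p, 's) mor => bool" where
 "lands_in K D U x <-> (ALL Q:spf_pts K D. pts x Q : U)"

locale affine_chart =
 fixes K :: "'r::comm_ring_1 base" and X :: "('p, 'r, 's) rspace" and U :: "'p set"
 assumes X: "ringed X" and affine: "affine_open K X U"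
begin

abbreviation C :: "('r, 's) ralg" where "C \<equiv> sec X U"

lemma U: "openin (tp X) U" using affine by (simp add: affine_open_def)
lemma C_complete: "adic K C" using affine by (simp add: affine_open_def complete_algebras_def)
lemma C_alg: "ralgebra C" by (rule adicD(1)[OF C_complete])

lemma pre_lands: "lands_in K D U x ==> ralgebra D ==> pre x (Spf K D) U = spf_pts K D"
 by (auto simp: pre_def lands_in_def Spf_topspace)

lemma point_hom_const:
 assumes D: "adic K D" and x: "x : Mor (Spf K D) X" "lands_in K D U x" and c: "c <: C"
 shows "pull x U c = spf_const K D (spf_pts K D) (point_hom K X U D x c)" "point_hom K X U D x c <: D"
proof -
 have rD: "ralgebra D" by (rule adicD(1)[OF D])
 interpret D: spf_algebra D K by (rule spf_algebraI[OF rD])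
 have "pull x U c : spf_sections K D D.X" using Mor_pull[OF x(1) U c] pre_lands[OF x(2) rD] by simp
 from D.spf_global[OF D this] show "pull x U c = spf_const K D (spf_pts K D) (point_hom K X U D x c)"
  "point_hom K X U D x c <: D" using c by (simp_all add: point_hom_def)
qed

lemma point_hom_unique:
 assumes D: "adic K D" and c: "c <: C"
  and "d <: D" "pull x U c = spf_const K D (spf_pts K D) d"
 shows "point_hom K X U D x c = d"
proof -
 interpret D: spf_algebra D K by (rule spf_algebraI[OF adicD(1)[OF D]])
 show ?thesis using D.spf_global_const[OF D assms(3)] c assms(4) by (simp add: point_hom_def)
qed

lemma point_hom_alg_hom:
 assumes D: "adic K D" and x: "x : Mor (Spf K D) X" "lands_in K D U x"
 shows "point_hom K X U D x : alg_hom C D"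
proof -
 have rD: "ralgebra D" by (rule adicD(1)[OF D])
 interpret D: spf_algebra D K by (rule spf_algebraI[OF rD])
 interpret C: r_algebra C using C_alg ..
 let ?S = "spf_alg K D D.X"
 have hom: "is_alg_hom C ?S (pull x U)"
  using alg_homD[OF MorD(4)[OF x(1) U]] pre_lands[OF x(2) rD] by simp
 note c = point_hom_const[OF D x]
 note cm = D.spf_const_mult[OF subset_refl]
 have "is_alg_hom C D (point_hom K X U D x)"
 proof (rule homI)
  fix a b assume ab: "a <: C" "b <: C"
  show "point_hom K X U D x (a **.C b) = point_hom K X U D x a **.D point_hom K X U D x b"
  by (rule point_hom_unique[OF D]) (use ab c(2) homD(4)[OF hom ab] c(1) cm(1) in auto)
  show "point_hom K X U D x (a ++.C b) = point_hom K X U D x a ++.D point_hom K X U D x b"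
  by (rule point_hom_unique[OF D]) (use ab c(2) homD(5)[OF hom ab] c(1) cm(2) in auto)
 next
  show "point_hom K X U D x (alg C r) = alg D r" for r
  by (rule point_hom_unique[OF D]) (use homD(3)[OF hom] in auto)
  show "point_hom K X U D x \<one>.C = \<one>.D"
  by (rule point_hom_unique[OF D]) (use homD(6)[OF hom] in auto)
 qed (rule c(2))
 thus ?thesis by (simp add: alg_hom_def point_hom_def)
qed

context
 fixes f g
 assumes f: "f : Mor (restr X U) (Spf K C)" and g: "g : Mor (Spf K C) (restr X U)"
  and gf: "comp_mor (restr X U) (Spf K C) (restr X U) g f = id_mor (restr X U)"
  and fg: "comp_mor (Spf K C) (restr X U) (Spf K C) f g = id_mor (Spf K C)"
begin

interpretation C: spf_algebra C K by (rule spf_algebraI[OF C_alg])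

lemma oU: "openin (tp (restr X U)) U" using U by (simp add: openin_restr[OF U])

lemma pre_f: "pre f (restr X U) C.X = U"
 using Mor_pts[OF f] restr_topspace[OF X U] by (auto simp: pre_def)

lemma pre_g: "pre g (Spf K C) U = C.X"
 using Mor_pts[OF g] restr_topspace[OF X U] by (auto simp: pre_def)

lemma chart_inj:
 assumes D: "adic K D"
  and x: "x : Mor (Spf K D) X" "lands_in K D U x" and y: "y : Mor (Spf K D) X" "lands_in K D U y"
  and eq: "point_hom K X U D x = point_hom K X U D y"
 shows "x = y"
proof -
 have rD: "ralgebra D" by (rule adicD(1)[OF D])
 interpret D: spf_algebra D K by (rule spf_algebraI[OF rD])
 have fp: "pull f C.X (spf_const K C C.X c) <: C" if "c <: C" for c
  using Mor_pull[OF f, of C.X] C.open_X C.spf_const_section[OF C.open_X that] pre_f by simp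
 \<comment> \<open>The isomorphism \<open>f\<close> of the chart with \<open>Spf K C\<close> need
   not induce the identity on global sections, so the homomorphism belonging to \<open>x\<close> is
   twisted by the endomorphism of \<open>C\<close> that \<open>f\<close> induces.\<close>
 define h where "h c = point_hom K X U D x (pull f C.X (spf_const K C C.X c))" for c
 have fh: "is_alg_hom (spf_alg K C C.X) C (pull f C.X)"
  using alg_homD[OF MorD(4)[OF f, of C.X]] C.open_X pre_f by simp
 have ch: "is_alg_hom C (spf_alg K C C.X) (spf_const K C C.X)"
  by (rule homI) (simp_all add: C.spf_const_section[OF C.open_X] C.spf_const_mult)
 have h: "is_alg_hom C D h" unfolding h_def
  by (rule hom_comp[OF hom_comp[OF ch fh] alg_homD[OF point_hom_alg_hom[OF D x]]])
 have pr: "presheaf (restr X U)" by (rule restr_presheaf[OF ringed_presheaf[OF X] U])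
 have *: "comp_mor (Spf K D) (restr X U) (Spf K C) f (corestrict X U z) = Spf_map K C D h"
  if z: "z : Mor (Spf K D) X" "lands_in K D U z" and eqz: "point_hom K X U D z = point_hom K X U D x" for z
 proof (rule Spf_map_eqI[OF C_alg rD h])
  have z': "corestrict X U z : Mor (Spf K D) (restr X U)"
  by (rule corestrict_Mor[OF X U z(1)]) (use z(2) Spf_topspace[OF rD] in "simp add: lands_in_def")
  show "comp_mor (Spf K D) (restr X U) (Spf K C) f (corestrict X U z) : Mor (Spf K D) (Spf K C)"
  by (rule comp_mor_Mor[OF z' f Spf_presheaf[OF C_alg]])
  fix c assume c: "c <: C"
  have "pull (comp_mor (Spf K D) (restr X U) (Spf K C) f (corestrict X U z)) C.X (spf_const K C C.X c) =
  pull z U (pull f C.X (spf_const K C C.X c))"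
  using C.open_X C.spf_const_section[OF C.open_X c] U by (simp add: comp_mor_sel pre_f corestrict_def)
  also have "... = spf_const K D D.X (h c)"
  using point_hom_const(1)[OF D z fp[OF c]] by (simp add: eqz h_def)
  finally show "pull (comp_mor (Spf K D) (restr X U) (Spf K C) f (corestrict X U z)) C.X (spf_const K C C.X c) =
  spf_const K D D.X (h c)" .
 qed
 have **: "corestrict X U z = comp_mor (Spf K D) (Spf K C) (restr X U) g (Spf_map K C D h)"
  if z: "z : Mor (Spf K D) X" "lands_in K D U z" and eqz: "point_hom K X U D z = point_hom K X U D x" for z
 proof -
  have z': "corestrict X U z : Mor (Spf K D) (restr X U)"
  by (rule corestrict_Mor[OF X U z(1)]) (use z(2) Spf_topspace[OF rD] in "simp add: lands_in_def")
  show ?thesis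
  unfolding *[OF z eqz, symmetric] comp_mor_assoc[OF z' f g Spf_presheaf[OF C_alg] pr] gf
  by (rule comp_mor_id_left[OF z' pr, symmetric])
 qed
 show ?thesis
  by (rule Mor_eq_if_corestrict_eq[OF X U rD x(1) y(1)])
  (use x(2) **[OF x refl] **[OF y eq[symmetric]] in "simp_all add: lands_in_def")
qed

lemma chart_surj:
 assumes D: "adic K D" and al: "al : alg_hom C D"
 shows "EX x:Mor (Spf K D) X. lands_in K D U x & point_hom K X U D x = al"
proof -
 have rD: "ralgebra D" by (rule adicD(1)[OF D])
 interpret D: spf_algebra D K by (rule spf_algebraI[OF rD])
 have fh: "is_alg_hom (spf_alg K C C.X) C (pull f C.X)"
  using alg_homD[OF MorD(4)[OF f, of C.X]] C.open_X pre_f by simp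
 have ch: "is_alg_hom C (spf_alg K C C.X) (spf_const K C C.X)"
  by (rule homI) (simp_all add: C.spf_const_section[OF C.open_X] C.spf_const_mult)
 define h where "h c = al (pull f C.X (spf_const K C C.X c))" for c
 have h: "is_alg_hom C D h" unfolding h_def
  by (rule hom_comp[OF hom_comp[OF ch fh] alg_homD[OF al]])
 note S = Spf_map_in_Mor[OF C_alg rD h, where K = K]
 have pr: "presheaf (restr X U)" by (rule restr_presheaf[OF ringed_presheaf[OF X] U])
 define y where "y = comp_mor (Spf K D) (Spf K C) (restr X U) g (Spf_map K C D h)"
 have y: "y : Mor (Spf K D) (restr X U)" unfolding y_def by (rule comp_mor_Mor[OF S(1) g pr])
 have yp: "pull y U c = spf_const K D D.X (al c)" if c: "c <: C" for c
 proof -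
  have gs: "pull g U c : spf_sections K C C.X" using Mor_pull[OF g oU, of c] c pre_g by simp
  obtain d where d: "d <: C" "spf_const K C C.X d = pull g U c"
  using C.global_section[OF C_complete gs] by blast
  have "pull f C.X (pull g U c) = pull (id_mor (restr X U)) U c"
  using c oU U by (simp flip: gf add: comp_mor_sel pre_g)
  also have "... = c" using c oU by (simp add: id_mor_def)
  finally have "h d = al c" by (simp add: h_def d(2))
  moreover have "pull y U c = pull (Spf_map K C D h) C.X (pull g U c)"
  unfolding y_def using c oU by (simp add: comp_mor_sel pre_g)
  ultimately show ?thesis using S(2)[OF d(1)] d(2) by simp
 qed
 define x where "x = comp_mor (Spf K D) (restr X U) X (inclusion X U) y"
 have x: "x : Mor (Spf K D) X" unfolding x_def
  by (rule comp_mor_Mor[OF y inclusion_Mor[OF X U] ringed_presheaf[OF X]])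
 have xU: "lands_in K D U x"
  unfolding lands_in_def x_def
 proof
  fix Q assume Q: "Q : spf_pts K D"
  hence "pts y Q : U" using Mor_pts[OF y, of Q] restr_topspace[OF X U] by simp
  thus "pts (comp_mor (Spf K D) (restr X U) X (inclusion X U) y) Q : U"
  using Q by (simp add: comp_mor_sel inclusion_def)
 qed
 have "point_hom K X U D x = al"
 proof (rule alg_hom_eqI[OF point_hom_alg_hom[OF D x xU] al])
  fix c assume c: "c <: C"
  have "pull x U c = pull y U c"
  unfolding x_def comp_mor_sel(2)[OF U c] inclusion_pre[OF X U] inclusion_pull[OF X U U c]
  using ringedD(3)[OF X U c] by simp
  thus "point_hom K X U D x c = al c"
  using yp[OF c] ahD(2)[OF al c] by (intro point_hom_unique[OF D c]) simp_all
 qed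
 thus ?thesis using x xU by blast
qed

end

lemma chart_iso:
 obtains f g where "f : Mor (restr X U) (Spf K C)" "g : Mor (Spf K C) (restr X U)"
  "comp_mor (restr X U) (Spf K C) (restr X U) g f = id_mor (restr X U)"
  "comp_mor (Spf K C) (restr X U) (Spf K C) f g = id_mor (Spf K C)"
 using affine unfolding affine_open_def isomorphic_def by blast

lemma point_hom_inj:
 assumes "adic K D"
  "x : Mor (Spf K D) X" "lands_in K D U x" "y : Mor (Spf K D) X" "lands_in K D U y"
  "point_hom K X U D x = point_hom K X U D y"
 shows "x = y"
 by (rule chart_iso) (rule chart_inj[OF _ _ _ _ assms])

lemma point_hom_surj:
 assumes "adic K D" "al : alg_hom C D"
 obtains x where "x : Mor (Spf K D) X" "lands_in K D U x" "point_hom K X U D x = al"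
proof -
 have "EX x:Mor (Spf K D) X. lands_in K D U x & point_hom K X U D x = al"
  by (rule chart_iso) (rule chart_surj[OF _ _ _ _ assms])
 thus thesis using that by blast
qed

lemma point_hom_map:
 assumes D: "adic K D" and E: "adic K E" and k: "is_alg_hom D E k"
  and x: "x : Mor (Spf K D) X" "lands_in K D U x"
 defines "y \<equiv> comp_mor (Spf K E) (Spf K D) X x (Spf_map K D E k)"
 shows "y : Mor (Spf K E) X" "lands_in K E U y"
  "!!c. c <: C ==> point_hom K X U E y c = k (point_hom K X U D x c)"
proof -
 have r: "ralgebra D" "ralgebra E" using D E by (simp_all add: adicD(1))
 note S = Spf_map_in_Mor[OF r k, where K = K]
 show "y : Mor (Spf K E) X" unfolding y_def by (rule comp_mor_Mor[OF S(1) x(1) ringed_presheaf[OF X]])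
 have "pts (Spf_map K D E k) Q : spf_pts K D" if "Q : spf_pts K E" for Q
  using Mor_pts[OF S(1), of Q] that r by (simp add: Spf_topspace)
 thus "lands_in K E U y" using x(2) r by (simp add: y_def lands_in_def comp_mor_sel Spf_topspace)
 fix c assume c: "c <: C"
 note p = point_hom_const[OF D x c]
 have "pull y U c = pull (Spf_map K D E k) (spf_pts K D) (pull x U c)"
  unfolding y_def comp_mor_sel(2)[OF U c] pre_lands[OF x(2) r(1)] ..
 also have "... = spf_const K E (spf_pts K E) (k (point_hom K X U D x c))"
  unfolding p(1) by (rule S(2)[OF p(2)])
 finally show "point_hom K X U E y c = k (point_hom K X U D x c)"
  using homD(2)[OF k p(2)] by (intro point_hom_unique[OF E c]) simp_all
qed

end

section \<open>Test algebras: polynomial rings and completions inside the universe\<close>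

section \<open>Universal torsion-free algebras\<close>

subsection \<open>The polynomial algebra in countably many variables\<close>

type_synonym 'r mpoly = "(nat \<Rightarrow>\<^sub>0 nat) \<Rightarrow>\<^sub>0 'r"

definition poly_alg :: "('r::comm_ring_1, 'r mpoly) ralg" where
 "poly_alg = \<lparr>carrier = UNIV, monoid.mult = (*), one = 1, zero = 0, add = (+), alg = psing 0\<rparr>"

definition mvar :: "nat => 'r::comm_ring_1 mpoly" where
 "mvar i = psing (psing i 1) 1"

lemma poly_alg_sel [simp]:
 "carrier poly_alg = UNIV" "a **.poly_alg b = a * b" "\<one>.poly_alg = 1"
 "\<zero>.poly_alg = 0" "a ++.poly_alg b = a + b" "alg poly_alg r = psing 0 r"
 by (simp_all add: poly_alg_def)

lemma cring_poly_alg: "cring (poly_alg :: ('r::comm_ring_1, 'r mpoly) ralg)"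
proof (rule cringI)
 show "abelian_group (poly_alg :: ('r, 'r mpoly) ralg)"
 proof (rule abelian_groupI)
  show "EX y:carrier poly_alg. y ++.poly_alg x = \<zero>.poly_alg" for x :: "'r mpoly"
  by (auto intro: exI[of _ "- x"])
 qed (auto simp: algebra_simps)
 show "Group.comm_monoid (poly_alg :: ('r, 'r mpoly) ralg)"
  by (rule comm_monoidI) (auto simp: algebra_simps)
qed (auto simp: algebra_simps)

lemma ralgebra_poly_alg: "ralgebra poly_alg"
 unfolding ralgebra_def
 by (auto simp: cring_poly_alg mult_single single_add intro!: ring_hom_memI)

lemma poly_alg_minus [simp]:
 fixes a b :: "'a::comm_ring_1 mpoly"
 shows "\<ominus>.poly_alg a = - a" "a \<ominus>.poly_alg b = a - b"
proof -
 interpret cring "poly_alg :: ('a, 'a mpoly) ralg" by (rule cring_poly_alg)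
 show 1: "\<ominus>.poly_alg a = - a" for a :: "'a mpoly"
  by (rule minus_equality) auto
 show "a \<ominus>.poly_alg b = a - b" by (simp add: minus_eq 1)
qed

lemma poly_alg_pow [simp]: "a [^].poly_alg (n::nat) = a ^ n"
 by (induction n) (simp_all add: mult.commute)

lemma poly_alg_finsum [simp]:
 fixes f :: "'i => 'a::comm_ring_1 mpoly"
 shows "finite A ==> (\<Oplus>.poly_alg i\<in>A. f i) = (\<Sum>i\<in>A. f i)"
proof -
 interpret cring "poly_alg :: ('a, 'a mpoly) ralg" by (rule cring_poly_alg)
 show "finite A ==> (\<Oplus>.poly_alg i\<in>A. f i) = (\<Sum>i\<in>A. f i)"
  by (induction A rule: finite_induct) simp_all
qed

lemma lookup_scale: "plook (psing 0 s * p) m = s * plook (p :: 'r::comm_ring_1 mpoly) m"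
 unfolding mult_map_scale_conv_mult[symmetric] by (simp add: Poly_Mapping.map.rep_eq when_def)

lemma torsion_free_poly_alg:
 fixes a :: "'r::idom" assumes "a ~= 0" shows "torsion_free a poly_alg"
 unfolding torsion_free_def
proof (intro ballI impI)
 fix c :: "'r mpoly" assume "alg poly_alg a **.poly_alg c = \<zero>.poly_alg"
 hence "psing 0 a * c = 0" by simp
 hence "a * plook c m = 0" for m by (metis lookup_scale lookup_zero)
 thus "c = \<zero>.poly_alg" using assms by (intro poly_mapping_eqI) simp
qed

lemma poly_mapping_sum_induct [case_names single add]:
 assumes "!!m a. P (psing m a)" "!!f g. P f ==> P g ==> P (f + g)"
 shows "P (f :: 'a \<Rightarrow>\<^sub>0 'b::comm_monoid_add)"
proof -
 have "P (\<Sum>m\<in>A. psing m (plook f m))" if "finite A" for A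
  using that
 proof (induction A)
  case empty
  thus ?case using assms(1)[of undefined 0] by simp
 next
  case (insert x A)
  thus ?case using assms by simp
 qed
 moreover have "(\<Sum>m\<in>pkeys f. psing m (plook f m)) = f"
  by (intro poly_mapping_eqI)
  (simp add: lookup_sum lookup_single when_def sum.delta in_keys_iff)
 ultimately show ?thesis using finite_keys[of f] by metis
qed

context r_algebra begin

definition eval_mon :: "(nat => 'b) => (nat \<Rightarrow>\<^sub>0 nat) => 'b" where
 "eval_mon x m = (\<Otimes>i\<in>pkeys m. x i [^] plook m i)"

definition eval_poly :: "(nat => 'b) => 'r mpoly => 'b" where
 "eval_poly x f = (\<Oplus>m\<in>pkeys f. alg B (plook f m) ** eval_mon x m)"

context
 fixes x :: "nat => 'b"
 assumes x: "!!i. x i <: B"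
begin

lemma eval_mon_closed [simp]: "eval_mon x m <: B"
 unfolding eval_mon_def using x by (intro finprod_closed) auto

lemma eval_mon_superset:
 assumes "finite S" "pkeys m <= S"
 shows "eval_mon x m = (\<Otimes>i\<in>S. x i [^] plook m i)"
 unfolding eval_mon_def
 by (rule finprod_mono_neutral_cong_left) (use assms x in "auto simp: in_keys_iff")

lemma eval_mon_add: "eval_mon x (m + m') = eval_mon x m ** eval_mon x m'"
proof -
 let ?S = "pkeys m \<union> pkeys m'"
 have "eval_mon x (m + m') = (\<Otimes>i\<in>?S. x i [^] plook (m + m') i)"
  by (rule eval_mon_superset) (auto dest: keys_add[THEN subsetD])
 also have "... = (\<Otimes>i\<in>?S. x i [^] plook m i ** x i [^] plook m' i)"
  by (rule finprod_cong') (use x in "auto simp: lookup_add nat_pow_mult")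
 also have "... = (\<Otimes>i\<in>?S. x i [^] plook m i) ** (\<Otimes>i\<in>?S. x i [^] plook m' i)"
  by (rule finprod_multf) (use x in auto)
 also have "... = eval_mon x m ** eval_mon x m'"
  using eval_mon_superset[of ?S m] eval_mon_superset[of ?S m'] by simp
 finally show ?thesis .
qed

lemma eval_poly_closed [simp]: "eval_poly x f <: B"
 unfolding eval_poly_def by (intro finsum_closed) auto

lemma eval_poly_superset:
 assumes "finite S" "pkeys f <= S"
 shows "eval_poly x f = (\<Oplus>m\<in>S. alg B (plook f m) ** eval_mon x m)"
 unfolding eval_poly_def
 by (rule add.finprod_mono_neutral_cong_left) (use assms in "auto simp: in_keys_iff")

lemma eval_poly_add: "eval_poly x (f + g) = eval_poly x f ++ eval_poly x g"
proof -
 let ?S = "pkeys f \<union> pkeys g"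
 have "eval_poly x (f + g) = (\<Oplus>m\<in>?S. alg B (plook (f + g) m) ** eval_mon x m)"
  by (rule eval_poly_superset) (auto dest: keys_add[THEN subsetD])
 also have "... = (\<Oplus>m\<in>?S. alg B (plook f m) ** eval_mon x m ++ alg B (plook g m) ** eval_mon x m)"
  by (rule finsum_cong') (auto simp: lookup_add alg_add l_distr)
 also have "... = (\<Oplus>m\<in>?S. alg B (plook f m) ** eval_mon x m) ++ (\<Oplus>m\<in>?S. alg B (plook g m) ** eval_mon x m)"
  by (rule finsum_addf) auto
 also have "... = eval_poly x f ++ eval_poly x g"
  using eval_poly_superset[of ?S f] eval_poly_superset[of ?S g] by simp
 finally show ?thesis .
qed

lemma eval_poly_single: "eval_poly x (psing m a) = alg B a ** eval_mon x m"
 by (subst eval_poly_superset[of "{m}"]) (auto simp: lookup_single)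

lemma eval_poly_mult: "eval_poly x (f * g) = eval_poly x f ** eval_poly x g"
proof (induction f rule: poly_mapping_sum_induct)
 case (single m a)
 show ?case
 proof (induction g rule: poly_mapping_sum_induct)
  case (single m' b)
  show ?case by (simp add: mult_single eval_poly_single eval_mon_add alg_mult m_ac)
 next
  case (add f g)
  thus ?case by (simp add: distrib_left eval_poly_add r_distr)
 qed
next
 case (add f g')
 thus ?case by (simp add: distrib_right eval_poly_add l_distr)
qed

lemma eval_poly_alg: "eval_poly x (psing 0 r) = alg B r"
 by (simp add: eval_poly_single eval_mon_def)

lemma eval_poly_hom: "is_alg_hom poly_alg B (eval_poly x)"
 by (rule homI)
  (use eval_poly_alg[of 1] in "simp_all add: eval_poly_mult eval_poly_add eval_poly_alg")

lemma eval_poly_var: "eval_poly x (mvar i) = x i"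
 using x by (simp add: mvar_def eval_poly_single eval_mon_def finprod_insert)

end

end

subsection \<open>Completion\<close>

definition cauchy_alg :: "'r::comm_ring_1 => ('r, 'd) ralg => ('r, nat => 'd) ralg" where
 "cauchy_alg a D = \<lparr>carrier = {s. ALL m. cgr a m D (s (Suc m)) (s m)},
  monoid.mult = (%s t m. s m **.D t m), one = (%m. \<one>.D), zero = (%m. \<zero>.D),
  add = (%s t m. s m ++.D t m), alg = (%r m. alg D r)\<rparr>"

text \<open>A point of the completion is a coherent sequence of chosen representatives modulo \<open>a\<^sup>m\<close>.\<close>

definition completion :: "'r::comm_ring_1 => ('r, 'd) ralg => ('r, nat => 'd) ralg" where
 "completion a D = image_alg (%s m. crep D (pow_ideal a m D) (s m)) (cauchy_alg a D)"

locale completion_of = r_algebra D for a :: "'r::comm_ring_1" and D :: "('r, 'd) ralg" (structure)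
begin

abbreviation (input) E where "E \<equiv> completion a D"
abbreviation (input) C where "C \<equiv> cauchy_alg a D"
abbreviation (input) eqv where "eqv m \<equiv> cgr a m D"

lemma D_alg: "ralgebra D" using r_algebra_axioms by (simp add: r_algebra_iff)

lemmas eqv_sym = cong_sym[OF pow_ideal] and eqv_trans = cong_trans[OF pow_ideal]
 and eqv_refl = cong_refl[OF pow_ideal] and eqv_add = cong_add[OF pow_ideal]
 and eqv_mult = cong_mult[OF pow_ideal] and eqv_uminus = cong_uminus[OF pow_ideal]

lemma eqv_join: "eqv m x z ==> eqv m y z ==> eqv m x y"
 by (rule eqv_trans[OF _ eqv_sym])

lemma cauchy_sel: "carrier C = {s. ALL m. eqv m (s (Suc m)) (s m)}" "s **.C t = (%m. s m ** t m)"
 "\<one>.C = (%m. \<one>)" "\<zero>.C = (%m. \<zero>)" "s ++.C t = (%m. s m ++ t m)" "alg C r = (%m. alg D r)"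
 by (simp_all add: cauchy_alg_def)

lemma cauchy_closed: "s <: C ==> s m <: D"
 by (auto simp: cauchy_sel dest: cong_modD)

lemma cauchy_ralgebra: "ralgebra C"
proof -
 have "cring C"
 proof (rule cringI)
  show "abelian_group C"
  proof (rule abelian_groupI)
  fix s assume s: "s <: C"
  show "EX t:carrier C. t ++.C s = \<zero>.C"
  using s cauchy_closed[OF s] by (intro bexI[of _ "%m. \<ominus> s m"]) (auto simp: cauchy_sel l_neg intro: eqv_uminus)
  qed (use cauchy_closed in "auto simp: cauchy_sel a_ac intro: eqv_add eqv_refl")
  show "comm_monoid C"
  by (rule comm_monoidI) (use cauchy_closed in "auto simp: cauchy_sel m_ac intro: eqv_mult eqv_refl")
 qed (use cauchy_closed in "simp add: cauchy_sel l_distr")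
 thus ?thesis unfolding ralgebra_def
  by (auto intro!: ring_hom_memI eqv_refl simp: cauchy_sel alg_mult alg_add)
qed

definition lim_of :: "(nat => 'd) => nat => 'd" where "lim_of d = (%m. crep D (pow_ideal a m D) (d m))"

lemma lim_of_eq_iff:
 assumes "s <: C" "t <: C" shows "lim_of s = lim_of t <-> (ALL m. eqv m (s m) (t m))"
 using crep(3)[OF pow_ideal] cauchy_closed[OF assms(1)] cauchy_closed[OF assms(2)]
 by (simp add: lim_of_def fun_eq_iff cong_mod_def)

lemma lim_of_eqv: "d m <: D ==> eqv m (lim_of d m) (d m)"
 unfolding lim_of_def by (rule eqv_sym[OF crep(1)[OF pow_ideal]])

lemma eval_hom: "is_alg_hom C D (%s. s m)"
 by (rule homI) (auto simp: cauchy_sel dest: cong_modD)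

lemma null_ideal: "ideal {s : carrier C. ALL m. s m : pow_ideal a m D} C"
proof -
 interpret C: r_algebra C using cauchy_ralgebra ..
 note I = idealD[OF pow_ideal]
 show ?thesis by (rule idealI_cring) (use I cauchy_closed C.is_cring in "auto simp: cauchy_sel intro: eqv_add eqv_mult eqv_refl")
qed

lemma E_image: "E = image_alg lim_of C"
 by (simp add: completion_def lim_of_def[abs_def])

lemma E_ralgebra: "ralgebra E" and lim_of_hom: "is_alg_hom C E lim_of"
 and E_carrier: "carrier E = lim_of ` carrier C"
proof -
 interpret C: r_algebra C using cauchy_ralgebra ..
 have "lim_of s = lim_of t <-> s \<ominus>.C t : {s : carrier C. ALL m. s m : pow_ideal a m D}"
  if "s <: C" "t <: C" for s t
  using lim_of_eq_iff[OF that] cauchy_closed[OF that(1)] cauchy_closed[OF that(2)] C.minus_closed[OF that]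
  hom_more(3)[OF cauchy_ralgebra D_alg eval_hom that] by (simp add: cong_mod_def)
 from image_alg[OF cauchy_ralgebra null_ideal this]
 show "ralgebra E" "is_alg_hom C E lim_of" "carrier E = lim_of ` carrier C" unfolding E_image by auto
qed

lemma lim_of_closed: "(!!m. eqv m (d (Suc m)) (d m)) ==> lim_of d <: E"
 by (auto simp: E_carrier cauchy_sel)

lemma E_lim: assumes "s <: E" shows "s <: C" "lim_of s = s"
proof -
 obtain c where c: "c <: C" "s = lim_of c" using assms by (auto simp: E_carrier)
 have e: "eqv m (s m) (c m)" for m unfolding c(2) by (rule lim_of_eqv[OF cauchy_closed[OF c(1)]])
 have "eqv m (s (Suc m)) (s m)" for m
  by (rule eqv_trans[OF cong_mod_mono[OF e pow_ideal_antimono] eqv_join[OF _ e]]) (use c(1) in "auto simp: cauchy_sel")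
 thus s: "s <: C" by (simp add: cauchy_sel)
 show "lim_of s = s" using lim_of_eq_iff[OF s c(1)] e c(2) by simp
qed

lemma E_closed: "s <: E ==> s m <: D"
 and E_step: "s <: E ==> eqv m (s (Suc m)) (s m)"
 using cauchy_closed[OF E_lim(1)] E_lim(1) by (auto simp: cauchy_sel)

lemma E_le: "s <: E ==> m \<le> n ==> eqv m (s n) (s m)"
 by (rule cauchy_cong[OF E_step])

lemma E_eqI: assumes "s <: E" "t <: E" "!!m. eqv m (s m) (t m)" shows "s = t"
 using lim_of_eq_iff[of s t] E_lim assms by simp

lemma E_op_closed:
 "s <: E ==> t <: E ==> s **.E t <: E"
 "s <: E ==> t <: E ==> s ++.E t <: E"
 "\<one>.E <: E" "\<zero>.E <: E" "alg E r <: E"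
proof -
 interpret E: r_algebra E using E_ralgebra ..
 show "s <: E ==> t <: E ==> s **.E t <: E" "s <: E ==> t <: E ==> s ++.E t <: E"
  "\<one>.E <: E" "\<zero>.E <: E" "alg E r <: E" by auto
qed

text \<open>Sums and products in the completion are only congruent to the componentwise ones,
  because representatives are chosen anew.\<close>

lemma E_eqv:
 "s <: E ==> t <: E ==> eqv m ((s **.E t) m) (s m ** t m)"
 "s <: E ==> t <: E ==> eqv m ((s ++.E t) m) (s m ++ t m)"
 "eqv m (\<one>.E m) \<one>" "eqv m (\<zero>.E m) \<zero>" "eqv m (alg E r m) (alg D r)"
 "s <: E ==> t <: E ==> eqv m ((s \<ominus>.E t) m) (s m \<ominus> t m)"
proof -
 interpret C: r_algebra C using cauchy_ralgebra ..
 have L: "eqv m (lim_of c m) (c m)" if "c <: C" for c m by (rule lim_of_eqv[OF cauchy_closed[OF that]])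
 note h = homD[OF lim_of_hom] hom_more[OF cauchy_ralgebra E_ralgebra lim_of_hom]
 show "eqv m (\<one>.E m) \<one>" "eqv m (\<zero>.E m) \<zero>" "eqv m (alg E r m) (alg D r)"
  using L[OF C.one_closed, of m] L[OF C.zero_closed, of m] L[OF C.alg_closed, of m r]
  unfolding h(3,6,7) unfolding cauchy_sel(3,4,6) by auto
 show "eqv m ((s **.E t) m) (s m ** t m)" "eqv m ((s ++.E t) m) (s m ++ t m)"
  "eqv m ((s \<ominus>.E t) m) (s m \<ominus> t m)" if "s <: E" "t <: E"
 proof -
  note st = E_lim(1)[OF that(1)] E_lim(1)[OF that(2)]
  show "eqv m ((s **.E t) m) (s m ** t m)" "eqv m ((s ++.E t) m) (s m ++ t m)"
  "eqv m ((s \<ominus>.E t) m) (s m \<ominus> t m)"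
  using L[OF C.m_closed[OF st], of m] L[OF C.a_closed[OF st], of m] L[OF C.minus_closed[OF st], of m] st
  by (simp_all add: h E_lim that homD[OF eval_hom] hom_more(3)[OF cauchy_ralgebra D_alg eval_hom])
 qed
qed

definition to_compl :: "'d => nat => 'd" where "to_compl d = lim_of (%m. d)"

lemma to_completion_hom: "is_alg_hom D E to_compl"
proof -
 have "is_alg_hom D C (%d m. d)" by (rule homI) (auto simp: cauchy_sel intro: eqv_refl)
 from hom_comp[OF this lim_of_hom] show ?thesis by (simp add: to_compl_def[abs_def])
qed

lemma to_completion_closed: "x <: D ==> to_compl x <: E"
 by (rule homD(2)[OF to_completion_hom])

lemma to_completion_eqv: "x <: D ==> eqv m (to_compl x m) x"
 unfolding to_compl_def by (rule lim_of_eqv)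

lemma eqv_zero_iff: "x <: D ==> eqv m x \<zero> <-> x : pow_ideal a m D"
 by (rule cong_zero_iff[OF pow_ideal])

context
 assumes tf: "torsion_free a D"
begin

text \<open>If \<open>s m\<close> is divisible by \<open>a^m\<close>, so are all later members. By
  torsion-freeness the quotients of \<open>s (m + k)\<close> by \<open>a^m\<close> are coherent
  modulo \<open>a^k\<close>, and their limit is the quotient of \<open>s\<close>.\<close>

lemma E_pow_ideal_iff:
 assumes s: "s <: E" shows "s : pow_ideal a m E <-> s m : pow_ideal a m D"
proof
 interpret E: r_algebra E using E_ralgebra ..
 assume "s : pow_ideal a m E"
 then obtain t where t: "t <: E" "s = alg E (a ^ m) **.E t" by (rule E.pow_idealE)
 have "eqv m (s m) (alg D (a ^ m) ** t m)"
  unfolding t(2) by (rule eqv_trans[OF E_eqv(1) eqv_mult[OF E_eqv(5) eqv_refl]]) (use t E_closed in auto)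
 thus "s m : pow_ideal a m D"
  using cong_mem[OF pow_ideal] pow_idealI[of "t m"] E_closed[OF t(1)] by blast
next
 interpret E: r_algebra E using E_ralgebra ..
 assume sm: "s m : pow_ideal a m D"
 have "s (m + k) : pow_ideal a m D" for k
  using cong_mem[OF pow_ideal E_le[OF s, of m "m + k"]] sm by simp
 hence "EX e. e <: D & s (m + k) = alg D (a ^ m) ** e" for k by (auto simp: pow_ideal_def)
 then obtain e where e: "!!k. e k <: D" "!!k. s (m + k) = alg D (a ^ m) ** e k" by metis
 have ek: "eqv k (e (Suc k)) (e k)" for k
 proof -
  have "s (m + Suc k) \<ominus> s (m + k) : pow_ideal a (m + k) D"
  using E_step[OF s, of "m + k"] by (simp add: cong_mod_def)
  then obtain y where y: "y <: D" "s (m + Suc k) \<ominus> s (m + k) = alg D (a ^ (m + k)) ** y"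
  by (rule pow_idealE)
  have "alg D (a ^ m) ** (e (Suc k) \<ominus> e k) = alg D (a ^ m) ** (alg D (a ^ k) ** y)"
  using y e(1) unfolding e(2) by (simp add: minus_eq r_distr r_minus power_add alg_mult m_assoc)
  hence "e (Suc k) \<ominus> e k = alg D (a ^ k) ** y"
  by (rule torsion_free_cancel[OF D_alg tf _ _, rotated 2]) (use e(1) y(1) in auto)
  thus ?thesis using e(1) y(1) by (simp add: cong_mod_def pow_idealI[of y])
 qed
 define t where "t = lim_of e"
 have t: "t <: E" unfolding t_def by (rule lim_of_closed[OF ek])
 have tk: "eqv k (t k) (e k)" for k unfolding t_def by (rule lim_of_eqv[OF e(1)])
 have "s = alg E (a ^ m) **.E t"
 proof (rule E_eqI[OF s])
  fix k
  have "eqv k ((alg E (a ^ m) **.E t) k) (s (m + k))"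
  unfolding e(2) by (rule eqv_trans[OF E_eqv(1) eqv_mult[OF E_eqv(5) tk]]) (use t in auto)
  thus "eqv k (s k) ((alg E (a ^ m) **.E t) k)"
  by (rule eqv_join[OF eqv_sym[OF E_le[OF s]], rotated]) simp
 qed (use t in simp)
 thus "s : pow_ideal a m E" by (rule E.pow_idealI[OF t])
qed

lemma E_cong_iff:
 assumes "s <: E" "t <: E"
 shows "cgr a m E s t <-> eqv m (s m) (t m)"
proof -
 interpret E: r_algebra E using E_ralgebra ..
 have d: "s \<ominus>.E t <: E" using assms by simp
 have "cgr a m E s t <-> (s \<ominus>.E t) m : pow_ideal a m D"
  using E_pow_ideal_iff[OF d] assms by (simp add: cong_mod_def)
 also have "... <-> s m \<ominus> t m : pow_ideal a m D"
  by (rule cong_mem[OF pow_ideal E_eqv(6)[OF assms]])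
 finally show ?thesis using E_closed assms by (simp add: cong_mod_def)
qed

text \<open>The limit is the diagonal sequence, since congruence modulo \<open>a^m\<close> in
  \<open>E\<close> is congruence of the \<open>m\<close>-th members.\<close>

lemma E_complete: "adic_complete a E"
proof (rule adic_completeI[OF E_ralgebra])
 fix s assume s: "s <: E" "!!m. s : pow_ideal a m E"
 show "s = \<zero>.E"
 proof (rule E_eqI[OF s(1) E_op_closed(4)])
  fix m
  have "eqv m (s m) \<zero>" using s E_pow_ideal_iff E_closed by (simp add: eqv_zero_iff)
  thus "eqv m (s m) (\<zero>.E m)" by (rule eqv_join[OF _ E_eqv(4)])
 qed
next
 fix \<sigma> assume *: "!!m. cgr a m E (\<sigma> (Suc m)) (\<sigma> m)"
 hence sE: "\<sigma> m <: E" for m by (rule cong_modD)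
 have step: "eqv m (\<sigma> (Suc m) (Suc m)) (\<sigma> m m)" for m
  by (rule eqv_trans[OF E_step[OF sE]]) (use *[of m] E_cong_iff[OF sE sE] in simp)
 let ?c = "lim_of (%m. \<sigma> m m)"
 have c: "?c <: E" by (rule lim_of_closed[OF step])
 have "cgr a m E ?c (\<sigma> m)" for m
  unfolding E_cong_iff[OF c sE] by (rule lim_of_eqv) (rule E_closed[OF sE])
 thus "EX c:carrier E. ALL m. cgr a m E c (\<sigma> m)" using c by blast
qed

lemma E_torsion_free: "torsion_free a E"
 unfolding torsion_free_def
proof (intro ballI impI)
 fix s assume s: "s <: E" and z: "alg E a **.E s = \<zero>.E"
 show "s = \<zero>.E"
 proof (rule E_eqI[OF s E_op_closed(4)])
  fix m
  \<comment> \<open>Cancelling \<open>a\<close> costs one level, so the vanishing of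
    \<open>s\<close> at level \<open>m\<close> is read off level \<open>m + 1\<close>.\<close>
  have "eqv (Suc m) (alg D a ** s (Suc m)) ((alg E a **.E s) (Suc m))"
  by (rule eqv_sym[OF eqv_trans[OF E_eqv(1) eqv_mult[OF E_eqv(5) eqv_refl]]]) (use s E_closed E_op_closed in auto)
  hence "eqv (Suc m) (alg D a ** s (Suc m)) \<zero>" unfolding z by (rule eqv_trans[OF _ E_eqv(4)])
  hence "alg D a ** s (Suc m) : pow_ideal a (Suc m) D" using E_closed[OF s] by (simp add: eqv_zero_iff)
  then obtain y where y: "y <: D" "alg D a ** s (Suc m) = alg D (a ^ Suc m) ** y" by (rule pow_idealE)
  have "s (Suc m) = alg D (a ^ m) ** y"
  by (rule torsion_free_cancel[OF D_alg tf, where m = 1])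
  (use y E_closed[OF s] in "simp_all add: alg_mult m_assoc")
  hence "s (Suc m) : pow_ideal a m D" using y by (intro pow_idealI) auto
  hence "eqv m (s (Suc m)) \<zero>" using E_closed[OF s] by (simp add: eqv_zero_iff)
  hence "eqv m (s m) \<zero>" by (rule eqv_trans[OF eqv_sym[OF E_step[OF s]]])
  thus "eqv m (s m) (\<zero>.E m)" by (rule eqv_join[OF _ E_eqv(4)])
 qed
qed

lemma E_dense:
 assumes "s <: E"
 shows "cgr a m E s (to_compl (s m))"
 unfolding E_cong_iff[OF assms to_completion_closed[OF E_closed[OF assms]]]
 by (rule eqv_sym[OF to_completion_eqv[OF E_closed[OF assms]]])

end

text \<open>The values are the limits of \<open>h (s m)\<close>. A limit is determined by its
  congruences, so compatibility with the operations is checked level by level.\<close>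

lemma E_extend:
 assumes B: "adic_complete a B" and h: "is_alg_hom D B h"
 obtains g where "is_alg_hom E B g" "!!d. d <: D ==> g (to_compl d) = h d"
  "!!s m. s <: E ==> cgr a m B (g s) (h (s m))"
proof -
 have rB: "ralgebra B" by (rule adicD(1)[OF B])
 interpret B: r_algebra B using rB ..
 note hc = hom_cong_mod[OF D_alg rB h]
 have "EX b. ALL m. cgr a m B b (h (s m))" if s: "s <: E" for s
  using adicD(3)[OF B, of "%m. h (s m)"] hc[OF E_step[OF s]] by blast
 then obtain g where g: "!!s m. s <: E ==> cgr a m B (g s) (h (s m))" by metis
 note bt = B.cong_trans[OF B.pow_ideal] and bs = B.cong_sym[OF B.pow_ideal]
 have gl: "g s = b" if "s <: E" "!!m. cgr a m B b (h (s m))" for s b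
  by (rule adic_complete_eqI[OF B]) (rule bt[OF g[OF that(1)] bs[OF that(2)]])
 have "is_alg_hom E B g"
 proof (rule homI)
  show "g x <: B" if "x <: E" for x using g[OF that] by (rule cong_modD)
  show "g (alg E r) = alg B r" for r
  by (rule gl[OF E_op_closed(5)]) (use bs[OF hc[OF E_eqv(5)]] homD(3)[OF h] in simp)
  show "g \<one>.E = \<one>.B"
  by (rule gl[OF E_op_closed(3)]) (use bs[OF hc[OF E_eqv(3)]] homD(6)[OF h] in simp)
  fix s t assume st: "s <: E" "t <: E"
  note c = E_closed[OF st(1)] E_closed[OF st(2)]
  show "g (s **.E t) = g s **.B g t"
  proof (rule gl[OF E_op_closed(1)[OF st]])
  fix m
  have "cgr a m B (g s **.B g t) (h (s m) **.B h (t m))"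
  by (rule B.cong_mult[OF B.pow_ideal g[OF st(1)] g[OF st(2)]])
  hence "cgr a m B (g s **.B g t) (h (s m ** t m))"
  using homD(4)[OF h c, of m m] by simp
  thus "cgr a m B (g s **.B g t) (h ((s **.E t) m))"
  by (rule bt[OF _ bs[OF hc[OF E_eqv(1)[OF st]]]])
  qed
  show "g (s ++.E t) = g s ++.B g t"
  proof (rule gl[OF E_op_closed(2)[OF st]])
  fix m
  have "cgr a m B (g s ++.B g t) (h (s m) ++.B h (t m))"
  by (rule B.cong_add[OF B.pow_ideal g[OF st(1)] g[OF st(2)]])
  hence "cgr a m B (g s ++.B g t) (h (s m ++ t m))"
  using homD(5)[OF h c, of m m] by simp
  thus "cgr a m B (g s ++.B g t) (h ((s ++.E t) m))"
  by (rule bt[OF _ bs[OF hc[OF E_eqv(2)[OF st]]]])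
  qed
 qed
 moreover have "g (to_compl d) = h d" if "d <: D" for d
  by (rule gl[OF to_completion_closed[OF that]]) (rule bs[OF hc[OF to_completion_eqv[OF that]]])
 ultimately show thesis using g that by blast
qed

end

section \<open>The base ring\<close>

text \<open>The two families of ideals define the same topology. This turns the given completeness
  for \<open>p\<close> into completeness for \<pi>.\<close>

lemma adic_complete_coarsen:
 assumes b: "adic_complete b C" and e: "e \<ge> 1" and eq: "!!m. pow_ideal a (e * m) C = pow_ideal b m C"
 shows "adic_complete a C"
proof -
 have rC: "ralgebra C" by (rule adicD(1)[OF b])
 interpret r_algebra C using rC ..
 show ?thesis
 proof (rule adic_completeI[OF rC])
  fix c assume *: "!!m. c : pow_ideal a m C"
  have "c : pow_ideal b m C" for m using *[of "e * m"] eq[of m] by simp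
  thus "c = \<zero>.C" by (rule adicD(2)[OF b])
 next
  fix s assume s: "!!m. cgr a m C (s (Suc m)) (s m)"
  have le: "m \<le> e * m" for m using e by (cases e) auto
  have "cgr b m C (s (e * Suc m)) (s (e * m))" for m
  using cauchy_cong[OF s, of "e * m" "e * Suc m"] eq[of m] by simp
  then obtain c where c: "c <: C" "!!m. cgr b m C c (s (e * m))"
  using adicD(3)[OF b, of "%m. s (e * m)"] by blast
  have "cgr a m C c (s m)" for m
  proof (rule cong_trans[OF pow_ideal])
  show "cgr a m C c (s (e * m))"
  by (rule cong_mod_mono[OF c(2)]) (use eq[of m, symmetric] pow_ideal_antimono[OF le[of m]] in simp)
  show "cgr a m C (s (e * m)) (s m)" by (rule cauchy_cong[OF s le])
  qed
  thus "EX c:carrier C. ALL m. cgr a m C c (s m)" using c(1) by blast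
 qed
qed

lemma (in r_algebra) pow_ideal_unit:
 assumes "u dvd 1" "a ^ k = u * b" shows "pow_ideal a k B = pow_ideal b 1 B"
proof -
 obtain v where v: "1 = u * v" using assms(1) by (rule dvdE)
 have "v * a ^ k = (u * v) * b" by (simp only: assms(2) ac_simps)
 hence b: "b = v * a ^ k" using v by simp
 show ?thesis
 proof
  show "pow_ideal a k B <= pow_ideal b 1 B"
  proof
  fix x assume "x : pow_ideal a k B"
  then obtain c where c: "c <: B" "x = alg B (a ^ k) ** c" by (rule pow_idealE)
  thus "x : pow_ideal b 1 B"
  by (intro pow_idealI[of "alg B u ** c"]) (auto simp: assms(2) alg_mult m_ac)
  qed
  show "pow_ideal b 1 B <= pow_ideal a k B"
  proof
  fix x assume "x : pow_ideal b 1 B"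
  then obtain c where c: "c <: B" "x = alg B (b ^ 1) ** c" by (rule pow_idealE)
  hence "x = alg B b ** c" by simp
  hence "x = alg B (v * a ^ k) ** c" using b by simp
  thus "x : pow_ideal a k B" using c(1)
  by (intro pow_idealI[of "alg B v ** c"]) (auto simp: alg_mult m_ac)
  qed
 qed
qed

locale base_ring =
 fixes p :: nat and K :: "'r::idom base"
 assumes base: "base_data p K"
begin

abbreviation (input) \<pi> where "\<pi> \<equiv> unif K"
abbreviation (input) q where "q \<equiv> resq K"
abbreviation (input) \<phi> where "\<phi> \<equiv> frob K"

lemma prime_p: "prime p" using base by (simp add: base_data_def)

lemma pi_nz: "\<pi> ~= 0" and pi_nunit: "\<not> \<pi> dvd 1" using base by (simp_all add: base_data_def)

lemma q_pow: "\<exists>h\<ge>1. q = p ^ h" using base by (simp add: base_data_def)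

lemma q_ge2: "q \<ge> 2"
proof -
 obtain h where h: "h \<ge> 1" "q = p ^ h" using q_pow by blast
 have "p ^ 1 \<le> p ^ h" using h(1) prime_ge_1_nat[OF prime_p] by (intro power_increasing) auto
 thus ?thesis using prime_ge_2_nat[OF prime_p] h(2) by simp
qed

lemma dvr: "x ~= 0 ==> EX u k. u dvd 1 & x = u * \<pi> ^ k" using base by (simp add: base_data_def)

lemma ramification: "EX e u. 1 \<le> e & u dvd 1 & of_nat p = u * \<pi> ^ e"
 using base unfolding base_data_def by blast

lemma pi_dvd_p: "\<pi> dvd of_nat p"
proof -
 obtain e u where e: "1 \<le> e" "of_nat p = u * \<pi> ^ e" using ramification by blast
 have "\<pi> dvd \<pi> ^ e" using e(1) by (simp add: dvd_power)
 thus ?thesis using e(2) by simp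
qed

lemma unit_or_dvd: "x dvd 1 \<or> \<pi> dvd x"
proof (cases "x = 0")
 case False
 then obtain u k where "u dvd 1" "x = u * \<pi> ^ k" using dvr by blast
 thus ?thesis by (cases k) auto
qed simp

lemma pi_prime: assumes "\<pi> dvd x * y" shows "\<pi> dvd x \<or> \<pi> dvd y"
 using unit_or_dvd[of x]
proof
 assume "x dvd 1"
 then obtain v where v: "1 = x * v" by (rule dvdE)
 have "\<pi> dvd v * (x * y)" using assms by simp
 also have "v * (x * y) = (x * v) * y" by (simp only: ac_simps)
 also have "... = y" using v by simp
 finally show ?thesis ..
qed simp

lemma pi_power_dvd_zero: assumes "!!m. \<pi> ^ m dvd x" shows "x = 0"
proof (rule ccontr)
 assume "x ~= 0"
 then obtain u k where u: "u dvd 1" "x = u * \<pi> ^ k" using dvr by blast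
 have "\<pi> * \<pi> ^ k dvd u * \<pi> ^ k" using assms[of "Suc k"] u(2) by simp
 hence "\<pi> dvd u" using pi_nz by simp
 thus False using u(1) pi_nunit dvd_trans by blast
qed

lemma frob_simps: "\<phi> (a + b) = \<phi> a + \<phi> b" "\<phi> (a * b) = \<phi> a * \<phi> b" "\<phi> 1 = 1"
 using base unfolding base_data_def by (auto simp: ring_hom_def)

lemma frob_0: "\<phi> 0 = 0"
proof -
 have "\<phi> 0 + 0 = \<phi> 0 + \<phi> 0" using frob_simps(1)[of 0 0] by (simp only: add_0_right)
 thus ?thesis by (simp only: add_left_cancel)
qed

lemma frob_power: "\<phi> (a ^ n) = \<phi> a ^ n" by (induction n) (simp_all add: frob_simps)

lemma frob_of_nat: "\<phi> (of_nat n) = of_nat n" by (induction n) (simp_all add: frob_simps frob_0)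

lemma frob_cong: "\<pi> dvd \<phi> x - x ^ q" using base by (simp add: base_data_def)

lemma base_complete: "adic K (base_alg :: ('r, 'r) ralg)"
proof -
 obtain e u where e: "1 \<le> e" "u dvd 1" "of_nat p = u * \<pi> ^ e" using ramification by blast
 obtain v where v: "1 = u * v" using e(2) by (rule dvdE)
 interpret r_algebra "base_alg :: ('r, 'r) ralg" using ralgebra_base_alg ..
 show ?thesis
 proof (rule adic_complete_coarsen[OF _ e(1)])
  show "adic_complete (of_nat p) (base_alg :: ('r, 'r) ralg)" using base by (simp add: base_data_def)
  show "pow_ideal \<pi> (e * m) (base_alg :: ('r, 'r) ralg) = pow_ideal (of_nat p) m base_alg" for m
  proof -
  have "v ^ m * of_nat p ^ m = (u * v) ^ m * \<pi> ^ (e * m)"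
  by (simp only: e(3) power_mult power_mult_distrib ac_simps)
  hence "\<pi> ^ (e * m) = v ^ m * of_nat p ^ m" using v by simp
  moreover have "v ^ m dvd 1"
  proof (rule dvdI)
  have "(u * v) ^ m = 1" using v by simp
  thus "1 = v ^ m * u ^ m" by (simp only: power_mult_distrib mult.commute)
  qed
  ultimately have "pow_ideal \<pi> (e * m) (base_alg :: ('r, 'r) ralg) = pow_ideal (of_nat p ^ m) 1 base_alg"
  by (intro pow_ideal_unit) auto
  thus ?thesis by (simp add: pow_ideal_def)
  qed
 qed
qed

end

section \<open>Universal algebras inside the universe\<close>

lemma ex_inj_monomials: "\<exists>f :: (nat \<Rightarrow>\<^sub>0 nat) => nat. inj f"
proof -
 let ?f = "%m :: nat \<Rightarrow>\<^sub>0 nat. map (%k. (k, plook m k)) (sorted_list_of_set (pkeys m))"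
 have "inj ?f"
 proof (rule injI)
  fix m m' assume "?f m = ?f m'"
  hence eq: "set (?f m) = set (?f m')" by simp
  have set: "set (?f m) = {(k, v). v = plook m k & v ~= 0}" for m
  by (auto simp: in_keys_iff)
  show "m = m'"
  proof (rule poly_mapping_eqI)
  fix k
  show "plook m k = plook m' k"
  using eq[unfolded set, THEN eqset_imp_iff, of "(k, plook m k)"]
  eq[unfolded set, THEN eqset_imp_iff, of "(k, plook m' k)"] by auto
  qed
 qed
 hence "inj (to_nat \<circ> ?f)" by (intro inj_compose inj_to_nat)
 thus ?thesis by (rule exI[of "%f. inj f"])
qed

lemma torsion_free_iso:
 assumes "torsion_free a C" "ralgebra C" "ralgebra D" "is_alg_hom D C g" "inj_on g (carrier D)"
 shows "torsion_free a D"
 unfolding torsion_free_def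
proof (intro ballI impI)
 fix c assume c: "c <: D" "alg D a **.D c = \<zero>.D"
 interpret D: r_algebra D using assms(3) ..
 note g = homD[OF assms(4)] hom_more[OF assms(3,2,4)]
 have "alg C a **.C g c = \<zero>.C" using g(4)[of "alg D a" c] c g(3,7) by simp
 hence "g c = \<zero>.C" using assms(1) g(2)[OF c(1)] by (simp add: torsion_free_def)
 thus "c = \<zero>.D" using inj_onD[OF assms(5), of c "\<zero>.D"] c(1) g(7) by simp
qed

text \<open>Coding sequences in \<open>'b\<close> and scalars by elements of \<open>'b\<close> makes
  room for polynomial algebras and their completions in the one type on which the functors are
  defined.\<close>

locale universe = base_ring p K for p :: nat and K :: "'r::idom base" +
 fixes u :: "'b itself"
 assumes ex_iota: "\<exists>\<iota> :: (nat => 'b) => 'b. inj \<iota>" and ex_kappa: "\<exists>kp :: 'r => 'b. inj kp"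
begin

definition seq_code :: "(nat => 'b) => 'b" where "seq_code = (SOME f. inj f)"
definition scalar_code :: "'r => 'b" where "scalar_code = (SOME f. inj f)"

lemma inj_seq_code: "inj seq_code" unfolding seq_code_def by (rule someI_ex[OF ex_iota])
lemma inj_scalar_code: "inj scalar_code" unfolding scalar_code_def by (rule someI_ex[OF ex_kappa])

definition mon_code :: "(nat \<Rightarrow>\<^sub>0 nat) => nat" where "mon_code = (SOME f. inj f)"

lemma inj_mon_code: "inj mon_code" unfolding mon_code_def by (rule someI_ex[OF ex_inj_monomials])

definition poly_code :: "'r mpoly => 'b" where
 "poly_code f = seq_code (%n. scalar_code (plook f (inv_into UNIV mon_code n)))"

lemma inj_poly_code: "inj poly_code"
proof (rule injI)
 fix f g assume "poly_code f = poly_code g"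
 hence "plook f (inv_into UNIV mon_code n) = plook g (inv_into UNIV mon_code n)" for n
  using injD[OF inj_seq_code] injD[OF inj_scalar_code] unfolding poly_code_def by metis
 thus "f = g" using inv_f_f[OF inj_mon_code] by (metis poly_mapping_eqI)
qed

text \<open>The polynomial algebra in countably many variables, copied into \<open>'b\<close>.
  Identities of Witt vectors are verified here.\<close>

definition univ :: "('r, 'b) ralg" where "univ = image_alg poly_code poly_alg"
definition uvar :: "nat => 'b" where "uvar i = poly_code (mvar i)"

lemma poly_code_hom: "is_alg_hom poly_alg univ poly_code"
 and poly_code_inv_hom: "is_alg_hom univ poly_alg (inv_into UNIV poly_code)"
 and poly_code_bij: "bij_betw poly_code UNIV (carrier univ)"
 and univ_ralgebra: "ralgebra univ"
 using image_alg_inj[OF ralgebra_poly_alg inj_on_subset[OF inj_poly_code]] unfolding univ_def by auto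

lemma inv_poly_code [simp]: "inv_into UNIV poly_code (poly_code f) = f"
 by (rule inv_f_f[OF inj_poly_code])

lemma poly_code_inv: "x <: univ ==> poly_code (inv_into UNIV poly_code x) = x"
 using poly_code_bij by (auto simp: bij_betw_def f_inv_into_f)

lemma uvar_closed [simp]: "uvar i <: univ"
 using homD(2)[OF poly_code_hom] by (simp add: uvar_def)

lemma univ_tf: "torsion_free \<pi> univ"
 by (rule torsion_free_iso[OF torsion_free_poly_alg[OF pi_nz] ralgebra_poly_alg univ_ralgebra poly_code_inv_hom])
  (use poly_code_bij in "auto simp: bij_betw_def intro: inj_on_inv_into")

lemma univ_map:
 fixes B :: "('r, 'd) ralg"
 assumes B: "ralgebra B" and x: "!!i. x i <: B"
 obtains h where "h : alg_hom univ B" "!!i. h (uvar i) = x i"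
proof -
 interpret r_algebra B using B ..
 let ?h = "%c. eval_poly x (inv_into UNIV poly_code c)"
 have h: "is_alg_hom univ B ?h" by (rule hom_comp[OF poly_code_inv_hom eval_poly_hom[OF x]])
 have "restrict ?h (carrier univ) (uvar i) = x i" for i
  using eval_poly_var[of x i, OF x] uvar_closed[of i] by (simp add: uvar_def)
 thus thesis using that[OF restrict_hom[OF univ_ralgebra h]] by blast
qed

text \<open>Jet kernels and characters are evaluated on complete algebras only, so their generic
  points need the completion of \<open>univ\<close>, again copied into \<open>'b\<close>.\<close>

definition cuniv :: "('r, 'b) ralg" where "cuniv = image_alg seq_code (completion \<pi> univ)"
definition cuvar :: "nat => 'b" where "cuvar i = seq_code (completion_of.to_compl \<pi> univ (uvar i))"

lemma completion_univ: "completion_of univ"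
 by (simp add: completion_of_def r_algebra_iff univ_ralgebra)

sublocale cmpl: completion_of \<pi> univ by (rule completion_univ)

lemma cuniv_facts:
 "ralgebra cuniv" "is_alg_hom (completion \<pi> univ) cuniv seq_code"
 "is_alg_hom cuniv (completion \<pi> univ) (inv_into (carrier (completion \<pi> univ)) seq_code)"
 "bij_betw seq_code (carrier (completion \<pi> univ)) (carrier cuniv)"
 using image_alg_inj[OF cmpl.E_ralgebra inj_on_subset[OF inj_seq_code subset_UNIV]] unfolding cuniv_def by auto

lemma cuniv_complete: "adic K cuniv"
 by (rule adic_complete_iso[OF cmpl.E_complete[OF univ_tf] cuniv_facts(1,2,4)])

lemma cuniv_torsion_free: "torsion_free \<pi> cuniv"
 by (rule torsion_free_iso[OF cmpl.E_torsion_free[OF univ_tf] cmpl.E_ralgebra cuniv_facts(1,3)])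
  (use cuniv_facts(4) in "auto simp: bij_betw_def intro: inj_on_inv_into")

definition to_cuniv :: "'b => 'b" where "to_cuniv d = seq_code (cmpl.to_compl d)"

lemma to_cuniv_hom: "is_alg_hom univ cuniv to_cuniv"
 unfolding to_cuniv_def by (rule hom_comp[OF cmpl.to_completion_hom cuniv_facts(2)])

lemma cuvar_eq: "cuvar i = to_cuniv (uvar i)" by (simp add: cuvar_def to_cuniv_def)

lemma cuvar_closed [simp]: "cuvar i <: cuniv"
 unfolding cuvar_eq by (rule homD(2)[OF to_cuniv_hom uvar_closed])

lemma cuniv_map:
 fixes B :: "('r, 'd) ralg"
 assumes B: "adic K B" and x: "!!i. x i <: B"
 obtains h where "h : alg_hom cuniv B" "!!i. h (cuvar i) = x i"
proof -
 obtain h where h: "h : alg_hom univ B" "!!i. h (uvar i) = x i"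
  by (rule univ_map[where x = x, OF adicD(1)[OF B] x]) (rule that)
 obtain g where g: "is_alg_hom (completion \<pi> univ) B g" "!!d. d <: univ ==> g (cmpl.to_compl d) = h d"
  by (rule cmpl.E_extend[OF B alg_homD[OF h(1)]]) (rule that)
 let ?k = "%c. g (inv_into (carrier (completion \<pi> univ)) seq_code c)"
 have k: "is_alg_hom cuniv B ?k" by (rule hom_comp[OF cuniv_facts(3) g(1)])
 have "restrict ?k (carrier cuniv) (cuvar i) = x i" for i
 proof -
  have "?k (cuvar i) = g (cmpl.to_compl (uvar i))"
  using cmpl.to_completion_closed[OF uvar_closed] inv_into_f_f[OF inj_on_subset[OF inj_seq_code subset_UNIV]]
  by (simp add: cuvar_def)
  thus ?thesis using g(2)[OF uvar_closed] h(2) by simp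
 qed
 thus thesis using that[OF restrict_hom[OF cuniv_facts(1) k]] by blast
qed

lemma cuniv_dense:
 assumes "x <: cuniv"
 shows "EX d:carrier univ. cgr \<pi> m cuniv x (to_cuniv d)"
proof -
 let ?E = "completion \<pi> univ"
 obtain s where s: "s <: ?E" "x = seq_code s" using cuniv_facts(4) assms by (auto simp: bij_betw_def)
 have "cgr \<pi> m cuniv (seq_code s) (seq_code (cmpl.to_compl (s m)))"
  by (rule hom_cong_mod[OF cmpl.E_ralgebra cuniv_facts(1,2) cmpl.E_dense[OF univ_tf s(1)]])
 thus ?thesis using s cmpl.E_closed[OF s(1)] unfolding to_cuniv_def by blast
qed

text \<open>Completion creates no new congruences, because congruence modulo \<open>\<pi>^m\<close>
  is decided by the \<open>m\<close>-th members of the sequences. Coefficients can thus be compared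
  through images in the completion.\<close>

lemma to_cuniv_cong_iff:
 assumes "d <: univ" "d' <: univ"
 shows "cgr \<pi> m cuniv (to_cuniv d) (to_cuniv d') <-> cgr \<pi> m univ d d'"
proof
 let ?E = "completion \<pi> univ" and ?g = "inv_into (carrier (completion \<pi> univ)) seq_code"
 note c = cmpl.to_completion_closed[OF assms(1)] cmpl.to_completion_closed[OF assms(2)]
 assume "cgr \<pi> m cuniv (to_cuniv d) (to_cuniv d')"
 from hom_cong_mod[OF cuniv_facts(1) cmpl.E_ralgebra cuniv_facts(3) this]
 have "cgr \<pi> m ?E (cmpl.to_compl d) (cmpl.to_compl d')"
  unfolding to_cuniv_def using c inv_into_f_f[OF inj_on_subset[OF inj_seq_code subset_UNIV]] by simp
 hence e: "cgr \<pi> m univ (cmpl.to_compl d m) (cmpl.to_compl d' m)"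
  by (simp add: cmpl.E_cong_iff[OF univ_tf c])
 show "cgr \<pi> m univ d d'"
  by (rule cmpl.eqv_trans[OF cmpl.eqv_sym[OF cmpl.to_completion_eqv[OF assms(1)]]
  cmpl.eqv_trans[OF e cmpl.to_completion_eqv[OF assms(2)]]])
qed (rule hom_cong_mod[OF univ_ralgebra cuniv_facts(1) to_cuniv_hom])

end

section \<open>Witt vectors through ghost components\<close>

section \<open>Ghost components\<close>

text \<open>The cofactor of \<open>a - b\<close> in \<open>a^p - b^p\<close> has \<open>p\<close>
  summands, all congruent to \<open>b^(p - 1)\<close> modulo \<open>c\<close>, so it is itself
  divisible by \<open>c\<close>.\<close>

lemma power_p_cong:
 fixes a b c :: "'a::comm_ring_1"
 assumes p: "c dvd of_nat p" and ab: "c ^ j dvd a - b" and j: "j \<ge> 1"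
 shows "c ^ Suc j dvd a ^ p - b ^ p"
proof -
 have "c dvd c ^ j" using j by (simp add: dvd_power)
 hence cab: "c dvd a - b" using ab dvd_trans by blast
 have "c dvd (\<Sum>i<p. a ^ i * b ^ (p - Suc i) - b ^ i * b ^ (p - Suc i))"
 proof (rule dvd_sum)
  fix i
  have "a - b dvd a ^ i - b ^ i" by (simp add: power_diff_sumr2)
  hence "c dvd a ^ i - b ^ i" using cab dvd_trans by blast
  thus "c dvd a ^ i * b ^ (p - Suc i) - b ^ i * b ^ (p - Suc i)"
  by (simp flip: left_diff_distrib)
 qed
 moreover have "(\<Sum>i<p. b ^ i * b ^ (p - Suc i)) = (\<Sum>i<p. b ^ (p - 1))"
  by (rule sum.cong) (auto simp flip: power_add)
 ultimately have "c dvd (\<Sum>i<p. a ^ i * b ^ (p - Suc i)) - of_nat p * b ^ (p - 1)"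
  by (simp add: sum_subtractf)
 moreover have "c dvd of_nat p * b ^ (p - 1)" using p by simp
 ultimately have "c dvd (\<Sum>i<p. a ^ i * b ^ (p - Suc i))" using dvd_diffD by (metis dvd_add diff_add_cancel)
 hence "c ^ j * c dvd (a - b) * (\<Sum>i<p. a ^ i * b ^ (p - Suc i))" by (rule mult_dvd_mono[OF ab])
 moreover have "a ^ p - b ^ p = (a - b) * (\<Sum>i<p. b ^ (p - Suc i) * a ^ i)"
  by (rule power_diff_sumr2)
 ultimately show ?thesis by (simp add: mult.commute)
qed

text \<open>A power with exponent \<open>p^h\<close> is made of \<open>h \<ge> 1\<close> powers with
  exponent \<open>p\<close>, each of which gains a factor \<open>c\<close>; one of these factors is
  kept.\<close>

lemma power_q_cong:
 fixes a b c :: "'a::comm_ring_1"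
 assumes p: "c dvd of_nat p" and h: "h \<ge> 1" and ab: "c dvd a - b"
 shows "c ^ Suc k dvd a ^ ((p ^ h) ^ k) - b ^ ((p ^ h) ^ k)"
proof (induction k)
 case (Suc k)
 let ?A = "a ^ ((p ^ h) ^ k)" and ?B = "b ^ ((p ^ h) ^ k)"
 have "c ^ (Suc k + i) dvd ?A ^ (p ^ i) - ?B ^ (p ^ i)" for i
 proof (induction i)
  case 0
  thus ?case using Suc.IH by simp
 next
  case (Suc i)
  have "c ^ Suc (Suc k + i) dvd (?A ^ (p ^ i)) ^ p - (?B ^ (p ^ i)) ^ p"
  by (rule power_p_cong[OF p Suc.IH]) simp
  thus ?case by (simp only: power_Suc2 power_mult add_Suc_right)
 qed
 from this[of h] have "c ^ (Suc k + h) dvd ?A ^ (p ^ h) - ?B ^ (p ^ h)" .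
 moreover have "c ^ Suc (Suc k) dvd c ^ (Suc k + h)" using h by (intro le_imp_power_dvd) simp
 ultimately have "c ^ Suc (Suc k) dvd ?A ^ (p ^ h) - ?B ^ (p ^ h)" using dvd_trans by blast
 thus ?case by (simp only: power_Suc2 power_mult)
qed (use ab in simp)

text \<open>The ghost polynomial over rings given by a type class, where the equations for Witt
  components are solved by ordinary arithmetic and divisibility.\<close>

definition cghost :: "'a::comm_ring_1 => nat => nat => (nat => 'a) => 'a" where
 "cghost c q i x = (\<Sum>j\<le>i. c ^ j * x j ^ (q ^ (i - j)))"

lemma cghost_cong: "(!!j. j \<le> i ==> x j = y j) ==> cghost c q i x = cghost c q i y"
 unfolding cghost_def by (rule sum.cong) auto

lemma cghost_split: "cghost c q i x = (\<Sum>j<i. c ^ j * x j ^ (q ^ (i - j))) + c ^ i * x i"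
 unfolding cghost_def by (simp flip: lessThan_Suc_atMost)

text \<open>The equations are solved one component at a time. As \<open>y j\<close> and
  \<open>x j ^ q\<close> agree modulo \<open>c\<close>, their powers with exponent
  \<open>q^(i - j)\<close> agree modulo \<open>c^(i - j + 1)\<close>. So the earlier summands match
  modulo \<open>c^(i + 1)\<close>, and the next component can be chosen congruent to
  \<open>x i ^ q\<close> modulo \<open>c\<close>.\<close>

lemma cghost_frobenius:
 fixes x :: "nat => 'a::comm_ring_1"
 assumes p: "c dvd of_nat p" and h: "h \<ge> 1" and q: "q = p ^ h"
 shows "EX y. \<forall>i\<le>n. cghost c q i y = cghost c q (Suc i) x & c dvd y i - x i ^ q"
proof -
 have step: "EX z. cghost c q i (y(i := z)) = cghost c q (Suc i) x & c dvd z - x i ^ q"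
  if y: "!!j. j < i ==> c dvd y j - x j ^ q" for i and y :: "nat => 'a"
 proof -
  have "c ^ Suc i dvd (\<Sum>j<i. c ^ j * (x j ^ q) ^ (q ^ (i - j)) - c ^ j * y j ^ (q ^ (i - j)))"
  proof (rule dvd_sum)
  fix j assume "j : {..<i}"
  hence j: "j < i" by simp
  have "c dvd x j ^ q - y j" using y[OF j] dvd_minus_iff[of c "y j - x j ^ q"] by (simp only: minus_diff_eq)
  from power_q_cong[OF p h this, of "i - j"]
  have "c ^ Suc (i - j) dvd (x j ^ q) ^ (q ^ (i - j)) - y j ^ (q ^ (i - j))" by (simp add: q)
  hence "c ^ j * c ^ Suc (i - j) dvd c ^ j * ((x j ^ q) ^ (q ^ (i - j)) - y j ^ (q ^ (i - j)))"
  by (rule mult_dvd_mono[OF dvd_refl])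
  moreover have "c ^ j * c ^ Suc (i - j) = c ^ Suc i"
  using j by (simp only: power_add[symmetric] add_Suc_right le_add_diff_inverse less_imp_le)
  ultimately show "c ^ Suc i dvd c ^ j * (x j ^ q) ^ (q ^ (i - j)) - c ^ j * y j ^ (q ^ (i - j))"
  by (simp add: right_diff_distrib)
  qed
  then obtain w where w: "(\<Sum>j<i. c ^ j * (x j ^ q) ^ (q ^ (i - j))) - (\<Sum>j<i. c ^ j * y j ^ (q ^ (i - j))) = c ^ Suc i * w"
  by (auto simp: sum_subtractf dvd_def)
  define z where "z = x i ^ q + c * (w + x (Suc i))"
  have "cghost c q (Suc i) x = (\<Sum>j<i. c ^ j * (x j ^ q) ^ (q ^ (i - j))) + c ^ i * x i ^ q + c ^ Suc i * x (Suc i)"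
  proof -
  have "(\<Sum>j<i. c ^ j * x j ^ (q ^ (Suc i - j))) = (\<Sum>j<i. c ^ j * (x j ^ q) ^ (q ^ (i - j)))"
  by (rule sum.cong) (auto simp: Suc_diff_le less_imp_le simp flip: power_mult)
  thus ?thesis by (simp add: cghost_split)
  qed
  also have "... = (\<Sum>j<i. c ^ j * y j ^ (q ^ (i - j))) + c ^ i * z"
  using w by (simp add: z_def algebra_simps)
  also have "... = cghost c q i (y(i := z))"
  proof -
  have "(\<Sum>j<i. c ^ j * y j ^ (q ^ (i - j))) = (\<Sum>j<i. c ^ j * (y(i := z)) j ^ (q ^ (i - j)))"
  by (rule sum.cong) auto
  thus ?thesis by (simp add: cghost_split)
  qed
  finally show ?thesis by (intro exI[of _ z]) (simp add: z_def)
 qed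
 show ?thesis
 proof (induction n)
  case 0
  from step[of 0 "%_. 0"] show ?case by (metis fun_upd_same le_zero_eq less_nat_zero_code)
 next
  case (Suc n)
  then obtain y where y: "!!i. i \<le> n ==> cghost c q i y = cghost c q (Suc i) x & c dvd y i - x i ^ q" by blast
  obtain z where z: "cghost c q (Suc n) (y(Suc n := z)) = cghost c q (Suc (Suc n)) x" "c dvd z - x (Suc n) ^ q"
  using step[of "Suc n" y] y by auto
  have "cghost c q i (y(Suc n := z)) = cghost c q (Suc i) x & c dvd (y(Suc n := z)) i - x i ^ q" if "i \<le> Suc n" for i
  proof (cases "i = Suc n")
  case False
  have "cghost c q i (y(Suc n := z)) = cghost c q i y" by (rule cghost_cong) (use False that in auto)
  thus ?thesis using y[of i] False that by simp
  qed (use z in auto)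
  thus ?case by blast
 qed
qed

text \<open>If \<open>c^(N - j)\<close> divides \<open>y j\<close> and the exponent
  \<open>Q = q^(i - j)\<close> is at least 2, then \<open>c^N\<close> divides
  \<open>c^j (y j)^Q\<close>, because \<open>j + (N - j) Q \<ge> N\<close>. So the next component
  exists and is a multiple of \<open>c^(N - i)\<close>.\<close>

lemma cghost_divisible:
 fixes t :: "nat => 'a::comm_ring_1"
 assumes q: "q \<ge> 2" and nN: "n \<le> N"
 shows "EX y. \<forall>i\<le>n. cghost c q i y = c ^ N * t i & c ^ (N - i) dvd y i"
 using nN
proof (induction n)
 case 0
 show ?case by (rule exI[of _ "%_. c ^ N * t 0"]) (simp add: cghost_def)
next
 case (Suc n)
 then obtain y where y: "!!i. i \<le> n ==> cghost c q i y = c ^ N * t i & c ^ (N - i) dvd y i" by auto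
 have "c ^ N dvd (\<Sum>j<Suc n. c ^ j * y j ^ (q ^ (Suc n - j)))"
 proof (rule dvd_sum)
  fix j assume "j : {..<Suc n}"
  hence j: "j \<le> n" by simp
  have "q ^ 1 \<le> q ^ (Suc n - j)" using j q by (intro power_increasing) auto
  hence two: "2 \<le> q ^ (Suc n - j)" using q by simp
  have "(c ^ (N - j)) ^ (q ^ (Suc n - j)) dvd y j ^ (q ^ (Suc n - j))" using y[OF j] dvd_power_same by blast
  hence "c ^ (j + (N - j) * q ^ (Suc n - j)) dvd c ^ j * y j ^ (q ^ (Suc n - j))"
  unfolding power_add power_mult by (rule mult_dvd_mono[OF dvd_refl])
  moreover have "c ^ N dvd c ^ (j + (N - j) * q ^ (Suc n - j))"
  proof (rule le_imp_power_dvd)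
  have "(N - j) * 1 \<le> (N - j) * q ^ (Suc n - j)" using two by (intro mult_le_mono2) simp
  hence "N - j \<le> (N - j) * q ^ (Suc n - j)" by (simp only: mult_1_right)
  thus "N \<le> j + (N - j) * q ^ (Suc n - j)" by linarith
  qed
  ultimately show "c ^ N dvd c ^ j * y j ^ (q ^ (Suc n - j))" using dvd_trans by blast
 qed
 then obtain w where w: "(\<Sum>j<Suc n. c ^ j * y j ^ (q ^ (Suc n - j))) = c ^ N * w" by (rule dvdE)
 define z where "z = c ^ (N - Suc n) * (t (Suc n) - w)"
 have "cghost c q i (y(Suc n := z)) = c ^ N * t i & c ^ (N - i) dvd (y(Suc n := z)) i" if "i \<le> Suc n" for i
 proof (cases "i = Suc n")
  case False
  have "cghost c q i (y(Suc n := z)) = cghost c q i y" by (rule cghost_cong) (use False that in auto)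
  thus ?thesis using y[of i] False that by simp
 next
  case True
  have "(\<Sum>j<Suc n. c ^ j * (y(Suc n := z)) j ^ (q ^ (Suc n - j))) = c ^ N * w"
  unfolding w[symmetric] by (rule sum.cong) auto
  moreover have "c ^ Suc n * z = c ^ N * (t (Suc n) - w)"
  using Suc.prems by (simp only: z_def mult.assoc[symmetric] power_add[symmetric] le_add_diff_inverse)
  ultimately have "cghost c q (Suc n) (y(Suc n := z)) = c ^ N * t (Suc n)"
  by (simp only: cghost_split fun_upd_same) (simp add: algebra_simps)
  thus ?thesis using True by (simp add: z_def)
 qed
 thus ?case by blast
qed

lemma (in r_algebra) eval_poly_natural:
 assumes C: "ralgebra C" and h: "is_alg_hom B C h" and x: "!!i. x i <: B"
 shows "h (eval_poly x f) = r_algebra.eval_poly C (%i. h (x i)) f"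
proof -
 have B: "ralgebra B" using r_algebra_axioms by (simp add: r_algebra_iff)
 interpret C: r_algebra C using C ..
 interpret h: ring_hom_cring B C h by (rule ring_hom_cringI[OF B C h])
 note hs = homD[OF h] hom_more[OF B C h]
 have hx: "h (x i) <: C" for i by (rule hs(2)[OF x])
 have mon: "h (eval_mon x m) = C.eval_mon (%i. h (x i)) m" for m
  unfolding eval_mon_def C.eval_mon_def
  by (subst h.hom_finprod) (use x hx in "auto simp: hs intro!: C.finprod_cong'")
 show ?thesis
 proof (induction f rule: poly_mapping_sum_induct)
  case (single m a)
  show ?case by (simp add: eval_poly_single[OF x] C.eval_poly_single[OF hx] hs(3,4) eval_mon_closed[OF x] mon)
 next
  case (add f g)
  thus ?case by (simp add: eval_poly_add[OF x] C.eval_poly_add[OF hx] hs(5) eval_poly_closed[OF x])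
 qed
qed

section \<open>Witt vectors\<close>

lemma twist_sel [simp]:
 "carrier (twist K k B) = carrier B" "a **.(twist K k B) b = a **.B b" "\<one>.(twist K k B) = \<one>.B"
 "\<zero>.(twist K k B) = \<zero>.B" "a ++.(twist K k B) b = a ++.B b" "alg (twist K k B) r = alg B ((frob K ^^ k) r)"
 by (simp_all add: twist_def)

lemma twist_twist: "twist K j (twist K k B) = twist K (j + k) B"
 by (simp add: twist_def o_assoc[symmetric] funpow_add[symmetric] add.commute)

lemma twist_0 [simp]: "twist K 0 B = B"
 by (simp add: twist_def)

lemma cring_same_ops:
 assumes "cring B" "carrier C = carrier B" "!!a b. a **.C b = a **.B b" "!!a b. a ++.C b = a ++.B b"
  "\<one>.C = \<one>.B" "\<zero>.C = \<zero>.B"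
 shows "cring C"
proof -
 interpret cring B by fact
 show ?thesis
 proof (rule cringI)
  show "abelian_group C"
  by (rule abelian_groupI) (use assms(2-) in \<open>auto simp: a_ac intro!: bexI[of _ "\<ominus>.B _"] l_neg\<close>)
  show "Group.comm_monoid C" by (rule comm_monoidI) (use assms(2-) in "auto simp: m_ac")
 qed (use assms(2-) in "auto simp: l_distr")
qed

lemma pow_same_ops:
 assumes "!!a b. a **.C b = a **.B b" "\<one>.C = \<one>.B"
 shows "a [^].C (n::nat) = a [^].B n"
 by (induction n) (simp_all add: assms)

lemma minus_same_ops:
 assumes "cring B" "cring C" "carrier C = carrier B" "!!a b. a ++.C b = a ++.B b" "\<zero>.C = \<zero>.B"
  "a <: B" "b <: B"
 shows "a \<ominus>.C b = a \<ominus>.B b"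
proof -
 interpret B: cring B by fact
 interpret C: cring C by fact
 have "\<ominus>.C b = \<ominus>.B b" by (rule C.minus_equality) (use assms in "auto simp: B.l_neg")
 thus ?thesis by (simp add: B.minus_eq C.minus_eq assms(4))
qed

context base_ring begin

lemma funpow_frob_simps:
 "(\<phi> ^^ k) (a + b) = (\<phi> ^^ k) a + (\<phi> ^^ k) b" "(\<phi> ^^ k) (a * b) = (\<phi> ^^ k) a * (\<phi> ^^ k) b" "(\<phi> ^^ k) 1 = 1"
 by (induction k) (simp_all add: frob_simps)

lemma twist_ralgebra:
 fixes B :: "('r, 'd) ralg"
 assumes "ralgebra B" shows "ralgebra (twist K k B)"
proof -
 interpret r_algebra B by (rule ralgebraD) fact
 have "cring (twist K k B)" by (rule cring_same_ops[OF is_cring]) simp_all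
 thus ?thesis unfolding ralgebra_def
  by (auto intro!: ring_hom_memI simp: funpow_frob_simps alg_mult alg_add)
qed

lemma twist_alg_hom:
 "is_alg_hom B C h ==> is_alg_hom (twist K k B) (twist K k C) h"
 by (rule homI) (simp_all add: homD)

lemma alg_hom_twist: "h : alg_hom B C ==> h : alg_hom (twist K k B) (twist K k C)"
 using twist_alg_hom[of B C h k] by (simp add: alg_hom_def)

subsection \<open>The ghost map\<close>

lemma ghost_closed:
 fixes B :: "('r, 'd) ralg"
 assumes "ralgebra B" "set x <= carrier B" "i < length x"
 shows "ghost K B i x <: B"
proof -
 interpret r_algebra B by (rule ralgebraD) fact
 have "x ! j <: B" if "j \<le> i" for j using assms(2,3) that nth_mem[of j x] by auto
 thus ?thesis unfolding ghost_def by (intro finsum_closed) auto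
qed

lemma ghost_cong:
 fixes B :: "('r, 'd) ralg"
 assumes "ralgebra B" "!!j. j \<le> i ==> x ! j = y ! j" "!!j. j \<le> i ==> y ! j <: B"
 shows "ghost K B i x = ghost K B i y"
proof -
 interpret r_algebra B by (rule ralgebraD) fact
 show ?thesis unfolding ghost_def by (rule finsum_cong') (use assms(2,3) in auto)
qed

lemma ghost_natural:
 fixes B :: "('r, 'd) ralg" and C :: "('r, 'e) ralg"
 assumes "ralgebra B" "ralgebra C" "is_alg_hom B C h" "set x <= carrier B" "i < length x"
 shows "ghost K C i (map h x) = h (ghost K B i x)"
proof -
 interpret B: r_algebra B by (rule ralgebraD) fact
 interpret C: r_algebra C by (rule ralgebraD) fact
 interpret h: ring_hom_cring B C h by (rule ring_hom_cringI) fact+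
 note hs = homD[OF assms(3)] hom_more[OF assms(1-3)]
 have x: "x ! j <: B" if "j \<le> i" for j using assms(4,5) that nth_mem[of j x] by auto
 have "h (ghost K B i x) = (\<Oplus>.C j\<in>{..i}. h (alg B (unif K ^ j) **.B (x ! j) [^].B (resq K ^ (i - j))))"
  unfolding ghost_def by (subst h.hom_finsum) (use x in "auto simp: comp_def")
 also have "... = ghost K C i (map h x)"
  unfolding ghost_def by (rule C.finsum_cong') (use x assms(5) in "auto simp: hs")
 finally show ?thesis by simp
qed

lemma ghost_split:
 fixes B :: "('r, 'd) ralg" (structure)
 assumes "ralgebra B" "!!j. j \<le> i ==> x ! j <: B"
 shows "ghost K B i x = (\<Oplus>j\<in>{..<i}. alg B (\<pi> ^ j) ** (x ! j) [^] (q ^ (i - j))) ++ alg B (\<pi> ^ i) ** x ! i"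
proof -
 interpret r_algebra B by (rule ralgebraD) fact
 have "{..i} = insert i {..<i}" by auto
 hence "ghost K B i x = alg B (\<pi> ^ i) ** (x ! i) [^] (q ^ (i - i)) ++ (\<Oplus>j\<in>{..<i}. alg B (\<pi> ^ j) ** (x ! j) [^] (q ^ (i - j)))"
  unfolding ghost_def using assms(2) by (simp only:) (rule finsum_insert, auto)
 also have "... = (\<Oplus>j\<in>{..<i}. alg B (\<pi> ^ j) ** (x ! j) [^] (q ^ (i - j))) ++ alg B (\<pi> ^ i) ** (x ! i) [^] (q ^ (i - i))"
  by (rule a_comm) (use assms(2) in "auto intro!: finsum_closed")
 finally show ?thesis using assms(2)[of i] by simp
qed

lemma ghost_0:
 fixes B :: "('r, 'd) ralg"
 assumes "ralgebra B" "x ! 0 <: B" shows "ghost K B 0 x = x ! 0"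
proof -
 interpret r_algebra B by (rule ralgebraD) fact
 show ?thesis using assms(2) by (simp add: ghost_def)
qed

text \<open>The ghost map is triangular: once the components below \<open>i\<close> agree, the ghost
  component of index \<open>i\<close> determines \<open>\<pi>^i\<close> times the
  \<open>i\<close>-th component.\<close>

lemma ghost_inj:
 fixes B :: "('r, 'd) ralg" (structure)
 assumes B: "ralgebra B" and tf: "torsion_free \<pi> B" and x: "set x <= carrier B" "length x = Suc n"
  and y: "set y <= carrier B" "length y = Suc n" and eq: "!!i. i \<le> n ==> ghost K B i x = ghost K B i y"
 shows "x = y"
proof -
 interpret r_algebra B by (rule ralgebraD) fact
 have xc: "x ! j <: B" "y ! j <: B" if "j \<le> n" for j
  using x y that nth_mem[of j x] nth_mem[of j y] by auto
 have "i \<le> n --> x ! i = y ! i" for i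
 proof (induction i rule: less_induct)
  case (less i)
  show ?case
  proof
  assume i: "i \<le> n"
  let ?S = "%x. \<Oplus>j\<in>{..<i}. alg B (\<pi> ^ j) ** (x ! j) [^] (q ^ (i - j))"
  have S: "?S x = ?S y" by (rule finsum_cong') (use less i xc in auto)
  have Sc: "?S y <: B" by (intro finsum_closed) (use i xc in auto)
  have "?S y ++ alg B (\<pi> ^ i) ** x ! i = ?S y ++ alg B (\<pi> ^ i) ** y ! i"
  using eq[OF i] ghost_split[OF B, of i x] ghost_split[OF B, of i y] xc i S by simp
  hence "alg B (\<pi> ^ i) ** x ! i = alg B (\<pi> ^ i) ** y ! i"
  using Sc xc i by simp
  thus "x ! i = y ! i" by (rule torsion_free_cancel[OF B tf xc[OF i]])
  qed
 qed
 thus ?thesis using x(2) y(2) by (intro nth_equalityI) auto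
qed

lemma single_pow: "psing 0 a ^ n = (psing 0 (a ^ n) :: 'r mpoly)"
 by (induction n) (simp_all add: mult_single)

lemma ghost_poly:
 assumes "i < length x"
 shows "ghost K poly_alg i x = cghost (psing 0 \<pi>) q i ((!) x)"
 by (simp add: ghost_def cghost_def single_pow atMost_def[symmetric])

lemma ghost_base:
 assumes "i < length x"
 shows "ghost K base_alg i x = cghost \<pi> q i ((!) x)"
proof -
 interpret cring "base_alg :: ('r, 'r) ralg" by (rule cring_base_alg)
 have "finite A ==> (\<Oplus>.base_alg i\<in>A. f i) = (\<Sum>i\<in>A. f i)" for A :: "nat set" and f :: "nat => 'r"
  by (induction A rule: finite_induct) simp_all
 thus ?thesis by (simp add: ghost_def cghost_def)
qed

lemma ghost_eval:
 fixes B :: "('r, 'd) ralg"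
 assumes B: "ralgebra B" and ev: "is_alg_hom poly_alg B ev"
  and y: "!!i. i \<le> n ==> cghost (psing 0 \<pi>) q i y = g i" and i: "i \<le> n"
 shows "ghost K B i (map (%i. ev (y i)) [0..<Suc n]) = ev (g i)"
proof -
 let ?y = "map y [0..<Suc n]"
 have nth: "?y ! j = y j" if "j \<le> n" for j
  using that nth_map_upt[of j "Suc n" 0 y] by (simp del: upt_Suc)
 have "ghost K poly_alg i ?y = cghost (psing 0 \<pi>) q i ((!) ?y)"
  by (rule ghost_poly) (use i in simp)
 also have "... = cghost (psing 0 \<pi>) q i y"
  by (rule cghost_cong) (use nth i in "simp del: upt_Suc")
 also have "... = g i" by (rule y[OF i])
 finally have "ghost K B i (map ev ?y) = ev (g i)"
  using ghost_natural[OF ralgebra_poly_alg B ev, of ?y i] i by simp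
 thus ?thesis by (simp only: map_map comp_def)
qed

text \<open>The equations are solved once in the polynomial ring, with variables as the quotients,
  and the solution is evaluated at \<open>b\<close>; nothing has to be divided in
  \<open>B\<close>.\<close>

lemma ghost_divisible:
 fixes B :: "('r, 'd) ralg" (structure)
 assumes B: "ralgebra B" and b: "!!i. b i <: B" and nN: "n \<le> N"
 obtains z where "length z = Suc n" "set z <= carrier B"
  "!!i. i \<le> n ==> ghost K B i z = alg B (\<pi> ^ N) **.B b i"
  "!!i. i \<le> n ==> z ! i : pow_ideal \<pi> (N - i) B"
proof -
 interpret r_algebra B using B ..
 define ev where "ev = eval_poly b"
 have ev: "is_alg_hom poly_alg B ev" "!!i. ev (mvar i) = b i"
  using eval_poly_hom[OF b] eval_poly_var[OF b] by (simp_all add: ev_def)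
 let ?c = "psing 0 \<pi> :: 'r mpoly"
 obtain y where y: "!!i. i \<le> n ==> cghost ?c q i y = ?c ^ N * mvar i & ?c ^ (N - i) dvd y i"
  using cghost_divisible[OF q_ge2 nN, of ?c mvar] by blast
 let ?z = "map (%i. ev (y i)) [0..<Suc n]"
 have nth: "?z ! i = ev (y i)" if "i \<le> n" for i
  using that nth_map_upt[of i "Suc n" 0 "%i. ev (y i)"] by (simp del: upt_Suc)
 have evc: "ev (?c ^ k * f) = alg B (\<pi> ^ k) ** ev f" for k f
  using homD(4)[OF ev(1), of "?c ^ k" f] homD(3)[OF ev(1), of "\<pi> ^ k"] by (simp add: single_pow)
 show thesis
 proof (rule that[of ?z])
  show "length ?z = Suc n" by simp
  show "set ?z <= carrier B" using homD(2)[OF ev(1)] by auto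
  fix i assume i: "i \<le> n"
  have "ghost K B i ?z = ev (?c ^ N * mvar i)"
  by (rule ghost_eval[OF B ev(1) _ i, where g = "%i. ?c ^ N * mvar i"]) (use y in blast)
  thus "ghost K B i ?z = alg B (\<pi> ^ N) ** b i" by (simp add: evc ev(2))
  obtain f where "y i = ?c ^ (N - i) * f" using y[OF i] by (auto simp: dvd_def)
  thus "?z ! i : pow_ideal \<pi> (N - i) B"
  unfolding nth[OF i] by (intro pow_idealI[of "ev f"]) (use homD(2)[OF ev(1)] in "simp_all add: evc")
 qed
qed

end

locale witt_vectors = universe p K u for p :: nat and K :: "'r::idom base" and u :: "'b itself" +
 assumes witt_exists: "!!m. \<exists>W :: ('r, 'b) ralg => ('r, 'b list) ralg. witt_structure K m W"
begin

abbreviation W :: "nat => ('r, 'b) ralg => ('r, 'b list) ralg" where "W \<equiv> witt K"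

lemma witt_structure_W: "witt_structure K n (W n)"
 unfolding witt_def by (rule someI_ex[OF witt_exists])

lemma W_ralgebra: "ralgebra B ==> ralgebra (W n B)"
 and W_carrier: "ralgebra B ==> carrier (W n B) = {x. length x = Suc n & set x <= carrier B}"
 and W_ghost: "ralgebra B ==> i \<le> n ==> is_alg_hom (W n B) (twist K i B) (ghost K B i)"
 and W_map: "ralgebra B ==> ralgebra C ==> h : alg_hom B C ==> is_alg_hom (W n B) (W n C) (map h)"
 using witt_structure_W[of n] unfolding witt_structure_def by blast+

lemmas W_r_algebra [intro?] = ralgebraD[OF W_ralgebra]

lemma W_length: "ralgebra B ==> x <: W n B ==> length x = Suc n"
 and W_set: "ralgebra B ==> x <: W n B ==> set x <= carrier B"
 and W_nth: "ralgebra B ==> x <: W n B ==> j \<le> n ==> x ! j <: B"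
 and W_I: "ralgebra B ==> length y = Suc n ==> set y <= carrier B ==> y <: W n B"
 using nth_mem[of j x] by (auto simp: W_carrier)

lemma W_ghost_closed: "ralgebra B ==> x <: W n B ==> i \<le> n ==> ghost K B i x <: B"
 by (rule ghost_closed) (auto simp: W_carrier)

lemma W_ghost_simps:
 assumes B: "ralgebra B" and i: "i \<le> n"
 shows "x <: W n B ==> y <: W n B ==> ghost K B i (x **.(W n B) y) = ghost K B i x **.B ghost K B i y"
  "x <: W n B ==> y <: W n B ==> ghost K B i (x ++.(W n B) y) = ghost K B i x ++.B ghost K B i y"
  "ghost K B i \<one>.(W n B) = \<one>.B" "ghost K B i \<zero>.(W n B) = \<zero>.B"
  "ghost K B i (alg (W n B) r) = alg B ((\<phi> ^^ i) r)"
  "x <: W n B ==> y <: W n B ==> ghost K B i (x \<ominus>.(W n B) y) = ghost K B i x \<ominus>.B ghost K B i y"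
proof -
 note h = homD[OF W_ghost[OF B i]] hom_more[OF W_ralgebra[OF B] twist_ralgebra[OF B] W_ghost[OF B i]]
 show "ghost K B i \<one>.(W n B) = \<one>.B" "ghost K B i \<zero>.(W n B) = \<zero>.B"
  "ghost K B i (alg (W n B) r) = alg B ((\<phi> ^^ i) r)"
  using h by simp_all
 show "ghost K B i (x **.(W n B) y) = ghost K B i x **.B ghost K B i y"
  "ghost K B i (x ++.(W n B) y) = ghost K B i x ++.B ghost K B i y"
  "ghost K B i (x \<ominus>.(W n B) y) = ghost K B i x \<ominus>.B ghost K B i y"
  if "x <: W n B" "y <: W n B"
  using h(4,5,9)[OF that] that W_ghost_closed[OF B _ i] ralgebraD[OF B] ralgebraD[OF twist_ralgebra[OF B, of i]]
  by (auto simp: minus_same_ops[of B "twist K i B"] r_algebra_def)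
qed

lemma W_eqI:
 assumes "ralgebra B" "torsion_free \<pi> B" "x <: W n B" "y <: W n B"
  "!!i. i \<le> n ==> ghost K B i x = ghost K B i y"
 shows "x = y"
 by (rule ghost_inj[OF assms(1,2) _ _ _ _ assms(5)]) (use assms(1,3,4) in "auto simp: W_carrier")

text \<open>Every pair of Witt vectors is the image of a pair over a torsion-free algebra, where ghost
 components determine Witt vectors.\<close>

lemma W_lift2:
 fixes B (structure)
 assumes B: "ralgebra B" and x: "x <: W n B" and y: "y <: W m B"
 obtains h X Y where "h : alg_hom univ B" "X <: W n univ" "Y <: W m univ" "map h X = x" "map h Y = y"
proof -
 interpret r_algebra B using B ..
 \<comment> \<open>The first \<open>n + 1\<close> variables go to the components of
   \<open>x\<close>, the next \<open>m + 1\<close> to those of \<open>y\<close>.\<close>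
 let ?b = "%i. if i \<le> n then x ! i else if i - Suc n \<le> m then y ! (i - Suc n) else \<zero>"
 have b: "?b i <: B" for i using W_nth[OF B x] W_nth[OF B y] by auto
 obtain h where h: "h : alg_hom univ B" "!!i. h (uvar i) = ?b i" by (rule univ_map[where x = ?b, OF B b]) (rule that)
 let ?X = "map uvar [0..<Suc n]" and ?Y = "map (%i. uvar (Suc n + i)) [0..<Suc m]"
 have "map h ?X = x"
  by (rule nth_equalityI) (use W_length[OF B x] in "auto simp: h(2) nth_append simp del: upt_Suc")
 moreover have "map h ?Y = y"
  by (rule nth_equalityI) (use W_length[OF B y] in "auto simp: h(2) nth_append simp del: upt_Suc")
 ultimately show thesis using h(1) by (intro that[of h ?X ?Y]) (auto simp: W_carrier univ_ralgebra)
qed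

lemma W_nth0: "ralgebra B ==> x <: W n B ==> ghost K B 0 x = x ! 0"
 by (rule ghost_0) (auto intro: W_nth)

subsection \<open>The Frobenius lift fixes the uniformizer\<close>

text \<open>The Witt components of the structure map at \<open>r\<close> are such elements. They are
  computed over \<open>univ\<close> and specialised, because the base ring has its carrier in
  another type.\<close>

lemma ghost_solution_base: "\<exists>c :: nat => 'r. \<forall>i\<le>n. cghost \<pi> q i c = (\<phi> ^^ i) r"
proof -
 interpret C: r_algebra "base_alg :: ('r, 'r) ralg" using ralgebra_base_alg ..
 obtain h where h: "h : alg_hom univ (base_alg :: ('r, 'r) ralg)"
  by (rule univ_map[OF ralgebra_base_alg, of "%_. 0"]) auto
 let ?x = "alg (W n univ) r"
 interpret Wn: r_algebra "W n univ" using univ_ralgebra ..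
 have x: "?x <: W n univ" by simp
 have "cghost \<pi> q i ((!) (map h ?x)) = (\<phi> ^^ i) r" if i: "i \<le> n" for i
 proof -
  have "cghost \<pi> q i ((!) (map h ?x)) = ghost K base_alg i (map h ?x)"
  by (rule ghost_base[symmetric]) (use W_length[OF univ_ralgebra x] i in simp)
  also have "... = h (ghost K univ i ?x)"
  by (rule ghost_natural[OF univ_ralgebra ralgebra_base_alg alg_homD[OF h]])
  (use W_length[OF univ_ralgebra x] W_set[OF univ_ralgebra x] i in auto)
  also have "... = (\<phi> ^^ i) r"
  using W_ghost_simps(5)[OF univ_ralgebra i, of r] ahD(3)[OF h] by simp
  finally show ?thesis .
 qed
 thus ?thesis by blast
qed

text \<open>Write \<open>\<phi> \<pi> = \<pi> v\<close>; comparing with \<open>\<phi> p = p\<close>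
  shows that \<open>v\<close> is a unit. Suppose \<open>1 - v = w \<pi>^k\<close> with a unit
  \<open>w\<close>, and let \<open>c\<close> be the Witt components of the structure map at \<pi>.
  Applying \<phi> to the ghost component of index \<open>n = k + 1\<close> gives the next one.
  Modulo \<open>\<pi>^(n + 1)\<close> this says that the sum of all
  \<open>\<pi>^j (1 - v^j) (c j)^(q^(n - j + 1))\<close> vanishes. The term \<open>j = 0\<close> is
  zero and those with \<open>j \<ge> 2\<close> are divisible by \<open>\<pi>^(n + 1)\<close>, but
  the term \<open>j = 1\<close> is not, since \<open>c 1 = v - \<pi>^(q - 1)\<close> is a
  unit.\<close>

lemma frob_pi: "\<phi> \<pi> = \<pi>"
proof -
 have "\<pi> dvd \<phi> \<pi>"
 proof -
  have "\<pi> dvd \<pi> ^ q" using q_ge2 by (simp add: dvd_power)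
  thus ?thesis using frob_cong[of \<pi>] dvd_add[of \<pi> "\<phi> \<pi> - \<pi> ^ q" "\<pi> ^ q"] by simp
 qed
 then obtain v where v: "\<phi> \<pi> = \<pi> * v" by (rule dvdE)
 obtain e w where e: "1 \<le> e" "w dvd 1" "of_nat p = w * \<pi> ^ e" using ramification by blast
 have "\<phi> w * v ^ e * \<pi> ^ e = w * \<pi> ^ e"
  using frob_of_nat[of p] unfolding e(3) frob_simps frob_power v by (simp add: power_mult_distrib mult.assoc mult.commute)
 hence "\<phi> w * v ^ e = w" using pi_nz by simp
 hence "v ^ e dvd 1" using e(2) by (metis dvd_trans dvd_triv_right)
 hence vu: "v dvd 1" using e(1) dvd_power[of e v] dvd_trans by (metis One_nat_def Suc_le_eq)
 show ?thesis
 proof (rule ccontr)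
  assume "\<phi> \<pi> ~= \<pi>"
  hence "1 - v ~= 0" using v by auto
  then obtain w k where w: "w dvd 1" "1 - v = w * \<pi> ^ k" using dvr by blast
  obtain c where c: "!!i. i \<le> Suc (Suc k) ==> cghost \<pi> q i c = (\<phi> ^^ i) \<pi>"
  using ghost_solution_base[of "Suc (Suc k)" \<pi>] by blast
  have c0: "c 0 = \<pi>" using c[of 0] by (simp add: cghost_def)
  have "\<pi> * c 1 = \<pi> * (v - \<pi> ^ (q - 1))"
  proof -
  have "\<pi> ^ q + \<pi> * c 1 = \<pi> * v" using c[of 1] v by (simp add: cghost_def c0)
  moreover have "\<pi> ^ q = \<pi> * \<pi> ^ (q - 1)" using q_ge2 by (simp flip: power_Suc)
  ultimately show ?thesis by (simp add: right_diff_distrib eq_diff_eq add.commute)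
  qed
  hence c1: "c 1 = v - \<pi> ^ (q - 1)" using pi_nz by simp
  have c1u: "\<not> \<pi> dvd c 1"
  proof
  assume "\<pi> dvd c 1"
  moreover have "\<pi> dvd \<pi> ^ (q - 1)" using q_ge2 by (simp add: dvd_power)
  ultimately have "\<pi> dvd c 1 + \<pi> ^ (q - 1)" by (rule dvd_add)
  hence "\<pi> dvd v" by (simp only: c1 diff_add_cancel)
  thus False using dvd_trans[OF _ vu] pi_nunit by blast
  qed
  obtain h where h: "h \<ge> 1" "q = p ^ h" using q_pow by blast
  define n where "n = Suc k"
  have eq: "\<phi> (cghost \<pi> q n c) = cghost \<pi> q (Suc n) c" using c[of n] c[of "Suc n"] by (simp add: n_def)
  have "\<pi> ^ Suc n dvd (\<Sum>j\<le>n. \<pi> ^ j * (v ^ j * \<phi> (c j) ^ (q ^ (n - j))) - \<pi> ^ j * (v ^ j * (c j ^ q) ^ (q ^ (n - j))))"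
  proof (rule dvd_sum)
  fix j assume "j : {..n}"
  hence j: "j \<le> n" by simp
  have "\<pi> ^ Suc (n - j) dvd \<phi> (c j) ^ (q ^ (n - j)) - (c j ^ q) ^ (q ^ (n - j))"
  using power_q_cong[OF pi_dvd_p h(1), of "\<phi> (c j)" "c j ^ q" "n - j"] frob_cong[of "c j"] by (simp flip: h(2))
  hence "\<pi> ^ j * \<pi> ^ Suc (n - j) dvd \<pi> ^ j * (v ^ j * (\<phi> (c j) ^ (q ^ (n - j)) - (c j ^ q) ^ (q ^ (n - j))))"
  by (intro mult_dvd_mono[OF dvd_refl] dvd_mult)
  moreover have "\<pi> ^ j * \<pi> ^ Suc (n - j) = \<pi> ^ Suc n"
  using j by (simp only: power_add[symmetric] add_Suc_right le_add_diff_inverse)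
  ultimately show "\<pi> ^ Suc n dvd \<pi> ^ j * (v ^ j * \<phi> (c j) ^ (q ^ (n - j))) - \<pi> ^ j * (v ^ j * (c j ^ q) ^ (q ^ (n - j)))"
  by (simp only: right_diff_distrib)
  qed
  moreover have "\<phi> (cghost \<pi> q n c) = (\<Sum>j\<le>n. \<pi> ^ j * (v ^ j * \<phi> (c j) ^ (q ^ (n - j))))"
  proof -
  have "\<phi> (\<Sum>j\<in>A. f j) = (\<Sum>j\<in>A. \<phi> (f j))" if "finite A" for A :: "nat set" and f
  using that by (induction A rule: finite_induct) (simp_all add: frob_0 frob_simps)
  thus ?thesis
  by (simp add: cghost_def frob_simps frob_power v power_mult_distrib mult.assoc)
  qed
  ultimately have 1: "\<pi> ^ Suc n dvd cghost \<pi> q (Suc n) c - (\<Sum>j\<le>n. \<pi> ^ j * (v ^ j * (c j ^ q) ^ (q ^ (n - j))))"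
  using eq by (simp add: sum_subtractf)
  have "cghost \<pi> q (Suc n) c = (\<Sum>j\<le>n. \<pi> ^ j * (c j ^ q) ^ (q ^ (n - j))) + \<pi> ^ Suc n * c (Suc n)"
  proof -
  have "(\<Sum>j\<le>n. \<pi> ^ j * c j ^ (q ^ (Suc n - j))) = (\<Sum>j\<le>n. \<pi> ^ j * (c j ^ q) ^ (q ^ (n - j)))"
  by (rule sum.cong) (auto simp: Suc_diff_le simp flip: power_mult)
  thus ?thesis by (simp add: cghost_split lessThan_Suc_atMost)
  qed
  hence "\<pi> ^ Suc n dvd (\<Sum>j\<le>n. \<pi> ^ j * (c j ^ q) ^ (q ^ (n - j))) - (\<Sum>j\<le>n. \<pi> ^ j * (v ^ j * (c j ^ q) ^ (q ^ (n - j))))"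
  proof -
  assume a: "cghost \<pi> q (Suc n) c = (\<Sum>j\<le>n. \<pi> ^ j * (c j ^ q) ^ (q ^ (n - j))) + \<pi> ^ Suc n * c (Suc n)"
  have "\<pi> ^ Suc n dvd \<pi> ^ Suc n * c (Suc n)" by simp
  from dvd_diff[OF 1 this] show ?thesis by (simp add: a algebra_simps)
  qed
  hence 2: "\<pi> ^ Suc n dvd (\<Sum>j\<le>n. \<pi> ^ j * ((1 - v ^ j) * (c j ^ q) ^ (q ^ (n - j))))"
  by (simp add: sum_subtractf algebra_simps)
  have split: "(\<Sum>j\<le>n. f j) = f 0 + f 1 + (\<Sum>j=2..n. f j)" for f :: "nat => 'r"
  proof -
  have "{..n} = insert 0 (insert 1 {2..n})" by (auto simp: n_def)
  thus ?thesis by (simp add: add.assoc)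
  qed
  have big: "\<pi> ^ Suc n dvd (\<Sum>j=2..n. \<pi> ^ j * ((1 - v ^ j) * (c j ^ q) ^ (q ^ (n - j))))"
  proof (rule dvd_sum)
  fix j assume j: "j : {2..n}"
  have "1 - v dvd 1 - v ^ j" using power_diff_sumr2[of 1 j v] by simp
  hence "\<pi> ^ k dvd 1 - v ^ j" unfolding w(2) using dvd_trans[OF dvd_triv_right] by blast
  hence "\<pi> ^ j * \<pi> ^ k dvd \<pi> ^ j * ((1 - v ^ j) * (c j ^ q) ^ (q ^ (n - j)))"
  by (intro mult_dvd_mono[OF dvd_refl] dvd_mult2)
  moreover have "\<pi> ^ Suc n dvd \<pi> ^ j * \<pi> ^ k"
  unfolding power_add[symmetric] by (rule le_imp_power_dvd) (use j in "simp add: n_def")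
  ultimately show "\<pi> ^ Suc n dvd \<pi> ^ j * ((1 - v ^ j) * (c j ^ q) ^ (q ^ (n - j)))" using dvd_trans by blast
  qed
  have "\<pi> ^ Suc n dvd \<pi> * ((1 - v) * (c 1 ^ q) ^ (q ^ (n - 1)))"
  using 2 big unfolding split by (simp add: dvd_add_left_iff)
  hence "\<pi> * \<pi> ^ k * \<pi> dvd \<pi> * \<pi> ^ k * (w * (c 1 ^ q) ^ (q ^ (n - 1)))"
  unfolding w(2) n_def by (simp add: mult_ac)
  hence "\<pi> dvd w * (c 1 ^ q) ^ (q ^ (n - 1))" using pi_nz by simp
  hence "\<pi> dvd w \<or> \<pi> dvd (c 1 ^ q) ^ (q ^ (n - 1))" by (rule pi_prime)
  moreover have "\<not> \<pi> dvd w" using dvd_trans[OF _ w(1)] pi_nunit by blast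
  moreover have "\<pi> dvd x ^ m ==> \<pi> dvd x" for x m
  proof (induction m)
  case (Suc m)
  thus ?case using pi_prime[of x "x ^ m"] by auto
  qed (use pi_nunit in simp)
  ultimately show False using c1u by blast
 qed
qed

lemma funpow_frob_pi: "(\<phi> ^^ i) (\<pi> ^ m) = \<pi> ^ m"
 by (induction i) (simp_all add: frob_power frob_pi)

end

context witt_vectors begin

lemma W_hom:
 assumes "ralgebra B" "ralgebra C" "h : alg_hom B C"
 shows "!!x. x <: W n B ==> map h x <: W n C"
  "!!x y. x <: W n B ==> y <: W n B ==> map h (x ++.(W n B) y) = map h x ++.(W n C) map h y"
  "!!x y. x <: W n B ==> y <: W n B ==> map h (x **.(W n B) y) = map h x **.(W n C) map h y"
  "!!r. map h (alg (W n B) r) = alg (W n C) r"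
  "map h \<one>.(W n B) = \<one>.(W n C)" "map h \<zero>.(W n B) = \<zero>.(W n C)"
  "!!x y. x <: W n B ==> y <: W n B ==> map h (x \<ominus>.(W n B) y) = map h x \<ominus>.(W n C) map h y"
 using homD[OF W_map[OF assms, of n]]
  hom_more[OF W_ralgebra[OF assms(1), of n] W_ralgebra[OF assms(2)] W_map[OF assms, of n]] by blast+

lemma W_lift1:
 assumes "ralgebra B" "x <: W n B"
 obtains h X where "h : alg_hom univ B" "X <: W n univ" "map h X = x"
 by (rule W_lift2[OF assms assms(2)]) (rule that)

lemma W_closed:
 assumes "ralgebra B"
 shows "x <: W n B ==> y <: W n B ==> x ++.(W n B) y <: W n B"
  "x <: W n B ==> y <: W n B ==> x **.(W n B) y <: W n B"
  "x <: W n B ==> y <: W n B ==> x \<ominus>.(W n B) y <: W n B"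
  "\<zero>.(W n B) <: W n B" "\<one>.(W n B) <: W n B" "alg (W n B) r <: W n B"
proof -
 interpret r_algebra "W n B" using assms ..
 show "x <: W n B ==> y <: W n B ==> x ++.(W n B) y <: W n B"
  "x <: W n B ==> y <: W n B ==> x **.(W n B) y <: W n B"
  "x <: W n B ==> y <: W n B ==> x \<ominus>.(W n B) y <: W n B"
  "\<zero>.(W n B) <: W n B" "\<one>.(W n B) <: W n B" "alg (W n B) r <: W n B"
  by simp_all
qed

text \<open>The zero of the Witt vectors is given only through the ring axioms; over
  \<open>univ\<close> its ghost components identify it, and homomorphisms carry it to
  \<open>B\<close>.\<close>

lemma W_zero: assumes B: "ralgebra B" shows "\<zero>.(W n B) = replicate (Suc n) \<zero>.B"
proof -
 obtain h X where h: "h : alg_hom univ B" by (rule W_lift1[OF B W_closed(4)[OF B]])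
 have "\<zero>.(W n univ) = replicate (Suc n) \<zero>.univ"
 proof (rule W_eqI[OF univ_ralgebra univ_tf W_closed(4)[OF univ_ralgebra] W_I[OF univ_ralgebra]])
  fix i assume i: "i \<le> n"
  have "ghost K univ i (replicate (Suc n) \<zero>.univ) = (\<Oplus>.univ j\<in>{..i}. \<zero>.univ)"
  unfolding ghost_def using i q_ge2 by (intro cmpl.finsum_cong') (auto simp: cmpl.nat_pow_zero simp del: replicate.simps)
  thus "ghost K univ i \<zero>.(W n univ) = ghost K univ i (replicate (Suc n) \<zero>.univ)"
  by (simp add: W_ghost_simps(4)[OF univ_ralgebra i] del: replicate.simps)
 qed auto
 from arg_cong[OF this, of "map h"] show ?thesis
  using W_hom(6)[OF univ_ralgebra B h] hom_more(1)[OF univ_ralgebra B alg_homD[OF h]] by simp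
qed

subsection \<open>Verschiebung, truncation and Frobenius\<close>

text \<open>The structure map enters the ghost components only through powers of \<pi>, which \<phi>
  fixes.\<close>

lemma ghost_twist: "ghost K (twist K k B) i x = ghost K B i x"
proof -
 have "a [^].(twist K k B) (m::nat) = a [^].B m" for a m by (rule pow_same_ops) simp_all
 moreover have "finsum (twist K k B) f A = finsum B f A" for f and A :: "nat set"
  by (simp add: finsum_def finprod_def twist_def)
 ultimately show ?thesis unfolding ghost_def by (simp add: funpow_frob_pi)
qed

lemma ghost_V:
 assumes B: "ralgebra B" and x: "x <: W n B"
 shows "ghost K B 0 (witt_V B x) = \<zero>.B"
  "i \<le> n ==> ghost K B (Suc i) (witt_V B x) = alg B \<pi> **.B ghost K B i x"
proof -
 interpret r_algebra B using B ..
 show "ghost K B 0 (witt_V B x) = \<zero>.B" using ghost_0[OF B, of "witt_V B x"] by (simp add: witt_V_def)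
 assume i: "i \<le> n"
 let ?t = "%j. alg B (\<pi> ^ j) **.B (\<zero>.B # x) ! j [^].B (q ^ (Suc i - j))"
 have xc: "x ! j <: B" if "j \<le> i" for j using W_nth[OF B x] that i by simp
 have t: "?t : {..Suc i} \<rightarrow> carrier B" using xc by (auto simp: nth_Cons split: nat.splits)
 have "ghost K B (Suc i) (witt_V B x) = (\<Oplus>.B j\<in>{..i}. ?t (Suc j)) ++.B ?t 0"
  unfolding ghost_def witt_V_def by (rule finsum_Suc2[OF t])
 also have "?t 0 = \<zero>.B" using q_ge2 by (simp add: nat_pow_zero)
 also have "(\<Oplus>.B j\<in>{..i}. ?t (Suc j)) = (\<Oplus>.B j\<in>{..i}. alg B \<pi> **.B (alg B (\<pi> ^ j) **.B x ! j [^].B (q ^ (i - j))))"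
  by (rule finsum_cong') (use xc in "auto simp: alg_mult m_assoc")
 also have "... = alg B \<pi> **.B ghost K B i x"
  unfolding ghost_def by (rule finsum_rdistr[symmetric]) (use xc in auto)
 finally show "ghost K B (Suc i) (witt_V B x) = alg B \<pi> **.B ghost K B i x"
  using W_ghost_closed[OF B x i] by simp
qed

lemma V_closed: "ralgebra B ==> x <: W n B ==> witt_V B x <: W (Suc n) B"
 by (auto simp: W_carrier witt_V_def dest: ralgebraD simp: r_algebra_def cring_def ring.ring_simprules)

lemma V_natural:
 "ralgebra B ==> ralgebra C ==> h : alg_hom B C ==> map h (witt_V B x) = witt_V C (map h x)"
 using hom_more(1)[OF _ _ alg_homD] by (simp add: witt_V_def)

lemma V_inject: "witt_V B x = witt_V B y <-> x = y"
 by (simp add: witt_V_def)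

lemma V_add:
 assumes B: "ralgebra B" and x: "x <: W n B" and y: "y <: W n B"
 shows "witt_V B (x ++.(W n B) y) = witt_V B x ++.(W (Suc n) B) witt_V B y"
proof -
 note c = W_closed[OF univ_ralgebra] V_closed[OF univ_ralgebra]
 obtain h X Y where h: "h : alg_hom univ B" and X: "X <: W n univ" and Y: "Y <: W n univ"
  and m: "map h X = x" "map h Y = y" by (rule W_lift2[OF B x y])
 have "witt_V univ (X ++.(W n univ) Y) = witt_V univ X ++.(W (Suc n) univ) witt_V univ Y"
 proof (rule W_eqI[OF univ_ralgebra univ_tf])
  fix i assume i: "i \<le> Suc n"
  show "ghost K univ i (witt_V univ (X ++.(W n univ) Y)) = ghost K univ i (witt_V univ X ++.(W (Suc n) univ) witt_V univ Y)"
  by (cases i) (use i X Y in "simp_all add: c ghost_V[OF univ_ralgebra, where n = n] W_ghost_simps[OF univ_ralgebra] W_ghost_closed[OF univ_ralgebra] cmpl.r_distr")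
 qed (simp_all add: c X Y)
 from arg_cong[OF this, of "map h"] show ?thesis
  by (simp add: V_natural[OF univ_ralgebra B h] W_hom[OF univ_ralgebra B h] c X Y m)
qed

text \<open>Over \<open>univ\<close>, the ghost components of positive index are
  \<open>\<pi>^2\<close> times a product on both sides. Consequently the kernel of
  \<open>W_(n+1)(B) -> B\<close> squares into the multiples of \<pi>, which confines points of jet
  kernels to one chart.\<close>

lemma V_mult:
 assumes B: "ralgebra B" and x: "x <: W n B" and y: "y <: W n B"
 shows "witt_V B x **.(W (Suc n) B) witt_V B y = alg (W (Suc n) B) \<pi> **.(W (Suc n) B) witt_V B (x **.(W n B) y)"
proof -
 note c = W_closed[OF univ_ralgebra] V_closed[OF univ_ralgebra]
 obtain h X Y where h: "h : alg_hom univ B" and X: "X <: W n univ" and Y: "Y <: W n univ"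
  and m: "map h X = x" "map h Y = y" by (rule W_lift2[OF B x y])
 have "witt_V univ X **.(W (Suc n) univ) witt_V univ Y = alg (W (Suc n) univ) \<pi> **.(W (Suc n) univ) witt_V univ (X **.(W n univ) Y)"
 proof (rule W_eqI[OF univ_ralgebra univ_tf])
  fix i assume i: "i \<le> Suc n"
  show "ghost K univ i (witt_V univ X **.(W (Suc n) univ) witt_V univ Y)
  = ghost K univ i (alg (W (Suc n) univ) \<pi> **.(W (Suc n) univ) witt_V univ (X **.(W n univ) Y))"
  by (cases i) (use i X Y in "simp_all add: c ghost_V[OF univ_ralgebra, where n = n] W_ghost_simps[OF univ_ralgebra]
  W_ghost_closed[OF univ_ralgebra] cmpl.m_ac frob_pi funpow_frob_pi[of _ 1, simplified]")
 qed (simp_all add: c X Y)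
 from arg_cong[OF this, of "map h"] show ?thesis
  by (simp add: V_natural[OF univ_ralgebra B h] W_hom[OF univ_ralgebra B h] c X Y m)
qed

lemma V_scale:
 assumes B: "ralgebra B" and x: "x <: W n B"
 shows "witt_V B (alg (W n B) (\<pi> ^ k) **.(W n B) x) = alg (W (Suc n) B) (\<pi> ^ k) **.(W (Suc n) B) witt_V B x"
proof -
 note c = W_closed[OF univ_ralgebra] V_closed[OF univ_ralgebra]
 obtain h X where h: "h : alg_hom univ B" and X: "X <: W n univ" and m: "map h X = x" by (rule W_lift1[OF B x])
 have "witt_V univ (alg (W n univ) (\<pi> ^ k) **.(W n univ) X) = alg (W (Suc n) univ) (\<pi> ^ k) **.(W (Suc n) univ) witt_V univ X"
 proof (rule W_eqI[OF univ_ralgebra univ_tf])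
  fix i assume i: "i \<le> Suc n"
  show "ghost K univ i (witt_V univ (alg (W n univ) (\<pi> ^ k) **.(W n univ) X))
  = ghost K univ i (alg (W (Suc n) univ) (\<pi> ^ k) **.(W (Suc n) univ) witt_V univ X)"
  by (cases i) (use i X in "simp_all add: c ghost_V[OF univ_ralgebra, where n = n] W_ghost_simps[OF univ_ralgebra]
  W_ghost_closed[OF univ_ralgebra] cmpl.m_lcomm funpow_frob_pi frob_pi frob_power")
 qed (simp_all add: c X)
 from arg_cong[OF this, of "map h"] show ?thesis
  by (simp add: V_natural[OF univ_ralgebra B h] W_hom[OF univ_ralgebra B h] c X m)
qed

lemma W_head_hom: assumes B: "ralgebra B" shows "is_alg_hom (W n B) B (%w. w ! 0)"
 by (rule hom_cong[OF W_ralgebra[OF B] _ W_ghost[OF B, of 0, simplified]]) (simp add: W_nth0[OF B])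

lemma W_head_zero_iff:
 assumes B: "ralgebra B" and w: "w <: W (Suc n) B"
 shows "w ! 0 = \<zero>.B <-> (EX z:carrier (W n B). w = witt_V B z)"
proof
 assume "w ! 0 = \<zero>.B"
 thus "EX z:carrier (W n B). w = witt_V B z"
  using w by (cases w) (auto simp: W_carrier[OF B] witt_V_def)
qed (auto simp: witt_V_def)

text \<open>Truncation preserves the remaining ghost components, so over \<open>univ\<close> it
  respects the operations.\<close>

lemma W_butlast_hom: assumes B: "ralgebra B" shows "is_alg_hom (W (Suc n) B) (W n B) butlast"
proof -
 note c = W_closed[OF univ_ralgebra]
 have cl: "butlast x <: W n D" if "ralgebra D" "x <: W (Suc n) D" for x D
  using that by (auto simp: W_carrier dest: in_set_butlastD)
 have gh: "ghost K univ i (butlast x) = ghost K univ i x" if x: "x <: W (Suc n) univ" and i: "i \<le> n" for x i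
  by (rule ghost_cong[OF univ_ralgebra]) (use W_length[OF univ_ralgebra x] W_nth[OF univ_ralgebra x] i in "auto simp: nth_butlast")
 note uc = cl[OF univ_ralgebra]
 have U: "butlast (X ++.(W (Suc n) univ) Y) = butlast X ++.(W n univ) butlast Y"
  "butlast (X **.(W (Suc n) univ) Y) = butlast X **.(W n univ) butlast Y"
  if "X <: W (Suc n) univ" "Y <: W (Suc n) univ" for X Y
  using that by (auto simp: c uc gh W_ghost_simps[OF univ_ralgebra] intro!: W_eqI[OF univ_ralgebra univ_tf, where n = n])
 have U1: "butlast (alg (W (Suc n) univ) r) = alg (W n univ) r" for r
  by (rule W_eqI[OF univ_ralgebra univ_tf, where n = n]) (auto simp add: c uc gh W_ghost_simps[OF univ_ralgebra])
 have alg: "butlast (alg (W (Suc n) B) r) = alg (W n B) r" for r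
 proof -
  obtain h X where h: "h : alg_hom univ B" by (rule W_lift1[OF B W_closed(4)[OF B]])
  from arg_cong[OF U1, of "map h"] show ?thesis by (simp add: map_butlast W_hom[OF univ_ralgebra B h])
 qed
 show ?thesis
 proof (rule homI)
  fix x y assume xy: "x <: W (Suc n) B" "y <: W (Suc n) B"
  obtain h X Y where h: "h : alg_hom univ B" and X: "X <: W (Suc n) univ" and Y: "Y <: W (Suc n) univ"
  and m: "map h X = x" "map h Y = y" by (rule W_lift2[OF B xy])
  from arg_cong[OF U(1)[OF X Y], of "map h"] arg_cong[OF U(2)[OF X Y], of "map h"]
  show "butlast (x ++.(W (Suc n) B) y) = butlast x ++.(W n B) butlast y"
  "butlast (x **.(W (Suc n) B) y) = butlast x **.(W n B) butlast y"
  by (simp_all add: map_butlast W_hom[OF univ_ralgebra B h] X Y uc m)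
 next
  interpret S: r_algebra "W (Suc n) B" using B ..
  interpret N: r_algebra "W n B" using B ..
  show "butlast \<one>.(W (Suc n) B) = \<one>.(W n B)" using alg[of 1] by simp
 qed (simp_all add: cl[OF B] alg)
qed

end

lemma (in cring) finsum_ideal:
 assumes J: "ideal J R" and "finite A" "!!i. i : A ==> f i : J" shows "finsum R f A : J"
 using assms(2,3)
proof (induction A rule: finite_induct)
 case (insert i A)
 have "f : insert i A \<rightarrow> carrier R" using insert.prems idealD(1)[OF J] by auto
 thus ?case using insert by (simp add: finsum_insert idealD(3)[OF J])
qed (simp add: idealD(2)[OF J])

context witt_vectors begin

text \<open>The components of the Frobenius are polynomials, obtained from
  \<open>cghost_frobenius\<close> together with their congruence to \<open>q\<close>-th powers. The
  congruence is recorded for this particular structure and passes to the chosen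
  \<open>witt_F\<close> by uniqueness.\<close>

lemma witt_F_exists:
 obtains \<Phi> :: "('r, 'b) ralg => 'b list => 'b list" where "witt_F_structure K (Suc n) \<Phi>"
  "!!B x i. ralgebra B ==> x <: W (Suc n) B ==> i \<le> n ==>
  cgr \<pi> 1 B (\<Phi> B x ! i) ((x ! i) [^].B q)"
proof -
 let ?c = "psing 0 \<pi> :: 'r mpoly"
 obtain h where h: "h \<ge> 1" "q = p ^ h" using q_pow by blast
 obtain d where d: "of_nat p = \<pi> * d" using pi_dvd_p by (rule dvdE)
 have "(of_nat p :: 'r mpoly) = ?c * psing 0 d"
  by (simp add: mult_single flip: d single_of_nat)
 hence "?c dvd of_nat p" by simp
 from cghost_frobenius[OF this h, of n mvar]
 obtain y where y: "!!i. i \<le> n ==> cghost ?c q i y = cghost ?c q (Suc i) mvar" "!!i. i \<le> n ==> ?c dvd y i - mvar i ^ q"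
  by auto
 \<comment> \<open>The surplus variables are sent to zero, so that all values lie in
   \<open>B\<close>.\<close>
 define ev where "ev B x = r_algebra.eval_poly B (%k. if k \<le> Suc n then x ! k else \<zero>.B)" for B :: "('r, 'b) ralg" and x :: "'b list"
 define \<Phi> where "\<Phi> B x = map (%i. ev B x (y i)) [0..<Suc n]" for B x
 have arg: "(if k \<le> Suc n then x ! k else \<zero>.B) <: B" if B: "ralgebra B" and x: "x <: W (Suc n) B" for B x k
  using W_nth[OF B x, of k] ralgebraD[OF B] by (auto simp: r_algebra_def cring_def ring.ring_simprules)
 have ev: "is_alg_hom poly_alg B (ev B x)" "k \<le> Suc n ==> ev B x (mvar k) = x ! k"
  if B: "ralgebra B" and x: "x <: W (Suc n) B" for B x k
  using r_algebra.eval_poly_hom[OF ralgebraD[OF B], of "%k. if k \<le> Suc n then x ! k else \<zero>.B"]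
  r_algebra.eval_poly_var[OF ralgebraD[OF B], of "%k. if k \<le> Suc n then x ! k else \<zero>.B" k] arg[OF B x]
  by (simp_all add: ev_def)
 have nth: "\<Phi> B x ! i = ev B x (y i)" if "i \<le> n" for B x i
  using that nth_map_upt[of i "Suc n" 0 "%i. ev B x (y i)"] by (simp add: \<Phi>_def del: upt_Suc)
 have cl: "\<Phi> B x <: W n B" if B: "ralgebra B" and x: "x <: W (Suc n) B" for B x
  using homD(2)[OF ev(1)[OF that]] by (auto simp: W_carrier[OF B] \<Phi>_def simp del: upt_Suc)
 have gh: "ghost K B i (\<Phi> B x) = ghost K B (Suc i) x"
  if B: "ralgebra B" and x: "x <: W (Suc n) B" and i: "i \<le> n" for B x i
 proof -
  have eq: "map (%i. ev B x (mvar i)) [0..<Suc (Suc n)] = x"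
  by (rule nth_equalityI) (use W_length[OF B x] ev(2)[OF B x] in "auto simp del: upt_Suc")
  have "ghost K B i (\<Phi> B x) = ev B x (cghost ?c q (Suc i) mvar)"
  unfolding \<Phi>_def by (rule ghost_eval[OF B ev(1)[OF B x] y(1) i])
  also have "... = ghost K B (Suc i) x"
  using ghost_eval[OF B ev(1)[OF B x], of "Suc n" mvar "%i. cghost ?c q i mvar" "Suc i"] i by (simp only: eq Suc_le_mono)
  finally show ?thesis .
 qed
 have nat: "\<Phi> C (map h x) = map h (\<Phi> B x)"
  if B: "ralgebra B" and C: "ralgebra C" and h: "h : alg_hom B C" and x: "x <: W (Suc n) B" for B C h x
 proof -
  have "h (ev B x f) = ev C (map h x) f" for f
  unfolding ev_def r_algebra.eval_poly_natural[OF ralgebraD[OF B] C alg_homD[OF h] arg[OF B x]]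
  using W_length[OF B x] hom_more(1)[OF B C alg_homD[OF h]]
  by (intro arg_cong[where f = "%z. r_algebra.eval_poly C z f"]) auto
  thus ?thesis by (simp add: \<Phi>_def)
 qed
 note U = univ_ralgebra and c = W_closed[OF univ_ralgebra]
 have add: "\<Phi> univ (X ++.(W (Suc n) univ) Y) = \<Phi> univ X ++.(W n univ) \<Phi> univ Y"
  and mult: "\<Phi> univ (X **.(W (Suc n) univ) Y) = \<Phi> univ X **.(W n univ) \<Phi> univ Y"
  if "X <: W (Suc n) univ" "Y <: W (Suc n) univ" for X Y
  using that by (auto simp: c cl[OF U] gh[OF U] W_ghost_simps[OF U] intro!: W_eqI[OF U univ_tf, where n = n])
 have one: "\<Phi> univ \<one>.(W (Suc n) univ) = \<one>.(W n univ)"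
  by (rule W_eqI[OF U univ_tf, where n = n]) (auto simp: c cl[OF U] gh[OF U] W_ghost_simps[OF U])
 have "witt_F_structure K (Suc n) \<Phi>"
  unfolding witt_F_structure_def diff_Suc_1
 proof (intro allI impI conjI ballI)
  fix B :: "('r, 'b) ralg" assume B: "ralgebra B"
  show "\<Phi> B : ring_hom (W (Suc n) B) (W n B)"
  proof (rule ring_hom_memI)
  fix x y assume xy: "x <: W (Suc n) B" "y <: W (Suc n) B"
  show "\<Phi> B x <: W n B" by (rule cl[OF B xy(1)])
  obtain h X Y where h: "h : alg_hom univ B" and X: "X <: W (Suc n) univ" and Y: "Y <: W (Suc n) univ"
  and m: "map h X = x" "map h Y = y" by (rule W_lift2[OF B xy])
  from arg_cong[OF add[OF X Y], of "map h"] arg_cong[OF mult[OF X Y], of "map h"]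
  show "\<Phi> B (x ++.(W (Suc n) B) y) = \<Phi> B x ++.(W n B) \<Phi> B y"
  "\<Phi> B (x **.(W (Suc n) B) y) = \<Phi> B x **.(W n B) \<Phi> B y"
  by (simp_all add: W_hom[OF U B h] X Y c cl[OF U] m nat[OF U B h, symmetric])
  next
  obtain h X where h: "h : alg_hom univ B" by (rule W_lift1[OF B W_closed(4)[OF B]])
  from arg_cong[OF one, of "map h"] show "\<Phi> B \<one>.(W (Suc n) B) = \<one>.(W n B)"
  by (simp add: W_hom[OF U B h] c nat[OF U B h, symmetric])
  qed
 qed (simp_all add: gh nat)
 moreover have "cgr \<pi> 1 B (\<Phi> B x ! i) ((x ! i) [^].B q)"
  if B: "ralgebra B" and x: "x <: W (Suc n) B" and i: "i \<le> n" for B x i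
 proof -
  interpret r_algebra B using B ..
  note e = homD[OF ev(1)[OF B x]] hom_more[OF ralgebra_poly_alg B ev(1)[OF B x]]
  obtain f where f: "y i - mvar i ^ q = ?c * f" using y(2)[OF i] by (rule dvdE)
  have "y i \<ominus>.poly_alg mvar i [^].poly_alg q = alg poly_alg \<pi> **.poly_alg f" using f by simp
  from arg_cong[OF this, of "ev B x"]
  have "ev B x (y i) \<ominus>.B (x ! i) [^].B q = alg B \<pi> **.B ev B x f"
  using e(3,4,9,10) ev(2)[OF B x, of i] i by simp
  thus ?thesis unfolding cong_mod_def nth[OF i]
  using e(2) W_nth[OF B x, of i] i by (auto intro!: pow_idealI[of "ev B x f"])
 qed
 ultimately show thesis by (rule that)
qed

text \<open>On \<open>univ\<close> the ghost components leave no choice, and every Witt vector is a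
  specialisation of one over \<open>univ\<close>.\<close>

lemma witt_F_unique:
 assumes "witt_F_structure K (Suc n) \<Phi>" "witt_F_structure K (Suc n) \<Phi>'"
  and B: "ralgebra B" and x: "x <: W (Suc n) B"
 shows "\<Phi> B x = \<Phi>' B x"
proof -
 have s: "\<Phi> B : ring_hom (W (Suc n) B) (W n B)" "x <: W (Suc n) B ==> i \<le> n ==> ghost K B i (\<Phi> B x) = ghost K B (Suc i) x"
  "ralgebra C ==> h : alg_hom B C ==> x <: W (Suc n) B ==> \<Phi> C (map h x) = map h (\<Phi> B x)"
  if "witt_F_structure K (Suc n) \<Phi>" "ralgebra B" for \<Phi> and B C :: "('r, 'b) ralg" and x i h
  using that unfolding witt_F_structure_def by auto
 obtain h X where h: "h : alg_hom univ B" "X <: W (Suc n) univ" "map h X = x" by (rule W_lift1[OF B x])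
 have "\<Phi> univ X = \<Phi>' univ X"
  by (rule W_eqI[OF univ_ralgebra univ_tf, where n = n])
  (simp_all add: s(2)[OF assms(1) univ_ralgebra h(2)] s(2)[OF assms(2) univ_ralgebra h(2)]
  ring_hom_closed[OF s(1)[OF assms(1) univ_ralgebra] h(2)] ring_hom_closed[OF s(1)[OF assms(2) univ_ralgebra] h(2)])
 thus ?thesis using s(3)[OF assms(1) univ_ralgebra B h(1,2)] s(3)[OF assms(2) univ_ralgebra B h(1,2)] h(3) by simp
qed

lemma witt_F: "witt_F_structure K (Suc n) (witt_F K (Suc n) :: ('r, 'b) ralg => _)"
proof (rule witt_F_exists[of n])
 fix \<Phi> :: "('r, 'b) ralg => 'b list => 'b list" assume "witt_F_structure K (Suc n) \<Phi>"
 thus ?thesis unfolding witt_F_def by (rule someI[of "witt_F_structure K (Suc n)" \<Phi>])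
qed

lemma F_closed: "ralgebra B ==> x <: W (Suc n) B ==> witt_F K (Suc n) B x <: W n B"
 and F_ghost: "ralgebra B ==> x <: W (Suc n) B ==> i \<le> n ==>
  ghost K B i (witt_F K (Suc n) B x) = ghost K B (Suc i) x"
 and F_natural: "ralgebra B ==> ralgebra (C :: ('r, 'b) ralg) ==> h : alg_hom B C ==> x <: W (Suc n) B ==>
  witt_F K (Suc n) C (map h x) = map h (witt_F K (Suc n) B x)"
 using witt_F[of n] ring_hom_closed[of "witt_F K (Suc n) B" "W (Suc n) B" "W n B" x]
 unfolding witt_F_structure_def diff_Suc_1 less_Suc_eq_le by blast+

lemma F_cong:
 assumes B: "ralgebra B" and x: "x <: W (Suc n) B" and i: "i \<le> n"
 shows "cgr \<pi> 1 B (witt_F K (Suc n) B x ! i) ((x ! i) [^].B q)"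
proof (rule witt_F_exists[of n])
 fix \<Phi> :: "('r, 'b) ralg => 'b list => 'b list" assume \<Phi>: "witt_F_structure K (Suc n) \<Phi>"
  and c: "!!B x i. ralgebra B ==> x <: W (Suc n) B ==> i \<le> n ==>
  cgr \<pi> 1 B (\<Phi> B x ! i) ((x ! i) [^].B q)"
 show ?thesis using c[OF assms] witt_F_unique[OF witt_F \<Phi> B x] by simp
qed

subsection \<open>Completeness\<close>

lemma twist_complete:
 fixes B :: "('r, 'd) ralg"
 assumes "adic K B" shows "adic K (twist K k B)"
proof -
 note B = adicD[OF assms] and T = twist_ralgebra[OF adicD(1)[OF assms], of k]
 have pi: "pow_ideal \<pi> m (twist K k B) = pow_ideal \<pi> m B" for m by (simp add: pow_ideal_def funpow_frob_pi)
 have "cring B" "cring (twist K k B)" using B(1) T by (simp_all add: ralgebra_def)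
 hence cong: "cong_mod (twist K k B) J x y <-> cong_mod B J x y" for J x y
  unfolding cong_mod_def using minus_same_ops[of B "twist K k B" x y] by auto
 show ?thesis
  by (rule adic_completeI[OF T]) (use B(2,3) in "simp_all add: pi cong")
qed

text \<open>Over \<open>univ\<close> a multiple of \<open>\<pi>^(n + m)\<close> has ghost components
  divisible by \<open>\<pi>^(n + m)\<close>. Solving for the component of index \<open>i\<close>
  loses \<open>i\<close> factors \<pi>, hence at most \<open>n\<close>.\<close>

lemma W_pow_ideal_components:
 assumes B: "ralgebra B" and x: "x : pow_ideal \<pi> (n + m) (W n B)" and i: "i \<le> n"
 shows "x ! i : pow_ideal \<pi> m B"
proof -
 interpret Wn: r_algebra "W n B" using B ..
 note U = univ_ralgebra and c = W_closed[OF univ_ralgebra]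
 obtain y where y: "y <: W n B" "x = alg (W n B) (\<pi> ^ (n + m)) **.(W n B) y" by (rule Wn.pow_idealE[OF x])
 obtain h Y where h: "h : alg_hom univ B" and Y: "Y <: W n univ" and m: "map h Y = y" by (rule W_lift1[OF B y(1)])
 let ?X = "alg (W n univ) (\<pi> ^ (n + m)) **.(W n univ) Y"
 let ?b = "%i. if i \<le> n then ghost K univ i Y else \<zero>.univ"
 have b: "?b i <: univ" for i using W_ghost_closed[OF U Y] by auto
 obtain z where z: "length z = Suc n" "set z <= carrier univ"
  "!!i. i \<le> n ==> ghost K univ i z = alg univ (\<pi> ^ (n + m)) **.univ ?b i"
  "!!i. i \<le> n ==> z ! i : pow_ideal \<pi> (n + m - i) univ"
  by (rule ghost_divisible[where b = ?b and N = "n + m" and n = n, OF U b]) (simp, rule that)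
 have "?X = z"
  by (rule W_eqI[OF U univ_tf, where n = n])
  (use z W_I[OF U] in "simp_all add: c Y W_ghost_simps[OF U] funpow_frob_pi")
 moreover have "x = map h ?X" by (simp only: W_hom[OF U B h] c Y y(2) m)
 ultimately have "x = map h z" by simp
 hence "x ! i = h (z ! i)" using z(1) i by simp
 also have "... : pow_ideal \<pi> (n + m - i) B" by (rule hom_pow_ideal[OF U alg_homD[OF h] z(4)[OF i]])
 also have "... <= pow_ideal \<pi> m B" by (rule r_algebra.pow_ideal_antimono[OF ralgebraD[OF B]]) (use i in simp)
 finally show ?thesis .
qed

text \<open>Components divisible by \<open>\<pi>^(n + m)\<close> have ghost components divisible by
  it. Of this, \<open>\<pi>^n\<close> is spent on finding a Witt vector with prescribed ghost
  components, and \<open>\<pi>^m\<close> remains.\<close>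

lemma W_pow_ideal_if_components:
 assumes B: "ralgebra B" and x: "x <: W n B" and xi: "!!i. i \<le> n ==> x ! i : pow_ideal \<pi> (n + m) B"
 shows "x : pow_ideal \<pi> m (W n B)"
proof -
 interpret r_algebra B using B ..
 interpret Wn: r_algebra "W n B" using B ..
 note U = univ_ralgebra and c = W_closed[OF univ_ralgebra]
 have "EX b:carrier B. i \<le> n --> x ! i = alg B (\<pi> ^ (n + m)) **.B b" for i
 proof (cases "i \<le> n")
  case True
  obtain b where "b <: B" "x ! i = alg B (\<pi> ^ (n + m)) **.B b" by (rule pow_idealE[OF xi[OF True]])
  thus ?thesis by blast
 qed auto
 then obtain b where b: "!!i. b i <: B" "!!i. i \<le> n ==> x ! i = alg B (\<pi> ^ (n + m)) **.B b i" by metis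
 obtain h where h: "h : alg_hom univ B" "!!i. h (uvar i) = b i" by (rule univ_map[where x = b, OF B b(1)]) (rule that)
 let ?X = "map (%i. alg univ (\<pi> ^ (n + m)) **.univ uvar i) [0..<Suc n]"
 have X: "?X <: W n univ" by (auto simp: W_carrier[OF U] simp del: upt_Suc)
 have Xi: "?X ! i = alg univ (\<pi> ^ (n + m)) **.univ uvar i" if "i \<le> n" for i
  using that nth_map_upt[of i "Suc n" 0] by (simp del: upt_Suc)
 have xX: "x = map h ?X"
  by (rule nth_equalityI) (use W_length[OF B x] b(2) h(2) in "auto simp: ahD[OF h(1)] simp del: upt_Suc")
 have "EX g:carrier univ. i \<le> n --> ghost K univ i ?X = alg univ (\<pi> ^ (n + m)) **.univ g" for i
 proof (cases "i \<le> n")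
  case True
  note I = idealD[OF cmpl.pow_ideal[of \<pi> "n + m"]]
  have "alg univ (\<pi> ^ j) **.univ ?X ! j [^].univ (q ^ (i - j)) : pow_ideal \<pi> (n + m) univ" if j: "j : {..i}" for j
  proof -
  obtain l where l: "q ^ (i - j) = Suc l" using q_ge2 by (metis not0_implies_Suc not_numeral_le_zero power_not_zero)
  have "?X ! j : pow_ideal \<pi> (n + m) univ"
  using j True Xi[of j] by (intro cmpl.pow_idealI[of "uvar j"]) auto
  thus ?thesis using l I(1) by (auto intro!: I(4) simp del: upt_Suc)
  qed
  hence "ghost K univ i ?X : pow_ideal \<pi> (n + m) univ"
  unfolding ghost_def by (intro cmpl.finsum_ideal[OF cmpl.pow_ideal]) (simp_all del: upt_Suc)
  thus ?thesis by (rule cmpl.pow_idealE) blast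
 qed auto
 then obtain g where g: "!!i. g i <: univ" "!!i. i \<le> n ==> ghost K univ i ?X = alg univ (\<pi> ^ (n + m)) **.univ g i" by metis
 obtain z where z: "length z = Suc n" "set z <= carrier univ" "!!i. i \<le> n ==> ghost K univ i z = alg univ (\<pi> ^ n) **.univ g i"
  by (rule ghost_divisible[where b = g, OF U g(1) le_refl]) blast
 have zW: "z <: W n univ" using z W_I[OF U] by simp
 have "?X = alg (W n univ) (\<pi> ^ m) **.(W n univ) z"
  by (rule W_eqI[OF U univ_tf X])
  (use g(2) z(3) g(1) in "simp_all add: c zW W_ghost_simps[OF U] funpow_frob_pi power_add cmpl.alg_mult cmpl.m_ac del: upt_Suc")
 hence "x = alg (W n B) (\<pi> ^ m) **.(W n B) map h z" unfolding xX by (simp only: W_hom[OF U B h(1)] c zW)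
 thus ?thesis by (intro Wn.pow_idealI[of "map h z"] W_hom(1)[OF U B h(1) zW])
qed

text \<open>Subtraction of Witt vectors is not componentwise, but over \<open>B / \<pi>^m B\<close>
  a difference vanishes exactly when the reductions are equal.\<close>

lemma W_minus_components:
 assumes B: "ralgebra B" and x: "x <: W n B" and y: "y <: W n B"
 shows "(\<forall>i\<le>n. (x \<ominus>.(W n B) y) ! i : pow_ideal \<pi> m B) <-> (\<forall>i\<le>n. cgr \<pi> m B (x ! i) (y ! i))"
proof -
 interpret r_algebra B using B ..
 interpret Wn: r_algebra "W n B" using B ..
 let ?J = "pow_ideal \<pi> m B"
 note Q = quot[OF B pow_ideal[of \<pi> m]]
 define h where "h = restrict (crep B ?J) (carrier B)"
 have h: "h : alg_hom B (quot ?J B)" unfolding h_def by (rule restrict_hom[OF B Q(2)])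
 interpret QW: r_algebra "W n (quot ?J B)" using Q(1) ..
 have d: "x \<ominus>.(W n B) y <: W n B" by (rule W_closed(3)[OF B x y])
 have eq: "map h u = map h v <-> (\<forall>i\<le>n. h (u ! i) = h (v ! i))" if "u <: W n B" "v <: W n B" for u v
  using W_length[OF B that(1)] W_length[OF B that(2)] by (auto simp: list_eq_iff_nth_eq less_Suc_eq_le)
 have "(\<forall>i\<le>n. (x \<ominus>.(W n B) y) ! i : ?J) <-> map h (x \<ominus>.(W n B) y) = map h \<zero>.(W n B)"
  unfolding eq[OF d W_closed(4)[OF B]] using W_nth[OF B d] Q(5) cong_zero_iff[OF pow_ideal[of \<pi> m]]
  by (auto simp: W_zero[OF B] h_def simp del: replicate.simps)
 also have "... <-> map h x = map h y"
  using QW.minus_eq_zero_iff[OF W_hom(1)[OF B Q(1) h x] W_hom(1)[OF B Q(1) h y]]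
  by (simp add: W_hom[OF B Q(1) h] x y)
 also have "... <-> (\<forall>i\<le>n. cong_mod B ?J (x ! i) (y ! i))"
  unfolding eq[OF x y] using W_nth[OF B x] W_nth[OF B y] Q(5) by (auto simp: h_def)
 finally show ?thesis .
qed

lemma W_complete: assumes "adic K B" shows "adic K (W n B)"
proof -
 note B = adicD(1)[OF assms]
 interpret r_algebra B using B ..
 interpret Wn: r_algebra "W n B" using B ..
 note WI = Wn.pow_ideal[of \<pi>]
 show ?thesis
 proof (rule adic_completeI[OF W_ralgebra[OF B]])
  fix x assume x: "x <: W n B" and xm: "!!m. x : pow_ideal \<pi> m (W n B)"
  show "x = \<zero>.(W n B)"
  proof (rule nth_equalityI)
  show "length x = length \<zero>.(W n B)" using W_length[OF B x] by (simp add: W_zero[OF B])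
  fix i assume "i < length x"
  hence i: "i \<le> n" using W_length[OF B x] by simp
  have "x ! i = \<zero>.B" by (rule adicD(2)[OF assms]) (rule W_pow_ideal_components[OF B xm i])
  thus "x ! i = \<zero>.(W n B) ! i" using i by (simp add: W_zero[OF B] del: replicate.simps)
  qed
 next
  fix s assume s: "!!m. cgr \<pi> m (W n B) (s (Suc m)) (s m)"
  have sc: "s m <: W n B" for m using cong_modD(2)[OF s] .
  \<comment> \<open>The shift by \<open>n\<close> compensates the loss in
    \<open>W_pow_ideal_components\<close>; a second shift below does the same for the way
    back.\<close>
  have comp: "cgr \<pi> m B (s (n + Suc m) ! i) (s (n + m) ! i)" if i: "i \<le> n" for m i
  using W_minus_components[OF B sc sc, of "n + Suc m" "n + m" m] W_pow_ideal_components[OF B, of _ n m] cong_modD(3)[OF s, of "n + m"] i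
  by simp
  have "EX c:carrier B. i \<le> n --> (ALL m. cgr \<pi> m B c (s (n + m) ! i))" for i
  using adicD(3)[OF assms, of "%m. s (n + m) ! i"] comp[of i] by (cases "i \<le> n") auto
  then obtain c where c: "!!i. c i <: B" "!!i m. i \<le> n ==> cgr \<pi> m B (c i) (s (n + m) ! i)" by metis
  let ?x = "map c [0..<Suc n]"
  have x: "?x <: W n B" using c(1) by (auto simp: W_carrier[OF B] simp del: upt_Suc)
  have xi: "?x ! i = c i" if "i \<le> n" for i using that nth_map_upt[of i "Suc n" 0] by (simp del: upt_Suc)
  have "cgr \<pi> m (W n B) ?x (s m)" for m
  proof -
  have "?x \<ominus>.(W n B) s (n + (n + m)) : pow_ideal \<pi> m (W n B)"
  by (rule W_pow_ideal_if_components[OF B W_closed(3)[OF B x sc]])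
  (use W_minus_components[OF B x sc, of "n + (n + m)" "n + m"] c(2) xi in "simp del: upt_Suc")
  hence "cgr \<pi> m (W n B) ?x (s (n + (n + m)))" using x sc by (simp add: cong_mod_def del: upt_Suc)
  moreover have "cgr \<pi> m (W n B) (s (n + (n + m))) (s m)"
  by (rule Wn.cauchy_cong[OF s]) simp
  ultimately show ?thesis by (rule Wn.cong_trans[OF WI])
  qed
  thus "EX c:carrier (W n B). ALL m. cgr \<pi> m (W n B) c (s m)" using x by blast
 qed
qed

end

context witt_vectors begin

subsection \<open>The fibre product with the base ring\<close>

abbreviation T :: "nat => ('r, 'b) ralg => ('r, 'r \<times> 'b list) ralg" where "T \<equiv> twitt K"

lemma T_carrier: "(r, w) <: T n B <-> w <: W n B & w ! 0 = alg B r"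
 by (simp add: twitt_def)

lemma T_sel:
 "(r, w) **.(T n B) (s, v) = (r * s, w **.(W n B) v)" "(r, w) ++.(T n B) (s, v) = (r + s, w ++.(W n B) v)"
 "\<one>.(T n B) = (1, \<one>.(W n B))" "\<zero>.(T n B) = (0, \<zero>.(W n B))" "alg (T n B) r = (r, alg (W n B) r)"
 by (simp_all add: twitt_def)

lemma T_ralgebra: assumes B: "ralgebra B" shows "ralgebra (T n B)"
proof -
 interpret r_algebra B using B ..
 interpret Wn: r_algebra "W n B" using B ..
 note h = homD[OF W_head_hom[OF B, of n]] hom_more[OF W_ralgebra[OF B] B W_head_hom[OF B, of n]]
 have "cring (T n B)"
 proof (rule cringI)
  show "abelian_group (T n B)"
  proof (rule abelian_groupI)
  fix x assume x: "x <: T n B"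
  thus "EX y:carrier (T n B). y ++.(T n B) x = \<zero>.(T n B)"
  by (intro bexI[of _ "(- fst x, \<ominus>.(W n B) snd x)"]) (cases x; simp add: T_carrier T_sel h alg_uminus Wn.l_neg)+
  qed (auto simp: T_carrier T_sel h alg_add Wn.a_ac add_ac)
  show "Group.comm_monoid (T n B)"
  by (rule comm_monoidI) (auto simp: T_carrier T_sel h alg_mult Wn.m_ac mult_ac)
 qed (auto simp: T_carrier T_sel Wn.l_distr distrib_right)
 thus ?thesis unfolding ralgebra_def
  by (auto intro!: ring_hom_memI simp: T_carrier T_sel h Wn.alg_mult Wn.alg_add)
qed

lemmas T_r_algebra [intro?] = ralgebraD[OF T_ralgebra]

lemma T_fst_hom: "is_alg_hom (T n B) base_alg fst" and T_snd_hom: "is_alg_hom (T n B) (W n B) snd"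
 by (rule homI; auto simp: T_carrier T_sel)+

lemma T_hom:
 assumes "is_alg_hom D base_alg f" "is_alg_hom D (W n B) g" "!!c. c <: D ==> g c ! 0 = alg B (f c)"
 shows "is_alg_hom D (T n B) (%c. (f c, g c))"
 by (rule homI) (use assms(3) in "simp_all add: T_carrier T_sel homD[OF assms(1)] homD[OF assms(2)]")

text \<open>The unique presentation \<open>(r, f(r) + V z)\<close> of elements of the fibre product.
  In terms of \<open>r\<close> and \<open>z\<close>, addition and divisibility by powers of \<pi>
  split, which reduces completeness to that of the two parts.\<close>

definition T_pair :: "nat => ('r, 'b) ralg => 'r => 'b list => 'r \<times> 'b list" where
 "T_pair n B r z = (r, alg (W (Suc n) B) r ++.(W (Suc n) B) witt_V B z)"

context
 fixes B :: "('r, 'b) ralg"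
 assumes B: "ralgebra B"
begin

interpretation B: r_algebra B using B ..

lemma T_pair_closed: assumes z: "z <: W n B" shows "T_pair n B r z <: T (Suc n) B"
 using homD(3,5)[OF W_head_hom[OF B, of "Suc n"]] V_closed[OF B z] W_closed[OF B]
 by (simp add: T_pair_def T_carrier) (simp add: witt_V_def)

lemma T_pair_surj:
 assumes x: "x <: T (Suc n) B"
 obtains z where "z <: W n B" "x = T_pair n B (fst x) z"
proof -
 interpret Wn: r_algebra "W (Suc n) B" using B ..
 obtain r w where xrw: "x = (r, w)" by (cases x)
 hence w: "w <: W (Suc n) B" "w ! 0 = alg B r" using x by (simp_all add: T_carrier)
 have "(w \<ominus>.(W (Suc n) B) alg (W (Suc n) B) r) ! 0 = \<zero>.B"
  using hom_more(3)[OF W_ralgebra[OF B] B W_head_hom[OF B], of w "Suc n"] homD(3)[OF W_head_hom[OF B, of "Suc n"]] w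
  by (simp add: B.minus_eq B.r_neg)
 then obtain z where z: "z <: W n B" "w \<ominus>.(W (Suc n) B) alg (W (Suc n) B) r = witt_V B z"
  using W_head_zero_iff[OF B, of "w \<ominus>.(W (Suc n) B) alg (W (Suc n) B) r" n] w(1) by auto
 have "w = alg (W (Suc n) B) r ++.(W (Suc n) B) (w \<ominus>.(W (Suc n) B) alg (W (Suc n) B) r)"
  using w(1) by (simp add: Wn.minus_eq Wn.a_lcomm Wn.r_neg)
 thus thesis using z xrw by (intro that[of z]) (simp_all add: T_pair_def)
qed

lemma T_pair_inject:
 assumes "z <: W n B" "z' <: W n B" "T_pair n B r z = T_pair n B r z'"
 shows "z = z'"
proof -
 interpret Wn: r_algebra "W (Suc n) B" using B ..
 show ?thesis using assms V_closed[OF B] by (simp add: T_pair_def V_inject)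
qed

lemma T_pair_add:
 assumes z: "z <: W n B" "z' <: W n B"
 shows "T_pair n B r z ++.(T (Suc n) B) T_pair n B r' z' = T_pair n B (r + r') (z ++.(W n B) z')"
proof -
 interpret Wn: r_algebra "W (Suc n) B" using B ..
 show ?thesis using V_closed[OF B z(1)] V_closed[OF B z(2)] by (simp add: T_pair_def T_sel V_add[OF B z] Wn.alg_add Wn.a_ac)
qed

lemma T_pair_scale:
 assumes z: "z <: W n B"
 shows "alg (T (Suc n) B) (\<pi> ^ m) **.(T (Suc n) B) T_pair n B r z = T_pair n B (\<pi> ^ m * r) (alg (W n B) (\<pi> ^ m) **.(W n B) z)"
proof -
 interpret Wn: r_algebra "W (Suc n) B" using B ..
 show ?thesis using V_closed[OF B z] by (simp add: T_pair_def T_sel V_scale[OF B z] Wn.alg_mult Wn.r_distr)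
qed

lemma T_pair_minus:
 assumes z: "z <: W n B" "z' <: W n B"
 shows "T_pair n B r z \<ominus>.(T (Suc n) B) T_pair n B r' z' = T_pair n B (r - r') (z \<ominus>.(W n B) z')"
proof -
 interpret Wn: r_algebra "W n B" using B ..
 interpret Tn: r_algebra "T (Suc n) B" using B ..
 have d: "z \<ominus>.(W n B) z' <: W n B" using z by simp
 have "T_pair n B r z = T_pair n B (r - r') (z \<ominus>.(W n B) z') ++.(T (Suc n) B) T_pair n B r' z'"
  using z by (subst T_pair_add[OF d z(2)]) (simp add: Wn.minus_eq Wn.a_assoc Wn.l_neg)
 thus ?thesis using T_pair_closed[OF d, of "r - r'"] T_pair_closed[OF z(2), of r']
  by (simp add: Tn.minus_eq Tn.a_assoc Tn.r_neg)
qed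

lemma T_pair_pow_ideal:
 assumes z: "z <: W n B"
 shows "T_pair n B r z : pow_ideal \<pi> m (T (Suc n) B) <-> r : pow_ideal \<pi> m base_alg & z : pow_ideal \<pi> m (W n B)"
proof -
 interpret Wn: r_algebra "W n B" using B ..
 interpret Tn: r_algebra "T (Suc n) B" using B ..
 interpret R: r_algebra "base_alg :: ('r, 'r) ralg" using ralgebra_base_alg ..
 show ?thesis
 proof
  assume "T_pair n B r z : pow_ideal \<pi> m (T (Suc n) B)"
  then obtain y where y: "y <: T (Suc n) B" "T_pair n B r z = alg (T (Suc n) B) (\<pi> ^ m) **.(T (Suc n) B) y"
  by (rule Tn.pow_idealE)
  obtain v where v: "v <: W n B" "y = T_pair n B (fst y) v" by (rule T_pair_surj[OF y(1)])
  have eq: "T_pair n B r z = T_pair n B (\<pi> ^ m * fst y) (alg (W n B) (\<pi> ^ m) **.(W n B) v)"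
  using y(2) T_pair_scale[OF v(1)] v(2) by metis
  hence r: "r = \<pi> ^ m * fst y" by (simp add: T_pair_def)
  have "z = alg (W n B) (\<pi> ^ m) **.(W n B) v"
  by (rule T_pair_inject[OF z _ eq[folded r]]) (use v(1) in simp)
  thus "r : pow_ideal \<pi> m base_alg & z : pow_ideal \<pi> m (W n B)"
  using v(1) r by (auto intro!: Wn.pow_idealI R.pow_idealI)
 next
  assume a: "r : pow_ideal \<pi> m base_alg & z : pow_ideal \<pi> m (W n B)"
  obtain v where v: "v <: W n B" "z = alg (W n B) (\<pi> ^ m) **.(W n B) v" by (rule Wn.pow_idealE[OF conjunct2[OF a]])
  obtain s where s: "r = alg base_alg (\<pi> ^ m) **.base_alg s" by (rule R.pow_idealE[OF conjunct1[OF a]])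
  show "T_pair n B r z : pow_ideal \<pi> m (T (Suc n) B)"
  by (rule Tn.pow_idealI[OF T_pair_closed[OF v(1), of s]]) (simp add: T_pair_scale[OF v(1)] v(2) s)
 qed
qed

end

lemma T_complete: assumes c: "adic K B" shows "adic K (T (Suc n) B)"
proof -
 note B = adicD(1)[OF c] and Wc = W_complete[OF c, of n]
 interpret Wn: r_algebra "W n B" using B ..
 interpret Ws: r_algebra "W (Suc n) B" using B ..
 interpret Tn: r_algebra "T (Suc n) B" using B ..
 have zero: "T_pair n B 0 \<zero>.(W n B) = \<zero>.(T (Suc n) B)"
  by (simp add: T_pair_def T_sel W_zero[OF B] witt_V_def) (simp add: W_zero[OF B, symmetric, of "Suc n", simplified])
 have cong: "cgr \<pi> m (T (Suc n) B) (T_pair n B r z) (T_pair n B r' z')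
  <-> cgr \<pi> m base_alg r r' & cgr \<pi> m (W n B) z z'"
  if "z <: W n B" "z' <: W n B" for m r r' z z'
  using that T_pair_pow_ideal[OF B, of "z \<ominus>.(W n B) z'" n "r - r'" m]
  by (simp add: cong_mod_def T_pair_minus[OF B] T_pair_closed[OF B])
 show ?thesis
 proof (rule adic_completeI[OF T_ralgebra[OF B]])
  fix x assume x: "x <: T (Suc n) B" and xm: "!!m. x : pow_ideal \<pi> m (T (Suc n) B)"
  obtain z where z: "z <: W n B" "x = T_pair n B (fst x) z" by (rule T_pair_surj[OF B x])
  have m: "fst x : pow_ideal \<pi> m base_alg & z : pow_ideal \<pi> m (W n B)" for m
  using xm[of m] T_pair_pow_ideal[OF B z(1), of "fst x" m] z(2) by simp
  have "fst x = 0" using adicD(2)[OF base_complete, of "fst x"] m by simp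
  moreover have "z = \<zero>.(W n B)" using adicD(2)[OF Wc, of z] m by simp
  ultimately show "x = \<zero>.(T (Suc n) B)" using z(2) zero by simp
 next
  fix s assume s: "!!m. cgr \<pi> m (T (Suc n) B) (s (Suc m)) (s m)"
  have "EX z. z <: W n B & s m = T_pair n B (fst (s m)) z" for m
  by (rule T_pair_surj[OF B cong_modD(2)[OF s[of m]]]) blast
  then obtain z where z: "!!m. z m <: W n B" "!!m. s m = T_pair n B (fst (s m)) (z m)" by metis
  have 1: "cgr \<pi> m base_alg (fst (s (Suc m))) (fst (s m))
  & cgr \<pi> m (W n B) (z (Suc m)) (z m)" for m
  using s[of m] cong[OF z(1) z(1), of m "fst (s (Suc m))" "Suc m" "fst (s m)" m] by (simp flip: z(2))
  obtain r where r: "!!m. cgr \<pi> m base_alg r (fst (s m))"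
  using adicD(3)[OF base_complete, of "%m. fst (s m)"] 1 by auto
  obtain v where v: "v <: W n B" "!!m. cgr \<pi> m (W n B) v (z m)"
  using adicD(3)[OF Wc, of z] 1 by auto
  have "cgr \<pi> m (T (Suc n) B) (T_pair n B r v) (s m)" for m
  using cong[OF v(1) z(1), of m r "fst (s m)" m] r v(2) by (simp flip: z(2))
  thus "EX c:carrier (T (Suc n) B). ALL m. cgr \<pi> m (T (Suc n) B) c (s m)"
  using T_pair_closed[OF B v(1)] by blast
 qed
qed

subsection \<open>The lateral Frobenius on Witt vectors\<close>

text \<open>\<open>TF n\<close> goes from \<open>T (n + 2) B\<close> to \<open>T (n + 1)\<close> of
  the twist; the shift leaves out the case in which the target is just the base ring.\<close>

abbreviation TF :: "nat => ('r, 'b) ralg => 'r \<times> 'b list => 'r \<times> 'b list" where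
 "TF n \<equiv> twitt_F K (Suc (Suc n))"

lemma TF_pair:
 assumes B: "ralgebra B" and z: "z <: W (Suc n) B"
 shows "TF n B (T_pair (Suc n) B r z) = T_pair n (twist K (Suc 0) B) r (witt_F K (Suc n) B z)"
proof -
 have "(THE z'. z' <: W (Suc n) B & alg (W (Suc (Suc n)) B) r ++.(W (Suc (Suc n)) B) witt_V B z
  = alg (W (Suc (Suc n)) B) r ++.(W (Suc (Suc n)) B) witt_V B z') = z"
 proof (rule the_equality)
  fix z' assume a: "z' <: W (Suc n) B & alg (W (Suc (Suc n)) B) r ++.(W (Suc (Suc n)) B) witt_V B z
  = alg (W (Suc (Suc n)) B) r ++.(W (Suc (Suc n)) B) witt_V B z'"
  hence "T_pair (Suc n) B r z' = T_pair (Suc n) B r z" by (simp add: T_pair_def)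
  thus "z' = z" by (rule T_pair_inject[OF B conjunct1[OF a] z])
 qed (use z in simp)
 thus ?thesis
  using T_pair_closed[OF B z, of r] by (simp add: twitt_F_def T_pair_def witt_V_def Let_def)
qed

lemma TF_fst:
 assumes B: "ralgebra B" and x: "x <: T (Suc (Suc n)) B" shows "fst (TF n B x) = fst x"
proof -
 obtain z where z: "z <: W (Suc n) B" "x = T_pair (Suc n) B (fst x) z" by (rule T_pair_surj[OF B x])
 show ?thesis using TF_pair[OF B z(1), of "fst x"] z(2) by (simp add: T_pair_def)
qed

lemma TF_closed:
 assumes B: "ralgebra B" and x: "x <: T (Suc (Suc n)) B"
 shows "TF n B x <: T (Suc n) (twist K (Suc 0) B)"
proof -
 obtain z where z: "z <: W (Suc n) B" "x = T_pair (Suc n) B (fst x) z" by (rule T_pair_surj[OF B x])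
 have "witt_F K (Suc n) B z <: W n (twist K (Suc 0) B)"
  using F_closed[OF B z(1)] by (simp add: W_carrier[OF B] W_carrier[OF twist_ralgebra[OF B]])
 from T_pair_closed[OF twist_ralgebra[OF B] this, of "fst x"] show ?thesis
  using TF_pair[OF B z(1), of "fst x"] z(2) by simp
qed

text \<open>For \<open>x = (r, f(r) + V z)\<close> both sides are the image of
  \<open>\<phi>^(i + 2) r\<close> plus \<pi> times the ghost component of \<open>z\<close> of index
  \<open>i + 1\<close>; on the left one \<phi> comes from the twist. So the ghost components of
  positive index are shifted, while that of index 0 stays tied to \<open>r\<close>.\<close>

lemma TF_ghost:
 assumes B: "ralgebra B" and x: "x <: T (Suc (Suc n)) B" and i: "i \<le> n"
 shows "ghost K B (Suc i) (snd (TF n B x)) = ghost K B (Suc (Suc i)) (snd x)"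
proof -
 interpret r_algebra B using B ..
 let ?B = "twist K (Suc 0) B"
 note B' = twist_ralgebra[OF B, of "Suc 0"]
 obtain z where z: "z <: W (Suc n) B" "x = T_pair (Suc n) B (fst x) z" by (rule T_pair_surj[OF B x])
 let ?y = "witt_F K (Suc n) B z" and ?r = "fst x"
 note y = F_closed[OF B z(1)]
 have y': "?y <: W n ?B" using y by (simp add: W_carrier[OF B] W_carrier[OF B'])
 have V: "witt_V ?B ?y <: W (Suc n) ?B" by (rule V_closed[OF B' y'])
 have "ghost K B (Suc i) (snd (TF n B x)) = ghost K ?B (Suc i) (alg (W (Suc n) ?B) ?r ++.(W (Suc n) ?B) witt_V ?B ?y)"
  using TF_pair[OF B z(1), of ?r] z(2) by (simp add: T_pair_def ghost_twist)
 also have "... = alg B ((\<phi> ^^ Suc (Suc i)) ?r) ++.B alg B \<pi> **.B ghost K B (Suc i) z"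
  using i ghost_V(2)[OF B y i] F_ghost[OF B z(1) i]
  by (simp add: W_ghost_simps[OF B'] W_closed[OF B'] V funpow_swap1) (simp add: ghost_twist witt_V_def)
 also have "... = ghost K B (Suc (Suc i)) (snd (T_pair (Suc n) B ?r z))"
  using i ghost_V(2)[OF B z(1), of "Suc i"] V_closed[OF B z(1)]
  by (simp add: T_pair_def W_ghost_simps[OF B] W_closed[OF B])
 finally show ?thesis using z(2) by simp
qed

lemma T_map:
 assumes B: "ralgebra B" and C: "ralgebra C" and h: "h : alg_hom B C"
 shows "is_alg_hom (T n B) (T n C) (%x. (fst x, map h (snd x)))"
proof (rule T_hom[OF T_fst_hom hom_comp[OF T_snd_hom W_map[OF B C h]]])
 fix x assume "x <: T n B"
 hence x: "snd x <: W n B" "snd x ! 0 = alg B (fst x)" by (cases x; simp add: T_carrier)+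
 show "map h (snd x) ! 0 = alg C (fst x)"
  using W_length[OF B x(1)] x(2) ahD(3)[OF h] by simp
qed

lemma TF_natural:
 assumes B: "ralgebra B" and C: "ralgebra C" and h: "h : alg_hom B C" and x: "x <: T (Suc (Suc n)) B"
 shows "TF n C (fst x, map h (snd x)) = (fst x, map h (snd (TF n B x)))"
proof -
 note tw = twist_ralgebra[OF B, of "Suc 0"] twist_ralgebra[OF C, of "Suc 0"] alg_hom_twist[OF h, of "Suc 0"]
 have m: "map h (snd (T_pair k D r z)) = snd (T_pair k E r (map h z))"
  if "ralgebra D" "ralgebra E" "h : alg_hom D E" "z <: W k D" for k r z and D E :: "('r, 'b) ralg"
  using V_closed[OF that(1,4)] by (simp add: T_pair_def W_hom[OF that(1-3)] W_closed[OF that(1)] V_natural[OF that(1-3)])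
 obtain z where z: "z <: W (Suc n) B" "x = T_pair (Suc n) B (fst x) z" by (rule T_pair_surj[OF B x])
 have "(fst x, map h (snd x)) = T_pair (Suc n) C (fst x) (map h z)"
  using m[OF B C h z(1), of "fst x"] z(2) by (metis T_pair_def fst_conv prod.collapse)
 hence "TF n C (fst x, map h (snd x)) = T_pair n (twist K (Suc 0) C) (fst x) (map h (witt_F K (Suc n) B z))"
  by (simp only: TF_pair[OF C W_hom(1)[OF B C h z(1)]] F_natural[OF B C h z(1)])
 also have "... = (fst x, map h (snd (T_pair n (twist K (Suc 0) B) (fst x) (witt_F K (Suc n) B z))))"
  using F_closed[OF B z(1)]
  by (subst m[OF tw]) (simp_all add: T_pair_def W_carrier[OF B] W_carrier[OF tw(1)])
 also have "... = (fst x, map h (snd (TF n B x)))" using TF_pair[OF B z(1), of "fst x"] z(2) by simp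
 finally show ?thesis .
qed

text \<open>Over \<open>univ\<close> an element of the fibre product is determined by
  \<open>r\<close> and its ghost components of positive index, the one of index 0 being the image of
  \<open>r\<close>. \<open>TF_ghost\<close> controls these, and naturality gives the general
  case.\<close>

lemma TF_hom: assumes B: "ralgebra B" shows "is_alg_hom (T (Suc (Suc n)) B) (T (Suc n) (twist K (Suc 0) B)) (TF n B)"
proof -
 note U = univ_ralgebra and U' = twist_ralgebra[OF univ_ralgebra, of "Suc 0"] and B' = twist_ralgebra[OF B, of "Suc 0"]
 interpret TU: r_algebra "T (Suc (Suc n)) univ" using U ..
 interpret TU': r_algebra "T (Suc n) (twist K (Suc 0) univ)" using U' ..
 let ?T = "T (Suc (Suc n))" and ?T' = "%B. T (Suc n) (twist K (Suc 0) B)"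
 have eqI: "X = Y" if "X <: ?T' univ" "Y <: ?T' univ" "fst X = fst Y"
  "!!i. i \<le> n ==> ghost K univ (Suc i) (snd X) = ghost K univ (Suc i) (snd Y)" for X Y
 proof -
  have c: "snd X <: W (Suc n) (twist K (Suc 0) univ)" "snd Y <: W (Suc n) (twist K (Suc 0) univ)"
  "snd X ! 0 = snd Y ! 0" using that(1-3) by (cases X; cases Y; simp add: T_carrier)+
  have "ghost K univ 0 (snd X) = ghost K univ 0 (snd Y)"
  using W_nth0[OF U' c(1)] W_nth0[OF U' c(2)] c(3) by (simp add: ghost_twist)
  hence "ghost K univ i (snd X) = ghost K univ i (snd Y)" if "i \<le> Suc n" for i
  using \<open>!!i. i \<le> n ==> _ i\<close> that by (cases i) auto
  hence "snd X = snd Y" by (intro W_eqI[OF U univ_tf, where n = "Suc n"])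
  (use c(1,2) in "auto simp: W_carrier[OF U] W_carrier[OF U']")
  thus ?thesis using that(3) by (simp add: prod_eq_iff)
 qed
 have gs: "ghost K univ i (snd (X ++.(T k D) Y)) = ghost K univ i (snd X) ++.univ ghost K univ i (snd Y)"
  "ghost K univ i (snd (X **.(T k D) Y)) = ghost K univ i (snd X) **.univ ghost K univ i (snd Y)"
  if "D = univ \<or> D = twist K (Suc 0) univ" "i \<le> k" "X <: T k D" "Y <: T k D" for X Y i k D
  using that W_ghost_simps(1,2)[OF U that(2)] W_ghost_simps(1,2)[OF U' that(2)]
  by (cases X; cases Y; auto simp: T_sel T_carrier ghost_twist)+
 have fs: "fst (X ++.(T k D) Y) = fst X + fst Y" "fst (X **.(T k D) Y) = fst X * fst Y" for X Y k D
  by (cases X; cases Y; simp add: T_sel)+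
 have UH: "TF n univ (X ++.(?T univ) Y) = TF n univ X ++.(?T' univ) TF n univ Y"
  "TF n univ (X **.(?T univ) Y) = TF n univ X **.(?T' univ) TF n univ Y"
  if X: "X <: ?T univ" and Y: "Y <: ?T univ" for X Y
  using X Y TF_closed[OF U X] TF_closed[OF U Y]
  by (auto intro!: eqI simp: TF_closed[OF U] TF_fst[OF U] fs gs TF_ghost[OF U])
 show ?thesis
 proof (rule homI)
  fix x assume x: "x <: ?T B"
  show "TF n B x <: ?T' B" by (rule TF_closed[OF B x])
 next
  fix x y assume xy: "x <: ?T B" "y <: ?T B"
  obtain z where z: "z <: W (Suc n) B" "x = T_pair (Suc n) B (fst x) z" by (rule T_pair_surj[OF B xy(1)])
  obtain v where v: "v <: W (Suc n) B" "y = T_pair (Suc n) B (fst y) v" by (rule T_pair_surj[OF B xy(2)])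
  obtain h Z V where h: "h : alg_hom univ B" and Z: "Z <: W (Suc n) univ" and V: "V <: W (Suc n) univ"
  and m: "map h Z = z" "map h V = v" by (rule W_lift2[OF B z(1) v(1)])
  note H = homD[OF T_map[OF U B h, of "Suc (Suc n)"]]
  homD[OF T_map[OF U' B' alg_hom_twist[OF h], of "Suc n"]]
  let ?X = "T_pair (Suc n) univ (fst x) Z" and ?Y = "T_pair (Suc n) univ (fst y) V" and ?h = "%x. (fst x, map h (snd x))"
  have lift: "?h (T_pair (Suc n) univ r Z) = T_pair (Suc n) B r (map h Z)" if "Z <: W (Suc n) univ" for r Z
  using V_closed[OF U that] by (simp add: T_pair_def W_hom[OF U B h] W_closed[OF U] V_natural[OF U B h])
  have c: "?X <: ?T univ" "?Y <: ?T univ" by (simp_all add: T_pair_closed[OF U] Z V)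
  have x: "x = ?h ?X" "y = ?h ?Y" using lift Z V z(2) v(2) m by metis+
  have nat: "TF n B (?h X) = ?h (TF n univ X)" if "X <: ?T univ" for X
  using TF_natural[OF U B h that] TF_fst[OF U that] by simp
  note f = TF_closed[OF U]
  have "TF n B (?h ?X ++.(?T B) ?h ?Y) = TF n B (?h ?X) ++.(?T' B) TF n B (?h ?Y)"
  unfolding H(5)[OF c, symmetric] nat[OF TU.a_closed[OF c]] nat[OF c(1)] nat[OF c(2)] UH(1)[OF c]
  by (rule H(11)[OF f[OF c(1)] f[OF c(2)]])
  moreover have "TF n B (?h ?X **.(?T B) ?h ?Y) = TF n B (?h ?X) **.(?T' B) TF n B (?h ?Y)"
  unfolding H(4)[OF c, symmetric] nat[OF TU.m_closed[OF c]] nat[OF c(1)] nat[OF c(2)] UH(2)[OF c]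
  by (rule H(10)[OF f[OF c(1)] f[OF c(2)]])
  ultimately show "TF n B (x ++.(?T B) y) = TF n B x ++.(?T' B) TF n B y"
  "TF n B (x **.(?T B) y) = TF n B x **.(?T' B) TF n B y" using x by simp_all
 next
  interpret TB: r_algebra "?T B" using B ..
  interpret TB': r_algebra "?T' B" using B' ..
  have algU: "TF n univ (alg (?T univ) r) = alg (?T' univ) r" for r
  by (rule eqI) (use TF_ghost[OF U TU.alg_closed] TF_closed[OF U TU.alg_closed] TU'.alg_closed TF_fst[OF U TU.alg_closed] W_ghost_simps(5)[OF U] W_ghost_simps(5)[OF U']
  in "auto simp: T_sel ghost_twist funpow_swap1")
  show alg: "TF n B (alg (?T B) r) = alg (?T' B) r" for r
  proof -
  obtain h X where h: "h : alg_hom univ B" by (rule W_lift1[OF B W_closed(4)[OF B]])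
  show ?thesis using TF_natural[OF U B h TU.alg_closed, of r] algU[of r]
  by (simp add: T_sel W_hom(4)[OF U B h] W_hom(4)[OF U' B' alg_hom_twist[OF h]])
  qed
  show "TF n B \<one>.(?T B) = \<one>.(?T' B)" using alg[of 1] by simp
 qed
qed

subsection \<open>Reduction modulo the uniformizer\<close>

text \<open>Additivity is inherited from the Frobenius of Witt vectors with two components: it is
  additive, and where \<pi> vanishes its component of index 0 is the \<open>q\<close>-th
  power.\<close>

lemma power_q_hom:
 fixes B :: "('r, 'b) ralg"
 assumes B: "ralgebra B" and pi: "alg B \<pi> = \<zero>.B"
 shows "is_alg_hom B (twist K (Suc 0) B) (%b. b [^].B q)"
proof -
 interpret r_algebra B using B ..
 interpret W1: r_algebra "W (Suc 0) B" using B ..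
 have J: "pow_ideal \<pi> 1 B = {\<zero>.B}"
  using pi by (auto simp: pow_ideal_def image_iff intro!: bexI[of _ "\<zero>.B"])
 have eq0: "cgr \<pi> 1 B x y ==> x = y" for x y
  unfolding cong_mod_def J using minus_eq_zero_iff by blast
 have F: "witt_F K (Suc 0) B w ! 0 = (w ! 0) [^].B q" if "w <: W (Suc 0) B" for w
  using F_cong[OF B that, of 0] by (intro eq0) simp
 have "alg B (r ^ q) = alg B (\<phi> r)" for r
 proof -
  obtain d where "\<phi> r - r ^ q = \<pi> * d" using frob_cong[of r] by (rule dvdE)
  hence "\<phi> r = \<pi> * d + r ^ q" by (simp add: algebra_simps)
  thus ?thesis by (simp add: alg_add alg_mult pi)
 qed
 moreover have "(a ++.B b) [^].B q = a [^].B q ++.B b [^].B q" if ab: "a <: B" "b <: B" for a b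
 proof -
  have c: "[a, \<zero>.B] <: W (Suc 0) B" "[b, \<zero>.B] <: W (Suc 0) B" using ab by (auto simp: W_carrier[OF B])
  note H = homD(5)[OF W_head_hom[OF B]]
  have "witt_F K (Suc 0) B : ring_hom (W (Suc 0) B) (W 0 B)"
  using witt_F[of 0] B unfolding witt_F_structure_def by simp
  from ring_hom_add[OF this c] have "witt_F K (Suc 0) B ([a, \<zero>.B] ++.(W (Suc 0) B) [b, \<zero>.B]) ! 0
  = witt_F K (Suc 0) B [a, \<zero>.B] ! 0 ++.B witt_F K (Suc 0) B [b, \<zero>.B] ! 0"
  using H[of _ 0] F_closed[OF B c(1)] F_closed[OF B c(2)] by simp
  thus ?thesis using H[OF c] c by (simp add: F)
 qed
 ultimately show ?thesis by (intro homI) (simp_all add: nat_pow_distrib flip: alg_power)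
qed

text \<open>Where \<pi> vanishes, the Frobenius is truncation followed by the map that the
  \<open>q\<close>-th power, a homomorphism to the twist, induces on Witt vectors; the latter
  commutes with \<open>V\<close> and with the structure maps.\<close>

lemma TF_mod_pi:
 assumes B: "ralgebra B" and pi: "alg B \<pi> = \<zero>.B" and x: "x <: T (Suc (Suc n)) B"
 shows "snd (TF n B x) = map (%b. b [^].B q) (butlast (snd x))"
proof -
 interpret r_algebra B using B ..
 note B' = twist_ralgebra[OF B, of "Suc 0"]
 define \<sigma> where "\<sigma> = restrict (%b. b [^].B q) (carrier B)"
 have s: "\<sigma> : alg_hom B (twist K (Suc 0) B)" unfolding \<sigma>_def by (rule restrict_hom[OF B power_q_hom[OF B pi]])
 have ms: "map (%b. b [^].B q) w = map \<sigma> w" if "w <: W k B" for w k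
  using W_set[OF B that] by (auto simp: \<sigma>_def)
 have J: "pow_ideal \<pi> 1 B = {\<zero>.B}"
  using pi by (auto simp: pow_ideal_def image_iff intro!: bexI[of _ "\<zero>.B"])
 have eq0: "cgr \<pi> 1 B x y ==> x = y" for x y
  unfolding cong_mod_def J using minus_eq_zero_iff by blast
 obtain z where z: "z <: W (Suc n) B" "x = T_pair (Suc n) B (fst x) z" by (rule T_pair_surj[OF B x])
 note bl = homD[OF W_butlast_hom[OF B]]
 have bz: "butlast z <: W n B" by (rule bl(2)[OF z(1)])
 have Fz: "witt_F K (Suc n) B z = map \<sigma> (butlast z)"
 proof (rule nth_equalityI)
  show "length (witt_F K (Suc n) B z) = length (map \<sigma> (butlast z))"
  using W_length[OF B F_closed[OF B z(1)]] W_length[OF B z(1)] by simp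
  fix i assume "i < length (witt_F K (Suc n) B z)"
  hence i: "i \<le> n" using W_length[OF B F_closed[OF B z(1)]] by simp
  show "witt_F K (Suc n) B z ! i = map \<sigma> (butlast z) ! i"
  using eq0[OF F_cong[OF B z(1) i]] i W_length[OF B z(1)] W_nth[OF B z(1), of i] by (simp add: nth_butlast \<sigma>_def)
 qed
 have "snd (TF n B x) = alg (W (Suc n) (twist K (Suc 0) B)) (fst x) ++.(W (Suc n) (twist K (Suc 0) B)) witt_V B (map \<sigma> (butlast z))"
  using TF_pair[OF B z(1), of "fst x"] z(2) Fz by (simp add: T_pair_def witt_V_def)
 also have "witt_V B (map \<sigma> (butlast z)) = map \<sigma> (witt_V B (butlast z))"
  using V_natural[OF B B' s, of "butlast z"] by (simp add: witt_V_def)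
 also have "alg (W (Suc n) (twist K (Suc 0) B)) (fst x) ++.(W (Suc n) (twist K (Suc 0) B)) map \<sigma> (witt_V B (butlast z))
  = map \<sigma> (alg (W (Suc n) B) (fst x) ++.(W (Suc n) B) witt_V B (butlast z))"
  using V_closed[OF B bz] by (simp add: W_hom[OF B B' s] W_closed[OF B])
 also have "witt_V B (butlast z) = butlast (witt_V B z)" using W_length[OF B z(1)] by (auto simp: witt_V_def)
 also have "alg (W (Suc n) B) (fst x) ++.(W (Suc n) B) butlast (witt_V B z) = butlast (snd (T_pair (Suc n) B (fst x) z))"
  using V_closed[OF B z(1)] by (simp add: T_pair_def bl W_closed[OF B])
 finally have "snd (TF n B x) = map \<sigma> (butlast (snd x))" by (simp only: z(2)[symmetric])
 moreover have "snd x <: W (Suc (Suc n)) B" using x by (cases x) (simp add: T_carrier)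
 ultimately show ?thesis by (simp only: ms[OF bl(2)])
qed

end

section \<open>Jet kernels as sets of algebra homomorphisms\<close>

section \<open>Etale lifting\<close>

lemma alg_hom_restrict_comp:
 "ralgebra C ==> h : alg_hom C D ==> is_alg_hom D E k ==> (\<lambda>c\<in>carrier C. k (h c)) : alg_hom C E"
 using restrict_hom[OF _ hom_comp[OF alg_homD]] .

lemma ex1_unique: "EX! x. P x ==> P a ==> P b ==> a = b"
 by blast

lemma quot_map:
 fixes D :: "('r::comm_ring_1, 'd) ralg" and E :: "('r, 'e) ralg"
 assumes D: "ralgebra D" and E: "ralgebra E" and I: "ideal I D" and J: "ideal J E" and k: "is_alg_hom D E k"
  and kI: "k ` I <= J"
 defines "\<psi> \<equiv> \<lambda>x\<in>carrier (quot I D). crep E J (k x)"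
 shows "\<psi> : alg_hom (quot I D) (quot J E)" "!!x. x <: D ==> \<psi> (crep D I x) = crep E J (k x)"
  "k ` carrier D = carrier E ==> \<psi> ` carrier (quot I D) = carrier (quot J E)"
  "!!x. x <: D ==> \<psi> (crep D I x) = \<zero>.(quot J E) <-> k x : J"
proof -
 interpret D: r_algebra D using D ..
 interpret E: r_algebra E using E ..
 note QI = quot[OF D I] and QJ = quot[OF E J] and kh = homD[OF k] hom_more[OF D E k]
 show \<psi>: "\<psi> (crep D I x) = crep E J (k x)" if x: "x <: D" for x
 proof -
  have c: "crep D I x <: quot I D" "crep D I x <: D"
  using homD(2)[OF QI(2) x] QI(4) by auto
  have "cong_mod D I x (crep D I x)" by (rule D.crep(1)[OF I x])
  hence "cong_mod E J (k x) (k (crep D I x))"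
  using kI x c(2) by (auto simp: cong_mod_def kh simp flip: kh(9))
  thus ?thesis using c(1) QJ(5)[of "k x" "k (crep D I x)"] kh(2) x c(2) by (simp add: \<psi>_def)
 qed
 note p = homD[OF QI(2)] and r = homD[OF QJ(2)]
 have surj: "EX x:carrier D. u = crep D I x" if "u <: quot I D" for u using that QI(3) by auto
 have "is_alg_hom (quot I D) (quot J E) \<psi>"
 proof (rule homI)
  fix u assume "u <: quot I D"
  then obtain x where "x <: D" "u = crep D I x" using surj by auto
  thus "\<psi> u <: quot J E" using r(2)[OF kh(2)] by (simp add: \<psi>)
 next
  fix u v assume "u <: quot I D" "v <: quot I D"
  then obtain x y where x: "x <: D" "u = crep D I x" and y: "y <: D" "v = crep D I y"
  using surj by metis
  show "\<psi> (u **.(quot I D) v) = \<psi> u **.(quot J E) \<psi> v" "\<psi> (u ++.(quot I D) v) = \<psi> u ++.(quot J E) \<psi> v"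
  using x y by (simp_all add: \<psi> kh r flip: p(4,5))
 qed (simp_all add: p(3,6)[symmetric] \<psi> kh r)
 thus "\<psi> : alg_hom (quot I D) (quot J E)" unfolding \<psi>_def by (simp add: alg_hom_def)
 show "\<psi> (crep D I x) = \<zero>.(quot J E) <-> k x : J" if "x <: D" for x
  using QJ(7)[OF kh(2)[OF that]] by (simp add: \<psi>[OF that])
 assume "k ` carrier D = carrier E"
 hence "carrier (quot J E) = (%x. crep E J (k x)) ` carrier D" using QJ(3) by (auto simp: image_image[symmetric])
 thus "\<psi> ` carrier (quot I D) = carrier (quot J E)" using QI(3) \<psi> by (auto simp: image_image)
qed

locale etale_algebra =
 fixes K :: "'r::idom base" and C :: "('r, 's) ralg" and g :: nat and \<xi> :: "nat => 's" and univ_type :: "'c itself"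
 assumes C: "ralgebra C" and \<xi>: "!!j. j : {1..g} ==> \<xi> j <: C"
  and etale: "formally_etale TYPE('c) K C g \<xi>"
begin

abbreviation I :: "nat => ('r, 'd) ralg => 'd set" where "I \<equiv> pow_ideal (unif K)"

text \<open>The lifting property is applied to \<open>E / \<pi>^l E\<close> over
  \<open>B / \<pi>^m B\<close>, whose kernel has square zero by \<open>sq\<close>. Both quotients
  consist of representatives, so their elements are again elements of \<open>E\<close> and
  \<open>B\<close>.\<close>

lemma etale_lift:
 fixes E B :: "('r, 'c) ralg"
 assumes E: "ralgebra E" and B: "ralgebra B" and k: "is_alg_hom E B k" and surj: "k ` carrier E = carrier B" and ml: "m \<le> l"
  and sq: "!!x y. x <: E ==> y <: E ==> k x : I m B ==> k y : I m B ==> x **.E y : I l E"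
  and h: "h : alg_hom C (quot (I m B) B)" and d: "!!j. j : {1..g} ==> d j <: E & crep B (I m B) (k (d j)) = h (\<xi> j)"
 shows "EX! h'. h' : alg_hom C (quot (I l E) E) & (ALL c:carrier C. crep B (I m B) (k (h' c)) = h c) &
  (ALL j:{1..g}. h' (\<xi> j) = crep E (I l E) (d j))"
proof -
 interpret E: r_algebra E using E ..
 interpret B: r_algebra B using B ..
 note IE = E.pow_ideal[of "unif K" l] and IB = B.pow_ideal[of "unif K" m]
 have kI: "k ` I l E <= I m B"
  using hom_pow_ideal[OF E k, of _ "unif K" l] B.pow_ideal_antimono[OF ml] by blast
 note QE = quot[OF E IE] and QB = quot[OF B IB] and \<psi> = quot_map[OF E B IE IB k kI]
 let ?\<psi> = "\<lambda>x\<in>carrier (quot (I l E) E). crep B (I m B) (k x)" and ?d = "%j. crep E (I l E) (d j)"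
 have nil: "alg (quot (I l E) E) (unif K ^ l) = \<zero>.(quot (I l E) E)"
  using QE(7)[OF E.alg_closed] E.alg_pow_in_pow_ideal homD(3)[OF QE(2)] by auto
 have sq': "u **.(quot (I l E) E) v = \<zero>.(quot (I l E) E)"
  if u: "u <: quot (I l E) E" "v <: quot (I l E) E" "?\<psi> u = \<zero>.(quot (I m B) B)" "?\<psi> v = \<zero>.(quot (I m B) B)" for u v
 proof -
  obtain x where x: "x <: E" "u = crep E (I l E) x" using u(1) QE(3) by auto
  obtain y where y: "y <: E" "v = crep E (I l E) y" using u(2) QE(3) by auto
  have "x **.E y : I l E"
  by (rule sq[OF x(1) y(1)]) (use \<psi>(4)[OF x(1)] \<psi>(4)[OF y(1)] u(3,4) x(2) y(2) in simp_all)
  thus ?thesis using QE(7)[of "x **.E y"] x y homD(4)[OF QE(2) x(1) y(1)] by simp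
 qed
 have d': "?d j <: quot (I l E) E & ?\<psi> (?d j) = h (\<xi> j)" if j: "j : {1..g}" for j
  using homD(2)[OF QE(2)] \<psi>(2) d[OF j] by auto
 have "EX! h'. h' : alg_hom C (quot (I l E) E) & (ALL c:carrier C. ?\<psi> (h' c) = h c) & (ALL j:{1..g}. h' (\<xi> j) = ?d j)"
  using etale[unfolded formally_etale_def, rule_format, of "quot (I l E) E" "quot (I m B) B" l ?\<psi> h ?d]
  QE(1) QB(1) nil \<psi>(1) \<psi>(3)[OF surj] sq' h d' by blast
 moreover have "h' : alg_hom C (quot (I l E) E) & (ALL c:carrier C. ?\<psi> (h' c) = h c) & (ALL j:{1..g}. h' (\<xi> j) = ?d j)
  <-> h' : alg_hom C (quot (I l E) E) & (ALL c:carrier C. crep B (I m B) (k (h' c)) = h c) & (ALL j:{1..g}. h' (\<xi> j) = ?d j)" for h'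
  using homD(2)[OF alg_homD, of h' C "quot (I l E) E"] by (intro conj_cong refl) simp
 ultimately show ?thesis by (simp only:)
qed

lemma tower_square:
 fixes E :: "('r, 'c) ralg"
 assumes E: "ralgebra E" and "x : I (Suc m) E" "y : I (Suc m) E" shows "x **.E y : I (Suc (Suc m)) E"
proof -
 interpret r_algebra E using E ..
 show ?thesis using pow_ideal_mult[OF assms(2,3)] pow_ideal_antimono[of "Suc (Suc m)" "Suc m + Suc m" "unif K"] by auto
qed

text \<open>From \<open>D / \<pi>^(m + 1) D\<close> to \<open>D / \<pi>^(m + 2) D\<close> the kernel
  has square zero, so agreement modulo \<pi> and on the coordinates propagates to all
  levels.\<close>

lemma etale_unique:
 fixes D :: "('r, 'c) ralg"
 assumes D: "adic K D" and h: "h : alg_hom C D" "h' : alg_hom C D"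
  and \<xi>eq: "!!j. j : {1..g} ==> h (\<xi> j) = h' (\<xi> j)"
  and c1: "!!c. c <: C ==> cong_mod D (I (Suc 0) D) (h c) (h' c)"
 shows "h = h'"
proof -
 note rD = adicD(1)[OF D]
 interpret D: r_algebra D using rD ..
 note ID = D.pow_ideal[of "unif K"] and Q = quot[OF rD D.pow_ideal[of "unif K"]]
 note hc = ahD(2)[OF h(1)] ahD(2)[OF h(2)]
 have all: "ALL c:carrier C. cong_mod D (I (Suc m) D) (h c) (h' c)" for m
 proof (induction m)
  case (Suc m)
  let ?q = "%m. crep D (I m D)"
  have tow: "?q (Suc m) (?q (Suc (Suc m)) x) = ?q (Suc m) x" if x: "x <: D" for x
  using quot_map(2)[OF rD rD ID ID is_alg_hom_id, of "Suc (Suc m)" "Suc m" x] x D.pow_ideal_antimono[of "Suc m" "Suc (Suc m)"]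
  homD(2)[OF Q(2) x] by auto
  let ?k = "%h c. ?q (Suc (Suc m)) (h c)"
  have k: "(\<lambda>c\<in>carrier C. ?q l (k c)) : alg_hom C (quot (I l D) D)" if "k : alg_hom C D" for k l
  by (rule alg_hom_restrict_comp[OF C that Q(2)])
  have ex: "EX! k. k : alg_hom C (quot (I (Suc (Suc m)) D) D) & (ALL c:carrier C. ?q (Suc m) (k c) = (\<lambda>c\<in>carrier C. ?q (Suc m) (h c)) c) &
  (ALL j:{1..g}. k (\<xi> j) = ?q (Suc (Suc m)) (h (\<xi> j)))"
  proof (rule etale_lift[OF rD rD is_alg_hom_id image_ident _ _ k[OF h(1)]])
  show "x **.D y : I (Suc (Suc m)) D" if "x : I (Suc m) D" "y : I (Suc m) D" for x y
  by (rule tower_square[OF rD that])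
  qed (use hc \<xi> in simp_all)
  have hq: "?q (Suc m) (h' c) = ?q (Suc m) (h c)" if "c <: C" for c
  using Suc.IH that Q(5)[of "h c" "h' c" "Suc m"] hc by auto
  have eq: "(\<lambda>c\<in>carrier C. ?k h c) = (\<lambda>c\<in>carrier C. ?k h' c)"
  by (rule ex1_unique[OF ex]) (simp_all add: k h tow hc hq \<xi> \<xi>eq)
  show ?case
  proof
  fix c assume c: "c <: C"
  show "cong_mod D (I (Suc (Suc m)) D) (h c) (h' c)"
  using fun_cong[OF eq, of c] c Q(5)[OF hc(1)[OF c] hc(2)[OF c]] by simp
  qed
 qed (use c1 in simp)
 have "h c = h' c" if "c <: C" for c
 proof (intro adic_complete_eqI[OF D])
  fix m
  show "cong_mod D (I m D) (h c) (h' c)"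
  by (rule cong_mod_mono[OF bspec[OF all[of m] that] D.pow_ideal_antimono]) simp
 qed
 thus ?thesis by (rule alg_hom_eqI[OF h])
qed

text \<open>The kernel of \<open>k\<close> squares into multiples of \<pi>, not to zero. So the lift
  is made from \<open>B / \<pi> B\<close> to \<open>E / \<pi> E\<close>, raised through the
  quotients of \<open>E\<close>, and passed to the limit. That the limit lies over \<open>h\<close>,
  and not only over its reduction, is uniqueness of homomorphisms to \<open>B\<close>.\<close>

lemma etale_lift_complete:
 fixes E B :: "('r, 'c) ralg"
 assumes E: "adic K E" and B: "adic K B" and k: "is_alg_hom E B k"
  and surj: "k ` carrier E = carrier B"
  and sq: "!!x y. x <: E ==> y <: E ==> k x = \<zero>.B ==> k y = \<zero>.B ==> x **.E y : I (Suc 0) E"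
  and h: "h : alg_hom C B" and d: "!!j. j : {1..g} ==> d j <: E & k (d j) = h (\<xi> j)"
 shows "EX! h'. h' : alg_hom C E & (ALL c:carrier C. k (h' c) = h c) & (ALL j:{1..g}. h' (\<xi> j) = d j)" (is "EX! h'. ?P h'")
proof -
 note rE = adicD(1)[OF E] and rB = adicD(1)[OF B]
 interpret E: r_algebra E using rE ..
 interpret B: r_algebra B using rB ..
 note IE = E.pow_ideal[of "unif K"] and IB = B.pow_ideal[of "unif K"]
 note QE = quot[OF rE IE] and QB = quot[OF rB IB]
 note kh = homD[OF k] hom_more[OF rE rB k] and hc = ahD(2)[OF h]
 let ?q = "%m. crep E (I m E)" and ?r = "crep B (I (Suc 0) B)"
 \<comment> \<open>By surjectivity an element whose image is divisible by \<pi> is a multiple of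
   \<pi> plus an element of the kernel.\<close>
 have sq1: "x **.E y : I (Suc 0) E"
  if xy: "x <: E" "y <: E" "k x : I (Suc 0) B" "k y : I (Suc 0) B" for x y
 proof -
  have split: "EX u:I (Suc 0) E. EX v:carrier E. k v = \<zero>.B & x = u ++.E v" if x: "x <: E" "k x : I (Suc 0) B" for x
  proof -
  obtain b where b: "b <: B" "k x = alg B (unif K ^ Suc 0) **.B b" by (rule B.pow_idealE[OF x(2)])
  obtain e where e: "b = k e" "e <: E" using b(1) unfolding surj[symmetric] by (rule imageE)
  let ?u = "alg E (unif K ^ Suc 0) **.E e"
  have 1: "?u : I (Suc 0) E" by (rule E.pow_idealI[OF e(2) refl])
  have 2: "k (x \<ominus>.E ?u) = \<zero>.B" using x(1) e kh(2)[OF e(2)] unfolding kh(9)[OF x(1) E.m_closed[OF E.alg_closed e(2)]] by (simp add: b(2) kh(3,4) B.r_neg B.minus_eq)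
  have 3: "x = ?u ++.E (x \<ominus>.E ?u)" using x(1) e(2) by (simp add: E.minus_eq E.a_lcomm E.r_neg)
  show ?thesis by (rule bexI[of _ ?u], rule bexI[of _ "x \<ominus>.E ?u"], rule conjI[OF 2 3]) (use x(1) e(2) 1 in simp_all)
  qed
  obtain u v where u: "u : I (Suc 0) E" "v <: E" "k v = \<zero>.B" "x = u ++.E v" using split[OF xy(1,3)] by (elim bexE conjE)
  obtain u' v' where u': "u' : I (Suc 0) E" "v' <: E" "k v' = \<zero>.B" "y = u' ++.E v'" using split[OF xy(2,4)] by (elim bexE conjE)
  note J = idealD[OF IE[of "Suc 0"]]
  have "x **.E y = (y **.E u ++.E v **.E u') ++.E v **.E v'"
  using J(1)[OF u(1)] J(1)[OF u'(1)] u(2) u'(2) unfolding u(4) u'(4) by (simp add: E.l_distr E.r_distr E.m_ac E.a_ac)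
  thus ?thesis using J(3)[OF J(3)[OF J(4)[OF u(1) xy(2)] J(4)[OF u'(1) u(2)]] sq[OF u(2) u'(2) u(3) u'(3)]] by simp
 qed
 have h0: "(\<lambda>c\<in>carrier C. ?r (h c)) : alg_hom C (quot (I (Suc 0) B) B)" by (rule alg_hom_restrict_comp[OF C h QB(2)])
 have start: "EX! f. f : alg_hom C (quot (I (Suc 0) E) E) & (ALL c:carrier C. ?r (k (f c)) = (\<lambda>c\<in>carrier C. ?r (h c)) c) &
  (ALL j:{1..g}. f (\<xi> j) = ?q (Suc 0) (d j))"
  by (rule etale_lift[OF rE rB k surj le_refl sq1 h0]) (use d \<xi> in auto)
 \<comment> \<open>\<open>m\<close> indexes the quotient by \<open>\<pi>^(m + 1)\<close>. Lying over
   \<open>h\<close> is required at the bottom only; \<open>S\<close> ties the higher levels to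
   it.\<close>
 define P where "P m f <-> f : alg_hom C (quot (I (Suc m) E) E) & (m = 0 --> (ALL c:carrier C. ?r (k (f c)) = ?r (h c))) &
  (ALL j:{1..g}. f (\<xi> j) = ?q (Suc m) (d j))" for m f
 define S where "S m f f' <-> (ALL c:carrier C. ?q (Suc m) (f' c) = f c)" for m and f f' :: "'s => 'c"
 have "EX f. ALL m. P m (f m) & S m (f m) (f (Suc m))"
 proof (rule dependent_nat_choice)
  show "EX f. P 0 f" using start unfolding P_def by auto
  fix f m assume f: "P m f"
  have "EX! f'. f' : alg_hom C (quot (I (Suc (Suc m)) E) E) & (ALL c:carrier C. ?q (Suc m) (f' c) = f c) &
  (ALL j:{1..g}. f' (\<xi> j) = ?q (Suc (Suc m)) (d j))"
  proof (rule etale_lift[OF rE rE is_alg_hom_id image_ident])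
  show "x **.E y : I (Suc (Suc m)) E" if "x : I (Suc m) E" "y : I (Suc m) E" for x y
  by (rule tower_square[OF rE that])
  qed (use f d in "simp_all add: P_def")
  thus "EX f'. P (Suc m) f' & S m f f'" unfolding P_def S_def by auto
 qed
 then obtain f where f: "!!m. P m (f m)" "!!m. S m (f m) (f (Suc m))" by blast
 have fh: "f m : alg_hom C (quot (I (Suc m) E) E)" for m using f(1)[of m] by (simp add: P_def)
 have fq: "f m c <: quot (I (Suc m) E) E" "f m c <: E" if "c <: C" for m c
  using ahD(2)[OF fh that] QE(4) by auto
 have ff: "cong_mod E (I (Suc m) E) (f (Suc m) c) (f m c)" if c: "c <: C" for m c
  using f(2)[of m] c QE(5)[OF fq(2)[OF c] fq(2)[OF c], of "Suc m" "Suc m" m] QE(6)[OF fq(1)[OF c, of m]] by (simp add: S_def)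
 have "EX L. L <: E & (ALL m. cong_mod E (I m E) L (f m c))" if c: "c <: C" for c
  using adicD(3)[OF E, of "%m. f m c"] cong_mod_mono[OF ff[OF c] E.pow_ideal_antimono] by auto
 then obtain L where L: "!!c. c <: C ==> L c <: E" "!!c m. c <: C ==> cong_mod E (I m E) (L c) (f m c)" by metis
 have Lf: "?q (Suc m) (L c) = f m c" if c: "c <: C" for c m
  using iffD2[OF QE(5)[OF L(1)[OF c] fq(2)[OF c]] E.cong_trans[OF IE L(2)[OF c] ff[OF c]]] QE(6)[OF fq(1)[OF c], of m] by simp
 have eqI: "x = y" if "x <: E" "y <: E" "!!m. ?q (Suc m) x = ?q (Suc m) y" for x y
 proof (rule adic_complete_eqI[OF E])
  fix m
  show "cong_mod E (I m E) x y"
  by (rule cong_mod_mono[OF iffD1[OF QE(5)[OF that(1,2)] that(3)[of m]] E.pow_ideal_antimono]) simp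
 qed
 have "is_alg_hom C E L"
 proof (rule homI)
  interpret C: r_algebra C using C ..
  show "L (alg C r) = alg E r" for r
  by (rule eqI) (simp_all add: L Lf ahD[OF fh] homD[OF QE(2)])
  show "L \<one>.C = \<one>.E"
  by (rule eqI) (simp_all add: L Lf ahD[OF fh] homD[OF QE(2)])
  fix c c' assume c: "c <: C" "c' <: C"
  show "L (c **.C c') = L c **.E L c'"
  by (rule eqI) (use c in "simp_all add: L Lf ahD[OF fh] homD[OF QE(2)]")
  show "L (c ++.C c') = L c ++.E L c'"
  by (rule eqI) (use c in "simp_all add: L Lf ahD[OF fh] homD[OF QE(2)]")
 qed (rule L(1))
 hence Lh: "restrict L (carrier C) : alg_hom C E" by (rule restrict_hom[OF C])
 have L\<xi>: "L (\<xi> j) = d j" if j: "j : {1..g}" for j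
  by (rule eqI) (use f(1) j \<xi>[OF j] d[OF j] in "auto simp: L Lf P_def")
 have rk: "?r (k (?q (Suc 0) x)) = ?r (k x)" if "x <: E" for x
  using quot_map(2)[OF rE rB IE IB k _ that, of "Suc 0" "Suc 0"] hom_pow_ideal[OF rE k, of _ "unif K" "Suc 0"] homD(2)[OF QE(2) that] by auto
 have kL: "k (L c) = h c" if c: "c <: C" for c
 proof -
  have "(\<lambda>c\<in>carrier C. k (restrict L (carrier C) c)) = h"
  proof (rule etale_unique[OF B alg_hom_restrict_comp[OF C Lh k] h])
  fix c assume c: "c <: C"
  show "cong_mod B (I (Suc 0) B) ((\<lambda>c\<in>carrier C. k (restrict L (carrier C) c)) c) (h c)"
  using iffD1[OF QB(5)[OF kh(2)[OF L(1)[OF c]] hc[OF c], of "Suc 0"]] rk[OF L(1)[OF c]] Lf[OF c, of 0] f(1)[of 0] c by (simp add: P_def)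
  qed (use \<xi> d L\<xi> in auto)
  from fun_cong[OF this, of c] show ?thesis using c by simp
 qed
 have LL: "?P (restrict L (carrier C))" using Lh kL L\<xi> \<xi> by auto
 show ?thesis
 proof (rule ex1I[of ?P, OF LL])
  fix h' assume h': "?P h'"
  have lift: "(\<lambda>c\<in>carrier C. ?q (Suc 0) (h' c)) : alg_hom C (quot (I (Suc 0) E) E) &
  (ALL c:carrier C. ?r (k ((\<lambda>c\<in>carrier C. ?q (Suc 0) (h' c)) c)) = (\<lambda>c\<in>carrier C. ?r (h c)) c) &
  (ALL j:{1..g}. (\<lambda>c\<in>carrier C. ?q (Suc 0) (h' c)) (\<xi> j) = ?q (Suc 0) (d j))"
  if h': "?P h'" for h'
  using alg_hom_restrict_comp[OF C conjunct1[OF h'] QE(2)] h' \<xi> rk[OF ahD(2)[OF conjunct1[OF h']]] by auto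
  have eq: "(\<lambda>c\<in>carrier C. ?q (Suc 0) (h' c)) = (\<lambda>c\<in>carrier C. ?q (Suc 0) (restrict L (carrier C) c))"
  by (rule ex1_unique[OF start], rule lift[OF h'], rule lift[OF LL])
  show "h' = restrict L (carrier C)"
  proof (rule etale_unique[OF E conjunct1[OF h'] Lh])
  fix c assume c: "c <: C"
  show "cong_mod E (I (Suc 0) E) (h' c) (restrict L (carrier C) c)"
  using fun_cong[OF eq, of c] QE(5)[OF homD(2)[OF alg_homD[OF conjunct1[OF h']] c] L(1)[OF c], of "Suc 0"] c by simp
  qed (use h' L\<xi> \<xi> in auto)
 qed
qed

end

section \<open>Points of the kernel of the jet space\<close>

context affine_chart begin

text \<open>If the kernel of \<open>k : D \<rightarrow> E\<close> is nil modulo \<open>\<pi>\<close>, then \<open>Spf E\<close> and \<open>Spf D\<close> have the same points.\<close>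

lemma retract_point:
 assumes D: "adic K D" and E: "adic K E" and k: "is_alg_hom D E k"
  and surj: "k ` carrier D = carrier E"
  and sq: "!!d. d <: D ==> k d = \<zero>.E ==> d **.D d : pow_ideal (unif K) (Suc 0) D"
  and x: "x : Mor (Spf K D) X" and y: "y : Mor (Spf K E) X" "lands_in K E U y"
 shows "comp_mor (Spf K E) (Spf K D) X x (Spf_map K D E k) = y <->
  lands_in K D U x & (ALL c:carrier C. k (point_hom K X U D x c) = point_hom K X U E y c)"
proof
 note rD = adicD(1)[OF D] and rE = adicD(1)[OF E]
 interpret D: r_algebra D using rD ..
 interpret E: r_algebra E using rE ..
 note kh = homD[OF k] hom_more[OF rD rE k]
 assume eq: "comp_mor (Spf K E) (Spf K D) X x (Spf_map K D E k) = y"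
 have lands: "lands_in K D U x"
  unfolding lands_in_def
 proof
  fix P assume "P : spf_pts K D"
  hence P: "primeideal P D" and piP: "alg D (unif K) : P" by (simp_all add: spf_pts_def)
  interpret P: primeideal P D by (rule P)
  note IP = idealD[OF P.ideal_axioms]
  have ker: "d : P" if d: "d <: D" "k d = \<zero>.E" for d
  proof -
  obtain c where c: "c <: D" "d **.D d = alg D (unif K ^ Suc 0) **.D c" by (rule D.pow_idealE[OF sq[OF d]])
  hence "d **.D d : P" using IP(4)[OF piP c(1)] by (simp add: D.m_comm)
  thus ?thesis using P.I_prime[OF d(1) d(1)] by blast
  qed
  \<comment> \<open>\<open>P\<close> contains the kernel of \<open>k\<close>, so it is the preimage
    of its image, and \<open>x\<close> sends it where \<open>y\<close> sends the image.\<close>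
  have bk: "d : P" if d: "d <: D" "k d : k ` P" for d
  proof -
  obtain a where a: "k d = k a" "a : P" using d(2) by (rule imageE)
  have ac: "a <: D" by (rule IP(1)[OF a(2)])
  have "d \<ominus>.D a : P" by (rule ker) (use d(1) ac a(1) kh(2)[OF ac] in "simp_all add: kh E.minus_eq E.r_neg")
  from IP(3)[OF this a(2)] show ?thesis using d(1) ac by (simp add: D.minus_eq D.a_assoc D.l_neg)
  qed
  have Q: "k ` P : spf_pts K E"
  unfolding spf_pts_def
  proof (rule CollectI, rule conjI[OF primeidealI])
  show "ideal (k ` P) E"
  proof (rule idealI_cring[OF E.is_cring])
  show "k ` P <= carrier E" using kh(2) IP(1) by auto
  show "\<zero>.E : k ` P" using kh(7) IP(2) by (auto simp: image_iff intro!: bexI[of _ "\<zero>.D"])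
  show "a ++.E b : k ` P" if "a : k ` P" "b : k ` P" for a b
  using that kh(5)[symmetric] IP(1,3) by (auto intro!: imageI)
  show "b **.E a : k ` P" if ab: "a : k ` P" "b <: E" for a b
  proof -
  obtain b' where b': "b = k b'" "b' <: D" using ab(2) unfolding surj[symmetric] by (rule imageE)
  thus ?thesis using ab(1) kh(4)[symmetric] IP(1,4) by (auto intro!: imageI)
  qed
  qed
  show "carrier E ~= k ` P"
  proof
  assume "carrier E = k ` P"
  hence "k \<one>.D : k ` P" using kh(2)[of "\<one>.D"] by simp
  from bk[OF D.one_closed this] show False using P.one_imp_carrier P.I_notcarr by auto
  qed
  show "a : k ` P \<or> b : k ` P" if ab: "a <: E" "b <: E" "a **.E b : k ` P" for a b
  proof -
  obtain a' where a': "a = k a'" "a' <: D" using ab(1) unfolding surj[symmetric] by (rule imageE)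
  obtain b' where b': "b = k b'" "b' <: D" using ab(2) unfolding surj[symmetric] by (rule imageE)
  have "a' **.D b' : P" by (rule bk) (use a' b' ab(3) in "simp_all add: kh")
  from P.I_prime[OF a'(2) b'(2) this] show ?thesis unfolding a'(1) b'(1) by (blast intro: imageI)
  qed
  show "alg E (unif K) : k ` P" using piP kh(3)[symmetric] by (auto intro!: imageI)
  qed (rule E.is_cring)
  have "{d : carrier D. k d : k ` P} = P" using bk IP(1) by (auto intro!: imageI)
  hence "pts x P = pts (comp_mor (Spf K E) (Spf K D) X x (Spf_map K D E k)) (k ` P)"
  using Q Spf_map_in_Mor(4)[OF rD rE k Q] Spf_topspace[OF rE, of K] by (simp add: comp_mor_def Spf_def)
  thus "pts x P : U" using y(2) Q eq by (simp add: lands_in_def)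
 qed
 show "lands_in K D U x & (ALL c:carrier C. k (point_hom K X U D x c) = point_hom K X U E y c)"
  using lands point_hom_map(3)[OF D E k x lands] eq by simp
next
 assume a: "lands_in K D U x & (ALL c:carrier C. k (point_hom K X U D x c) = point_hom K X U E y c)"
 note m = point_hom_map[OF D E k x conjunct1[OF a]]
 show "comp_mor (Spf K E) (Spf K D) X x (Spf_map K D E k) = y"
  by (rule point_hom_inj[OF E m(1,2) y alg_hom_eqI[OF point_hom_alg_hom[OF E m(1,2)] point_hom_alg_hom[OF E y]]])
  (use m(3) a in simp)
qed

lemma point_eqI:
 assumes D: "adic K D" and x: "x : Mor (Spf K D) X" "lands_in K D U x"
  and y: "y : Mor (Spf K D) X" "lands_in K D U y"
  and eq: "!!c. c <: C ==> point_hom K X U D x c = point_hom K X U D y c"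
 shows "x = y"
 by (rule point_hom_inj[OF D x y alg_hom_eqI[OF point_hom_alg_hom[OF D x] point_hom_alg_hom[OF D y] eq]])

end

locale abelian_jets = witt_vectors p K u for p :: nat and K :: "'r::idom base" and u :: "'b itself" +
 fixes A :: "('p, 'r, 's, 'b list) fgroup" and g :: nat and U :: "'p set" and \<xi> :: "nat => 's"
 assumes group: "formal_group_scheme K A" and coordinates: "coordinates_at_identity K A g U \<xi>"
begin

lemma etale_coords: "etale_coordinates TYPE('b list) K (und A) g U \<xi>"
 using coordinates by (simp add: coordinates_at_identity_def)

sublocale chart: affine_chart K "und A" U
 using group etale_coords
 by unfold_locales (simp_all add: formal_group_scheme_def formal_scheme_def locally_ringed_def etale_coordinates_def)

abbreviation CU :: "('r, 's) ralg" where "CU \<equiv> sec (und A) U"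

sublocale etale: etale_algebra K CU g \<xi> "TYPE('b list)"
 using etale_coords chart.C_alg by unfold_locales (simp_all add: etale_coordinates_def)

abbreviation ph where "ph \<equiv> point_hom K (und A) U"

definition eps :: "'s => 'r" where "eps = ph base_alg (idsec A)"

lemma idsec: "idsec A : Mor (Spf K base_alg) (und A)" "lands_in K base_alg U (idsec A)"
 using group coordinates by (auto simp: formal_group_scheme_def points_def coordinates_at_identity_def lands_in_def)

lemma eps_hom: "eps : alg_hom CU base_alg"
 unfolding eps_def by (rule chart.point_hom_alg_hom[OF base_complete idsec])

lemma eps_\<xi>: "j : {1..g} ==> eps (\<xi> j) = 0"
 unfolding eps_def using etale.\<xi>[of j] coordinates
 by (intro chart.point_hom_unique[OF base_complete]) (auto simp: coordinates_at_identity_def)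

lemma points_map:
 assumes "adic K D" "adic K E" "is_alg_hom D E k"
  "x : points K A D" "lands_in K D U x"
 shows "points_map K A D E k x : points K A E" "lands_in K E U (points_map K A D E k x)"
  "!!c. c <: CU ==> ph E (points_map K A D E k x) c = k (ph D x c)"
 using chart.point_hom_map[OF assms[unfolded points_def]] by (simp_all add: points_map_def points_def)

lemma id_point:
 assumes D: "adic K D"
 shows "id_point K A D : points K A D" "lands_in K D U (id_point K A D)"
  "!!c. c <: CU ==> ph D (id_point K A D) c = alg D (eps c)"
 using points_map[OF base_complete D is_alg_hom_alg[OF adicD(1)[OF D]]] idsec
 by (simp_all add: id_point_def eps_def points_def)

lemma points_eqI:
 assumes "adic K D" "x : points K A D" "lands_in K D U x" "y : points K A D" "lands_in K D U y"
  "!!c. c <: CU ==> ph D x c = ph D y c"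
 shows "x = y"
 using chart.point_eqI[of D x y] assms by (simp add: points_def)

text \<open>By \<open>jet_hom\<close> and \<open>jet_of_hom\<close> these homomorphisms are the
  points of \<open>N^(n + 1)(B)\<close>. The parameter \<open>n\<close> is one less than the index
  of the jet kernel, which is thus at least 1.\<close>

definition JH :: "nat => ('r, 'b) ralg => ('s => 'b list) set" where
 "JH n B = {al : alg_hom CU (W (Suc n) B). ALL c:carrier CU. al c ! 0 = alg B (eps c)}"

abbreviation jk :: "nat => ('r, 'b) ralg => ('p, 's, 'b) jet set" where "jk n \<equiv> jet_ker K A (Suc n)"
abbreviation jh :: "nat => ('r, 'b) ralg => ('p, 's, 'b) jet => 's => 'b list" where "jh n B \<equiv> ph (W (Suc n) B)"
abbreviation (input) "jadd n B \<equiv> gmul A (W (Suc n) B)"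
abbreviation (input) "jmap n \<equiv> jet_ker_map K A (Suc n)"
abbreviation (input) "Hm n \<equiv> Hom_Ga K A (Suc n)"

lemma W_head:
 fixes n :: nat
 assumes B: "ralgebra B"
 defines "k \<equiv> \<lambda>w\<in>carrier (W (Suc n) B). w ! 0"
 shows "is_alg_hom (W (Suc n) B) B k" "k ` carrier (W (Suc n) B) = carrier B"
  "!!v w. v <: W (Suc n) B ==> w <: W (Suc n) B ==> v ! 0 = \<zero>.B ==> w ! 0 = \<zero>.B ==>
  v **.(W (Suc n) B) w : pow_ideal \<pi> (Suc 0) (W (Suc n) B)"
proof -
 interpret B: r_algebra B using B ..
 interpret Wn: r_algebra "W (Suc n) B" using B ..
 show "is_alg_hom (W (Suc n) B) B k" unfolding k_def
  using restrict_hom[OF W_ralgebra[OF B] W_head_hom[OF B]] by (rule alg_homD)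
 show "k ` carrier (W (Suc n) B) = carrier B"
 proof
  show "k ` carrier (W (Suc n) B) <= carrier B" using homD(2)[OF W_head_hom[OF B]] by (auto simp: k_def)
  show "carrier B <= k ` carrier (W (Suc n) B)"
  proof
  fix b assume b: "b <: B"
  have "b # replicate (Suc n) \<zero>.B <: W (Suc n) B" using b by (auto simp: W_carrier[OF B])
  thus "b : k ` carrier (W (Suc n) B)" by (rule rev_image_eqI) (use b in "auto simp: k_def W_carrier[OF B]")
  qed
 qed
 fix v w assume vw: "v <: W (Suc n) B" "w <: W (Suc n) B" "v ! 0 = \<zero>.B" "w ! 0 = \<zero>.B"
 obtain a where a: "a <: W n B" "v = witt_V B a" using W_head_zero_iff[OF B vw(1)] vw(3) by auto
 obtain b where b: "b <: W n B" "w = witt_V B b" using W_head_zero_iff[OF B vw(2)] vw(4) by auto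
 show "v **.(W (Suc n) B) w : pow_ideal \<pi> (Suc 0) (W (Suc n) B)"
  unfolding a(2) b(2) V_mult[OF B a(1) b(1)]
  by (rule Wn.pow_idealI[OF V_closed[OF B W_closed(2)[OF B a(1) b(1)]]]) simp
qed

text \<open>The kernel of \<open>W_(n+1)(B) -> B\<close> is nil modulo \<pi>, so
  \<open>retract_point\<close> applies: a point that truncates to the identity lands in the chart,
  and the condition can be read on homomorphisms.\<close>

lemma jet_ker_iff:
 assumes B: "adic K B"
 shows "x : jk n B <-> x : points K A (W (Suc n) B) & lands_in K (W (Suc n) B) U x &
  (ALL c:carrier CU. jh n B x c ! 0 = alg B (eps c))"
proof -
 note rB = adicD(1)[OF B] and Wc = W_complete[OF B, of "Suc n"]
 note h = W_head[OF rB, where n = n] and i = id_point[OF B]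
 let ?k = "\<lambda>w\<in>carrier (W (Suc n) B). w ! 0"
 have "points_map K A (W (Suc n) B) B ?k x = id_point K A B <->
  lands_in K (W (Suc n) B) U x & (ALL c:carrier CU. ?k (jh n B x c) = alg B (eps c))"
  if x: "x : points K A (W (Suc n) B)"
  unfolding points_map_def using x h(3) i
  by (subst chart.retract_point[OF Wc B h(1,2)]) (auto simp: points_def)
 moreover have "jh n B x c <: W (Suc n) B"
  if "x : points K A (W (Suc n) B)" "lands_in K (W (Suc n) B) U x" "c <: CU" for c
  using chart.point_hom_const(2)[OF Wc] that by (simp add: points_def)
 ultimately show ?thesis by (auto simp: jet_ker_def jet_space_def)
qed

context
 fixes B :: "('r, 'b) ralg"
 assumes B: "adic K B"
begin

lemma rB: "ralgebra B" by (rule adicD(1)[OF B])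

lemma jet_hom: assumes "x : jk n B" shows "jh n B x : JH n B"
 using assms chart.point_hom_alg_hom[OF W_complete[OF B]] unfolding jet_ker_iff[OF B]
 by (simp add: JH_def points_def)

lemma jet_closed: "x : jk n B ==> c <: CU ==> jh n B x c <: W (Suc n) B"
 using jet_hom[of x n] homD(2)[OF alg_homD, of "jh n B x" CU "W (Suc n) B" c] unfolding JH_def by simp

lemma jet_eqI: "x : jk n B ==> y : jk n B ==> (!!c. c <: CU ==> jh n B x c = jh n B y c) ==> x = y"
 unfolding jet_ker_iff[OF B] using points_eqI[OF W_complete[OF B], of x "Suc n" y] by blast

lemma jet_of_hom:
 assumes "al : JH n B" obtains x where "x : jk n B" "jh n B x = al"
proof -
 have a: "al : alg_hom CU (W (Suc n) B)" using assms by (simp add: JH_def)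
 obtain x where "x : Mor (Spf K (W (Suc n) B)) (und A)" "lands_in K (W (Suc n) B) U x" "jh n B x = al"
  by (rule chart.point_hom_surj[OF W_complete[OF B] a])
 thus thesis using assms by (intro that[of x]) (auto simp: jet_ker_iff[OF B] points_def JH_def)
qed

text \<open>The coordinates identify \<open>N\<^sup>n(B)\<close> with the \<open>g\<close>-th power of \<open>V W\<^sub>n\<^sub>-\<^sub>1(B)\<close>.\<close>

lemma jet_coords:
 assumes w: "!!j. j : {1..g} ==> w j <: W (Suc n) B & w j ! 0 = \<zero>.B"
 shows "EX! x. x : jk n B & (ALL j:{1..g}. jh n B x (\<xi> j) = w j)"
proof -
 interpret B: r_algebra B using rB ..
 \<comment> \<open>Etaleness is available for algebras with carrier in \<open>'b list\<close>, the
   type of Witt vectors; \<open>B\<close> is copied there as the algebra of lists of length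
   one.\<close>
 let ?f = "%b. [b]" let ?B = "image_alg ?f B"
 have "inj_on ?f (carrier B)" by (simp add: inj_on_def)
 note I = image_alg_inj[OF rB this]
 have cB: "adic K ?B" by (rule adic_complete_iso[OF B I(1,2,4)])
 have imB: "carrier ?B = ?f ` carrier B" using I(4) by (simp add: bij_betw_def)
 note h = W_head[OF rB, where n = n] and hh = homD[OF W_head_hom[OF rB]]
 let ?k = "%w. [(\<lambda>w\<in>carrier (W (Suc n) B). w ! 0) w]"
 have z: "\<zero>.?B = [\<zero>.B]" by (simp add: image_alg_def Let_def)
 have k: "is_alg_hom (W (Suc n) B) ?B ?k" by (rule hom_comp[OF h(1) I(2)])
 have eh: "(\<lambda>c\<in>carrier CU. [alg B (eps c)]) : alg_hom CU ?B"
  by (rule restrict_hom[OF chart.C_alg hom_comp[OF hom_comp[OF alg_homD[OF eps_hom] is_alg_hom_alg[OF rB]] I(2)]])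
 have surj: "?k ` carrier (W (Suc n) B) = carrier ?B" unfolding imB h(2)[symmetric] image_image ..
 have "\<exists>!al. al : alg_hom CU (W (Suc n) B) & (ALL c:carrier CU. ?k (al c) = (\<lambda>c\<in>carrier CU. [alg B (eps c)]) c) &
  (ALL j:{1..g}. al (\<xi> j) = w j)"
 proof (rule etale.etale_lift_complete[OF W_complete[OF B] cB k surj _ eh])
  fix x y assume xy: "x <: W (Suc n) B" "y <: W (Suc n) B" "?k x = \<zero>.?B" "?k y = \<zero>.?B"
  show "x **.(W (Suc n) B) y : pow_ideal \<pi> (Suc 0) (W (Suc n) B)"
  by (rule h(3)[OF xy(1,2)]) (use xy z in simp_all)
 next
  fix j assume j: "j : {1..g}"
  show "w j <: W (Suc n) B & ?k (w j) = (\<lambda>c\<in>carrier CU. [alg B (eps c)]) (\<xi> j)"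
  using w[OF j] etale.\<xi>[OF j] eps_\<xi>[OF j] by simp
 qed
 moreover have "al : alg_hom CU (W (Suc n) B) & (ALL c:carrier CU. ?k (al c) = (\<lambda>c\<in>carrier CU. [alg B (eps c)]) c) &
  (ALL j:{1..g}. al (\<xi> j) = w j) <-> al : JH n B & (ALL j:{1..g}. al (\<xi> j) = w j)" for al
  unfolding JH_def using homD(2)[OF alg_homD, of al CU "W (Suc n) B"] by auto
 ultimately have ex: "\<exists>!al. al : JH n B & (ALL j:{1..g}. al (\<xi> j) = w j)" by (simp only:)
 then obtain al where al: "al : JH n B" "ALL j:{1..g}. al (\<xi> j) = w j" by (elim ex1E conjE)
 obtain x where x: "x : jk n B" "jh n B x = al" by (rule jet_of_hom[OF al(1)])
 show ?thesis
 proof (rule ex1I[of _ x])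
  show "x : jk n B & (ALL j:{1..g}. jh n B x (\<xi> j) = w j)" using x al(2) by simp
  fix y assume y: "y : jk n B & (ALL j:{1..g}. jh n B y (\<xi> j) = w j)"
  have "jh n B y = al"
  by (rule ex1_unique[OF ex]) (use y al jet_hom[OF conjunct1[OF y]] in simp_all)
  hence eq: "jh n B y = jh n B x" using x(2) by simp
  show "y = x" by (rule jet_eqI[OF conjunct1[OF y] x(1)]) (simp only: eq)
 qed
qed

lemma id_jet: "id_point K A (W (Suc n) B) : jk n B"
 using id_point[OF W_complete[OF B, of "Suc n"]] homD(3)[OF W_head_hom[OF rB, of "Suc n"]]
 by (simp add: jet_ker_iff[OF B])

end

end

context abelian_jets begin

subsection \<open>The group law\<close>

lemma gmul_id:
 fixes D :: "('r, 'b list) ralg"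
 assumes D: "adic K D"
 shows "gmul A D (id_point K A D) (id_point K A D) = id_point K A D"
proof -
 interpret G: Group.group "\<lparr>carrier = points K A D, monoid.mult = gmul A D, one = id_point K A D\<rparr>"
  using group D by (simp add: formal_group_scheme_def complete_algebras_def)
 show ?thesis using G.l_one[of "id_point K A D"] id_point(1)[OF D] by simp
qed

context
 fixes D :: "('r, 'b list) ralg"
 assumes D: "adic K D"
begin

lemma D_group: "group \<lparr>carrier = points K A D, monoid.mult = gmul A D, one = id_point K A D\<rparr>"
 using group D by (simp add: formal_group_scheme_def complete_algebras_def)

lemma gmul_closed: "x : points K A D ==> y : points K A D ==> gmul A D x y : points K A D"
 using group.is_monoid[OF D_group] monoid.m_closed by fastforce

lemma points_map_gmul:
 assumes E: "adic K E" and k: "k : alg_hom D E" and "x : points K A D" "y : points K A D"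
 shows "points_map K A D E k (gmul A D x y) = gmul A E (points_map K A D E k x) (points_map K A D E k y)"
 using group assms D by (simp add: formal_group_scheme_def complete_algebras_def)

text \<open>The group law commutes with base change, so the product lies over the identity of
  \<open>E\<close>; \<open>retract_point\<close> translates this back into a statement about the
  chart.\<close>

lemma gmul_kernel:
 fixes E :: "('r, 'b list) ralg"
 assumes E: "adic K E" and k: "is_alg_hom D E k" and surj: "k ` carrier D = carrier E"
  and sq: "!!d. d <: D ==> k d = \<zero>.E ==> d **.D d : pow_ideal \<pi> (Suc 0) D"
  and x: "x : points K A D" "lands_in K D U x" "!!c. c <: CU ==> k (ph D x c) = alg E (eps c)"
  and y: "y : points K A D" "lands_in K D U y" "!!c. c <: CU ==> k (ph D y c) = alg E (eps c)"
 shows "gmul A D x y : points K A D" "lands_in K D U (gmul A D x y)"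
  "!!c. c <: CU ==> k (ph D (gmul A D x y) c) = alg E (eps c)"
proof -
 note rD = adicD(1)[OF D] and i = id_point[OF E]
 interpret D: r_algebra D using rD ..
 let ?k = "restrict k (carrier D)"
 have k': "?k : alg_hom D E" by (rule restrict_hom[OF rD k])
 have surj': "?k ` carrier D = carrier E" using surj by simp
 have r: "points_map K A D E ?k z = id_point K A E <-> lands_in K D U z & (ALL c:carrier CU. ?k (ph D z c) = alg E (eps c))"
  if z: "z : points K A D" for z
  unfolding points_map_def using z sq i
  by (subst chart.retract_point[OF D E alg_homD[OF k'] surj']) (auto simp: points_def)
 have cl: "ph D z c <: D" if "z : points K A D" "lands_in K D U z" "c <: CU" for z c
  using chart.point_hom_const(2)[OF D] that by (simp add: points_def)
 have "points_map K A D E ?k x = id_point K A E" "points_map K A D E ?k y = id_point K A E"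
  using r[OF x(1)] r[OF y(1)] x y cl by simp_all
 hence "points_map K A D E ?k (gmul A D x y) = gmul A E (id_point K A E) (id_point K A E)"
  using points_map_gmul[OF E k' x(1) y(1)] by simp
 moreover have "gmul A E (id_point K A E) (id_point K A E) = id_point K A E" by (rule gmul_id[OF E])
 moreover show g: "gmul A D x y : points K A D" by (rule gmul_closed[OF x(1) y(1)])
 ultimately have 2: "lands_in K D U (gmul A D x y) & (ALL c:carrier CU. ?k (ph D (gmul A D x y) c) = alg E (eps c))"
  using r[OF g] by simp
 thus "lands_in K D U (gmul A D x y)" by blast
 thus "k (ph D (gmul A D x y) c) = alg E (eps c)" if "c <: CU" for c
  using bspec[OF conjunct2[OF 2] that] cl[OF g _ that] by simp
qed

end

lemma jet_mult:
 assumes B: "adic K B" and x: "x : jk n B" and y: "y : jk n B"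
 shows "jadd n B x y : jk n B"
proof -
 note rB = adicD(1)[OF B] and Wc = W_complete[OF B, of "Suc n"]
 interpret B: r_algebra B using rB ..
 \<comment> \<open>The group law of \<open>A\<close> is given on algebras with carrier in
   \<open>'b list\<close>, so truncation to \<open>B\<close> is replaced by truncation to its
   copy.\<close>
 let ?f = "%b. [b]" let ?B = "image_alg ?f B"
 have "inj_on ?f (carrier B)" by (simp add: inj_on_def)
 note I = image_alg_inj[OF rB this]
 have cB: "adic K ?B" by (rule adic_complete_iso[OF B I(1,2,4)])
 have imB: "carrier ?B = ?f ` carrier B" using I(4) by (simp add: bij_betw_def)
 note h = W_head[OF rB, where n = n]
 let ?k = "%w. [(\<lambda>w\<in>carrier (W (Suc n) B). w ! 0) w]"
 have z: "\<zero>.?B = [\<zero>.B]" by (simp add: image_alg_def Let_def)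
 have k: "is_alg_hom (W (Suc n) B) ?B ?k" by (rule hom_comp[OF h(1) I(2)])
 have surj: "?k ` carrier (W (Suc n) B) = carrier ?B" unfolding imB h(2)[symmetric] image_image ..
 have al: "alg ?B r = [alg B r]" for r using homD(3)[OF I(2)] by simp
 note G = gmul_kernel[OF Wc cB k surj]
 have j: "?k (jh n B x c) = alg ?B (eps c)" if "x : jk n B" "c <: CU" for x c
  using that jet_closed[OF B that] unfolding jet_ker_iff[OF B] by (simp add: al)
 have sq: "d **.(W (Suc n) B) d : pow_ideal \<pi> (Suc 0) (W (Suc n) B)" if "d <: W (Suc n) B" "?k d = \<zero>.?B" for d
  by (rule h(3)[OF that(1,1)]) (use that z in simp_all)
 have xy: "x : points K A (W (Suc n) B)" "lands_in K (W (Suc n) B) U x" "y : points K A (W (Suc n) B)" "lands_in K (W (Suc n) B) U y"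
  using x y unfolding jet_ker_iff[OF B] by auto
 have g: "jadd n B x y : points K A (W (Suc n) B)" "lands_in K (W (Suc n) B) U (jadd n B x y)"
  "!!c. c <: CU ==> ?k (jh n B (jadd n B x y) c) = alg ?B (eps c)"
  by (rule G; (rule sq j xy x y | assumption)+)+
 have "jh n B (jadd n B x y) c <: W (Suc n) B" if "c <: CU" for c
  using chart.point_hom_const(2)[OF Wc] g(1,2) that by (simp add: points_def)
 thus ?thesis unfolding jet_ker_iff[OF B] using g by (auto simp: al)
qed

subsection \<open>Maps between jet kernels\<close>

text \<open>Common form of functoriality and of truncation. The assumption \<open>k0\<close> says
  that \<open>k\<close> respects the condition on the component of index 0.\<close>

lemma jet_points_map:
 assumes B: "adic K B" and C: "adic K C" and k: "is_alg_hom (W (Suc n) B) (W (Suc m) C) k"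
  and k0: "!!w r. w <: W (Suc n) B ==> w ! 0 = alg B r ==> k w ! 0 = alg C r" and x: "x : jk n B"
 defines "P \<equiv> points_map K A (W (Suc n) B) (W (Suc m) C) (\<lambda>w\<in>carrier (W (Suc n) B). k w)"
 shows "P x : jk m C" "!!c. c <: CU ==> jh m C (P x) c = k (jh n B x c)"
  "y : jk n B ==> P (jadd n B x y) = gmul A (W (Suc m) C) (P x) (P y)"
proof -
 note rB = adicD(1)[OF B]
 have k': "(\<lambda>w\<in>carrier (W (Suc n) B). k w) : alg_hom (W (Suc n) B) (W (Suc m) C)"
  by (rule restrict_hom[OF W_ralgebra[OF rB] k])
 have xp: "x : points K A (W (Suc n) B)" "lands_in K (W (Suc n) B) U x" using x unfolding jet_ker_iff[OF B] by auto
 note m = points_map[OF W_complete[OF B] W_complete[OF C] alg_homD[OF k'] xp]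
 show 2: "jh m C (P x) c = k (jh n B x c)" if "c <: CU" for c
  using m(3)[OF that] jet_closed[OF B x that] by (simp add: P_def)
 show "P x : jk m C" unfolding jet_ker_iff[OF C]
  using m(1,2) 2 k0[OF jet_closed[OF B x]] x unfolding jet_ker_iff[OF B] by (auto simp: P_def)
 show "P (jadd n B x y) = gmul A (W (Suc m) C) (P x) (P y)" if y: "y : jk n B"
  unfolding P_def by (rule points_map_gmul[OF W_complete[OF B] W_complete[OF C] k' xp(1)]) (use y in "simp add: jet_ker_iff[OF B]")
qed

lemma jet_map:
 assumes B: "adic K B" and C: "adic K C" and h: "h : alg_hom B C" and x: "x : jk n B"
 shows "jmap n B C h x : jk n C"
  "!!c. c <: CU ==> jh n C (jmap n B C h x) c = map h (jh n B x c)"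
proof -
 note rB = adicD(1)[OF B] and rC = adicD(1)[OF C]
 have k0: "map h w ! 0 = alg C r" if "w <: W (Suc n) B" "w ! 0 = alg B r" for w r
  using W_length[OF rB that(1)] that(2) ahD(3)[OF h] by simp
 note m = jet_points_map[OF B C W_map[OF rB rC h] k0 x]
 show "jmap n B C h x : jk n C"
  "!!c. c <: CU ==> jh n C (jmap n B C h x) c = map h (jh n B x c)"
  unfolding jet_ker_map_def by (rule m(1), assumption+) (rule m(2), assumption+)
qed

lemma jet_proj:
 assumes B: "adic K B" and x: "x : jk (Suc n) B"
 shows "jet_ker_proj K A (Suc (Suc n)) B x : jk n B"
  "!!c. c <: CU ==> jh n B (jet_ker_proj K A (Suc (Suc n)) B x) c = butlast (jh (Suc n) B x c)"
  "y : jk (Suc n) B ==> jet_ker_proj K A (Suc (Suc n)) B (gmul A (W (Suc (Suc n)) B) x y)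
  = jadd n B (jet_ker_proj K A (Suc (Suc n)) B x) (jet_ker_proj K A (Suc (Suc n)) B y)"
proof -
 note rB = adicD(1)[OF B]
 have k0: "butlast w ! 0 = alg B r" if "w <: W (Suc (Suc n)) B" "w ! 0 = alg B r" for w r
  using W_length[OF rB that(1)] that(2) by (simp add: nth_butlast)
 note m = jet_points_map[OF B B W_butlast_hom[OF rB, of "Suc n"] k0 x]
 show "jet_ker_proj K A (Suc (Suc n)) B x : jk n B"
  "!!c. c <: CU ==> jh n B (jet_ker_proj K A (Suc (Suc n)) B x) c = butlast (jh (Suc n) B x c)"
  "y : jk (Suc n) B ==> jet_ker_proj K A (Suc (Suc n)) B (gmul A (W (Suc (Suc n)) B) x y)
  = jadd n B (jet_ker_proj K A (Suc (Suc n)) B x) (jet_ker_proj K A (Suc (Suc n)) B y)"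
  unfolding jet_ker_proj_def diff_Suc_1 by (rule m(1), assumption+) (rule m(2), assumption+, rule m(3), assumption+)
qed

lemma jet_proj_to_1:
 assumes B: "adic K B" and x: "x : jk n B"
 shows "jet_ker_proj_to_1 K A (Suc n) B x : jk 0 B"
  "!!c. c <: CU ==> jh 0 B (jet_ker_proj_to_1 K A (Suc n) B x) c = take 2 (jh n B x c)"
  "!!y. y : jk n B ==> jet_ker_proj_to_1 K A (Suc n) B (jadd n B x y)
  = gmul A (W (Suc 0) B) (jet_ker_proj_to_1 K A (Suc n) B x) (jet_ker_proj_to_1 K A (Suc n) B y)"
 using x
proof (induction n arbitrary: x)
 case 0
 { case 1 thus ?case by simp }
 { case (2 c) thus ?case using jet_closed[OF B 2(2) 2(1)] W_length[OF adicD(1)[OF B]] by simp }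
 { case 3 thus ?case by simp }
next
 case (Suc n)
 note p = jet_proj[OF B]
 { case 1 thus ?case using Suc.IH(1)[OF p(1)[OF 1]] by simp }
 { case (2 c)
  thus ?case using Suc.IH(2)[OF 2(1) p(1)[OF 2(2)]] p(2)[OF 2(2,1)] W_length[OF adicD(1)[OF B] jet_closed[OF B 2(2,1)]]
  by (simp add: take_butlast) }
 { case (3 y)
  thus ?case using Suc.IH(3)[OF p(1)[OF 3(1)] p(1)[OF 3(2)]] p(3)[OF 3(2,1)] by simp }
qed

subsection \<open>The lateral Frobenius\<close>

text \<open>The kernel of \<open>fst\<close> consists of Verschiebungen, so \<open>V_mult\<close>
  applies. This lets \<open>retract_point\<close> be used for the fibre product over the base
  ring.\<close>

lemma T_fst_kernel:
 assumes B: "ralgebra B" and x: "x <: T (Suc n) B" "fst x = 0"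
 shows "x **.(T (Suc n) B) x : pow_ideal \<pi> (Suc 0) (T (Suc n) B)"
proof -
 interpret Tn: r_algebra "T (Suc n) B" using B ..
 interpret B: r_algebra B using B ..
 interpret Ws: r_algebra "W (Suc n) B" using B ..
 have w: "snd x <: W (Suc n) B" "snd x ! 0 = \<zero>.B" using x by (cases x; simp add: T_carrier)+
 obtain z where z: "z <: W n B" "snd x = witt_V B z" using W_head_zero_iff[OF B w(1)] w(2) by auto
 let ?y = "(0, witt_V B (z **.(W n B) z))"
 have "?y <: T (Suc n) B"
  using V_closed[OF B W_closed(2)[OF B z(1,1)]] by (simp add: T_carrier) (simp add: witt_V_def)
 moreover have "x **.(T (Suc n) B) x = alg (T (Suc n) B) (\<pi> ^ Suc 0) **.(T (Suc n) B) ?y"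
  using x(2) z(2) V_mult[OF B z(1,1)] by (cases x) (simp add: T_sel)
 ultimately show ?thesis by (rule Tn.pow_idealI)
qed

lemma T_fst_surj: assumes B: "ralgebra B" shows "fst ` carrier (T n B) = UNIV"
proof -
 interpret Tn: r_algebra "T n B" using B ..
 have "fst (alg (T n B) r) = r" for r by (simp add: T_sel)
 thus ?thesis using Tn.alg_closed by (metis UNIV_eq_I image_eqI)
qed

lemma jet_T_hom:
 assumes B: "adic K B" and x: "x : jk n B"
 shows "is_alg_hom CU (T (Suc n) B) (%c. (eps c, jh n B x c))"
 using jet_hom[OF B x] by (intro T_hom[OF alg_homD[OF eps_hom]]) (auto simp: JH_def dest: alg_homD)

text \<open>The point is assembled from \<open>eps\<close> and the homomorphism to Witt vectors.
  Conversely, \<open>retract_point\<close> for \<open>fst\<close> places every candidate in the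
  chart, where the two projections determine it; so the definite description is satisfied.\<close>

lemma jet_ext:
 assumes B: "adic K B" and x: "x : jk n B"
 shows "jet_ker_ext K A (Suc n) B x : points K A (T (Suc n) B)" "lands_in K (T (Suc n) B) U (jet_ker_ext K A (Suc n) B x)"
  "!!c. c <: CU ==> ph (T (Suc n) B) (jet_ker_ext K A (Suc n) B x) c = (eps c, jh n B x c)"
proof -
 note rB = adicD(1)[OF B] and Tc = T_complete[OF B, of n] and Wc = W_complete[OF B, of "Suc n"]
 let ?T = "T (Suc n) B" and ?f = "\<lambda>w\<in>carrier (T (Suc n) B). fst w" and ?s = "\<lambda>w\<in>carrier (T (Suc n) B). snd w"
 have f: "?f : alg_hom ?T base_alg" and s: "?s : alg_hom ?T (W (Suc n) B)"
  by (rule restrict_hom[OF T_ralgebra[OF rB]], rule T_fst_hom T_snd_hom)+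
 have fsurj: "?f ` carrier ?T = carrier (base_alg :: ('r, 'r) ralg)" using T_fst_surj[OF rB, of "Suc n"] by simp
 have xp: "x : points K A (W (Suc n) B)" "lands_in K (W (Suc n) B) U x" using x unfolding jet_ker_iff[OF B] by auto
 obtain y where y: "y : Mor (Spf K ?T) (und A)" "lands_in K ?T U y" "ph ?T y = (\<lambda>c\<in>carrier CU. (eps c, jh n B x c))"
  by (rule chart.point_hom_surj[OF Tc restrict_hom[OF chart.C_alg jet_T_hom[OF B x]]])
 have yp: "y : points K A ?T" using y(1) by (simp add: points_def)
 have cl: "ph ?T z c <: ?T" if "z : points K A ?T" "lands_in K ?T U z" "c <: CU" for z c
  using chart.point_hom_const(2)[OF Tc] that by (simp add: points_def)
 have F: "points_map K A ?T base_alg ?f z = idsec A <-> lands_in K ?T U z & (ALL c:carrier CU. ?f (ph ?T z c) = eps c)"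
  if z: "z : points K A ?T" for z
  unfolding points_map_def eps_def using z T_fst_kernel[OF rB]
  by (subst chart.retract_point[OF Tc base_complete alg_homD[OF f] fsurj _ _ idsec]) (auto simp: points_def)
 have "jet_ker_ext K A (Suc n) B x = y" unfolding jet_ker_ext_def
 proof (rule the_equality)
  have "points_map K A ?T base_alg ?f y = idsec A" using F[OF yp] y(2,3) cl[OF yp y(2)] by simp
  moreover have "points_map K A ?T (W (Suc n) B) ?s y = x"
  proof (rule points_eqI[OF Wc _ _ xp])
  note m = points_map[OF Tc Wc alg_homD[OF s] yp y(2)]
  show "points_map K A ?T (W (Suc n) B) ?s y : points K A (W (Suc n) B)" "lands_in K (W (Suc n) B) U (points_map K A ?T (W (Suc n) B) ?s y)"
  by (rule m)+
  show "jh n B (points_map K A ?T (W (Suc n) B) ?s y) c = jh n B x c" if "c <: CU" for c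
  using m(3)[OF that] cl[OF yp y(2) that] y(3) that by simp
  qed
  ultimately show "y : points K A ?T & points_map K A ?T base_alg ?f y = idsec A & points_map K A ?T (W (Suc n) B) ?s y = x"
  using yp by simp
  fix z assume z: "z : points K A ?T & points_map K A ?T base_alg ?f z = idsec A & points_map K A ?T (W (Suc n) B) ?s z = x"
  have zl: "lands_in K ?T U z" "!!c. c <: CU ==> ?f (ph ?T z c) = eps c" using F[of z] z by auto
  note m = points_map(3)[OF Tc Wc alg_homD[OF s] conjunct1[OF z] zl(1)]
  show "z = y"
  proof (rule points_eqI[OF Tc conjunct1[OF z] zl(1) yp y(2)])
  fix c assume c: "c <: CU"
  show "ph ?T z c = ph ?T y c"
  using m[OF c] zl(2)[OF c] z cl[OF conjunct1[OF z] zl(1) c] y(3) c by (simp add: prod_eq_iff)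
  qed
 qed
 thus "jet_ker_ext K A (Suc n) B x : points K A ?T" "lands_in K ?T U (jet_ker_ext K A (Suc n) B x)"
  "!!c. c <: CU ==> ph ?T (jet_ker_ext K A (Suc n) B x) c = (eps c, jh n B x c)"
  using yp y(2,3) by simp_all
qed

lemma lat_frob:
 assumes B: "adic K B" and x: "x : jk (Suc n) B"
 shows "lat_frob K A (Suc (Suc n)) B x : jk n (twist K (Suc 0) B)"
  "!!c. c <: CU ==> jh n (twist K (Suc 0) B) (lat_frob K A (Suc (Suc n)) B x) c = snd (TF n B (eps c, jh (Suc n) B x c))"
proof -
 note rB = adicD(1)[OF B] and B' = twist_complete[OF B, of "Suc 0"]
 note rB' = adicD(1)[OF B'] and e = jet_ext[OF B x]
 let ?B = "twist K (Suc 0) B" let ?T = "T (Suc n) ?B" and ?s = "\<lambda>w\<in>carrier (T (Suc n) (twist K (Suc 0) B)). snd w"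
 have tf: "is_alg_hom (T (Suc (Suc n)) B) ?T (TF n B)" using TF_hom[OF rB, of n] by simp
 have s: "?s : alg_hom ?T (W (Suc n) ?B)" by (rule restrict_hom[OF T_ralgebra[OF rB'] T_snd_hom])
 note m = points_map[OF T_complete[OF B] T_complete[OF B'] tf e(1,2)]
 note m2 = points_map[OF T_complete[OF B'] W_complete[OF B'] alg_homD[OF s] m(1,2)]
 have l: "lat_frob K A (Suc (Suc n)) B x = points_map K A ?T (W (Suc n) ?B) ?s (points_map K A (T (Suc (Suc n)) B) ?T (TF n B) (jet_ker_ext K A (Suc (Suc n)) B x))"
  by (simp add: lat_frob_def Let_def)
 have tc: "TF n B (eps c, jh (Suc n) B x c) <: ?T" "fst (TF n B (eps c, jh (Suc n) B x c)) = eps c" if c: "c <: CU" for c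
  using homD(2)[OF jet_T_hom[OF B x] c] homD(2)[OF tf] TF_fst[OF rB] by auto
 show 2: "jh n ?B (lat_frob K A (Suc (Suc n)) B x) c = snd (TF n B (eps c, jh (Suc n) B x c))" if c: "c <: CU" for c
  unfolding l using m2(3)[OF c] m(3)[OF c] e(3)[OF c] tc(1)[OF c] by simp
 show "lat_frob K A (Suc (Suc n)) B x : jk n ?B"
  unfolding jet_ker_iff[OF B']
 proof (intro conjI ballI)
  show "lat_frob K A (Suc (Suc n)) B x : points K A (W (Suc n) ?B)" "lands_in K (W (Suc n) ?B) U (lat_frob K A (Suc (Suc n)) B x)"
  unfolding l by (rule m2)+
  fix c assume c: "c <: CU"
  show "jh n ?B (lat_frob K A (Suc (Suc n)) B x) c ! 0 = alg ?B (eps c)"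
  using tc[OF c] 2[OF c] by (cases "TF n B (eps c, jh (Suc n) B x c)") (simp add: T_carrier)
 qed
qed

text \<open>The group law lives on algebras with carrier in "'b list", so the fibre product is copied there.\<close>

lemma lat_frob_gmul:
 assumes B: "adic K B" and x: "x : jk (Suc n) B" and y: "y : jk (Suc n) B"
 shows "lat_frob K A (Suc (Suc n)) B (gmul A (W (Suc (Suc n)) B) x y)
  = gmul A (W (Suc n) (twist K (Suc 0) B)) (lat_frob K A (Suc (Suc n)) B x) (lat_frob K A (Suc (Suc n)) B y)"
proof -
 note rB = adicD(1)[OF B] and B' = twist_complete[OF B, of "Suc 0"]
 note rB' = adicD(1)[OF B']
 let ?B = "twist K (Suc 0) B" and ?W = "W (Suc (Suc n)) B" and ?TT = "T (Suc (Suc n)) B"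
 note Wc = W_complete[OF B, of "Suc (Suc n)"] and Wc' = W_complete[OF B', of "Suc n"]
 \<comment> \<open>The fibre product is coded by putting the code of the scalar in front of the Witt
   vector; \<open>?R\<close> is the base ring, copied to lists in the same way.\<close>
 let ?code = "%(r, w). scalar_code r # w" and ?rc = "%r. [scalar_code r]"
 let ?T = "image_alg ?code ?TT" and ?R = "image_alg ?rc (base_alg :: ('r, 'r) ralg)"
 have "inj_on ?code (carrier ?TT)" using inj_scalar_code by (auto simp: inj_on_def)
 note IT = image_alg_inj[OF T_ralgebra[OF rB] this]
 have "inj_on ?rc (carrier (base_alg :: ('r, 'r) ralg))" using inj_scalar_code by (auto simp: inj_on_def)
 note IR = image_alg_inj[OF ralgebra_base_alg this]
 have Tc: "adic K ?T" by (rule adic_complete_iso[OF T_complete[OF B] IT(1,2,4)])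
 have Rc: "adic K ?R" by (rule adic_complete_iso[OF base_complete IR(1,2,4)])
 interpret IT: r_algebra ?T using IT(1) ..
 define dec where "dec = inv_into (carrier ?TT) ?code"
 have dec: "is_alg_hom ?T ?TT dec" unfolding dec_def by (rule IT(3))
 note dh = homD[OF dec] hom_more[OF IT(1) T_ralgebra[OF rB] dec]
 have dc: "dec (?code t) = t" if "t <: ?TT" for t
  unfolding dec_def by (rule inv_into_f_f) (use that IT(4) in "auto simp: bij_betw_def")
 have cd: "?code (dec t) = t" if "t <: ?T" for t
  unfolding dec_def by (rule f_inv_into_f) (use that IT(4) in "auto simp: bij_betw_def")
 let ?k = "%t. ?rc (fst (dec t))"
 have k: "is_alg_hom ?T ?R ?k" by (rule hom_comp[OF hom_comp[OF dec T_fst_hom] IR(2)])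
 have Rsurj: "carrier ?R = range ?rc" using IR(4) by (simp add: bij_betw_def)
 have ksurj: "?k ` carrier ?T = carrier ?R"
 proof
  show "?k ` carrier ?T <= carrier ?R" using Rsurj by auto
  show "carrier ?R <= ?k ` carrier ?T"
  proof
  fix v assume "v <: ?R"
  then obtain r where r: "v = ?rc r" using Rsurj by auto
  obtain t where t: "t <: ?TT" "fst t = r" using T_fst_surj[OF rB, of "Suc (Suc n)"] by (metis UNIV_I imageE)
  show "v : ?k ` carrier ?T" by (rule rev_image_eqI[OF homD(2)[OF IT(2) t(1)]]) (simp only: dc[OF t(1)] t(2) r)
  qed
 qed
 have zR: "\<zero>.?R = ?rc 0" by (simp add: image_alg_def Let_def)
 have ksq: "d **.?T d : pow_ideal \<pi> (Suc 0) ?T" if d: "d <: ?T" "?k d = \<zero>.?R" for d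
 proof -
  have 0: "fst (dec d) = 0" using d(2) inj_scalar_code zR by (simp add: inj_eq)
  have "?code (dec d **.?TT dec d) : pow_ideal \<pi> (Suc 0) ?T"
  by (rule hom_pow_ideal[OF T_ralgebra[OF rB] IT(2) T_fst_kernel[OF rB dh(2)[OF d(1)] 0]])
  thus ?thesis by (simp only: dh(4)[OF d(1,1), symmetric] cd[OF IT.m_closed[OF d(1,1)]])
 qed
 have algR: "alg ?R r = ?rc r" for r by (simp add: image_alg_def Let_def)
 define L where "L z <-> z : points K A ?T & lands_in K ?T U z" for z
 have cl: "ph ?T z c <: ?T" if "L z" "c <: CU" for z c
  using chart.point_hom_const(2)[OF Tc] that by (simp add: points_def L_def)
 let ?s = "\<lambda>t\<in>carrier ?T. snd (dec t)" and ?G = "\<lambda>t\<in>carrier ?T. snd (TF n B (dec t))"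
 have s: "?s : alg_hom ?T ?W" by (rule restrict_hom[OF IT(1) hom_comp[OF dec T_snd_hom]])
 have G: "?G : alg_hom ?T (W (Suc n) ?B)"
  using TF_hom[OF rB, of n] by (intro restrict_hom[OF IT(1) hom_comp[OF hom_comp[OF dec] T_snd_hom]]) simp
 have lift: "EX z. L z & (ALL c:carrier CU. dec (ph ?T z c) = (eps c, jh (Suc n) B v c))" if v: "v : jk (Suc n) B" for v
 proof -
  obtain z where z: "z : Mor (Spf K ?T) (und A)" "lands_in K ?T U z" "ph ?T z = (\<lambda>c\<in>carrier CU. ?code (eps c, jh (Suc n) B v c))"
  by (rule chart.point_hom_surj[OF Tc restrict_hom[OF chart.C_alg hom_comp[OF jet_T_hom[OF B v] IT(2)]]])
  show ?thesis
  proof (intro exI[of _ z] conjI ballI)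
  show "L z" using z(1,2) by (simp add: L_def points_def)
  fix c assume c: "c <: CU"
  show "dec (ph ?T z c) = (eps c, jh (Suc n) B v c)" unfolding z(3) restrict_apply'[OF c] by (rule dc[OF homD(2)[OF jet_T_hom[OF B v] c]])
  qed
 qed
 have ps: "points_map K A ?T ?W ?s z = v" if z: "L z" and v: "v : jk (Suc n) B"
  and e: "!!c. c <: CU ==> snd (dec (ph ?T z c)) = jh (Suc n) B v c" for z v
 proof -
  note m = points_map[OF Tc Wc alg_homD[OF s] z[unfolded L_def, THEN conjunct1] z[unfolded L_def, THEN conjunct2]]
  show ?thesis
  by (rule points_eqI[OF Wc m(1,2)]) (use v m(3) e cl[OF z] in "simp_all add: jet_ker_iff[OF B]")
 qed
 have pG: "points_map K A ?T (W (Suc n) ?B) ?G z = lat_frob K A (Suc (Suc n)) B v" if z: "L z" and v: "v : jk (Suc n) B"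
  and e: "!!c. c <: CU ==> dec (ph ?T z c) = (eps c, jh (Suc n) B v c)" for z v
 proof -
  note m = points_map[OF Tc Wc' alg_homD[OF G] z[unfolded L_def, THEN conjunct1] z[unfolded L_def, THEN conjunct2]]
  note l = lat_frob[OF B v]
  show ?thesis
  by (rule points_eqI[OF Wc' m(1,2)]) (use l m(3) e cl[OF z] in "simp_all add: jet_ker_iff[OF B']")
 qed
 obtain x' where x': "L x'" "!!c. c <: CU ==> dec (ph ?T x' c) = (eps c, jh (Suc n) B x c)" using lift[OF x] by (elim exE conjE) blast
 obtain y' where y': "L y'" "!!c. c <: CU ==> dec (ph ?T y' c) = (eps c, jh (Suc n) B y c)" using lift[OF y] by (elim exE conjE) blast
 have xp: "x' : points K A ?T" "y' : points K A ?T" "lands_in K ?T U x'" "lands_in K ?T U y'" using x'(1) y'(1) by (simp_all add: L_def)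
 have kx: "?k (ph ?T x' c) = alg ?R (eps c)" "?k (ph ?T y' c) = alg ?R (eps c)" if "c <: CU" for c
  using x'(2)[OF that] y'(2)[OF that] by (simp_all add: algR)
 \<comment> \<open>The product over the fibre product yields both sides. Through \<open>?s\<close>
   it becomes the product of \<open>x\<close> and \<open>y\<close>, which identifies it; through
   \<open>?G\<close> it becomes the product of their images under the lateral Frobenius.\<close>
 let ?z = "gmul A ?T x' y'"
 have z: "?z : points K A ?T" "lands_in K ?T U ?z" "!!c. c <: CU ==> ?k (ph ?T ?z c) = alg ?R (eps c)"
  by (rule gmul_kernel[OF Tc Rc k ksurj]; (rule ksq kx xp | assumption)+)+
 have Lz: "L ?z" using z by (simp add: L_def)
 have f: "fst (dec (ph ?T ?z c)) = eps c" if "c <: CU" for c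
  using z(3)[OF that] inj_scalar_code by (simp add: algR inj_eq)
 have "points_map K A ?T ?W ?s ?z = gmul A ?W x y"
  unfolding points_map_gmul[OF Tc Wc s xp(1,2)] using ps[OF x'(1) x] ps[OF y'(1) y] x'(2) y'(2) by simp
 hence s2: "snd (dec (ph ?T ?z c)) = jh (Suc n) B (gmul A ?W x y) c" if "c <: CU" for c
  using points_map(3)[OF Tc Wc alg_homD[OF s] z(1,2) that] cl[OF Lz that] by simp
 have "points_map K A ?T (W (Suc n) ?B) ?G ?z = lat_frob K A (Suc (Suc n)) B (gmul A ?W x y)"
  by (rule pG[OF Lz jet_mult[OF B x y]]) (use f s2 in "simp add: prod_eq_iff")
 moreover have "points_map K A ?T (W (Suc n) ?B) ?G ?z = gmul A (W (Suc n) ?B) (lat_frob K A (Suc (Suc n)) B x) (lat_frob K A (Suc (Suc n)) B y)"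
  unfolding points_map_gmul[OF Tc Wc' G xp(1,2)] using pG[OF x'(1) x] pG[OF y'(1) y] x'(2) y'(2) by simp
 ultimately show ?thesis by simp
qed

end

context base_ring begin

lemma twist_pow: "a [^].(twist K k B) (n::nat) = a [^].B n"
 by (rule pow_same_ops) simp_all

end

context abelian_jets begin

subsection \<open>Iterates of the lateral Frobenius\<close>

abbreviation lf :: "nat => nat => ('r, 'b) ralg => ('p, 's, 'b) jet => ('p, 's, 'b) jet" where
 "lf n k \<equiv> lat_frob_iter K A (Suc n) k"

lemma lf_step:
 assumes B: "adic K B" and x: "x : jk n B" and k: "Suc k \<le> n"
  and y: "lf n k B x : jk (n - k) (twist K k B)"
 shows "lf n (Suc k) B x : jk (n - Suc k) (twist K (Suc k) B)"
  "!!c. c <: CU ==> jh (n - Suc k) (twist K (Suc k) B) (lf n (Suc k) B x) c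
  = snd (TF (n - Suc k) (twist K k B) (eps c, jh (n - k) (twist K k B) (lf n k B x) c))"
  "!!c. c <: CU ==> (eps c, jh (n - k) (twist K k B) (lf n k B x) c) <: T (Suc (Suc (n - Suc k))) (twist K k B)"
proof -
 have n: "Suc n - k = Suc (Suc (n - Suc k))" "n - k = Suc (n - Suc k)" using k by auto
 have y': "lf n k B x : jk (Suc (n - Suc k)) (twist K k B)" using y n by simp
 note l = lat_frob[OF twist_complete[OF B] y', simplified twist_twist]
 show "lf n (Suc k) B x : jk (n - Suc k) (twist K (Suc k) B)" using l(1) n by simp
 show "jh (n - Suc k) (twist K (Suc k) B) (lf n (Suc k) B x) c
  = snd (TF (n - Suc k) (twist K k B) (eps c, jh (n - k) (twist K k B) (lf n k B x) c))" if "c <: CU" for c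
  using l(2)[OF that] n by simp
 show "(eps c, jh (n - k) (twist K k B) (lf n k B x) c) <: T (Suc (Suc (n - Suc k))) (twist K k B)"
  if "c <: CU" for c
  using homD(2)[OF jet_T_hom[OF twist_complete[OF B] y'] that] n by simp
qed

lemma lf_closed:
 assumes B: "adic K B" and x: "x : jk n B"
 shows "k \<le> n ==> lf n k B x : jk (n - k) (twist K k B)"
proof (induction k)
 case (Suc k)
 thus ?case using lf_step(1)[OF B x, of k] by simp
qed (use x in simp)

lemma lf_ghost:
 assumes B: "adic K B" and x: "x : jk n B" and c: "c <: CU"
 shows "k \<le> n ==> i \<le> n - k ==> ghost K B (Suc i) (jh (n - k) (twist K k B) (lf n k B x) c) = ghost K B (Suc (i + k)) (jh n B x c)"
proof (induction k arbitrary: i)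
 case (Suc k)
 note s = lf_step[OF B x Suc.prems(1) lf_closed[OF B x]]
 show ?case
  using TF_ghost[OF twist_ralgebra[OF adicD(1)[OF B]] s(3)[OF _ c], of i] s(2)[OF _ c] Suc.IH[of "Suc i"] Suc.prems
  by (simp add: ghost_twist)
qed simp

lemma lf_natural:
 assumes B: "adic K B" and C: "adic K C" and h: "h : alg_hom B C" and x: "x : jk n B" and c: "c <: CU"
 shows "k \<le> n ==> jh (n - k) (twist K k C) (lf n k C (jmap n B C h x)) c = map h (jh (n - k) (twist K k B) (lf n k B x) c)"
proof (induction k)
 case 0
 show ?case using jet_map(2)[OF B C h x c] by simp
next
 case (Suc k)
 note m = jet_map[OF B C h x]
 have k: "k \<le> n" using Suc.prems by simp
 note s = lf_step[OF B x Suc.prems lf_closed[OF B x k]] and s' = lf_step[OF C m(1) Suc.prems lf_closed[OF C m(1) k]]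
 note r = twist_ralgebra[OF adicD(1)[OF B], of k] twist_ralgebra[OF adicD(1)[OF C], of k] alg_hom_twist[OF h, of k]
 show ?case unfolding s(2)[OF c] s'(2)[OF c] Suc.IH[OF k]
  using TF_natural[OF r s(3)[OF c]] by simp
qed

lemma lf_gmul:
 assumes B: "adic K B" and x: "x : jk n B" and y: "y : jk n B"
 shows "k \<le> n ==> lf n k B (jadd n B x y) = gmul A (W (Suc (n - k)) (twist K k B)) (lf n k B x) (lf n k B y)"
proof (induction k)
 case (Suc k)
 have n: "Suc n - k = Suc (Suc (n - Suc k))" "n - k = Suc (n - Suc k)" using Suc.prems by auto
 have c: "lf n k B x : jk (Suc (n - Suc k)) (twist K k B)" "lf n k B y : jk (Suc (n - Suc k)) (twist K k B)"
  using lf_closed[OF B x, of k] lf_closed[OF B y, of k] Suc.prems n by simp_all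
 show ?case using lat_frob_gmul[OF twist_complete[OF B] c] Suc.IH Suc.prems n by (simp add: twist_twist)
qed simp

lemma lf_mod_pi:
 assumes B: "adic K B" and x: "x : jk n B" and c: "c <: CU" and pi: "alg B \<pi> = \<zero>.B"
 shows "k \<le> n ==> jh (n - k) (twist K k B) (lf n k B x) c = map (%b. b [^].B (q ^ k)) (take (Suc (Suc n) - k) (jh n B x c))"
proof (induction k)
 case 0
 have rB: "ralgebra B" by (rule adicD(1)[OF B])
 interpret B: r_algebra B using rB ..
 show ?case using W_set[OF rB jet_closed[OF B x c]] W_length[OF rB jet_closed[OF B x c]] by (auto intro!: map_idI[symmetric])
next
 case (Suc k)
 have rB: "ralgebra B" by (rule adicD(1)[OF B])
 interpret B: r_algebra B using rB ..
 have k: "k \<le> n" using Suc.prems by simp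
 note s = lf_step[OF B x Suc.prems lf_closed[OF B x k]]
 note jc = jet_closed[OF B x c]
 have pi': "alg (twist K k B) \<pi> = \<zero>.(twist K k B)" using pi funpow_frob_pi[of k 1] by simp
 have "butlast (take (Suc (Suc n) - k) (jh n B x c)) = take (Suc (Suc n) - Suc k) (jh n B x c)"
  using W_length[OF rB jc] Suc.prems by (simp add: butlast_take)
 thus ?case unfolding s(2)[OF c] TF_mod_pi[OF twist_ralgebra[OF rB] pi' s(3)[OF c]]
  using Suc.IH[OF k] W_set[OF rB jc] by (auto simp: map_butlast[symmetric] twist_pow B.nat_pow_pow mult.commute dest: in_set_takeD)
qed

text \<open>The \<open>k\<close>-fold lateral Frobenius followed by the projection, as a map from
  \<open>N^(n + 1)\<close> to \<open>N^1\<close>; composed with \<open>\<Psi>1 j\<close> it gives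
  the character of index \<open>k + 1\<close>.\<close>

definition red :: "nat => nat => ('r, 'b) ralg => ('p, 's, 'b) jet => ('p, 's, 'b) jet" where
 "red n k B x = jet_ker_proj_to_1 K A (Suc (n - k)) (twist K k B) (lf n k B x)"

context
 fixes B :: "('r, 'b) ralg" and n k :: nat
 assumes B: "adic K B" and k: "k \<le> n"
begin

lemma red_closed: "x : jk n B ==> red n k B x : jk 0 (twist K k B)"
 unfolding red_def by (rule jet_proj_to_1(1)[OF twist_complete[OF B] lf_closed[OF B _ k]])

lemma red_jh: "x : jk n B ==> c <: CU ==>
 jh 0 (twist K k B) (red n k B x) c = take 2 (jh (n - k) (twist K k B) (lf n k B x) c)"
 unfolding red_def by (rule jet_proj_to_1(2)[OF twist_complete[OF B] lf_closed[OF B _ k]])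

text \<open>A point of \<open>N^1\<close> has one ghost component besides that of index 0, and here
  it is the one of index \<open>k + 1\<close> of \<open>x\<close>. Letting \<open>k\<close> run up
  to \<open>n\<close> recovers all ghost components of positive index.\<close>

lemma red_ghost:
 assumes x: "x : jk n B" and c: "c <: CU"
 shows "ghost K B (Suc 0) (jh 0 (twist K k B) (red n k B x) c) = ghost K B (Suc k) (jh n B x c)"
proof -
 note rB = twist_ralgebra[OF adicD(1)[OF B], of k]
 note w = jet_closed[OF twist_complete[OF B] lf_closed[OF B x k] c]
 have "ghost K (twist K k B) (Suc 0) (take 2 (jh (n - k) (twist K k B) (lf n k B x) c)) = ghost K (twist K k B) (Suc 0) (jh (n - k) (twist K k B) (lf n k B x) c)"
  by (rule ghost_cong[OF rB]) (use W_nth[OF rB w] in auto)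
 thus ?thesis using lf_ghost[OF B x c k, of 0] red_jh[OF x c] by (simp add: ghost_twist)
qed

lemma red_gmul:
 assumes x: "x : jk n B" and y: "y : jk n B"
 shows "red n k B (jadd n B x y) = gmul A (W (Suc 0) (twist K k B)) (red n k B x) (red n k B y)"
 unfolding red_def lf_gmul[OF B x y k]
 by (rule jet_proj_to_1(3)[OF twist_complete[OF B] lf_closed[OF B x k] lf_closed[OF B y k]])

lemma red_natural:
 assumes C: "adic K C" and h: "h : alg_hom B C" and x: "x : jk n B"
 shows "red n k C (jmap n B C h x) = jet_ker_map K A (Suc 0) (twist K k B) (twist K k C) h (red n k B x)"
proof (rule jet_eqI[OF twist_complete[OF C]])
 note m = jet_map[OF B C h x] and t = jet_map[OF twist_complete[OF B] twist_complete[OF C] alg_hom_twist[OF h] red_closed[OF x]]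
 show "red n k C (jmap n B C h x) : jk 0 (twist K k C)"
  unfolding red_def by (rule jet_proj_to_1(1)[OF twist_complete[OF C] lf_closed[OF C m(1) k]])
 show "jet_ker_map K A (Suc 0) (twist K k B) (twist K k C) h (red n k B x) : jk 0 (twist K k C)" by (rule t(1))
 fix c assume c: "c <: CU"
 show "jh 0 (twist K k C) (red n k C (jmap n B C h x)) c
  = jh 0 (twist K k C) (jet_ker_map K A (Suc 0) (twist K k B) (twist K k C) h (red n k B x)) c"
  unfolding t(2)[OF c] red_jh[OF x c] take_map[symmetric] lf_natural[OF B C h x c k, symmetric]
  unfolding red_def by (rule jet_proj_to_1(2)[OF twist_complete[OF C] lf_closed[OF C m(1) k] c])
qed

lemma red_mod_pi:
 assumes x: "x : jk n B" and c: "c <: CU" and pi: "alg B \<pi> = \<zero>.B"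
 shows "jh 0 (twist K k B) (red n k B x) c = map (%b. b [^].B (q ^ k)) (take 2 (jh n B x c))"
 using k unfolding red_jh[OF x c] lf_mod_pi[OF B x c pi k] take_map by (simp add: min_absorb1)

end

end

section \<open>Characters and their linear combinations\<close>

abbreviation (input) "CA \<equiv> complete_algebras"

section \<open>Linearity of additive functions\<close>

interpretation poly: r_algebra poly_alg using ralgebra_poly_alg ..

lemma finsum_poly_alg: "finite A ==> finsum poly_alg f A = sum f A"
 by (induction A rule: finite_induct) simp_all

lemma finprod_poly_alg: "finite A ==> finprod poly_alg f A = prod f A"
 by (induction A rule: finite_induct) simp_all

text \<open>Scaling the variables acts diagonally on monomials.\<close>

lemma lookup_eval_scaled:
 fixes s :: "nat => 'r::comm_ring_1"
 shows "plook (poly.eval_poly (%i. psing 0 (s i) * mvar i) F) \<mu>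
  = (\<Prod>i\<in>pkeys \<mu>. s i ^ plook \<mu> i) * plook F \<mu>"
proof (induction F rule: poly_mapping_sum_induct)
 case (single m a)
 have pw: "(psing 0 (s i) * mvar i) ^ k = psing (psing i k) (s i ^ k)" for i k
  by (induction k) (simp_all add: mvar_def mult_single single_add[symmetric] flip: single_one)
 have "(\<Prod>i\<in>S. (psing 0 (s i) * mvar i) ^ f i)
  = psing (\<Sum>i\<in>S. psing i (f i)) (\<Prod>i\<in>S. s i ^ f i)" if "finite S" for S and f :: "nat => nat"
  using that by (induction S rule: finite_induct) (simp_all add: pw mult_single)
 moreover have "(\<Sum>i\<in>pkeys m. psing i (plook m i)) = m"
  by (rule poly_mapping_eqI) (simp add: lookup_sum lookup_single when_def in_keys_iff)
 ultimately have "poly.eval_mon (%i. psing 0 (s i) * mvar i) m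
  = psing m (\<Prod>i\<in>pkeys m. s i ^ plook m i)"
  by (simp add: poly.eval_mon_def finprod_poly_alg)
 thus ?case by (simp add: poly.eval_poly_single mult_single lookup_single when_def mult.commute)
next
 case (add f g)
 thus ?case by (simp add: poly.eval_poly_add lookup_add distrib_left)
qed

text \<open>A polynomial is its own value at the variables, which is
  \<open>lookup_eval_scaled\<close> with all factors 1, and homomorphisms commute with
  evaluation.\<close>

lemma poly_hom_eqI:
 assumes B: "ralgebra B" and h: "is_alg_hom poly_alg B h" and k: "is_alg_hom poly_alg B k" and eq: "!!i. h (mvar i) = k (mvar i)"
 shows "h F = k F"
proof -
 have "poly.eval_poly mvar F = F"
  by (rule poly_mapping_eqI) (use lookup_eval_scaled[of "%_. 1" F] in "simp add: single_one")
 thus ?thesis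
  using poly.eval_poly_natural[OF B h, of mvar F] poly.eval_poly_natural[OF B k, of mvar F] eq by simp
qed

lemma poly_cong_iff:
 fixes a :: "'r::comm_ring_1"
 shows "cgr a m poly_alg F G <-> (\<forall>\<mu>. a ^ m dvd plook F \<mu> - plook G \<mu>)"
proof
 assume "cgr a m poly_alg F G"
 then obtain H where "F - G = psing 0 (a ^ m) * H" by (auto simp: cong_mod_def pow_ideal_def)
 hence "plook (F - G) \<mu> = a ^ m * plook H \<mu>" for \<mu> by (simp add: lookup_scale)
 thus "\<forall>\<mu>. a ^ m dvd plook F \<mu> - plook G \<mu>" by (simp add: lookup_minus)
next
 assume "\<forall>\<mu>. a ^ m dvd plook F \<mu> - plook G \<mu>"
 hence "\<forall>\<mu>. EX c. plook (F - G) \<mu> = a ^ m * c" by (simp add: lookup_minus dvd_def)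
 then obtain c where c: "!!\<mu>. plook (F - G) \<mu> = a ^ m * c \<mu>" by metis
 have "F - G = psing 0 (a ^ m) * (\<Sum>\<mu>\<in>pkeys (F - G). psing \<mu> (c \<mu>))"
 proof (rule poly_mapping_eqI)
  fix \<mu>
  show "plook (F - G) \<mu> = plook (psing 0 (a ^ m) * (\<Sum>\<mu>\<in>pkeys (F - G). psing \<mu> (c \<mu>))) \<mu>"
  unfolding lookup_scale lookup_sum using c[of \<mu>] by (auto simp: lookup_single when_def in_keys_iff sum.delta)
 qed
 thus "cgr a m poly_alg F G" by (auto simp: cong_mod_def pow_ideal_def)
qed

context universe begin

definition poly_emb :: "'r mpoly => 'b" where "poly_emb F = to_cuniv (poly_code F)"

lemma poly_emb_hom: "is_alg_hom poly_alg cuniv poly_emb"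
 unfolding poly_emb_def by (rule hom_comp[OF poly_code_hom to_cuniv_hom])

lemma poly_emb_var: "poly_emb (mvar i) = cuvar i"
 by (simp add: poly_emb_def cuvar_eq flip: uvar_def)

text \<open>Elements of \<open>cuniv\<close> carry no coefficients by construction; coefficients are
  compared through congruences between images of polynomials.\<close>

lemma poly_emb_cong_iff:
 "cgr \<pi> m cuniv (poly_emb F) (poly_emb G) <-> (\<forall>\<mu>. \<pi> ^ m dvd plook F \<mu> - plook G \<mu>)"
proof -
 have c: "poly_code F <: univ" for F using poly_code_bij by (auto simp: bij_betw_def)
 have "cgr \<pi> m univ (poly_code F) (poly_code G) <-> cgr \<pi> m poly_alg F G"
  using hom_cong_mod[OF univ_ralgebra ralgebra_poly_alg poly_code_inv_hom, of \<pi> m "poly_code F" "poly_code G"]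
  hom_cong_mod[OF ralgebra_poly_alg univ_ralgebra poly_code_hom, of \<pi> m F G] by auto
 thus ?thesis unfolding poly_emb_def by (simp add: to_cuniv_cong_iff c poly_cong_iff)
qed

lemma p_power_minus_1_unit: "l \<ge> 1 ==> of_nat p ^ l - 1 dvd (1 :: 'r)"
proof (rule ccontr)
 assume l: "l \<ge> 1" and "\<not> of_nat p ^ l - 1 dvd (1 :: 'r)"
 hence "\<pi> dvd of_nat p ^ l - 1" using unit_or_dvd by blast
 moreover have "\<pi> dvd of_nat p ^ l" using dvd_trans[OF pi_dvd_p dvd_power[of l "of_nat p"]] l by simp
 ultimately have "\<pi> dvd of_nat p ^ l - (of_nat p ^ l - 1)" by (rule dvd_diff[rotated])
 thus False using pi_nunit by simp
qed

text \<open>Additive natural functions on the powers of the affine line are linear: comparing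
 coefficients in "f (p X) = p f(X)", only monomials of degree one survive.\<close>

lemma linear_of_scaling:
 assumes f: "f <: cuniv" and kp: "kp : alg_hom cuniv cuniv"
  and \<kappa>v: "!!i. kp (cuvar i) = alg cuniv (if i < M then of_nat p else 0) **.cuniv cuvar i"
  and \<kappa>f: "kp f = alg cuniv (of_nat p) **.cuniv f"
 shows "EX c. f = (\<Oplus>.cuniv i\<in>{..<M}. alg cuniv (c i) **.cuniv cuvar i)"
proof -
 note rU = adicD(1)[OF cuniv_complete]
 interpret U: r_algebra cuniv using rU ..
 note J = U.pow_ideal[of \<pi>] and E = homD[OF poly_emb_hom]
 \<comment> \<open>The factor 0 kills the surplus variables, so that \<open>f\<close> can involve
   only the first \<open>M\<close>.\<close>
 define s where "s i = (if i < M then of_nat p else 0 :: 'r)" for i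
 define S where "S = poly.eval_poly (%i. psing 0 (s i) * mvar i)"
 have Sh: "is_alg_hom poly_alg poly_alg S" unfolding S_def by (rule poly.eval_poly_hom) simp
 have Sv: "S (mvar i) = psing 0 (s i) * mvar i" for i unfolding S_def by (rule poly.eval_poly_var) simp
 have emb_scale: "poly_emb (psing 0 a * F) = alg cuniv a **.cuniv poly_emb F" for a F
  using E(4)[of "psing 0 a" F] E(3)[of a] by simp
 have \<kappa>e: "kp (poly_emb F) = poly_emb (S F)" for F
  by (rule poly_hom_eqI[OF rU hom_comp[OF poly_emb_hom alg_homD[OF kp]] hom_comp[OF Sh poly_emb_hom]])
  (simp add: poly_emb_var \<kappa>v Sv emb_scale s_def)
 obtain e u where e: "u dvd 1" "of_nat p = u * \<pi> ^ e" using ramification by auto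
 \<comment> \<open>\<open>f\<close> is replaced by polynomials \<open>F m\<close> that approximate
   it modulo \<open>\<pi>^m\<close>.\<close>
 have "EX F. cgr \<pi> m cuniv f (poly_emb F)" for m
 proof -
  obtain d where d: "d <: univ" "cgr \<pi> m cuniv f (to_cuniv d)" using cuniv_dense[OF f] by blast
  thus ?thesis by (intro exI[of _ "inv_into UNIV poly_code d"]) (simp add: poly_emb_def poly_code_inv)
 qed
 then obtain F where F: "!!m. cgr \<pi> m cuniv f (poly_emb (F m))" by metis
 \<comment> \<open>Let \<open>a\<close> be the coefficient of the monomial and \<open>c\<close> its
   scaling factor. The scaling equation makes \<open>(c - p) a\<close> divisible by
   \<open>\<pi>^(m + e)\<close>. As \<open>c - p\<close> divides \<open>p\<close>, which is
   \<open>\<pi>^e\<close> up to a unit, \<open>e\<close> levels are lost; hence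
   \<open>F (m + e)\<close>.\<close>
 have bad: "\<pi> ^ m dvd plook (F (m + e)) \<mu>" if \<mu>: "!!i. i < M ==> \<mu> ~= psing i 1" for m \<mu>
 proof -
  let ?a = "plook (F (m + e)) \<mu>" and ?J = "pow_ideal \<pi> (m + e) cuniv"
  define c where "c = (\<Prod>i\<in>pkeys \<mu>. s i ^ plook \<mu> i)"
  have "cong_mod cuniv ?J (kp f) (poly_emb (S (F (m + e))))"
  using hom_cong_mod[OF rU rU alg_homD[OF kp] F[of "m + e"]] by (simp add: \<kappa>e)
  moreover have "cong_mod cuniv ?J (kp f) (poly_emb (psing 0 (of_nat p) * F (m + e)))"
  unfolding \<kappa>f emb_scale by (rule U.cong_mult[OF J U.cong_refl[OF J U.alg_closed] F])
  ultimately have "cong_mod cuniv ?J (poly_emb (S (F (m + e)))) (poly_emb (psing 0 (of_nat p) * F (m + e)))"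
  using U.cong_trans[OF J U.cong_sym[OF J]] by blast
  hence "\<pi> ^ (m + e) dvd plook (S (F (m + e))) \<mu> - plook (psing 0 (of_nat p) * F (m + e)) \<mu>"
  unfolding poly_emb_cong_iff by blast
  hence d: "\<pi> ^ (m + e) dvd (c - of_nat p) * ?a"
  unfolding S_def lookup_eval_scaled lookup_scale by (simp add: c_def left_diff_distrib)
  \<comment> \<open>\<open>c\<close> is 0 if a surplus variable occurs, and otherwise
    \<open>p^k\<close> in degree \<open>k\<close>. Degree 1 is excluded; in degree 0 the difference
    is the unit \<open>1 - p\<close>, and in degree \<open>l + 1\<close> it is \<open>p\<close>
    times the unit \<open>p^l - 1\<close>.\<close>
  have "c - of_nat p dvd of_nat p"
  proof (cases "EX i:pkeys \<mu>. i \<ge> M")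
  case True
  then obtain i where "i : pkeys \<mu>" "i \<ge> M" by blast
  hence "c = 0" unfolding c_def by (intro prod_zero bexI[of _ i]) (simp_all add: s_def in_keys_iff)
  thus ?thesis by simp
  next
  case False
  define k where "k = (\<Sum>i\<in>pkeys \<mu>. plook \<mu> i)"
  have c: "c = of_nat p ^ k" using False unfolding c_def k_def power_sum by (intro prod.cong) (auto simp: s_def)
  have "k ~= 1"
  proof
  assume "k = 1"
  then obtain i where i: "i : pkeys \<mu>" "plook \<mu> i = 1" "ALL j:pkeys \<mu>. i ~= j --> plook \<mu> j = 0"
  unfolding k_def by (subst (asm) sum_eq_1_iff) auto
  have "\<mu> = psing i 1"
  by (rule poly_mapping_eqI) (use i in "auto simp: lookup_single when_def in_keys_iff")
  thus False using \<mu>[of i] False i(1) by auto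
  qed
  then consider "k = 0" | l where "l \<ge> 1" "k = Suc l" by (cases k) auto
  thus ?thesis
  proof cases
  case 1
  have "- (of_nat p ^ 1 - 1 :: 'r) dvd 1" using p_power_minus_1_unit[of 1] by (simp only: minus_dvd_iff)
  hence "c - of_nat p dvd 1" using 1 c by simp
  thus ?thesis by (rule dvd_trans) simp
  next
  case 2
  have "of_nat p * (of_nat p ^ l - 1) dvd of_nat p * (1 :: 'r)" by (rule mult_dvd_mono[OF dvd_refl p_power_minus_1_unit[OF 2(1)]])
  thus ?thesis using 2 c by (simp add: algebra_simps)
  qed
  qed
  hence "(c - of_nat p) * ?a dvd of_nat p * ?a" by (rule mult_dvd_mono) simp
  hence "\<pi> ^ (m + e) dvd of_nat p * ?a" using d by (rule dvd_trans[rotated])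
  moreover have "of_nat p * ?a dvd \<pi> ^ e * ?a"
  proof -
  have "u * (\<pi> ^ e * ?a) dvd 1 * (\<pi> ^ e * ?a)" by (rule mult_dvd_mono[OF e(1) dvd_refl])
  thus ?thesis unfolding e(2) by (simp add: mult.assoc)
  qed
  ultimately have "\<pi> ^ e * \<pi> ^ m dvd \<pi> ^ e * ?a" unfolding power_add[symmetric] add.commute[of e] by (rule dvd_trans)
  thus ?thesis using pi_nz by simp
 qed
 define lin where "lin c = (\<Sum>i<M. psing 0 (c i) * mvar i :: 'r mpoly)" for c
 have lookup_lin: "plook (lin c) \<mu> = (\<Sum>i<M. if \<mu> = psing i 1 then c i else 0)" for c \<mu>
  unfolding lin_def lookup_sum mvar_def mult_single by (rule sum.cong) (auto simp: lookup_single when_def)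
 have lin1: "plook (lin c) (psing i 1) = c i" if "i < M" for c i
 proof -
  have "psing i (1::nat) = psing j 1 <-> i = j" for j by (metis lookup_single_eq lookup_single_not_eq zero_neq_one)
  thus ?thesis using that unfolding lookup_lin by (simp add: sum.delta)
 qed
 have lin0: "plook (lin c) \<mu> = 0" if "!!i. i < M ==> \<mu> ~= psing i 1" for c \<mu>
  unfolding lookup_lin by (rule sum.neutral) (use that in auto)
 define a where "a m i = plook (F (m + e)) (psing i 1)" for m i
 have fa: "cgr \<pi> m cuniv f (poly_emb (lin (a m)))" for m
 proof -
  have "cgr \<pi> m cuniv (poly_emb (F (m + e))) (poly_emb (lin (a m)))"
  unfolding poly_emb_cong_iff
  proof
  fix \<mu>
  show "\<pi> ^ m dvd plook (F (m + e)) \<mu> - plook (lin (a m)) \<mu>"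
  proof (cases "\<exists>i<M. \<mu> = psing i 1")
  case True
  thus ?thesis by (auto simp: lin1[simplified] a_def)
  next
  case False
  thus ?thesis using bad[of \<mu> m] lin0[of \<mu> "a m"] by simp
  qed
  qed
  thus ?thesis
  by (rule U.cong_trans[OF J cong_mod_mono[OF F[of "m + e"] U.pow_ideal_antimono[OF le_add1]]])
 qed
 have step: "\<pi> ^ m dvd a (Suc m) i - a m i" if i: "i < M" for m i
 proof -
  have "cgr \<pi> m cuniv (poly_emb (lin (a (Suc m)))) (poly_emb (lin (a m)))"
  using U.cong_trans[OF J U.cong_sym[OF J cong_mod_mono[OF fa[of "Suc m"] U.pow_ideal_antimono]] fa[of m]] by simp
  hence "\<pi> ^ m dvd plook (lin (a (Suc m))) (psing i 1) - plook (lin (a m)) (psing i 1)"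
  unfolding poly_emb_cong_iff by blast
  thus ?thesis unfolding lin1[OF i] .
 qed
 have base_cong: "cgr \<pi> m base_alg x y <-> \<pi> ^ m dvd x - y" for m and x y :: 'r
  by (auto simp: cong_mod_def pow_ideal_def dvd_def)
 \<comment> \<open>The linear coefficients of the approximations converge in the base ring.\<close>
 have "EX c. i < M --> (ALL m. \<pi> ^ m dvd c - a m i)" for i
  using adicD(3)[OF base_complete, of "%m. a m i"] step[of i] unfolding base_cong by auto
 then obtain c where c: "!!i m. i < M ==> \<pi> ^ m dvd c i - a m i" by metis
 have "f = poly_emb (lin c)"
 proof (rule adic_complete_eqI[OF cuniv_complete])
  fix m
  have "cgr \<pi> m cuniv (poly_emb (lin (a m))) (poly_emb (lin c))"
  unfolding poly_emb_cong_iff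
  proof
  fix \<mu>
  show "\<pi> ^ m dvd plook (lin (a m)) \<mu> - plook (lin c) \<mu>"
  proof (cases "\<exists>i<M. \<mu> = psing i 1")
  case True
  then obtain i where i: "i < M" "\<mu> = psing i 1" by blast
  show ?thesis unfolding i(2) lin1[OF i(1)] using c[OF i(1), of m] dvd_minus_iff[of "\<pi> ^ m" "c i - a m i"] by simp
  next
  case False
  thus ?thesis using lin0[of \<mu>] by simp
  qed
  qed
  from U.cong_trans[OF J fa this] show "cgr \<pi> m cuniv f (poly_emb (lin c))" .
 qed
 also have "... = (\<Oplus>.cuniv i\<in>{..<M}. alg cuniv (c i) **.cuniv cuvar i)"
 proof -
  interpret h: ring_hom_cring poly_alg cuniv poly_emb by (rule ring_hom_cringI[OF ralgebra_poly_alg rU poly_emb_hom])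
  have "poly_emb (finsum poly_alg (%i. psing 0 (c i) * mvar i) {..<M})
  = (\<Oplus>.cuniv i\<in>{..<M}. poly_emb (psing 0 (c i) * mvar i))"
  by (subst h.hom_finsum) (simp_all add: comp_def)
  thus ?thesis by (simp add: lin_def finsum_poly_alg emb_scale poly_emb_var)
 qed
 finally show ?thesis by blast
qed

end

section \<open>Characters\<close>

context abelian_jets begin

lemma complete_iff: "B : CA K <-> adic K B"
 by (simp add: complete_algebras_def)

text \<open>Coherent sequences become stationary from index \<open>m\<close> on.\<close>

lemma killed_complete:
 fixes B :: "('r, 'd) ralg"
 assumes B: "ralgebra B" and m: "alg B (\<pi> ^ m) = \<zero>.B"
 shows "adic K B"
proof -
 interpret B: r_algebra B using B ..
 have 0: "x : pow_ideal \<pi> m B ==> x = \<zero>.B" for x using m by (elim B.pow_idealE) simp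
 show ?thesis
 proof (rule adic_completeI[OF B])
  fix s assume s: "!!l. cgr \<pi> l B (s (Suc l)) (s l)"
  have "cgr \<pi> l B (s m) (s l)" for l
  proof (cases "l \<le> m")
  case True
  thus ?thesis by (rule B.cauchy_cong[OF s])
  next
  case False
  hence "cgr \<pi> m B (s l) (s m)" by (intro B.cauchy_cong[OF s]) simp
  hence "s l = s m" using 0 B.minus_eq_zero_iff[of "s l" "s m"] by (simp add: cong_mod_def)
  thus ?thesis using cong_modD(2)[OF s] B.cong_refl[OF B.pow_ideal] by metis
  qed
  thus "EX c:carrier B. ALL l. cgr \<pi> l B c (s l)" using cong_modD(2)[OF s] by blast
 qed (use 0 in blast)
qed

text \<open>By \<open>jet_coords\<close> the coordinates of points are free, so a point over
  \<open>cuniv\<close> whose coordinates are distinct variables specialises to every point.\<close>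

lemma jet_lift:
 assumes B: "adic K B" and x: "x : jk n B"
 obtains h X where "h : alg_hom cuniv B" "X : jk n cuniv" "jmap n cuniv B h X = x"
proof -
 note rB = adicD(1)[OF B] and rU = adicD(1)[OF cuniv_complete]
 interpret B: r_algebra B using rB ..
 interpret U: r_algebra cuniv using rU ..
 let ?b = "%m. case prod_decode m of (i, j) => if i \<le> Suc n & j : {1..g} then jh n B x (\<xi> j) ! i else \<zero>.B"
 have "?b m <: B" for m
  using W_nth[OF rB jet_closed[OF B x etale.\<xi>]] by (auto split: prod.split)
 then obtain h where h: "h : alg_hom cuniv B" "!!m. h (cuvar m) = ?b m" by (rule cuniv_map[OF B, where x = ?b]) (rule that)
 \<comment> \<open>The variable with index \<open>prod_encode (i, j)\<close> stands for the Witt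
   coordinate \<open>x_ij\<close>. The component of index 0 is zero because the coordinates vanish
   along the identity section.\<close>
 let ?w = "%j. \<zero>.cuniv # map (%i. cuvar (prod_encode (Suc i, j))) [0..<Suc n]"
 have "?w j <: W (Suc n) cuniv & ?w j ! 0 = \<zero>.cuniv" for j
  by (auto simp: W_carrier[OF rU])
 then obtain X where X: "X : jk n cuniv" "ALL j:{1..g}. jh n cuniv X (\<xi> j) = ?w j"
  using jet_coords[OF cuniv_complete, of ?w n] by blast
 note m = jet_map[OF cuniv_complete B h(1) X(1)]
 have "map h (?w j) = jh n B x (\<xi> j)" if j: "j : {1..g}" for j
 proof (rule nth_equalityI)
  note l = W_length[OF rB jet_closed[OF B x etale.\<xi>[OF j]]]
  show "length (map h (?w j)) = length (jh n B x (\<xi> j))" using l by simp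
  fix i assume "i < length (map h (?w j))"
  hence i: "i \<le> Suc n" by simp
  have "jh n B x (\<xi> j) ! 0 = \<zero>.B" using x etale.\<xi>[OF j] eps_\<xi>[OF j] unfolding jet_ker_iff[OF B] by simp
  thus "map h (?w j) ! i = jh n B x (\<xi> j) ! i"
  using i j nth_map_upt[of "i - 1" "Suc n" 0 "%i. cuvar (prod_encode (Suc i, j))"] hom_more(1)[OF rU rB alg_homD[OF h(1)]]
  by (cases i) (auto simp: h(2) simp del: upt_Suc)
 qed
 hence "jmap n cuniv B h X = x"
  using jet_coords[OF B, of "%j. jh n B x (\<xi> j)" n] jet_closed[OF B x etale.\<xi>] x eps_\<xi> etale.\<xi> m X(2)
  by (intro ex1_unique[of "%y. y : jk n B & (ALL j:{1..g}. jh n B y (\<xi> j) = jh n B x (\<xi> j))"]) (simp_all add: jet_ker_iff[OF B])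
 thus thesis by (rule that[OF h(1) X(1)])
qed

lemma Hom_GaD:
 assumes "th : Hm n" and B: "adic K B"
 shows "x : jk n B ==> th B x <: B"
  "x : jk n B ==> y : jk n B ==> th B (jadd n B x y) = th B x ++.B th B y"
  "adic K C ==> h : alg_hom B C ==> x : jk n B ==> th C (jmap n B C h x) = h (th B x)"
 using assms by (auto simp: Hom_Ga_def complete_iff PiE_iff)

lemma Hom_Ga_id:
 assumes th: "th : Hm n" and B: "adic K B"
 shows "th B (id_point K A (W (Suc n) B)) = \<zero>.B"
proof -
 interpret B: r_algebra B using B ..
 note i = id_jet[OF B, of n]
 show ?thesis using Hom_GaD(2)[OF th B i i] gmul_id[OF W_complete[OF B]] Hom_GaD(1)[OF th B i] by simp
qed

text \<open>The point is the \<open>m\<close>-fold sum of \<open>x\<close> in the group. It serves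
  for all characters at once, so that an arbitrary character can be compared with the
  \<open>Psi\<close>.\<close>

lemma jet_multiple:
 assumes B: "adic K B" and x: "x : jk n B"
 shows "EX y:jk n B. ALL th:Hm n. th B y = alg B (of_nat m) **.B th B x"
proof -
 interpret B: r_algebra B using B ..
 show ?thesis
 proof (induction m)
  case 0
  thus ?case using id_jet[OF B, of n] by (auto simp: Hom_Ga_id[OF _ B] Hom_GaD(1)[OF _ B x] intro!: bexI)
 next
  case (Suc m)
  then obtain y where y: "y : jk n B" "ALL th:Hm n. th B y = alg B (of_nat m) **.B th B x" by blast
  thus ?case
  by (intro bexI[OF _ jet_mult[OF B x y(1)]])
  (simp add: Hom_GaD(1)[OF _ B x] Hom_GaD(2)[OF _ B x y(1)] B.alg_add B.l_distr)
 qed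
qed

end

locale jet_characters = abelian_jets p K u A g U \<xi>
 for p :: nat and K :: "'r::idom base" and u :: "'b itself" and A :: "('p, 'r, 's, 'b list) fgroup" and g U \<xi> +
 fixes \<Psi>1 :: "nat => ('p, 'r, 's, 'b) character"
 assumes iso: "normalized_iso K A g U \<xi> \<Psi>1"
begin

lemma \<Psi>1: "j : {1..g} ==> \<Psi>1 j : Hom_Ga K A (Suc 0)"
 using iso by (simp add: normalized_iso_def)

lemma \<Psi>1_bij: "adic K B ==> bij_betw (%x. \<lambda>j\<in>{1..g}. \<Psi>1 j B x) (jk 0 B) ({1..g} \<rightarrow>\<^sub>E carrier B)"
 using iso by (simp add: normalized_iso_def complete_iff)

lemma \<Psi>1_inj:
 assumes "adic K B" "x : jk 0 B" "y : jk 0 B" "!!j. j : {1..g} ==> \<Psi>1 j B x = \<Psi>1 j B y"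
 shows "x = y"
proof -
 have "(\<lambda>j\<in>{1..g}. \<Psi>1 j B x) = (\<lambda>j\<in>{1..g}. \<Psi>1 j B y)" by (rule restrict_ext) (rule assms(4))
 thus ?thesis by (rule inj_onD[OF bij_betw_imp_inj_on[OF \<Psi>1_bij[OF assms(1)]] _ assms(2,3)])
qed

lemma \<Psi>1_surj:
 assumes "adic K B" "!!j. j : {1..g} ==> b j <: B"
 shows "EX x:jk 0 B. ALL j:{1..g}. \<Psi>1 j B x = b j"
proof -
 have "restrict b {1..g} : (%x. \<lambda>j\<in>{1..g}. \<Psi>1 j B x) ` jk 0 B"
  using assms(2) bij_betw_imp_surj_on[OF \<Psi>1_bij[OF assms(1)]] by auto
 then obtain x where x: "restrict b {1..g} = (\<lambda>j\<in>{1..g}. \<Psi>1 j B x)" "x : jk 0 B" by (rule imageE)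
 have "\<Psi>1 j B x = b j" if "j : {1..g}" for j using fun_cong[OF x(1), of j] that by simp
 thus ?thesis using x(2) by blast
qed

text \<open>The character \<open>Psi\<close> of index \<open>k + 1\<close> on
  \<open>N^(n + 1)\<close>, without the restriction to complete algebras and their jet
  kernels.\<close>

definition psi :: "nat => nat => nat => ('r, 'b) ralg => ('p, 's, 'b) jet => 'b" where
 "psi n k j B x = \<Psi>1 j (twist K k B) (red n k B x)"

context
 fixes n k j :: nat
 assumes k: "k \<le> n" and j: "j : {1..g}"
begin

lemma psi_closed: "adic K B ==> x : jk n B ==> psi n k j B x <: B"
 using Hom_GaD(1)[OF \<Psi>1[OF j] twist_complete red_closed[OF _ k]] by (simp add: psi_def)

lemma psi_add: "adic K B ==> x : jk n B ==> y : jk n B ==>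
  psi n k j B (jadd n B x y) = psi n k j B x ++.B psi n k j B y"
 using Hom_GaD(2)[OF \<Psi>1[OF j] twist_complete red_closed[OF _ k] red_closed[OF _ k]] by (simp add: psi_def red_gmul[OF _ k])

lemma psi_natural:
 "adic K B ==> adic K C ==> h : alg_hom B C ==> x : jk n B ==>
  psi n k j C (jmap n B C h x) = h (psi n k j B x)"
 using Hom_GaD(3)[OF \<Psi>1[OF j] twist_complete twist_complete alg_hom_twist red_closed[OF _ k]] by (simp add: psi_def red_natural[OF _ k])

lemma Psi_eq: "adic K B ==> x : jk n B ==> Psi K A \<Psi>1 (Suc n) (Suc k) j B x = psi n k j B x"
 using k by (simp add: Psi_def psi_def red_def complete_iff Let_def)

lemma Psi_Hom: "Psi K A \<Psi>1 (Suc n) (Suc k) j : Hm n"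
 unfolding Hom_Ga_def
proof (rule CollectI, intro conjI ballI)
 show "Psi K A \<Psi>1 (Suc n) (Suc k) j : (\<Pi>\<^sub>E B\<in>CA K. jk n B \<rightarrow>\<^sub>E carrier B)"
  using psi_closed Psi_eq by (auto simp: PiE_iff complete_iff) (auto simp: Psi_def complete_iff)
next
 fix B x y assume a: "B : CA K" "x : jk n B" "y : jk n B"
 note B = a(1)[unfolded complete_iff]
 show "Psi K A \<Psi>1 (Suc n) (Suc k) j B (jadd n B x y)
  = Psi K A \<Psi>1 (Suc n) (Suc k) j B x ++.B Psi K A \<Psi>1 (Suc n) (Suc k) j B y"
  unfolding Psi_eq[OF B jet_mult[OF B a(2,3)]] Psi_eq[OF B a(2)] Psi_eq[OF B a(3)] by (rule psi_add[OF B a(2,3)])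
next
 fix B C :: "('r, 'b) ralg" and h x assume a: "B : CA K" "C : CA K" "h : alg_hom B C" "x : jk n B"
 note B = a(1)[unfolded complete_iff] and C = a(2)[unfolded complete_iff]
 show "Psi K A \<Psi>1 (Suc n) (Suc k) j C (jmap n B C h x) = h (Psi K A \<Psi>1 (Suc n) (Suc k) j B x)"
  unfolding Psi_eq[OF C jet_map(1)[OF B C a(3,4)]] Psi_eq[OF B a(4)] by (rule psi_natural[OF B C a(3,4)])
qed

end

text \<open>By \<open>red_mod_pi\<close> the point \<open>red n k B x\<close> is the image of
  \<open>red n 0 B x\<close> under the homomorphism to the twist that raises to the power
  \<open>q^k\<close>, and \<open>\<Psi>1 j\<close> is natural.\<close>

lemma psi_mod_pi:
 assumes B: "adic K B" and pi: "alg B \<pi> = \<zero>.B" and x: "x : jk n B" and k: "k \<le> n" and j: "j : {1..g}"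
 shows "psi n k j B x = (psi n 0 j B x) [^].B (q ^ k)"
proof -
 note rB = adicD(1)[OF B]
 interpret B: r_algebra B using rB ..
 have hom: "is_alg_hom B (twist K k B) (%b. b [^].B (q ^ k))"
 proof (induction k)
  case 0
  show ?case unfolding twist_0 by (rule hom_cong[OF rB _ is_alg_hom_id]) simp
 next
  case (Suc k)
  have "alg (twist K k B) \<pi> = \<zero>.(twist K k B)" using pi funpow_frob_pi[of k 1] by simp
  from hom_comp[OF Suc power_q_hom[OF twist_ralgebra[OF rB] this]]
  show ?case by (simp add: twist_twist twist_pow) (rule hom_cong[OF rB], simp_all add: B.nat_pow_pow mult.commute)
 qed
 define \<sigma> where "\<sigma> = restrict (%b. b [^].B (q ^ k)) (carrier B)"
 have s: "\<sigma> : alg_hom B (twist K k B)" unfolding \<sigma>_def by (rule restrict_hom[OF rB hom])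
 have r0: "red n 0 B x : jk 0 B" using red_closed[OF B le0 x] by simp
 note m = jet_map[OF B twist_complete[OF B] s r0]
 have "red n k B x = jet_ker_map K A (Suc 0) B (twist K k B) \<sigma> (red n 0 B x)"
 proof (rule jet_eqI[OF twist_complete[OF B] red_closed[OF B k x] m(1)])
  fix c assume c: "c <: CU"
  show "jh 0 (twist K k B) (red n k B x) c = jh 0 (twist K k B) (jet_ker_map K A (Suc 0) B (twist K k B) \<sigma> (red n 0 B x)) c"
  unfolding m(2)[OF c] red_mod_pi[OF B k x c pi]
  using red_jh[OF B le0 x c] W_set[OF rB jet_closed[OF B x c]] by (auto simp: \<sigma>_def dest: in_set_takeD)
 qed
 thus ?thesis
  using Hom_GaD(3)[OF \<Psi>1[OF j] B twist_complete[OF B] s r0] Hom_GaD(1)[OF \<Psi>1[OF j] B r0] by (simp add: psi_def \<sigma>_def)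
qed

text \<open>The projection from \<open>N^(n + 1)\<close> to \<open>N^1\<close> is surjective on
  points, since Witt coordinates can be prolonged by zeros.\<close>

lemma psi_0_surj:
 assumes B: "adic K B" and b: "!!j. j : {1..g} ==> b j <: B"
 shows "EX x:jk n B. ALL j:{1..g}. psi n 0 j B x = b j"
proof -
 note rB = adicD(1)[OF B]
 interpret B: r_algebra B using rB ..
 obtain y where y: "y : jk 0 B" "ALL j:{1..g}. \<Psi>1 j B y = b j" using \<Psi>1_surj[OF B, of b] b by blast
 let ?w = "%j. jh 0 B y (\<xi> j) @ replicate n \<zero>.B"
 have j0: "jh 0 B y (\<xi> j) <: W (Suc 0) B & jh 0 B y (\<xi> j) ! 0 = \<zero>.B" if "j : {1..g}" for j
  using jet_closed[OF B y(1) etale.\<xi>[OF that]] y(1) etale.\<xi>[OF that] eps_\<xi>[OF that] unfolding jet_ker_iff[OF B] by simp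
 have l: "length (jh 0 B y (\<xi> j)) = 2" if "j : {1..g}" for j
  using W_length[OF rB conjunct1[OF j0[OF that]]] by simp
 have "?w j <: W (Suc n) B & ?w j ! 0 = \<zero>.B" if "j : {1..g}" for j
  using j0[OF that] by (auto simp: W_carrier[OF rB] nth_append)
 then obtain x where x: "x : jk n B" "ALL j:{1..g}. jh n B x (\<xi> j) = ?w j" using jet_coords[OF B, of ?w n] by blast
 have "red n 0 B x = y"
 proof (rule ex1_unique[OF jet_coords[OF B j0]])
  show "red n 0 B x : jk 0 B & (ALL j:{1..g}. jh 0 B (red n 0 B x) (\<xi> j) = jh 0 B y (\<xi> j))"
  using red_closed[OF B le0 x(1)] red_jh[OF B le0 x(1) etale.\<xi>] x(2) l by simp
  show "y : jk 0 B & (ALL j:{1..g}. jh 0 B y (\<xi> j) = jh 0 B y (\<xi> j))" using y(1) by simp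
 qed
 thus ?thesis using x(1) y(2) by (auto simp: psi_def intro!: bexI[of _ x])
qed

text \<open>The values determine all \<open>red n k B x\<close>, these determine the ghost
  components of positive index, and the one of index 0 is given by \<open>eps\<close>.\<close>

lemma psi_inj:
 assumes B: "adic K B" and tf: "torsion_free \<pi> B" and x: "x : jk n B" and y: "y : jk n B"
  and eq: "!!k j. k \<le> n ==> j : {1..g} ==> psi n k j B x = psi n k j B y"
 shows "x = y"
proof (rule jet_eqI[OF B x y])
 note rB = adicD(1)[OF B]
 fix c assume c: "c <: CU"
 have r: "red n k B x = red n k B y" if k: "k \<le> n" for k
  by (rule \<Psi>1_inj[OF twist_complete[OF B] red_closed[OF B k x] red_closed[OF B k y]]) (use eq[OF k] in "simp add: psi_def")
 show "jh n B x c = jh n B y c"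
 proof (rule W_eqI[OF rB tf jet_closed[OF B x c] jet_closed[OF B y c]])
  fix i assume i: "i \<le> Suc n"
  show "ghost K B i (jh n B x c) = ghost K B i (jh n B y c)"
  proof (cases i)
  case 0
  thus ?thesis using W_nth0[OF rB jet_closed[OF B x c]] W_nth0[OF rB jet_closed[OF B y c]] x y c unfolding jet_ker_iff[OF B] by simp
  next
  case (Suc k)
  thus ?thesis using i red_ghost[OF B _ x c, of k] red_ghost[OF B _ y c, of k] r[of k] by simp
  qed
 qed
qed

lemma pi_power_dvd_p_power: "\<pi> ^ m dvd of_nat p ^ m"
 by (rule dvd_power_same[OF pi_dvd_p])

text \<open>Points \<open>y k\<close> of \<open>N^1\<close> with the prescribed values exist because
  \<open>\<Psi>1\<close> is an isomorphism. They are the reductions of one point of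
  \<open>N^(n + 1)\<close> if \<open>eps\<close> and their ghost components
  \<open>\<gamma> k\<close> together form the ghost of a Witt vector. The values are divisible by
  \<open>\<pi>^(n + 1)\<close>, so modulo this power each \<open>y k\<close> is the identity and
  \<open>\<gamma> k\<close> comes from the base ring. A difference divisible by
  \<open>\<pi>^(n + 1)\<close> from the ghost of a constant is itself a ghost, by
  \<open>ghost_divisible\<close>.\<close>

lemma psi_surj:
 assumes B: "adic K B" and tf: "torsion_free \<pi> B" and b: "!!k j. k \<le> n ==> j : {1..g} ==> b k j <: B"
 shows "EX x:jk n B. \<forall>k\<le>n. ALL j:{1..g}. psi n k j B x = alg B (of_nat p ^ Suc n) **.B b k j"
proof -
 note rB = adicD(1)[OF B]
 interpret B: r_algebra B using rB ..
 interpret Wn: r_algebra "W (Suc n) B" using rB ..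
 let ?P = "alg B (of_nat p ^ Suc n)" and ?J = "pow_ideal \<pi> (Suc n) B"
 have "EX y. y : jk 0 (twist K k B) & (ALL j:{1..g}. \<Psi>1 j (twist K k B) y = ?P **.B b k j)" if k: "k \<le> n" for k
  using \<Psi>1_surj[OF twist_complete[OF B], of "%j. ?P **.B b k j" k] b[OF k] by auto
 then obtain y where y: "!!k. k \<le> n ==> y k : jk 0 (twist K k B)"
  "!!k j. k \<le> n ==> j : {1..g} ==> \<Psi>1 j (twist K k B) (y k) = ?P **.B b k j" by metis
 define \<gamma> where "\<gamma> k c = ghost K B (Suc 0) (jh 0 (twist K k B) (y k) c)" for k c
 have \<gamma>h: "is_alg_hom CU (twist K (Suc k) B) (\<gamma> k)" if k: "k \<le> n" for k
 proof -
  have "is_alg_hom CU (twist K 1 (twist K k B)) (%c. ghost K (twist K k B) (Suc 0) (jh 0 (twist K k B) (y k) c))"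
  using hom_comp[OF _ W_ghost[OF twist_ralgebra[OF rB], of 1 "Suc 0"]] jet_hom[OF twist_complete[OF B] y(1)[OF k]]
  by (auto simp: JH_def dest: alg_homD)
  thus ?thesis by (simp add: twist_twist ghost_twist \<gamma>_def[abs_def])
 qed
 note \<gamma> = homD[OF \<gamma>h]
 \<comment> \<open>\<open>\<Psi>1\<close> is injective also over \<open>B / \<pi>^(n + 1) B\<close>,
   where the values at \<open>y k\<close> vanish.\<close>
 have \<gamma>c: "cong_mod B ?J (\<gamma> k c) (alg B ((\<phi> ^^ Suc k) (eps c)))" if k: "k \<le> n" and c: "c <: CU" for k c
 proof -
  let ?Q = "quot ?J B"
  note Q = quot[OF rB B.pow_ideal[of \<pi> "Suc n"]]
  interpret Q: r_algebra ?Q using Q(1) ..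
  define h where "h = restrict (crep B ?J) (carrier B)"
  have h: "h : alg_hom B ?Q" unfolding h_def by (rule restrict_hom[OF rB Q(2)])
  have "alg ?Q (\<pi> ^ Suc n) = \<zero>.?Q"
  using Q(7)[OF B.alg_closed, of "\<pi> ^ Suc n"] B.alg_pow_in_pow_ideal[of \<pi> "Suc n"] homD(3)[OF Q(2)] by metis
  from killed_complete[OF Q(1) this] have cQ: "adic K ?Q" .
  let ?Bk = "twist K k B" and ?Qk = "twist K k ?Q"
  note tB = twist_complete[OF B, of k] and tQ = twist_complete[OF cQ, of k] and hk = alg_hom_twist[OF h, of k]
  note m = jet_map[OF tB tQ hk y(1)[OF k]]
  have "jet_ker_map K A (Suc 0) ?Bk ?Qk h (y k) = id_point K A (W (Suc 0) ?Qk)"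
  proof (rule \<Psi>1_inj[OF tQ m(1) id_jet[OF tQ]])
  fix j assume j: "j : {1..g}"
  obtain d where d: "of_nat p ^ Suc n = \<pi> ^ Suc n * d" using pi_power_dvd_p_power[of "Suc n"] by (rule dvdE)
  have "?P **.B b k j : ?J"
  by (rule B.pow_idealI[of "alg B d **.B b k j"]) (use b[OF k j] in "simp_all only: d B.alg_mult B.m_assoc B.alg_closed B.m_closed")
  thus "\<Psi>1 j ?Qk (jet_ker_map K A (Suc 0) ?Bk ?Qk h (y k)) = \<Psi>1 j ?Qk (id_point K A (W (Suc 0) ?Qk))"
  using Hom_GaD(3)[OF \<Psi>1[OF j] tB tQ hk y(1)[OF k]] Hom_Ga_id[OF \<Psi>1[OF j] tQ] y(2)[OF k j] b[OF k j] Q(7)[of "?P **.B b k j"]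
  by (simp add: h_def)
  qed
  hence "map h (jh 0 ?Bk (y k) c) = alg (W (Suc 0) ?Qk) (eps c)"
  using m(2)[OF c] id_point(3)[OF W_complete[OF tQ] c] by simp
  from arg_cong[OF this, of "ghost K ?Qk (Suc 0)"]
  have "h (\<gamma> k c) = alg ?Q ((\<phi> ^^ Suc k) (eps c))"
  using ghost_natural[OF adicD(1)[OF tB] adicD(1)[OF tQ] alg_homD[OF hk], of "jh 0 ?Bk (y k) c" "Suc 0"]
  W_set[OF adicD(1)[OF tB] jet_closed[OF tB y(1)[OF k] c]] W_length[OF adicD(1)[OF tB] jet_closed[OF tB y(1)[OF k] c]]
  W_ghost_simps(5)[OF adicD(1)[OF tQ], of "Suc 0" "Suc 0" "eps c"]
  by (simp add: ghost_twist \<gamma>_def funpow_swap1)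
  thus ?thesis using Q(5)[of "\<gamma> k c" "alg B ((\<phi> ^^ Suc k) (eps c))"] \<gamma>(2)[OF k c] homD(3)[OF Q(2)]
  by (simp add: h_def)
 qed
 define t where "t i c = (case i of 0 => alg B (eps c) | Suc k => \<gamma> k c)" for i c
 have th: "is_alg_hom CU (twist K i B) (t i)" if "i \<le> Suc n" for i
  using \<gamma>h[of "i - 1"] hom_comp[OF alg_homD[OF eps_hom] is_alg_hom_alg[OF rB]] that by (cases i) (simp_all add: t_def[abs_def])
 note T = homD[OF th]
 have "EX w. w <: W (Suc n) B & (\<forall>i\<le>Suc n. ghost K B i w = t i c)" if c: "c <: CU" for c
 proof -
  have "EX d. d <: B & (i \<le> Suc n --> t i c \<ominus>.B alg B ((\<phi> ^^ i) (eps c)) = alg B (\<pi> ^ Suc n) **.B d)" for i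
  proof (cases i)
  case 0
  thus ?thesis by (intro exI[of _ "\<zero>.B"]) (simp add: t_def B.minus_eq B.r_neg)
  next
  case (Suc k)
  show ?thesis
  proof (cases "k \<le> n")
  case True
  obtain d where "d <: B" "\<gamma> k c \<ominus>.B alg B ((\<phi> ^^ Suc k) (eps c)) = alg B (\<pi> ^ Suc n) **.B d"
  by (rule B.pow_idealE[OF cong_modD(3)[OF \<gamma>c[OF True c]]])
  thus ?thesis by (intro exI[of _ d]) (simp add: t_def Suc)
  qed (use Suc in auto)
  qed
  then obtain d where d: "!!i. d i <: B" "!!i. i \<le> Suc n ==> t i c \<ominus>.B alg B ((\<phi> ^^ i) (eps c)) = alg B (\<pi> ^ Suc n) **.B d i"
  by metis
  obtain z where z: "length z = Suc (Suc n)" "set z <= carrier B" "!!i. i \<le> Suc n ==> ghost K B i z = alg B (\<pi> ^ Suc n) **.B d i"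
  by (rule ghost_divisible[where b = d and n = "Suc n" and N = "Suc n", OF rB d(1) le_refl]) blast
  have zW: "z <: W (Suc n) B" by (rule W_I[OF rB z(1,2)])
  have "ghost K B i (alg (W (Suc n) B) (eps c) ++.(W (Suc n) B) z) = t i c" if i: "i \<le> Suc n" for i
  using W_ghost_simps(2)[OF rB i W_closed(6)[OF rB] zW] W_ghost_simps(5)[OF rB i] z(3)[OF i] d(2)[OF i, symmetric] T(2)[OF i c]
  by (simp add: B.minus_eq B.a_lcomm B.r_neg)
  thus ?thesis using zW by (intro exI[of _ "alg (W (Suc n) B) (eps c) ++.(W (Suc n) B) z"]) simp
 qed
 then obtain al where al: "!!c. c <: CU ==> al c <: W (Suc n) B"
  "!!c i. c <: CU ==> i \<le> Suc n ==> ghost K B i (al c) = t i c" by metis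
 interpret C: r_algebra CU using chart.C_alg ..
 \<comment> \<open>The vectors \<open>al c\<close> were chosen separately for each \<open>c\<close>;
   ghost components, faithful on a torsion-free algebra, make \<open>al\<close> a
   homomorphism.\<close>
 have "is_alg_hom CU (W (Suc n) B) al"
 proof (rule homI)
  note e = W_eqI[OF rB tf, where n = "Suc n"] and gs = W_ghost_simps[OF rB, of _ "Suc n"]
  show "al (alg CU r) = alg (W (Suc n) B) r" for r by (rule e) (simp_all add: al T gs)
  show "al \<one>.CU = \<one>.(W (Suc n) B)" by (rule e) (simp_all add: al T gs)
  fix c c' assume c: "c <: CU" "c' <: CU"
  show "al (c **.CU c') = al c **.(W (Suc n) B) al c'" by (rule e) (simp_all add: c al T gs)
  show "al (c ++.CU c') = al c ++.(W (Suc n) B) al c'" by (rule e) (simp_all add: c al T gs)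
 qed (rule al)
 hence "restrict al (carrier CU) : JH n B"
  using restrict_hom[OF chart.C_alg] al(2)[of _ 0] W_nth0[OF rB al(1)] by (simp add: JH_def t_def)
 then obtain x where x: "x : jk n B" "jh n B x = restrict al (carrier CU)" by (rule jet_of_hom[OF B])
 have "psi n k j B x = ?P **.B b k j" if k: "k \<le> n" and j: "j : {1..g}" for k j
 proof -
  note rk = twist_ralgebra[OF rB, of k] and ck = twist_complete[OF B, of k]
  have tfk: "torsion_free \<pi> (twist K k B)" using tf funpow_frob_pi[of k 1] by (simp add: torsion_free_def)
  have "red n k B x = y k"
  proof (rule jet_eqI[OF ck red_closed[OF B k x(1)] y(1)[OF k]])
  fix c assume c: "c <: CU"
  note cl = jet_closed[OF ck red_closed[OF B k x(1)] c] jet_closed[OF ck y(1)[OF k] c]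
  show "jh 0 (twist K k B) (red n k B x) c = jh 0 (twist K k B) (y k) c"
  proof (rule W_eqI[OF rk tfk cl])
  fix i assume "i \<le> Suc 0"
  then consider "i = 0" | "i = Suc 0" by linarith
  thus "ghost K (twist K k B) i (jh 0 (twist K k B) (red n k B x) c) = ghost K (twist K k B) i (jh 0 (twist K k B) (y k) c)"
  proof cases
  case 1
  thus ?thesis using W_nth0[OF rk cl(1)] W_nth0[OF rk cl(2)] red_closed[OF B k x(1)] y(1)[OF k] c unfolding jet_ker_iff[OF ck] by simp
  next
  case 2
  thus ?thesis using red_ghost[OF B k x(1) c] al(2)[OF c, of "Suc k"] k x(2) c by (simp add: ghost_twist t_def \<gamma>_def)
  qed
  qed
  qed
  thus ?thesis using y(2)[OF k j] by (simp add: psi_def)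
 qed
 thus ?thesis using x(1) by blast
qed

end

context jet_characters begin

definition J :: "nat => (nat \<times> nat) set" where "J n = {1..Suc n} \<times> {1..g}"

definition pc :: "nat => nat \<times> nat => ('r, 'b) ralg => ('p, 's, 'b) jet => 'b" where
 "pc n i = psi n (fst i - 1) (snd i)"

definition lc :: "nat => (nat \<times> nat => 'r) => ('r, 'b) ralg => ('p, 's, 'b) jet => 'b" where
 "lc n d B x = (\<Oplus>.B i\<in>J n. alg B (d i) **.B pc n i B x)"

lemma finite_J [simp]: "finite (J n)" by (simp add: J_def)

lemma J_D: "i : J n ==> fst i - 1 \<le> n & snd i : {1..g}" by (auto simp: J_def)

lemma J_I: "k \<le> n ==> j : {1..g} ==> (Suc k, j) : J n" by (auto simp: J_def)

lemma pc_closed: "i : J n ==> adic K B ==> x : jk n B ==> pc n i B x <: B"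
 unfolding pc_def by (rule psi_closed) (use J_D[of i n] in auto)

lemma pc_natural: "i : J n ==> adic K B ==> adic K C ==> h : alg_hom B C ==> x : jk n B ==>
  pc n i C (jmap n B C h x) = h (pc n i B x)"
 unfolding pc_def by (rule psi_natural) (use J_D[of i n] in auto)

lemma Psi_pc: "i : J n ==> adic K B ==> x : jk n B ==> Psi K A \<Psi>1 (Suc n) (fst i) (snd i) B x = pc n i B x"
 using Psi_eq[of "fst i - 1" n "snd i" B x] J_D[of i n] by (auto simp: J_def pc_def)

lemma Psi_J_Hom: "i : J n ==> Psi K A \<Psi>1 (Suc n) (fst i) (snd i) : Hm n"
 using Psi_Hom[of "fst i - 1" n "snd i"] J_D[of i n] by (auto simp: J_def)

lemma pc_inj:
 assumes "adic K B" "torsion_free \<pi> B" "x : jk n B" "y : jk n B" "!!i. i : J n ==> pc n i B x = pc n i B y"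
 shows "x = y"
 by (rule psi_inj[OF assms(1-4)]) (use assms(5)[OF J_I] in "simp add: pc_def")

lemma pc_multiple:
 assumes "adic K B" "x : jk n B"
 shows "EX y:jk n B. (ALL th:Hm n. th B y = alg B (of_nat m) **.B th B x)
  & (ALL i:J n. pc n i B y = alg B (of_nat m) **.B pc n i B x)"
proof -
 obtain y where y: "y : jk n B" "ALL th:Hm n. th B y = alg B (of_nat m) **.B th B x"
  using jet_multiple[OF assms, of m] by blast
 have "pc n i B y = alg B (of_nat m) **.B pc n i B x" if i: "i : J n" for i
  using bspec[OF y(2) Psi_J_Hom[OF i]] Psi_pc[OF i assms(1) y(1)] Psi_pc[OF i assms] by simp
 thus ?thesis using y by blast
qed

context
 fixes B :: "('r, 'b) ralg" and n :: nat and x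
 assumes B: "adic K B" and x: "x : jk n B"
begin

interpretation B: r_algebra B using B ..

lemma lc_closed: "lc n d B x <: B"
 unfolding lc_def by (rule B.finsum_closed) (use pc_closed[OF _ B x] in auto)

lemma lc_scale: "lc n (%i. a * d i) B x = alg B a **.B lc n d B x"
proof -
 have "lc n (%i. a * d i) B x = (\<Oplus>.B i\<in>J n. alg B a **.B (alg B (d i) **.B pc n i B x))"
  unfolding lc_def by (rule B.finsum_cong') (use pc_closed[OF _ B x] in "auto simp: B.alg_mult B.m_assoc")
 also have "... = alg B a **.B lc n d B x"
  unfolding lc_def by (rule B.finsum_rdistr[symmetric]) (use pc_closed[OF _ B x] in auto)
 finally show ?thesis .
qed

lemma lc_add: "lc n (%i. d i + d' i) B x = lc n d B x ++.B lc n d' B x"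
proof -
 have "lc n (%i. d i + d' i) B x = (\<Oplus>.B i\<in>J n. alg B (d i) **.B pc n i B x ++.B alg B (d' i) **.B pc n i B x)"
  unfolding lc_def by (rule B.finsum_cong') (use pc_closed[OF _ B x] in "auto simp: B.alg_add B.l_distr")
 thus ?thesis unfolding lc_def by (simp add: B.finsum_addf Pi_def pc_closed[OF _ B x])
qed

lemma lc_cong: "(!!i. i : J n ==> d i = d' i) ==> lc n d B x = lc n d' B x"
 unfolding lc_def by (rule B.finsum_cong') (use pc_closed[OF _ B x] in auto)

lemma lc_natural:
 assumes C: "adic K C" and h: "h : alg_hom B C"
 shows "lc n d C (jmap n B C h x) = h (lc n d B x)"
proof -
 note rC = adicD(1)[OF C] and rB = adicD(1)[OF B]
 interpret C: r_algebra C using rC ..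
 interpret h: ring_hom_cring B C h by (rule ring_hom_cringI[OF rB rC alg_homD[OF h]])
 have "h (lc n d B x) = (\<Oplus>.C i\<in>J n. h (alg B (d i) **.B pc n i B x))"
  unfolding lc_def by (subst h.hom_finsum) (use pc_closed[OF _ B x] in "auto simp: comp_def")
 also have "... = lc n d C (jmap n B C h x)" unfolding lc_def
  by (rule C.finsum_cong')
  (use pc_closed[OF _ B x] pc_natural[OF _ B C h x] ahD[OF h] in auto)
 finally show ?thesis by simp
qed

end

subsection \<open>Saturation\<close>

text \<open>Over algebras killed by \<open>\<pi>\<close> the lateral Frobenius raises coordinates to their \<open>q\<close>-th powers,
 so the reductions of the \<open>\<Psi>\<^sub>i\<^sub>j\<close> are the linearly independent functions \<open>X\<^sub>j\<^bsup>q ^ (i - 1)\<^esup>\<close>.\<close>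

lemma saturated:
 assumes d: "!!B x. adic K B ==> torsion_free \<pi> B ==> x : jk n B ==> lc n d B x : pow_ideal \<pi> (Suc 0) B"
  and i0: "i0 : J n"
 shows "\<pi> dvd d i0"
proof -
 note rU = adicD(1)[OF cuniv_complete]
 interpret U: r_algebra cuniv using rU ..
 let ?I = "pow_ideal \<pi> (Suc 0) cuniv"
 define B0 where "B0 = quot ?I cuniv"
 note Q = quot[OF rU U.pow_ideal[of \<pi> "Suc 0"], folded B0_def]
 interpret B0: r_algebra B0 using Q(1) ..
 have pi0: "alg B0 (\<pi> ^ Suc 0) = \<zero>.B0"
  using Q(7)[OF U.alg_closed, of "\<pi> ^ Suc 0"] U.alg_pow_in_pow_ideal[of \<pi> "Suc 0"] homD(3)[OF Q(2)] by metis
 have cB: "adic K B0" by (rule killed_complete[OF Q(1) pi0])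
 define e where "e F = crep cuniv ?I (poly_emb F)" for F
 have eh: "is_alg_hom poly_alg B0 e" unfolding e_def by (rule hom_comp[OF poly_emb_hom Q(2)])
 note E = homD[OF eh] hom_more[OF ralgebra_poly_alg Q(1) eh]
 have Ec: "e F <: B0" for F by (rule E(2)) simp
 \<comment> \<open>At this point only the characters whose second index is that of \<open>i0\<close>
   survive, and they take the values \<open>X^(q^k)\<close> for one variable \<open>X\<close>, that
   is, distinct monomials.\<close>
 have "EX x:jk n B0. ALL j:{1..g}. psi n 0 j B0 x = (if j = snd i0 then e (mvar 0) else \<zero>.B0)"
  by (rule psi_0_surj[OF cB]) (simp add: Ec)
 then obtain x where x: "x : jk n B0" "!!j. j : {1..g} ==> psi n 0 j B0 x = (if j = snd i0 then e (mvar 0) else \<zero>.B0)" by blast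
 let ?m = "%i. if snd i = snd i0 then mvar 0 ^ (q ^ (fst i - 1)) else 0"
 have pcx: "pc n i B0 x = e (?m i)" if i: "i : J n" for i
 proof -
  have "pc n i B0 x = (psi n 0 (snd i) B0 x) [^].B0 (q ^ (fst i - 1))"
  unfolding pc_def by (rule psi_mod_pi[OF cB _ x(1)]) (use pi0 J_D[OF i] in auto)
  moreover have "\<zero>.B0 [^].B0 (q ^ (fst i - 1)) = \<zero>.B0" using q_ge2 by (intro B0.nat_pow_zero) simp
  ultimately show ?thesis using x(2)[of "snd i"] J_D[OF i] E(10)[of "mvar 0" "q ^ (fst i - 1)"] E(7) by simp
 qed
 define G where "G = (\<Sum>i\<in>J n. psing 0 (d i) * ?m i)"
 have "lc n d B0 x = e G"
 proof -
  interpret h: ring_hom_cring poly_alg B0 e by (rule ring_hom_cringI[OF ralgebra_poly_alg Q(1) eh])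
  have "e (finsum poly_alg (%i. psing 0 (d i) * ?m i) (J n)) = (\<Oplus>.B0 i\<in>J n. e (psing 0 (d i) * ?m i))"
  by (subst h.hom_finsum) (simp_all add: comp_def)
  moreover have "e (psing 0 (d i) * ?m i) = alg B0 (d i) **.B0 e (?m i)" for i
  using E(4)[of "psing 0 (d i)" "?m i"] E(3)[of "d i"] by simp
  ultimately have "e G = (\<Oplus>.B0 i\<in>J n. alg B0 (d i) **.B0 e (?m i))" by (simp only: G_def finsum_poly_alg finite_J)
  also have "... = lc n d B0 x" unfolding lc_def by (rule B0.finsum_cong') (use pcx Ec in auto)
  finally show ?thesis by simp
 qed
 moreover have "lc n d B0 x = \<zero>.B0"
 proof -
  \<comment> \<open>The assumption on \<open>d\<close> speaks of torsion-free algebras, while \<pi>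
    vanishes in \<open>B0\<close>; so the point is lifted to \<open>cuniv\<close>.\<close>
  obtain h X where h: "h : alg_hom cuniv B0" and X: "X : jk n cuniv" and hX: "jmap n cuniv B0 h X = x"
  by (rule jet_lift[OF cB x(1)])
  have "lc n d B0 x = h (lc n d cuniv X)" using lc_natural[OF cuniv_complete X cB h, of d] hX by simp
  also have "... : pow_ideal \<pi> (Suc 0) B0"
  by (rule hom_pow_ideal[OF rU alg_homD[OF h] d[OF cuniv_complete cuniv_torsion_free X]])
  finally show ?thesis by (rule B0.pow_idealE) (simp add: pi0[simplified])
 qed
 ultimately have "e G = \<zero>.B0" by simp
 hence "poly_emb G : ?I" using Q(7)[OF homD(2)[OF poly_emb_hom]] by (simp add: e_def)
 hence "cong_mod cuniv ?I (poly_emb G) (poly_emb 0)"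
  using hom_more(1)[OF ralgebra_poly_alg rU poly_emb_hom] homD(2)[OF poly_emb_hom, of G]
  by (simp add: U.cong_zero_iff[OF U.pow_ideal])
 hence "\<pi> dvd plook G \<mu>" for \<mu> unfolding poly_emb_cong_iff by simp
 moreover have "plook G (psing 0 (q ^ (fst i0 - 1))) = d i0"
 proof -
  let ?\<mu> = "psing (0::nat) (q ^ (fst i0 - 1))"
  have mv: "mvar 0 ^ k = (psing (psing 0 k) 1 :: 'r mpoly)" for k
  by (induction k) (simp_all add: mvar_def mult_single single_add[symmetric] flip: single_one)
  have eq: "plook (psing 0 (d i) * ?m i) ?\<mu> = (if i = i0 then d i else 0)" if i: "i : J n" for i
  proof -
  have "psing 0 (q ^ (fst i - 1)) = ?\<mu> <-> fst i = fst i0"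
  proof
  assume "psing (0::nat) (q ^ (fst i - 1)) = ?\<mu>"
  hence "q ^ (fst i - 1) = q ^ (fst i0 - 1)" by (metis lookup_single_eq)
  hence "fst i - 1 = fst i0 - 1" using q_ge2 by (simp add: power_inject_exp)
  thus "fst i = fst i0" using i i0 by (auto simp: J_def)
  qed simp
  thus ?thesis unfolding lookup_scale mv by (auto simp: lookup_single when_def prod_eq_iff)
  qed
  have "plook G ?\<mu> = (\<Sum>i\<in>J n. if i = i0 then d i else 0)"
  unfolding G_def lookup_sum by (rule sum.cong[OF refl eq])
  also have "... = d i0" using i0 by (simp add: sum.delta')
  finally show ?thesis .
 qed
 ultimately show ?thesis by metis
qed

subsection \<open>Representation of characters\<close>

text \<open>Only torsion-free algebras are tested, since \<pi> can be cancelled there.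
  \<open>th\<close> is any function, because the notion is also applied to zero and to multiples of
  a character.\<close>

definition rep :: "nat => (('r, 'b) ralg => ('p, 's, 'b) jet => 'b) => (nat \<times> nat => 'r) => bool" where
 "rep n th d <-> (ALL B x. adic K B --> torsion_free \<pi> B --> x : jk n B --> th B x = lc n d B x)"

text \<open>Let \<open>s\<close> be a point over \<open>cuniv\<close> whose values are
  \<open>p^(n + 1)\<close> times variables, and \<open>f\<close> the value of \<open>th\<close> at
  \<open>s\<close>. Points are determined by their values. Hence multiplying the variables by
  \<open>p\<close> takes \<open>s\<close> to its \<open>p\<close>-fold multiple, so \<open>f\<close>
  is linear; and sending the variables to the values of a point \<open>x\<close> takes
  \<open>s\<close> to the \<open>p^(n + 1)\<close>-fold multiple of \<open>x\<close>, which
  expresses \<open>p^(n + 1)\<close> times \<open>th B x\<close> through these values.\<close>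

lemma rep_multiple:
 assumes th: "th : Hm n"
 shows "EX d. rep n (%B x. alg B (of_nat p ^ Suc n) **.B th B x) d"
proof -
 note rU = adicD(1)[OF cuniv_complete]
 interpret U: r_algebra cuniv using rU ..
 let ?P = "of_nat p ^ Suc n :: 'r"
 obtain e M where e: "bij_betw e (J n) {..<M::nat}" using ex_bij_betw_finite_nat[OF finite_J[of n]] by (auto simp: atLeast0LessThan)
 have eM: "e i < M" if "i : J n" for i using bij_betw_apply[OF e that] by simp
 have "EX s:jk n cuniv. \<forall>k\<le>n. ALL j:{1..g}. psi n k j cuniv s = alg cuniv ?P **.cuniv cuvar (e (Suc k, j))"
  by (rule psi_surj[OF cuniv_complete cuniv_torsion_free]) simp
 then obtain s where s: "s : jk n cuniv"
  "!!k j. k \<le> n ==> j : {1..g} ==> psi n k j cuniv s = alg cuniv ?P **.cuniv cuvar (e (Suc k, j))" by blast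
 have pcs: "pc n i cuniv s = alg cuniv ?P **.cuniv cuvar (e i)" if i: "i : J n" for i
  using s(2)[of "fst i - 1" "snd i"] J_D[OF i] i by (cases i) (auto simp: pc_def J_def)
 define f where "f = th cuniv s"
 have f: "f <: cuniv" unfolding f_def by (rule Hom_GaD(1)[OF th cuniv_complete s(1)])
 let ?v = "%m. alg cuniv (if m < M then of_nat p else 0) **.cuniv cuvar m"
 obtain kp where kp: "kp : alg_hom cuniv cuniv" "!!m. kp (cuvar m) = ?v m"
  by (rule cuniv_map[OF cuniv_complete, where x = ?v]) (simp, rule that)
 obtain y where y: "y : jk n cuniv" "th cuniv y = alg cuniv (of_nat p) **.cuniv f"
  "ALL i:J n. pc n i cuniv y = alg cuniv (of_nat p) **.cuniv pc n i cuniv s"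
  using pc_multiple[OF cuniv_complete s(1), of p] th unfolding f_def by blast
 note mkp = jet_map[OF cuniv_complete cuniv_complete kp(1) s(1)]
 have "jmap n cuniv cuniv kp s = y"
 proof (rule pc_inj[OF cuniv_complete cuniv_torsion_free mkp(1) y(1)])
  fix i assume i: "i : J n"
  show "pc n i cuniv (jmap n cuniv cuniv kp s) = pc n i cuniv y"
  using pc_natural[OF i cuniv_complete cuniv_complete kp(1) s(1)] bspec[OF y(3) i] pcs[OF i] eM[OF i]
  ahD(3,4)[OF kp(1)] by (simp add: kp(2) U.m_lcomm del: power_Suc)
 qed
 hence "kp f = alg cuniv (of_nat p) **.cuniv f"
  using Hom_GaD(3)[OF th cuniv_complete cuniv_complete kp(1) s(1)] y(2) by (simp add: f_def)
 from linear_of_scaling[OF f kp this]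
 obtain c where c: "f = (\<Oplus>.cuniv m\<in>{..<M}. alg cuniv (c m) **.cuniv cuvar m)" by blast
 have "alg B ?P **.B th B x = lc n (%i. c (e i)) B x"
  if B: "adic K B" and tf: "torsion_free \<pi> B" and x: "x : jk n B" for B x
 proof -
  note rB = adicD(1)[OF B]
  interpret B: r_algebra B using rB ..
  let ?b = "%m. if m < M then pc n (inv_into (J n) e m) B x else \<zero>.B"
  have inv: "inv_into (J n) e m : J n" if "m < M" for m using bij_betw_apply[OF bij_betw_inv_into[OF e]] that by simp
  have b: "?b m <: B" for m using pc_closed[OF inv B x] by simp
  obtain h where h: "h : alg_hom cuniv B" "!!m. h (cuvar m) = ?b m" by (rule cuniv_map[OF B, where x = ?b, OF b]) (rule that)
  have he: "h (cuvar (e i)) = pc n i B x" if i: "i : J n" for i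
  using h(2)[of "e i"] eM[OF i] bij_betw_inv_into_left[OF e i] by simp
  obtain y where y: "y : jk n B" "th B y = alg B (of_nat (p ^ Suc n)) **.B th B x"
  "ALL i:J n. pc n i B y = alg B (of_nat (p ^ Suc n)) **.B pc n i B x"
  using pc_multiple[OF B x, of "p ^ Suc n"] th by blast
  note H = ahD[OF h(1)]
  note mh = jet_map[OF cuniv_complete B h(1) s(1)]
  have "jmap n cuniv B h s = y"
  proof (rule pc_inj[OF B tf mh(1) y(1)])
  fix i assume i: "i : J n"
  show "pc n i B (jmap n cuniv B h s) = pc n i B y"
  using pc_natural[OF i cuniv_complete B h(1) s(1)] bspec[OF y(3) i] pcs[OF i] by (simp add: H he[OF i] del: power_Suc)
  qed
  hence "alg B ?P **.B th B x = h f"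
  using Hom_GaD(3)[OF th cuniv_complete B h(1) s(1)] y(2) by (simp add: f_def del: power_Suc)
  also have "... = (\<Oplus>.B m\<in>{..<M}. alg B (c m) **.B h (cuvar m))"
  proof -
  interpret hh: ring_hom_cring cuniv B h by (rule ring_hom_cringI[OF rU rB alg_homD[OF h(1)]])
  show ?thesis unfolding c by (subst hh.hom_finsum) (auto simp: comp_def H intro!: B.finsum_cong')
  qed
  also have "{..<M} = e ` J n" using e by (simp add: bij_betw_def)
  also have "(\<Oplus>.B m\<in>e ` J n. alg B (c m) **.B h (cuvar m)) = (\<Oplus>.B i\<in>J n. alg B (c (e i)) **.B h (cuvar (e i)))"
  by (rule B.finsum_reindex) (use H(2) e in "auto simp: bij_betw_def")
  also have "... = lc n (%i. c (e i)) B x" unfolding lc_def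
  by (rule B.finsum_cong') (use he pc_closed[OF _ B x] in auto)
  finally show ?thesis .
 qed
 thus ?thesis unfolding rep_def by blast
qed

text \<open>\<open>saturated\<close> divides the coefficients by \<pi>, and torsion-freeness of the
  test algebras cancels \<pi> from the equation.\<close>

lemma divide_rep:
 assumes "rep n (%B x. alg B \<pi> **.B et B x) d" and et: "!!B x. adic K B ==> x : jk n B ==> et B x <: B"
 shows "EX d'. (ALL i:J n. d i = \<pi> * d' i) & rep n et d'"
proof -
 have "\<pi> dvd d i" if "i : J n" for i
 proof (rule saturated[OF _ that])
  fix B x assume B: "adic K B" "torsion_free \<pi> B" "x : jk n B"
  show "lc n d B x : pow_ideal \<pi> (Suc 0) B"
  using assms(1) B by (intro r_algebra.pow_idealI[OF ralgebraD[OF adicD(1)[OF B(1)]] et[OF B(1,3)]]) (simp add: rep_def)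
 qed
 hence "EX d'. ALL i:J n. d i = \<pi> * d' i" by (intro bchoice) (auto simp: dvd_def)
 then obtain d' where d': "ALL i:J n. d i = \<pi> * d' i" by blast
 have "et B x = lc n d' B x" if B: "adic K B" "torsion_free \<pi> B" "x : jk n B" for B x
 proof (rule torsion_free_cancel[OF adicD(1)[OF B(1)] B(2) et[OF B(1,3)] lc_closed[OF B(1,3)], of 1])
  show "alg B (\<pi> ^ 1) **.B et B x = alg B (\<pi> ^ 1) **.B lc n d' B x"
  using assms(1) B lc_scale[OF B(1,3), of \<pi> d'] lc_cong[OF B(1,3), of d "%i. \<pi> * d' i"] d' by (simp add: rep_def)
 qed
 thus ?thesis using d' by (auto simp: rep_def)
qed

text \<open>The difference of the coefficients represents zero. Zero is \<pi> times zero, so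
  \<open>divide_rep\<close> can be repeated without end, and only 0 is divisible by all powers of
  \<pi>.\<close>

lemma rep_unique:
 assumes "rep n (%B x. lc n d B x) d'" and i: "i : J n" shows "d i = d' i"
proof -
 have zero: "rep n (%B x. \<zero>.B) \<delta> ==> ALL i:J n. \<pi> ^ m dvd \<delta> i" for \<delta> m
 proof (induction m arbitrary: \<delta>)
  case (Suc m)
  have z: "\<zero>.B <: B" "alg B \<pi> **.B \<zero>.B = \<zero>.B" if "adic K B" for B :: "('r, 'b) ralg"
  proof -
  interpret B: r_algebra B using that ..
  show "\<zero>.B <: B" "alg B \<pi> **.B \<zero>.B = \<zero>.B" by simp_all
  qed
  have "rep n (%B x. alg B \<pi> **.B \<zero>.B) \<delta>" using Suc.prems z(2) unfolding rep_def by metis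
  from divide_rep[OF this z(1)] obtain d' where d': "ALL i:J n. \<delta> i = \<pi> * d' i" "rep n (%B x. \<zero>.B) d'" by blast
  show ?case using Suc.IH[OF d'(2)] d'(1) by simp
 qed simp
 have "rep n (%B x. \<zero>.B) (%i. d i + (- 1) * d' i)"
  unfolding rep_def
 proof (intro allI impI)
  fix B :: "('r, 'b) ralg" and x assume B: "adic K B" "torsion_free \<pi> B" "x : jk n B"
  interpret B: r_algebra B using B(1) ..
  have "lc n d B x = lc n d' B x" using assms(1) B by (simp add: rep_def)
  thus "\<zero>.B = lc n (%i. d i + (- 1) * d' i) B x"
  unfolding lc_add[OF B(1,3)] lc_scale[OF B(1,3)] using lc_closed[OF B(1,3), of d']
  by (simp add: B.alg_uminus[of 1, simplified] B.l_minus B.r_neg)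
 qed
 from pi_power_dvd_zero[of "d i + (- 1) * d' i"] zero[OF this] i show ?thesis by simp
qed

text \<open>\<open>p^(n + 1)\<close> is a power of \<pi> up to a unit. The unit is moved into the
  coefficients, and \<pi> is cancelled one factor at a time.\<close>

lemma character_rep:
 assumes th: "th : Hm n"
 shows "EX d. ALL B x. adic K B --> x : jk n B --> th B x = lc n d B x"
proof -
 have cl: "th B x <: B" if "adic K B" "x : jk n B" for B x by (rule Hom_GaD(1)[OF th that])
 have cancel: "rep n (%B x. alg B (\<pi> ^ m) **.B th B x) d ==> EX d'. rep n th d'" for m d
 proof (induction m arbitrary: d)
  case 0
  thus ?case
  using cl by (intro exI[of _ d]) (auto simp: rep_def r_algebra.alg_one[OF ralgebraD[OF adicD(1)]]
  monoid.l_one[OF ring.axioms(2)[OF cring.axioms(1)[OF r_algebra.axioms(1)[OF ralgebraD[OF adicD(1)]]]]])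
 next
  case (Suc m)
  have "rep n (%B x. alg B \<pi> **.B (alg B (\<pi> ^ m) **.B th B x)) d"
  unfolding rep_def
  proof (intro allI impI)
  fix B :: "('r, 'b) ralg" and x assume B: "adic K B" "torsion_free \<pi> B" "x : jk n B"
  interpret B: r_algebra B using B(1) ..
  have "alg B (\<pi> ^ Suc m) **.B th B x = lc n d B x" using Suc.prems B unfolding rep_def by blast
  thus "alg B \<pi> **.B (alg B (\<pi> ^ m) **.B th B x) = lc n d B x"
  using cl[OF B(1,3)] by (simp add: B.alg_mult B.m_assoc)
  qed
  from divide_rep[OF this] obtain d' where "rep n (%B x. alg B (\<pi> ^ m) **.B th B x) d'"
  proof -
  assume a: "!!d'. rep n (%B x. alg B (\<pi> ^ m) **.B th B x) d' ==> thesis"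
  and b: "(!!B x. adic K B ==> x : jk n B ==> alg B (\<pi> ^ m) **.B th B x <: B) ==>
  EX d'. (ALL i:J n. d i = \<pi> * d' i) & rep n (%B x. alg B (\<pi> ^ m) **.B th B x) d'"
  have "alg B (\<pi> ^ m) **.B th B x <: B" if B: "adic K B" "x : jk n B" for B x
  proof -
  interpret B: r_algebra B using B(1) ..
  show ?thesis using cl[OF B] by simp
  qed
  from b[OF this] show thesis using a by blast
  qed
  thus ?case by (rule Suc.IH)
 qed
 obtain d where d: "rep n (%B x. alg B (of_nat p ^ Suc n) **.B th B x) d" using rep_multiple[OF th] by blast
 obtain e w where e: "w dvd 1" "of_nat p = w * \<pi> ^ e" using ramification by auto
 obtain v where v: "1 = w * v" using e(1) by (rule dvdE)
 have pe: "v ^ Suc n * of_nat p ^ Suc n = \<pi> ^ (e * Suc n)"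
 proof -
  have "v ^ Suc n * of_nat p ^ Suc n = (w * v * \<pi> ^ e) ^ Suc n" unfolding power_mult_distrib[symmetric] e(2) by (simp add: mult_ac)
  thus ?thesis unfolding v[symmetric] by (simp only: mult_1_left power_mult)
 qed
 have "rep n (%B x. alg B (\<pi> ^ (e * Suc n)) **.B th B x) (%i. v ^ Suc n * d i)"
  unfolding rep_def
 proof (intro allI impI)
  fix B :: "('r, 'b) ralg" and x assume B: "adic K B" "torsion_free \<pi> B" "x : jk n B"
  interpret B: r_algebra B using B(1) ..
  have "lc n d B x = alg B (of_nat p ^ Suc n) **.B th B x" using d B by (simp add: rep_def)
  thus "alg B (\<pi> ^ (e * Suc n)) **.B th B x = lc n (%i. v ^ Suc n * d i) B x"
  unfolding lc_scale[OF B(1,3)] pe[symmetric] using cl[OF B(1,3)] by (simp add: B.alg_mult B.m_assoc del: power_Suc)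
 qed
 then obtain d' where d': "rep n th d'" using cancel by blast
 have "th B x = lc n d' B x" if B: "adic K B" and x: "x : jk n B" for B x
 proof -
  obtain h X where h: "h : alg_hom cuniv B" and X: "X : jk n cuniv" and hX: "jmap n cuniv B h X = x"
  by (rule jet_lift[OF B x])
  have "th cuniv X = lc n d' cuniv X" using d' X cuniv_complete cuniv_torsion_free by (simp add: rep_def)
  thus ?thesis using Hom_GaD(3)[OF th cuniv_complete B h X] lc_natural[OF cuniv_complete X B h, of d'] hX by simp
 qed
 thus ?thesis by blast
qed

end

context jet_characters begin

subsection \<open>The module of characters\<close>

abbreviation M :: "nat => ('r, ('p, 'r, 's, 'b) character) module" where "M n \<equiv> Hom_module K A (Suc n)"

lemma M_carrier [simp]: "carrier (M n) = Hm n"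
 by (simp add: Hom_module_def)

lemma M_eval:
 assumes "adic K B" "x : jk n B"
 shows "(th ++.(M n) et) B x = th B x ++.B et B x" "\<zero>.(M n) B x = \<zero>.B"
  "(r \<odot>.(M n) th) B x = alg B r **.B th B x"
 using assms by (simp_all add: Hom_module_def complete_iff)

lemma Hom_Ga_ext:
 assumes th: "th : Hm n" and et: "et : Hm n"
  and eq: "!!B x. adic K B ==> x : jk n B ==> th B x = et B x"
 shows "th = et"
proof (rule PiE_ext)
 show "th : (\<Pi>\<^sub>E B\<in>CA K. jk n B \<rightarrow>\<^sub>E carrier B)" "et : (\<Pi>\<^sub>E B\<in>CA K. jk n B \<rightarrow>\<^sub>E carrier B)"
  using th et by (simp_all add: Hom_Ga_def)
 thus "th B = et B" if "B : CA K" for B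
  using that eq by (intro PiE_ext[of _ "jk n B" "%_. carrier B"]) (auto simp: complete_iff PiE_iff)
qed

lemma Hom_GaI:
 assumes "!!B x. adic K B ==> x : jk n B ==> f B x <: B"
  "!!B x y. adic K B ==> x : jk n B ==> y : jk n B ==> f B (jadd n B x y) = f B x ++.B f B y"
  "!!B C h x. adic K B ==> adic K C ==> h : alg_hom B C ==> x : jk n B ==>
  f C (jmap n B C h x) = h (f B x)"
 shows "(\<lambda>B\<in>CA K. \<lambda>x\<in>jk n B. f B x) : Hm n" (is "?F : _")
 unfolding Hom_Ga_def
proof (rule CollectI, intro conjI ballI)
 show "?F : (\<Pi>\<^sub>E B\<in>CA K. jk n B \<rightarrow>\<^sub>E carrier B)"
  using assms(1) by (auto simp: complete_iff)
next
 fix B x y assume "B : CA K" "x : jk n B" "y : jk n B"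
 thus "?F B (jadd n B x y) = ?F B x ++.B ?F B y"
  using jet_mult[of B x n y] assms(2) by (simp add: complete_iff)
next
 fix B C :: "('r, 'b) ralg" and h x assume "B : CA K" "C : CA K" "h : alg_hom B C" "x : jk n B"
 thus "?F C (jmap n B C h x) = h (?F B x)"
  using jet_map(1)[of B C h x n] assms(3) by (simp add: complete_iff)
qed

lemma M_zero: "\<zero>.(M n) : Hm n"
proof -
 have "(\<lambda>B\<in>CA K. \<lambda>x\<in>jk n B. \<zero>.B) : Hm n"
 proof (rule Hom_GaI)
  fix B assume B: "adic K (B :: ('r, 'b) ralg)"
  interpret r_algebra B using B ..
  show "\<zero>.B <: B" "\<zero>.B = \<zero>.B ++.B \<zero>.B" by simp_all
 next
  fix B C :: "('r, 'b) ralg" and h assume a: "adic K B" "adic K C" "h : alg_hom B C"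
  show "\<zero>.C = h \<zero>.B"
  using hom_more(1)[OF adicD(1)[OF a(1)] adicD(1)[OF a(2)] alg_homD[OF a(3)]] by simp
 qed
 thus ?thesis by (simp add: Hom_module_def)
qed

lemma M_closed:
 assumes th: "th : Hm n"
 shows "et : Hm n ==> th ++.(M n) et : Hm n" "r \<odot>.(M n) th : Hm n"
proof -
 have R: "r_algebra B" "cring B" if "adic K B" for B :: "('r, 'b) ralg"
  using adicD(1)[OF that] by (simp_all add: r_algebra_iff ralgebra_def)
 note S = Hom_GaD[OF th] cring.cring_simprules[OF R(2)] r_algebra.alg_closed[OF R(1)]
  ahD(2) ahD(3) ahD(4) ahD(5)
 show "th ++.(M n) et : Hm n" if et: "et : Hm n"
  using Hom_GaI[of n "%B x. th B x ++.B et B x"] by (simp add: Hom_module_def S Hom_GaD[OF et])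
 show "r \<odot>.(M n) th : Hm n"
  using Hom_GaI[of n "%B x. alg B r **.B th B x"] by (simp add: Hom_module_def S)
qed

text \<open>All laws hold pointwise; negatives are multiples by -1.\<close>

lemma M_module: "Module.module base_alg (M n)"
proof -
 have R: "r_algebra B" "cring B" if "adic K B" for B :: "('r, 'b) ralg"
  using adicD(1)[OF that] by (simp_all add: r_algebra_iff ralgebra_def)
 note S = cring.cring_simprules[OF R(2)] M_eval M_closed M_zero Hom_GaD(1)
  r_algebra.alg_closed[OF R(1)] r_algebra.alg_one[OF R(1)]
  r_algebra.alg_add[OF R(1)] r_algebra.alg_mult[OF R(1)]
 have neg: "alg B (- 1) **.B y ++.B y = \<zero>.B" if "adic K B" "y <: B" for B :: "('r, 'b) ralg" and y
 proof -
  interpret r_algebra B using that(1) ..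
  show ?thesis using that(2) by (simp add: alg_uminus l_minus l_neg)
 qed
 have ab: "abelian_group (M n)"
 proof (rule abelian_groupI, unfold M_carrier)
  fix th assume t: "th : Hm n"
  show "EX et:Hm n. et ++.(M n) th = \<zero>.(M n)"
   by (rule bexI[of _ "(- 1) \<odot>.(M n) th"], rule Hom_Ga_ext[where n = n])
  (use t in "simp_all add: neg M_eval M_closed M_zero Hom_GaD(1)")
 qed (rule Hom_Ga_ext[where n = n]; simp add: S | simp add: S)+
 show ?thesis
  by (rule moduleI[OF cring_base_alg ab], unfold M_carrier base_alg_sel)
   (rule Hom_Ga_ext[where n = n]; simp add: S | simp add: S)+
qed

lemma M_lincomb_eval:
 assumes S: "finite S" and b: "!!i. i : S ==> b i : Hm n" and B: "adic K B" "x : jk n B"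
 shows "(\<Oplus>.(M n) i\<in>S. c i \<odot>.(M n) b i) B x = (\<Oplus>.B i\<in>S. alg B (c i) **.B b i B x)"
 using S b
proof (induction S rule: finite_induct)
 interpret m: Module.module base_alg "M n" by (rule M_module)
 interpret B: r_algebra B using B(1) ..
 case empty
 thus ?case by (simp add: M_eval[OF B])
next
 interpret m: Module.module base_alg "M n" by (rule M_module)
 interpret B: r_algebra B using B(1) ..
 case (insert i S)
 have "c j \<odot>.(M n) b j <: M n" if "j : insert i S" for j
  using M_closed(2)[OF insert.prems[OF that]] by simp
 moreover have "alg B (c j) **.B b j B x <: B" if "j : insert i S" for j using Hom_GaD(1)[OF insert.prems[OF that] B] by simp
 ultimately show ?case using insert by (simp add: m.finsum_insert B.finsum_insert Pi_def M_eval[OF B] del: M_carrier)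
qed

text \<open>At a point a linear combination of the basis is \<open>lc\<close>, so existence of
  coefficients is \<open>character_rep\<close> and their uniqueness is
  \<open>rep_unique\<close>.\<close>

lemma Psi_basis: "is_basis base_alg (M n) (J n) (%(i, j). Psi K A \<Psi>1 (Suc n) i j)"
proof -
 let ?b = "%i. Psi K A \<Psi>1 (Suc n) (fst i) (snd i)"
 interpret m: Module.module base_alg "M n" by (rule M_module)
 have ev: "(\<Oplus>.(M n) i\<in>J n. c i \<odot>.(M n) ?b i) B x = lc n c B x" if B: "adic K B" "x : jk n B" for c B x
 proof -
  interpret B: r_algebra B using B(1) ..
  have "(\<Oplus>.(M n) i\<in>J n. c i \<odot>.(M n) ?b i) B x = (\<Oplus>.B i\<in>J n. alg B (c i) **.B ?b i B x)"
  by (rule M_lincomb_eval[OF finite_J Psi_J_Hom B])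
  also have "... = lc n c B x" unfolding lc_def
  by (rule B.finsum_cong') (use Psi_pc[OF _ B] pc_closed[OF _ B] in auto)
  finally show ?thesis .
 qed
 have mem: "(\<Oplus>.(M n) i\<in>J n. c i \<odot>.(M n) ?b i) : Hm n" for c
  using m.finsum_closed[of "%i. c i \<odot>.(M n) ?b i" "J n"] M_closed(2)[OF Psi_J_Hom] by (auto simp: Pi_def)
 have "EX! c. c : J n \<rightarrow>\<^sub>E UNIV & th = (\<Oplus>.(M n) i\<in>J n. c i \<odot>.(M n) ?b i)" if th: "th : Hm n" for th
 proof -
  obtain d where d: "!!B x. adic K B ==> x : jk n B ==> th B x = lc n d B x" using character_rep[OF th] by blast
  show ?thesis
  proof (rule ex1I[of _ "restrict d (J n)"])
  have "th = (\<Oplus>.(M n) i\<in>J n. restrict d (J n) i \<odot>.(M n) ?b i)"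
  proof (rule Hom_Ga_ext[OF th mem])
  fix B x assume B: "adic K B" "x : jk n B"
  show "th B x = (\<Oplus>.(M n) i\<in>J n. restrict d (J n) i \<odot>.(M n) ?b i) B x"
  unfolding ev[OF B] d[OF B] by (rule lc_cong[OF B]) simp
  qed
  thus "restrict d (J n) : J n \<rightarrow>\<^sub>E UNIV & th = (\<Oplus>.(M n) i\<in>J n. restrict d (J n) i \<odot>.(M n) ?b i)" by auto
  fix c assume c: "c : J n \<rightarrow>\<^sub>E UNIV & th = (\<Oplus>.(M n) i\<in>J n. c i \<odot>.(M n) ?b i)"
  have "rep n (%B x. lc n c B x) d" unfolding rep_def
  proof (intro allI impI)
  fix B x assume B: "adic K B" "torsion_free \<pi> B" "x : jk n B"
  have "th B x = lc n c B x" using conjunct2[OF c] ev[OF B(1,3), of c] by simp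
  thus "lc n c B x = lc n d B x" using d[OF B(1,3)] by simp
  qed
  from rep_unique[OF this] show "c = restrict d (J n)" by (intro PiE_ext[OF conjunct1[OF c]]) auto
  qed
 qed
 thus ?thesis unfolding is_basis_def case_prod_beta using M_module Psi_J_Hom by simp
qed

end

section \<open>Rank\<close>

text \<open>Elimination without division: an unknown \<open>w\<close> with nonzero coefficient
  \<open>a w i\<close> is removed by cross-multiplication, and a solution of the smaller system is
  scaled by \<open>a w i\<close>.\<close>

lemma homogeneous_system:
 fixes a :: "'v => 'i => 'r::idom"
 assumes "finite I"
 shows "finite S ==> card S > card I ==> EX c. (EX v:S. c v ~= 0) & (ALL i:I. (\<Sum>v\<in>S. c v * a v i) = 0)"
 using assms
proof (induction I arbitrary: S a rule: finite_induct)
 case empty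
 hence "S ~= {}" by auto
 thus ?case by (intro exI[of _ "%_. 1"]) auto
next
 case (insert i I)
 show ?case
 proof (cases "ALL v:S. a v i = 0")
  case True
  obtain c where "EX v:S. c v ~= 0" "ALL i:I. (\<Sum>v\<in>S. c v * a v i) = 0"
  using insert.IH[OF insert.prems(1), of a] insert.prems(2) insert.hyps by (auto simp: card_insert_if)
  thus ?thesis using True by auto
 next
  case False
  then obtain w where w: "w : S" "a w i ~= 0" by blast
  let ?S = "S - {w}" and ?a = "%v j. a w i * a v j - a v i * a w j"
  have fS: "finite ?S" "card ?S > card I" using insert.prems insert.hyps w by (auto simp: card_insert_if)
  obtain c where c: "EX v:?S. c v ~= 0" "ALL j:I. (\<Sum>v\<in>?S. c v * ?a v j) = 0" using insert.IH[OF fS, of ?a] by blast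
  \<comment> \<open>With the other values multiplied by \<open>a w i\<close>, this value at
    \<open>w\<close> makes the \<open>i\<close>-th equation hold.\<close>
  define c' where "c' v = (if v = w then - (\<Sum>v\<in>?S. c v * a v i) else a w i * c v)" for v
  have split: "(\<Sum>v\<in>S. c' v * a v j) = (\<Sum>v\<in>?S. a w i * c v * a v j) - (\<Sum>v\<in>?S. c v * a v i) * a w j" for j
  proof -
  have "(\<Sum>v\<in>S. c' v * a v j) = c' w * a w j + (\<Sum>v\<in>?S. c' v * a v j)" by (rule sum.remove[OF insert.prems(1) w(1)])
  also have "(\<Sum>v\<in>?S. c' v * a v j) = (\<Sum>v\<in>?S. a w i * c v * a v j)" by (rule sum.cong) (auto simp: c'_def)
  finally show ?thesis by (simp add: c'_def)
  qed
  have "(\<Sum>v\<in>S. c' v * a v j) = (\<Sum>v\<in>?S. c v * ?a v j)" for j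
  unfolding split sum_distrib_right sum_subtractf[symmetric] by (rule sum.cong) (auto simp: algebra_simps)
  moreover have "(\<Sum>v\<in>?S. c v * ?a v i) = 0" by (simp add: mult.commute)
  ultimately show ?thesis using c w by (intro exI[of _ c']) (auto simp: c'_def)
 qed
qed

text \<open>A basis is an independent set of the right size. A larger set has more elements than
  there are coordinates, so \<open>homogeneous_system\<close> gives a relation with coefficients in
  the ring itself.\<close>

lemma rank_of_basis:
 fixes M :: "('r::idom, 'a, 'y) module_scheme" (structure)
 assumes "is_basis (base_alg :: ('r, 'r) ralg) M I b"
 shows "module_rank (base_alg :: ('r, 'r) ralg) M = enat (card I)"
proof -
 let ?R = "base_alg :: ('r, 'r) ralg"
 interpret Module.module ?R M using assms by (simp add: is_basis_def)
 have I: "finite I" and b: "!!i. i : I ==> b i <: M"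
  and ex: "!!m. m <: M ==> EX! c. c : I \<rightarrow>\<^sub>E UNIV & m = (\<Oplus>i\<in>I. c i \<odot> b i)"
  using assms by (auto simp: is_basis_def)
 have sc: "r \<odot> v <: M" if "v <: M" for r v using smult_closed[of r v] that by simp
 have lcc: "(\<Oplus>i\<in>I. c i \<odot> b i) <: M" for c by (rule M.finsum_closed) (use b sc in auto)
 have uniq: "c i = c' i" if eq: "(\<Oplus>i\<in>I. c i \<odot> b i) = (\<Oplus>i\<in>I. c' i \<odot> b i)" and i: "i : I" for c c' i
 proof -
  have r: "(\<Oplus>i\<in>I. restrict d I i \<odot> b i) = (\<Oplus>i\<in>I. d i \<odot> b i)" for d
  by (rule M.finsum_cong') (use b sc in auto)
  have "restrict c I = restrict c' I" by (rule ex1_unique[OF ex[OF lcc[of c]]]) (rule conjI, simp, simp only: r eq)+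
  from fun_cong[OF this, of i] show ?thesis using i by simp
 qed
 have zero: "(\<Oplus>i\<in>I. 0 \<odot> b i) = \<zero>"
  using M.finsum_zero smult_l_null b by (simp add: M.finsum_cong'[of I I "%_. \<zero>"])
 have unit: "(\<Oplus>i\<in>I. (if i = k then 1 else 0) \<odot> b i) = b k" if k: "k : I" for k
 proof -
  have "(\<Oplus>i\<in>I. (if i = k then 1 else 0) \<odot> b i) = (\<Oplus>i\<in>I. if k = i then b i else \<zero>)"
  by (rule M.finsum_cong') (use b smult_l_null smult_one in auto)
  also have "... = b k" by (rule M.finsum_singleton[OF k I]) (use b in auto)
  finally show ?thesis .
 qed
 \<comment> \<open>A basis is given as a family; its members are distinct because coordinates are
   unique.\<close>
 have inj: "inj_on b I"
 proof (rule inj_onI)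
  fix i j assume ij: "i : I" "j : I" "b i = b j"
  hence "(\<Oplus>k\<in>I. (if k = i then 1 else 0) \<odot> b k) = (\<Oplus>k\<in>I. (if k = j then 1 else 0) \<odot> b k)" by (simp add: unit)
  from uniq[OF this ij(1)] show "i = j" by (simp split: if_splits)
 qed
 have indep: "lin_indep ?R M (b ` I)"
  unfolding lin_indep_def
 proof (intro ballI impI)
  fix c v assume c: "(\<Oplus>v\<in>b ` I. c v \<odot> v) = \<zero>" and v: "v : b ` I"
  obtain i where i: "v = b i" "i : I" using v by (rule imageE)
  have "(\<Oplus>v\<in>b ` I. c v \<odot> v) = (\<Oplus>i\<in>I. c (b i) \<odot> b i)" by (rule M.finsum_reindex[OF _ inj]) (use b sc in auto)
  hence "(\<Oplus>i\<in>I. c (b i) \<odot> b i) = (\<Oplus>i\<in>I. 0 \<odot> b i)" using c zero by simp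
  from uniq[OF this i(2)] show "c v = \<zero>.?R" using i(1) by simp
 qed
 have bound: "card S \<le> card I" if S: "finite S" "S <= carrier M" "lin_indep ?R M S" for S
 proof (rule ccontr)
  assume "\<not> card S \<le> card I"
  have "ALL v:S. EX a. v = (\<Oplus>i\<in>I. a i \<odot> b i)" using ex S(2) by blast
  then obtain a where a: "!!v. v : S ==> v = (\<Oplus>i\<in>I. a v i \<odot> b i)" by metis
  obtain c where c: "EX v:S. c v ~= 0" "ALL i:I. (\<Sum>v\<in>S. c v * a v i) = 0"
  using homogeneous_system[OF I S(1), of a] \<open>\<not> card S \<le> card I\<close> by auto
  have "(\<Oplus>v\<in>S'. c v \<odot> v) = (\<Oplus>i\<in>I. (\<Sum>v\<in>S'. c v * a v i) \<odot> b i)" if "finite S'" "S' <= S" for S'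
  using that
  proof (induction S' rule: finite_induct)
  case empty
  thus ?case using zero by simp
  next
  case (insert w S')
  have w: "w <: M" "w : S" using insert.prems S(2) by auto
  have "(\<Oplus>v\<in>insert w S'. c v \<odot> v) = c w \<odot> w ++ (\<Oplus>v\<in>S'. c v \<odot> v)"
  using insert S(2) sc by (intro M.finsum_insert) auto
  also have "c w \<odot> w = c w \<odot> (\<Oplus>i\<in>I. a w i \<odot> b i)" using a[OF w(2)] by simp
  also have "... = (\<Oplus>i\<in>I. c w \<odot> (a w i \<odot> b i))" by (rule finsum_smult_ldistr[OF I]) (use b sc in auto)
  also have "... = (\<Oplus>i\<in>I. (c w * a w i) \<odot> b i)" by (rule M.finsum_cong') (use b sc smult_assoc1 in auto)
  also have "(\<Oplus>v\<in>S'. c v \<odot> v) = (\<Oplus>i\<in>I. (\<Sum>v\<in>S'. c v * a v i) \<odot> b i)" using insert by simp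
  also have "(\<Oplus>i\<in>I. (c w * a w i) \<odot> b i) ++ (\<Oplus>i\<in>I. (\<Sum>v\<in>S'. c v * a v i) \<odot> b i)
  = (\<Oplus>i\<in>I. (c w * a w i) \<odot> b i ++ (\<Sum>v\<in>S'. c v * a v i) \<odot> b i)" by (rule M.finsum_addf[symmetric]) (use b sc in auto)
  also have "... = (\<Oplus>i\<in>I. (\<Sum>v\<in>insert w S'. c v * a v i) \<odot> b i)"
  by (rule M.finsum_cong') (use b sc smult_l_distr insert.hyps in auto)
  finally show ?case .
  qed
  from this[OF S(1) subset_refl] have "(\<Oplus>v\<in>S. c v \<odot> v) = (\<Oplus>i\<in>I. 0 \<odot> b i)"
  using c(2) b sc by (simp add: M.finsum_cong'[of I I])
  hence "(\<Oplus>v\<in>S. c v \<odot> v) = \<zero>" using zero by simp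
  moreover have "c : S \<rightarrow> carrier ?R" by simp
  ultimately have "ALL v:S. c v = \<zero>.?R" using S(3) unfolding lin_indep_def by blast
  thus False using c(1) by simp
 qed
 show ?thesis unfolding module_rank_def
 proof (rule antisym)
  show "(SUP S\<in>{S. finite S & S <= carrier M & lin_indep ?R M S}. enat (card S)) \<le> enat (card I)"
  by (rule SUP_least) (use bound in simp)
  have "enat (card (b ` I)) \<le> (SUP S\<in>{S. finite S & S <= carrier M & lin_indep ?R M S}. enat (card S))"
  by (rule SUP_upper) (use I b indep in auto)
  thus "enat (card I) \<le> (SUP S\<in>{S. finite S & S <= carrier M & lin_indep ?R M S}. enat (card S))"
  by (simp add: card_image[OF inj])
 qed
qed

theorem proposition5p2:
  fixes p g n :: nat
    and K :: "'r::idom base"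
    and A :: "('p, 'r, 's, 'b list) fgroup"
    and U :: "'p set" and \<xi> :: "nat \<Rightarrow> 's"
    and \<Psi>1 :: "nat \<Rightarrow> ('p, 'r, 's, 'b) character"
  assumes universe: "\<exists>\<iota> :: (nat \<Rightarrow> 'b) \<Rightarrow> 'b. inj \<iota>" "\<exists>\<kappa> :: 'r \<Rightarrow> 'b. inj \<kappa>"
    and base: "base_data p K"
    and witt: "\<And>m. \<exists>W :: ('r, 'b) ralg \<Rightarrow> ('r, 'b list) ralg. witt_structure K m W"
    and A: "formal_abelian_scheme K A g" and "g \<ge> 1"
    and coordinates: "coordinates_at_identity K A g U \<xi>"
    and \<Psi>1: "normalized_iso K A g U \<xi> \<Psi>1"
    and "n \<ge> 1"
  shows "is_basis base_alg (Hom_module K A n) ({1..n} \<times> {1..g}) (\<lambda>(i, j). Psi K A \<Psi>1 n i j) \<and>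
         module_rank base_alg (Hom_module K A n) = enat (n * g)"
proof -
 interpret jet_characters p K "TYPE('b)" A g U \<xi> \<Psi>1
  by unfold_locales (use universe base witt A coordinates \<Psi>1 in "simp_all add: formal_abelian_scheme_def")
 \<comment> \<open>The results on characters are indexed by \<open>m\<close>, one less than the
   index of the jet kernel.\<close>
 obtain m where m: "n = Suc m" using \<open>n \<ge> 1\<close> by (cases n) auto
 have "is_basis base_alg (Hom_module K A n) ({1..n} \<times> {1..g}) (%(i, j). Psi K A \<Psi>1 n i j)"
  using Psi_basis[of m] by (simp add: m J_def)
 from this rank_of_basis[OF this] show ?thesis by (simp add: card_cartesian_product)
qed

end
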